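(* There exists a DG category $\mathcal{I}$ (namely, the DG category $\mathcal{I}$ of one-sided twisted complexes over $\mathcal{I}'$ defined in the context) such that its $0$th cohomology category $H(\mathcal{I})$ is triangulated. There is a monoidal bifunctor $\otimes:\mathcal{I}\times\mathcal{I}\to\mathcal{I}$ whose decategorification, i.e. the induced multiplication $K_0(\otimes):K_0(\mathcal{I})\times K_0(\mathcal{I})\to K_0(\mathcal{I})$, makes $K_0(\mathcal{I})$ isomorphic to the ring $\mathbb{Z}[\sqrt{-1}]$.
   Context: All morphism spaces are over the field $\mathbb{F}_2$. For a DG category $\mathcal{A}$, $H(\mathcal{A})$ denotes its $0$th cohomology category (same objects, morphisms $H^0$ of the morphism complexes), and $K_0(\mathcal{A})$ denotes the Grothendieck group of $H(\mathcal{A})$ when $H(\mathcal{A})$ is triangulated. The category $\mathcal{I}'$. $\mathcal{I}'$ is a strict monoidal additive DG category whose morphism sets are $\mathbb{Z}$-graded $\mathbb{F}_2$-vector spaces with trivial differential. Its elementary objects are $Q^k$, $k\ge 0$ (tensor powers of a single generator $Q$, with $Q^0=\mathbf{1}$ the unit and $Q^k\otimes Q^l=Q^{k+l}$); $Q^k[m]$ denotes $Q^k$ with cohomological grading shifted by $m\in\mathbb{Z}$; general objects are finite formal direct sums $\bigoplus_{i=1}^n Q^{k_i}[m_i]$. Shifts satisfy $\mathrm{Hom}^i(A[m],B[n])=\mathrm{Hom}^{i+n-m}(A,B)$. Morphisms extend linearly to direct sums. The spaces $\mathrm{Hom}_{\mathcal{I}'}(Q^k,Q^l)$ are generated, under vertical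 composition $\circ$ (stacking, read bottom to top) and horizontal composition $\otimes$, by the elementary diagrams - $id_Q\in\mathrm{Hom}(Q,Q)$ (vertical strand), of degree $0$; - $cup\in\mathrm{Hom}(Q^0,Q^2)$, of degree $-1$; - $cap\in\mathrm{Hom}(Q^2,Q^0)$, of degree $1$; - $hf\in\mathrm{Hom}(Q^0,Q)$ (half strand), of degree $0$; modulo the following local relations: - (R1) isotopy: (R1-a) vertical strands act as identities; (R1-b) isotopy of a single strand: $(cap\otimes id_Q)\circ(id_Q\otimes cup)=id_Q$; (R1-c) isotopy of disjoint diagrams (the interchange law, without signs); - (R2) handle slide: $cup\circ cap=id_{Q^2}$; - (R3) loop: $cap\circ cup=id_{Q^0}$; - (R4) commutativity of a half strand with a strand: $hf\otimes id_Q=id_Q\otimes hf$ in $\mathrm{Hom}(Q,Q^2)$. The category $\mathcal{I}$. $\mathcal{I}$ is the DG category of one-sided twisted complexes over $\mathcal{I}'$: objects are pairs $(\bigoplus_{i=1}^n\mathbf{a}_i,\ f=\sum_{i<j}f_i^j)$ with $\mathbf{a}_i$ objects of $\mathcal{I}'$, $f_i^j\in\mathrm{Hom}^1_{\mathcal{I}'}(\mathbf{a}_i,\mathbf{a}_j)$ and $\sum_k f_k^j\circ f_i^k=0$ for all $i,j$. The morphism complex from $(\bigoplus\mathbf{a}_i,f)$ to $(\bigoplus\mathbf{b}_j,g)$ is the graded $\mathbb{F}_2$-vector space spanned by the $h_i^j\in\mathrm{Hom}_{\mathcal{I}'}(\mathbf{a}_i,\mathbf{b}_j)$, with differential $d(h_i^j)=\sum_{i'}h_i^j\circ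 f_{i'}^i+\sum_{j'}g_j^{j'}\circ h_i^j$. The monoidal structure of $\mathcal{I}'$ (horizontal composition) extends to $\mathcal{I}$ in the usual way: $(\bigoplus\mathbf{a}_i,f)\otimes(\bigoplus\mathbf{b}_j,g)=(\bigoplus\mathbf{a}_i\otimes\mathbf{b}_j,\ f\otimes id+id\otimes g)$. *)

theory Defs
  imports
    Complex_Main
    "HOL-Library.Function_Algebras"
    "HOL-Algebra.Free_Abelian_Groups"
    "HOL-Algebra.QuotRing"
begin

section \<open>DG categories over the field with two elements\<close>

text \<open>
  The degree \<open>n\<close> part of a morphism complex is a set \<open>Hom A B n\<close> inside an ambient abelian
  group; morphism sets of different pairs of objects need not be disjoint, so the composition
  \<open>Cmp A B D g f\<close> (first \<open>f : A \<rightarrow> B\<close>, then \<open>g : B \<rightarrow> D\<close>) and the differential take the objects as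
  arguments. Only homogeneous morphisms are represented.
\<close>

record ('o, 'm) dgcat =
  Obj :: "'o set"
  Hom :: "'o \<Rightarrow> 'o \<Rightarrow> int \<Rightarrow> 'm set"
  Cmp :: "'o \<Rightarrow> 'o \<Rightarrow> 'o \<Rightarrow> 'm \<Rightarrow> 'm \<Rightarrow> 'm"
  Idn :: "'o \<Rightarrow> 'm"
  Dif :: "'o \<Rightarrow> 'o \<Rightarrow> 'm \<Rightarrow> 'm"

text \<open>\<open>Tmor A A' B B' f g\<close> is the tensor product of \<open>f : A \<rightarrow> A'\<close> and \<open>g : B \<rightarrow> B'\<close>.\<close>

record ('o, 'm) monoidal_dgcat = "('o, 'm) dgcat" +
  Unit :: 'o
  Tob :: "'o \<Rightarrow> 'o \<Rightarrow> 'o"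
  Tmor :: "'o \<Rightarrow> 'o \<Rightarrow> 'o \<Rightarrow> 'o \<Rightarrow> 'm \<Rightarrow> 'm \<Rightarrow> 'm"

locale dg_category =
  fixes C :: "('o, 'm::ab_group_add, 'z) dgcat_scheme"
  assumes zero_Hom: "\<lbrakk>A \<in> Obj C; B \<in> Obj C\<rbrakk> \<Longrightarrow> 0 \<in> Hom C A B n"
    and add_Hom: "\<lbrakk>A \<in> Obj C; B \<in> Obj C; f \<in> Hom C A B n; g \<in> Hom C A B n\<rbrakk>
        \<Longrightarrow> f + g \<in> Hom C A B n"
    and char_two: "\<lbrakk>A \<in> Obj C; B \<in> Obj C; f \<in> Hom C A B n\<rbrakk> \<Longrightarrow> f + f = 0"
    and Cmp_Hom: "\<lbrakk>A \<in> Obj C; B \<in> Obj C; D \<in> Obj C; f \<in> Hom C A B m; g \<in> Hom C B D n\<rbrakk>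
        \<Longrightarrow> Cmp C A B D g f \<in> Hom C A D (m + n)"
    and Cmp_assoc: "\<lbrakk>A \<in> Obj C; B \<in> Obj C; D \<in> Obj C; E \<in> Obj C;
          f \<in> Hom C A B m; g \<in> Hom C B D n; h \<in> Hom C D E p\<rbrakk>
        \<Longrightarrow> Cmp C A D E h (Cmp C A B D g f) = Cmp C A B E (Cmp C B D E h g) f"
    and Idn_Hom: "A \<in> Obj C \<Longrightarrow> Idn C A \<in> Hom C A A 0"
    and Cmp_Idn_right: "\<lbrakk>A \<in> Obj C; B \<in> Obj C; f \<in> Hom C A B n\<rbrakk>
        \<Longrightarrow> Cmp C A A B f (Idn C A) = f"
    and Cmp_Idn_left: "\<lbrakk>A \<in> Obj C; B \<in> Obj C; f \<in> Hom C A B n\<rbrakk>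
        \<Longrightarrow> Cmp C A B B (Idn C B) f = f"
    and Cmp_add_right: "\<lbrakk>A \<in> Obj C; B \<in> Obj C; D \<in> Obj C;
          f \<in> Hom C A B m; f' \<in> Hom C A B m; g \<in> Hom C B D n\<rbrakk>
        \<Longrightarrow> Cmp C A B D g (f + f') = Cmp C A B D g f + Cmp C A B D g f'"
    and Cmp_add_left: "\<lbrakk>A \<in> Obj C; B \<in> Obj C; D \<in> Obj C;
          f \<in> Hom C A B m; g \<in> Hom C B D n; g' \<in> Hom C B D n\<rbrakk>
        \<Longrightarrow> Cmp C A B D (g + g') f = Cmp C A B D g f + Cmp C A B D g' f"
    and Dif_Hom: "\<lbrakk>A \<in> Obj C; B \<in> Obj C; f \<in> Hom C A B n\<rbrakk> \<Longrightarrow> Dif C A B f \<in> Hom C A B (n + 1)"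
    and Dif_add: "\<lbrakk>A \<in> Obj C; B \<in> Obj C; f \<in> Hom C A B n; g \<in> Hom C A B n\<rbrakk>
        \<Longrightarrow> Dif C A B (f + g) = Dif C A B f + Dif C A B g"
    and Dif_Dif: "\<lbrakk>A \<in> Obj C; B \<in> Obj C; f \<in> Hom C A B n\<rbrakk> \<Longrightarrow> Dif C A B (Dif C A B f) = 0"
    and Leibniz: "\<lbrakk>A \<in> Obj C; B \<in> Obj C; D \<in> Obj C; f \<in> Hom C A B m; g \<in> Hom C B D n\<rbrakk>
        \<Longrightarrow> Dif C A D (Cmp C A B D g f)
            = Cmp C A B D (Dif C B D g) f + Cmp C A B D g (Dif C A B f)"

text \<open>
  A DG bifunctor which is strictly associative and unital. All Koszul signs vanish in
  characteristic two.
\<close>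

locale strict_monoidal_dg_category = dg_category C
  for C :: "('o, 'm::ab_group_add, 'z) monoidal_dgcat_scheme" +
  assumes Unit_Obj: "Unit C \<in> Obj C"
    and Tob_Obj: "\<lbrakk>A \<in> Obj C; B \<in> Obj C\<rbrakk> \<Longrightarrow> Tob C A B \<in> Obj C"
    and Tmor_Hom: "\<lbrakk>A \<in> Obj C; A' \<in> Obj C; B \<in> Obj C; B' \<in> Obj C;
          f \<in> Hom C A A' m; g \<in> Hom C B B' n\<rbrakk>
        \<Longrightarrow> Tmor C A A' B B' f g \<in> Hom C (Tob C A B) (Tob C A' B') (m + n)"
    and Tmor_add_left: "\<lbrakk>A \<in> Obj C; A' \<in> Obj C; B \<in> Obj C; B' \<in> Obj C;
          f \<in> Hom C A A' m; f' \<in> Hom C A A' m; g \<in> Hom C B B' n\<rbrakk>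
        \<Longrightarrow> Tmor C A A' B B' (f + f') g = Tmor C A A' B B' f g + Tmor C A A' B B' f' g"
    and Tmor_add_right: "\<lbrakk>A \<in> Obj C; A' \<in> Obj C; B \<in> Obj C; B' \<in> Obj C;
          f \<in> Hom C A A' m; g \<in> Hom C B B' n; g' \<in> Hom C B B' n\<rbrakk>
        \<Longrightarrow> Tmor C A A' B B' f (g + g') = Tmor C A A' B B' f g + Tmor C A A' B B' f g'"
    and Tmor_Idn: "\<lbrakk>A \<in> Obj C; B \<in> Obj C\<rbrakk>
        \<Longrightarrow> Tmor C A A B B (Idn C A) (Idn C B) = Idn C (Tob C A B)"
    and interchange: "\<lbrakk>A \<in> Obj C; A' \<in> Obj C; A'' \<in> Obj C; B \<in> Obj C; B' \<in> Obj C; B'' \<in> Obj C;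
          f \<in> Hom C A A' m; f' \<in> Hom C A' A'' m'; g \<in> Hom C B B' n; g' \<in> Hom C B' B'' n'\<rbrakk>
        \<Longrightarrow> Tmor C A A'' B B'' (Cmp C A A' A'' f' f) (Cmp C B B' B'' g' g)
            = Cmp C (Tob C A B) (Tob C A' B') (Tob C A'' B'')
                (Tmor C A' A'' B' B'' f' g') (Tmor C A A' B B' f g)"
    and Dif_Tmor: "\<lbrakk>A \<in> Obj C; A' \<in> Obj C; B \<in> Obj C; B' \<in> Obj C;
          f \<in> Hom C A A' m; g \<in> Hom C B B' n\<rbrakk>
        \<Longrightarrow> Dif C (Tob C A B) (Tob C A' B') (Tmor C A A' B B' f g)
            = Tmor C A A' B B' (Dif C A A' f) g + Tmor C A A' B B' f (Dif C B B' g)"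
    and Tob_assoc: "\<lbrakk>A \<in> Obj C; B \<in> Obj C; D \<in> Obj C\<rbrakk>
        \<Longrightarrow> Tob C (Tob C A B) D = Tob C A (Tob C B D)"
    and Tmor_assoc: "\<lbrakk>A \<in> Obj C; A' \<in> Obj C; B \<in> Obj C; B' \<in> Obj C; D \<in> Obj C; D' \<in> Obj C;
          f \<in> Hom C A A' m; g \<in> Hom C B B' n; h \<in> Hom C D D' p\<rbrakk>
        \<Longrightarrow> Tmor C (Tob C A B) (Tob C A' B') D D' (Tmor C A A' B B' f g) h
            = Tmor C A A' (Tob C B D) (Tob C B' D') f (Tmor C B B' D D' g h)"
    and Tob_Unit: "A \<in> Obj C \<Longrightarrow> Tob C (Unit C) A = A" "A \<in> Obj C \<Longrightarrow> Tob C A (Unit C) = A"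
    and Tmor_Unit:
      "\<lbrakk>A \<in> Obj C; A' \<in> Obj C; f \<in> Hom C A A' n\<rbrakk>
        \<Longrightarrow> Tmor C (Unit C) (Unit C) A A' (Idn C (Unit C)) f = f"
      "\<lbrakk>A \<in> Obj C; A' \<in> Obj C; f \<in> Hom C A A' n\<rbrakk>
        \<Longrightarrow> Tmor C A A' (Unit C) (Unit C) f (Idn C (Unit C)) = f"


section \<open>Triangulated categories\<close>

text \<open>The morphism groups are written multiplicatively: \<open>mult\<close> is addition of morphisms.\<close>

record ('o, 'h) preadd =
  obj :: "'o set"
  mor :: "'o \<Rightarrow> 'o \<Rightarrow> 'h monoid"
  comp :: "'o \<Rightarrow> 'o \<Rightarrow> 'o \<Rightarrow> 'h \<Rightarrow> 'h \<Rightarrow> 'h"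
  ident :: "'o \<Rightarrow> 'h"

abbreviation arr :: "('o, 'h) preadd \<Rightarrow> 'o \<Rightarrow> 'o \<Rightarrow> 'h set"
  where "arr C A B \<equiv> carrier (mor C A B)"

definition zero_mor :: "('o, 'h) preadd \<Rightarrow> 'o \<Rightarrow> 'o \<Rightarrow> 'h"
  where "zero_mor C A B = \<one>\<^bsub>mor C A B\<^esub>"

definition neg_mor :: "('o, 'h) preadd \<Rightarrow> 'o \<Rightarrow> 'o \<Rightarrow> 'h \<Rightarrow> 'h"
  where "neg_mor C A B f = inv\<^bsub>mor C A B\<^esub> f"

definition zero_object :: "('o, 'h) preadd \<Rightarrow> 'o \<Rightarrow> bool"
  where "zero_object C Z \<longleftrightarrow>
    Z \<in> obj C \<and> (\<forall>A\<in>obj C. (\<exists>!f. f \<in> arr C A Z) \<and> (\<exists>!f. f \<in> arr C Z A))"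

definition biproduct ::
    "('o, 'h) preadd \<Rightarrow> 'o \<Rightarrow> 'o \<Rightarrow> 'o \<Rightarrow> 'h \<Rightarrow> 'h \<Rightarrow> 'h \<Rightarrow> 'h \<Rightarrow> bool"
  where "biproduct C A B S i1 i2 p1 p2 \<longleftrightarrow>
    S \<in> obj C \<and> i1 \<in> arr C A S \<and> i2 \<in> arr C B S \<and> p1 \<in> arr C S A \<and> p2 \<in> arr C S B \<and>
    comp C A S A p1 i1 = ident C A \<and> comp C B S B p2 i2 = ident C B \<and>
    comp C A S B p2 i1 = zero_mor C A B \<and> comp C B S A p1 i2 = zero_mor C B A \<and>
    comp C S A S i1 p1 \<otimes>\<^bsub>mor C S S\<^esub> comp C S B S i2 p2 = ident C S"

definition iso_mor :: "('o, 'h) preadd \<Rightarrow> 'o \<Rightarrow> 'o \<Rightarrow> 'h \<Rightarrow> bool"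
  where "iso_mor C A B f \<longleftrightarrow> f \<in> arr C A B \<and>
    (\<exists>g\<in>arr C B A. comp C A B A g f = ident C A \<and> comp C B A B f g = ident C B)"

locale additive_category =
  fixes C :: "('o, 'h) preadd"
  assumes mor_group: "\<lbrakk>A \<in> obj C; B \<in> obj C\<rbrakk> \<Longrightarrow> comm_group (mor C A B)"
    and comp_arr: "\<lbrakk>A \<in> obj C; B \<in> obj C; D \<in> obj C; f \<in> arr C A B; g \<in> arr C B D\<rbrakk>
        \<Longrightarrow> comp C A B D g f \<in> arr C A D"
    and comp_assoc: "\<lbrakk>A \<in> obj C; B \<in> obj C; D \<in> obj C; E \<in> obj C;
          f \<in> arr C A B; g \<in> arr C B D; h \<in> arr C D E\<rbrakk>
        \<Longrightarrow> comp C A D E h (comp C A B D g f) = comp C A B E (comp C B D E h g) f"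
    and ident_arr: "A \<in> obj C \<Longrightarrow> ident C A \<in> arr C A A"
    and comp_ident_right: "\<lbrakk>A \<in> obj C; B \<in> obj C; f \<in> arr C A B\<rbrakk> \<Longrightarrow> comp C A A B f (ident C A) = f"
    and comp_ident_left: "\<lbrakk>A \<in> obj C; B \<in> obj C; f \<in> arr C A B\<rbrakk> \<Longrightarrow> comp C A B B (ident C B) f = f"
    and comp_add_right: "\<lbrakk>A \<in> obj C; B \<in> obj C; D \<in> obj C;
          f \<in> arr C A B; f' \<in> arr C A B; g \<in> arr C B D\<rbrakk>
        \<Longrightarrow> comp C A B D g (f \<otimes>\<^bsub>mor C A B\<^esub> f')
            = comp C A B D g f \<otimes>\<^bsub>mor C A D\<^esub> comp C A B D g f'"
    and comp_add_left: "\<lbrakk>A \<in> obj C; B \<in> obj C; D \<in> obj C;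
          f \<in> arr C A B; g \<in> arr C B D; g' \<in> arr C B D\<rbrakk>
        \<Longrightarrow> comp C A B D (g \<otimes>\<^bsub>mor C B D\<^esub> g') f
            = comp C A B D g f \<otimes>\<^bsub>mor C A D\<^esub> comp C A B D g' f"
    and zero_object_ex: "\<exists>Z. zero_object C Z"
    and biproduct_ex: "\<lbrakk>A \<in> obj C; B \<in> obj C\<rbrakk> \<Longrightarrow> \<exists>S i1 i2 p1 p2. biproduct C A B S i1 i2 p1 p2"

text \<open>\<open>(X, Y, Z, u, v, w)\<close> stands for \<open>u : X \<rightarrow> Y\<close>, \<open>v : Y \<rightarrow> Z\<close>, \<open>w : Z \<rightarrow> T X\<close>.\<close>

type_synonym ('o, 'h) triangle = "'o \<times> 'o \<times> 'o \<times> 'h \<times> 'h \<times> 'h"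

definition triangles :: "('o, 'h) preadd \<Rightarrow> ('o \<Rightarrow> 'o) \<Rightarrow> ('o, 'h) triangle set"
  where "triangles C T = {(X, Y, Z, u, v, w).
    X \<in> obj C \<and> Y \<in> obj C \<and> Z \<in> obj C \<and>
    u \<in> arr C X Y \<and> v \<in> arr C Y Z \<and> w \<in> arr C Z (T X)}"

fun triangle_iso ::
    "('o, 'h) preadd \<Rightarrow> ('o \<Rightarrow> 'o) \<Rightarrow> ('o \<Rightarrow> 'o \<Rightarrow> 'h \<Rightarrow> 'h)
      \<Rightarrow> ('o, 'h) triangle \<Rightarrow> ('o, 'h) triangle \<Rightarrow> bool"
  where "triangle_iso C T Tm (X, Y, Z, u, v, w) (X', Y', Z', u', v', w') \<longleftrightarrow>
    (\<exists>a b c. iso_mor C X X' a \<and> iso_mor C Y Y' b \<and> iso_mor C Z Z' c \<and>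
      comp C X Y Y' b u = comp C X X' Y' u' a \<and>
      comp C Y Z Z' c v = comp C Y Y' Z' v' b \<and>
      comp C Z (T X) (T X') (Tm X X' a) w = comp C Z Z' (T X') w' c)"

text \<open>\<open>T\<close>, \<open>Tm\<close> are the object and morphism parts of the shift automorphism.\<close>

locale triangulated_category = additive_category C
  for C :: "('o, 'h) preadd" +
  fixes T :: "'o \<Rightarrow> 'o"
    and Tm :: "'o \<Rightarrow> 'o \<Rightarrow> 'h \<Rightarrow> 'h"
    and \<Delta> :: "('o, 'h) triangle set"
  assumes shift_obj: "bij_betw T (obj C) (obj C)"
    and shift_mor: "\<lbrakk>A \<in> obj C; B \<in> obj C\<rbrakk> \<Longrightarrow> Tm A B \<in> iso (mor C A B) (mor C (T A) (T B))"
    and shift_ident: "A \<in> obj C \<Longrightarrow> Tm A A (ident C A) = ident C (T A)"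
    and shift_comp: "\<lbrakk>A \<in> obj C; B \<in> obj C; D \<in> obj C; f \<in> arr C A B; g \<in> arr C B D\<rbrakk>
        \<Longrightarrow> Tm A D (comp C A B D g f) = comp C (T A) (T B) (T D) (Tm B D g) (Tm A B f)"
    and dist_triangles: "\<Delta> \<subseteq> triangles C T"
    and TR1_iso: "\<lbrakk>t \<in> \<Delta>; t' \<in> triangles C T; triangle_iso C T Tm t t'\<rbrakk> \<Longrightarrow> t' \<in> \<Delta>"
    and TR1_ident: "\<lbrakk>X \<in> obj C; zero_object C Z\<rbrakk>
        \<Longrightarrow> (X, X, Z, ident C X, zero_mor C X Z, zero_mor C Z (T X)) \<in> \<Delta>"
    and TR1_cone: "\<lbrakk>X \<in> obj C; Y \<in> obj C; u \<in> arr C X Y\<rbrakk> \<Longrightarrow> \<exists>Z v w. (X, Y, Z, u, v, w) \<in> \<Delta>"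
    and TR2: "(X, Y, Z, u, v, w) \<in> triangles C T
        \<Longrightarrow> (X, Y, Z, u, v, w) \<in> \<Delta> \<longleftrightarrow>
            (Y, Z, T X, v, w, neg_mor C (T X) (T Y) (Tm X Y u)) \<in> \<Delta>"
    and TR3: "\<lbrakk>(X, Y, Z, u, v, w) \<in> \<Delta>; (X', Y', Z', u', v', w') \<in> \<Delta>;
          a \<in> arr C X X'; b \<in> arr C Y Y'; comp C X Y Y' b u = comp C X X' Y' u' a\<rbrakk>
        \<Longrightarrow> \<exists>c\<in>arr C Z Z'.
              comp C Y Z Z' c v = comp C Y Y' Z' v' b \<and>
              comp C Z (T X) (T X') (Tm X X' a) w = comp C Z Z' (T X') w' c"
    and TR4: "\<lbrakk>(X, Y, Z', f, f1, f2) \<in> \<Delta>; (Y, Z, X', g, g1, g2) \<in> \<Delta>;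
          (X, Z, Y', comp C X Y Z g f, h1, h2) \<in> \<Delta>\<rbrakk>
        \<Longrightarrow> \<exists>u\<in>arr C Z' Y'. \<exists>v\<in>arr C Y' X'.
              (Z', Y', X', u, v, comp C X' (T Y) (T Z') (Tm Y Z' f1) g2) \<in> \<Delta> \<and>
              comp C Y Z' Y' u f1 = comp C Y Z Y' h1 g \<and>
              comp C Z' Y' (T X) h2 u = f2 \<and>
              comp C Z Y' X' v h1 = g1 \<and>
              comp C Y' X' (T Y) g2 v = comp C Y' (T X) (T Y) (Tm X Y f) h2"


section \<open>The zeroth cohomology category\<close>

definition cocycles :: "('o, 'm::ab_group_add, 'z) dgcat_scheme \<Rightarrow> 'o \<Rightarrow> 'o \<Rightarrow> 'm monoid"
  where "cocycles C A B =
    \<lparr>carrier = {f \<in> Hom C A B 0. Dif C A B f = 0}, monoid.mult = (+), one = 0\<rparr>"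

definition coboundaries :: "('o, 'm::ab_group_add, 'z) dgcat_scheme \<Rightarrow> 'o \<Rightarrow> 'o \<Rightarrow> 'm set"
  where "coboundaries C A B = Dif C A B ` Hom C A B (-1)"

definition coh_class :: "('o, 'm::ab_group_add, 'z) dgcat_scheme \<Rightarrow> 'o \<Rightarrow> 'o \<Rightarrow> 'm \<Rightarrow> 'm set"
  where "coh_class C A B f = coboundaries C A B #>\<^bsub>cocycles C A B\<^esub> f"

text \<open>
  Composition of cohomology classes is given by the union over all representatives, as in the
  library's multiplication of cosets of an ideal.
\<close>

definition H0 :: "('o, 'm::ab_group_add, 'z) dgcat_scheme \<Rightarrow> ('o, 'm set) preadd"
  where "H0 C =
    \<lparr>obj = Obj C,
     mor = (\<lambda>A B. cocycles C A B Mod coboundaries C A B),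
     comp = (\<lambda>A B D G F. \<Union>g\<in>G. \<Union>f\<in>F. coh_class C A D (Cmp C A B D g f)),
     ident = (\<lambda>A. coh_class C A A (Idn C A))\<rparr>"


section \<open>Grothendieck groups\<close>

definition K0_relations :: "'o set \<Rightarrow> ('o, 'h) triangle set \<Rightarrow> ('o \<Rightarrow>\<^sub>0 int) set"
  where "K0_relations S \<Delta> = generate (free_Abelian_group S)
    {frag_of Y - frag_of X - frag_of Z |X Y Z u v w. (X, Y, Z, u, v, w) \<in> \<Delta>}"

text \<open>
  Generators are objects rather than isomorphism classes: a distinguished triangle
  \<open>X \<rightarrow> Y \<rightarrow> 0 \<rightarrow> T X\<close> identifies isomorphic objects.
\<close>

definition K0_group :: "'o set \<Rightarrow> ('o, 'h) triangle set \<Rightarrow> ('o \<Rightarrow>\<^sub>0 int) set monoid"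
  where "K0_group S \<Delta> = free_Abelian_group S Mod K0_relations S \<Delta>"

definition K0_coset :: "'o set \<Rightarrow> ('o, 'h) triangle set \<Rightarrow> ('o \<Rightarrow>\<^sub>0 int) \<Rightarrow> ('o \<Rightarrow>\<^sub>0 int) set"
  where "K0_coset S \<Delta> x = K0_relations S \<Delta> #>\<^bsub>free_Abelian_group S\<^esub> x"

definition K0_class :: "'o set \<Rightarrow> ('o, 'h) triangle set \<Rightarrow> 'o \<Rightarrow> ('o \<Rightarrow>\<^sub>0 int) set"
  where "K0_class S \<Delta> A = K0_coset S \<Delta> (frag_of A)"

definition frag_bilinear :: "('o \<Rightarrow> 'o \<Rightarrow> 'o) \<Rightarrow> ('o \<Rightarrow>\<^sub>0 int) \<Rightarrow> ('o \<Rightarrow>\<^sub>0 int) \<Rightarrow> ('o \<Rightarrow>\<^sub>0 int)"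
  where "frag_bilinear F x y = frag_extend (\<lambda>A. frag_extend (\<lambda>B. frag_of (F A B)) y) x"

text \<open>
  The map on Grothendieck groups induced by an operation \<open>F\<close> on objects. The union over all
  representatives is a single coset exactly when the bilinear extension of \<open>F\<close> descends.
\<close>

definition K0_bifunctor ::
    "'o set \<Rightarrow> ('o, 'h) triangle set \<Rightarrow> ('o \<Rightarrow> 'o \<Rightarrow> 'o)
      \<Rightarrow> ('o \<Rightarrow>\<^sub>0 int) set \<Rightarrow> ('o \<Rightarrow>\<^sub>0 int) set \<Rightarrow> ('o \<Rightarrow>\<^sub>0 int) set"
  where "K0_bifunctor S \<Delta> F X Y = (\<Union>x\<in>X. \<Union>y\<in>Y. K0_coset S \<Delta> (frag_bilinear F x y))"

definition K0_ring ::
    "'o set \<Rightarrow> ('o, 'h) triangle set \<Rightarrow> ('o \<Rightarrow> 'o \<Rightarrow> 'o) \<Rightarrow> 'o \<Rightarrow> ('o \<Rightarrow>\<^sub>0 int) set ring"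
  where "K0_ring S \<Delta> F U =
    \<lparr>carrier = carrier (K0_group S \<Delta>),
     monoid.mult = K0_bifunctor S \<Delta> F,
     one = K0_class S \<Delta> U,
     zero = \<one>\<^bsub>K0_group S \<Delta>\<^esub>,
     add = (\<lambda>X Y. X \<otimes>\<^bsub>K0_group S \<Delta>\<^esub> Y)\<rparr>"

definition gaussian_integers :: "complex ring"
  where "gaussian_integers =
    \<lparr>carrier = {of_int a + of_int b * \<i> |a b. True},
     monoid.mult = (*), one = 1, zero = 0, add = (+)\<rparr>"


section \<open>Diagrams\<close>

text \<open>
  Formal linear combinations over the two-element field of diagrams. \<open>Over s t\<close> stacks \<open>s\<close> on
  top of \<open>t\<close> (vertical composition), \<open>Beside s t\<close> places \<open>s\<close> to the left of \<open>t\<close>, and \<open>Void\<close> is the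
  empty diagram, the identity of the unit object.
\<close>

datatype dterm =
    Null | Plus dterm dterm
  | Void | Strand | Cup | Cap | HalfStrand
  | Over dterm dterm | Beside dterm dterm

text \<open>\<open>has_type k l d t\<close>: the term \<open>t\<close> denotes a morphism of degree \<open>d\<close> from \<open>Q^k\<close> to \<open>Q^l\<close>.\<close>

inductive has_type :: "nat \<Rightarrow> nat \<Rightarrow> int \<Rightarrow> dterm \<Rightarrow> bool" where
  "has_type k l d Null"
| "has_type k l d s \<Longrightarrow> has_type k l d t \<Longrightarrow> has_type k l d (Plus s t)"
| "has_type 0 0 0 Void"
| "has_type 1 1 0 Strand"
| "has_type 0 2 (-1) Cup"
| "has_type 2 0 1 Cap"
| "has_type 0 1 0 HalfStrand"
| "has_type k l d t \<Longrightarrow> has_type l m e s \<Longrightarrow> has_type k m (d + e) (Over s t)"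
| "has_type k l d s \<Longrightarrow> has_type k' l' d' t \<Longrightarrow> has_type (k + k') (l + l') (d + d') (Beside s t)"

fun strands :: "nat \<Rightarrow> dterm" where
  "strands 0 = Void"
| "strands (Suc k) = Beside Strand (strands k)"

text \<open>
  The relation presenting the strict monoidal linear category. It is defined on all terms, so
  that the quotient is a type; terms without a type never enter the morphism spaces below.
\<close>

inductive deq :: "dterm \<Rightarrow> dterm \<Rightarrow> bool" where
  refl: "deq t t"
| sym: "deq s t \<Longrightarrow> deq t s"
| trans: "deq s t \<Longrightarrow> deq t u \<Longrightarrow> deq s u"
| cong_Plus: "deq s s' \<Longrightarrow> deq t t' \<Longrightarrow> deq (Plus s t) (Plus s' t')"
| cong_Over: "deq s s' \<Longrightarrow> deq t t' \<Longrightarrow> deq (Over s t) (Over s' t')"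
| cong_Beside: "deq s s' \<Longrightarrow> deq t t' \<Longrightarrow> deq (Beside s t) (Beside s' t')"
| Plus_assoc: "deq (Plus (Plus s t) u) (Plus s (Plus t u))"
| Plus_comm: "deq (Plus s t) (Plus t s)"
| Plus_Null: "deq (Plus Null t) t"
| Plus_self: "deq (Plus t t) Null"
| Over_Plus_left: "deq (Over (Plus s s') t) (Plus (Over s t) (Over s' t))"
| Over_Plus_right: "deq (Over s (Plus t t')) (Plus (Over s t) (Over s t'))"
| Beside_Plus_left: "deq (Beside (Plus s s') t) (Plus (Beside s t) (Beside s' t))"
| Beside_Plus_right: "deq (Beside s (Plus t t')) (Plus (Beside s t) (Beside s t'))"
| Over_assoc: "deq (Over (Over s t) u) (Over s (Over t u))"
| Beside_assoc: "deq (Beside (Beside s t) u) (Beside s (Beside t u))"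
| Beside_Void_left: "deq (Beside Void t) t"
| Beside_Void_right: "deq (Beside t Void) t"
| R1a_top: "has_type k l d t \<Longrightarrow> deq (Over (strands l) t) t"
| R1a_bottom: "has_type k l d t \<Longrightarrow> deq (Over t (strands k)) t"
| R1b: "deq (Over (Beside Cap Strand) (Beside Strand Cup)) Strand"
| R1c: "has_type k l d s \<Longrightarrow> has_type l m e s' \<Longrightarrow>
    has_type k' l' d' t \<Longrightarrow> has_type l' m' e' t' \<Longrightarrow>
    deq (Beside (Over s' s) (Over t' t)) (Over (Beside s' t') (Beside s t))"
| R2: "deq (Over Cup Cap) (strands 2)"
| R3: "deq (Over Cap Cup) Void"
| R4: "deq (Beside HalfStrand Strand) (Beside Strand HalfStrand)"

quotient_type dmor = dterm / deq
proof (rule equivpI)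
  show "reflp deq" by (rule reflpI) (rule deq.refl)
  show "symp deq" by (rule sympI) (rule deq.sym)
  show "transp deq" by (rule transpI) (rule deq.trans)
qed

instantiation dmor :: ab_group_add
begin

lift_definition zero_dmor :: dmor is Null .

lift_definition plus_dmor :: "dmor \<Rightarrow> dmor \<Rightarrow> dmor" is Plus
  by (rule deq.cong_Plus)

definition uminus_dmor :: "dmor \<Rightarrow> dmor"
  where "uminus_dmor x = x"

definition minus_dmor :: "dmor \<Rightarrow> dmor \<Rightarrow> dmor"
  where "minus_dmor x y = x + y"

instance
proof
  fix a b c :: dmor
  show "a + b + c = a + (b + c)" by transfer (rule deq.Plus_assoc)
  show "a + b = b + a" by transfer (rule deq.Plus_comm)
  show "0 + a = a" by transfer (rule deq.Plus_Null)
  show "- a + a = 0" unfolding uminus_dmor_def by transfer (rule deq.Plus_self)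
  show "a - b = a + - b" by (simp add: uminus_dmor_def minus_dmor_def)
qed

end

lift_definition vcomp :: "dmor \<Rightarrow> dmor \<Rightarrow> dmor" is Over
  by (rule deq.cong_Over)

lift_definition hcomp :: "dmor \<Rightarrow> dmor \<Rightarrow> dmor" is Beside
  by (rule deq.cong_Beside)

lift_definition idQ :: "nat \<Rightarrow> dmor" is strands .

definition diagHom :: "nat \<Rightarrow> nat \<Rightarrow> int \<Rightarrow> dmor set"
  where "diagHom k l d = {abs_dmor t |t. has_type k l d t}"

text \<open>
  The full subcategory on the shifted elementary objects: the pair \<open>(k, m)\<close> is \<open>Q^k[m]\<close>.
\<close>

definition elementary :: "(nat \<times> int, dmor) monoidal_dgcat"
  where "elementary =
    \<lparr>Obj = UNIV,
     Hom = (\<lambda>(k, m) (l, n) i. diagHom k l (i + n - m)),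
     Cmp = (\<lambda>_ _ _ g f. vcomp g f),
     Idn = (\<lambda>(k, m). idQ k),
     Dif = (\<lambda>_ _ _. 0),
     Unit = (0, 0),
     Tob = (\<lambda>(k, m) (l, n). (k + l, m + n)),
     Tmor = (\<lambda>_ _ _ _ f g. hcomp f g)\<rparr>"

definition elementary_shift :: "nat \<times> int \<Rightarrow> nat \<times> int"
  where "elementary_shift = (\<lambda>(k, m). (k, m + 1))"


section \<open>Formal direct sums\<close>

text \<open>
  A formal direct sum is the list of its summands, a morphism is a matrix whose entry at \<open>i\<close>,
  \<open>j\<close> goes from the \<open>i\<close>-th summand of the source to the \<open>j\<close>-th summand of the target; entries
  outside the index range vanish.
\<close>

type_synonym 'm mat = "nat \<Rightarrow> nat \<Rightarrow> 'm"

definition mat_Hom ::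
    "('o, 'm::ab_group_add, 'z) dgcat_scheme \<Rightarrow> 'o list \<Rightarrow> 'o list \<Rightarrow> int \<Rightarrow> 'm mat set"
  where "mat_Hom C A B n = {M. \<forall>i j.
    if i < length A \<and> j < length B then M i j \<in> Hom C (A ! i) (B ! j) n else M i j = 0}"

definition mat_Cmp ::
    "('o, 'm::ab_group_add, 'z) dgcat_scheme \<Rightarrow> 'o list \<Rightarrow> 'o list \<Rightarrow> 'o list
      \<Rightarrow> 'm mat \<Rightarrow> 'm mat \<Rightarrow> 'm mat"
  where "mat_Cmp C A B D g f = (\<lambda>i k.
    if i < length A \<and> k < length D
    then \<Sum>j<length B. Cmp C (A ! i) (B ! j) (D ! k) (g j k) (f i j) else 0)"

definition mat_Idn :: "('o, 'm::ab_group_add, 'z) dgcat_scheme \<Rightarrow> 'o list \<Rightarrow> 'm mat"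
  where "mat_Idn C A = (\<lambda>i j. if i < length A \<and> i = j then Idn C (A ! i) else 0)"

definition mat_Dif ::
    "('o, 'm::ab_group_add, 'z) dgcat_scheme \<Rightarrow> 'o list \<Rightarrow> 'o list \<Rightarrow> 'm mat \<Rightarrow> 'm mat"
  where "mat_Dif C A B M = (\<lambda>i j.
    if i < length A \<and> j < length B then Dif C (A ! i) (B ! j) (M i j) else 0)"

text \<open>Summands of a tensor product are ordered lexicographically.\<close>

definition mat_Tob :: "('o, 'm, 'z) monoidal_dgcat_scheme \<Rightarrow> 'o list \<Rightarrow> 'o list \<Rightarrow> 'o list"
  where "mat_Tob C A B = concat (map (\<lambda>a. map (Tob C a) B) A)"

definition mat_Tmor ::
    "('o, 'm::ab_group_add, 'z) monoidal_dgcat_scheme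
      \<Rightarrow> 'o list \<Rightarrow> 'o list \<Rightarrow> 'o list \<Rightarrow> 'o list \<Rightarrow> 'm mat \<Rightarrow> 'm mat \<Rightarrow> 'm mat"
  where "mat_Tmor C A A' B B' f g = (\<lambda>p q.
    if p < length A * length B \<and> q < length A' * length B'
    then
      let i = p div length B; j = p mod length B;
          i' = q div length B'; j' = q mod length B'
      in Tmor C (A ! i) (A' ! i') (B ! j) (B' ! j') (f i i') (g j j')
    else 0)"

definition direct_sums ::
    "('o, 'm::ab_group_add, 'z) monoidal_dgcat_scheme \<Rightarrow> ('o list, 'm mat) monoidal_dgcat"
  where "direct_sums C =
    \<lparr>Obj = lists (Obj C),
     Hom = mat_Hom C,
     Cmp = mat_Cmp C,
     Idn = mat_Idn C,
     Dif = mat_Dif C,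
     Unit = [Unit C],
     Tob = mat_Tob C,
     Tmor = mat_Tmor C\<rparr>"


section \<open>One-sided twisted complexes\<close>

text \<open>To be applied to categories \<open>C\<close> with trivial differential only.\<close>

type_synonym ('o, 'm) twisted = "'o list \<times> 'm mat"

definition twisted_complexes ::
    "('o, 'm::ab_group_add, 'z) dgcat_scheme \<Rightarrow> ('o, 'm) twisted set"
  where "twisted_complexes C = {(A, f).
    A \<in> lists (Obj C) \<and> f \<in> mat_Hom C A A 1 \<and>
    (\<forall>i j. \<not> i < j \<longrightarrow> f i j = 0) \<and> mat_Cmp C A A A f f = 0}"

definition twisted ::
    "('o, 'm::ab_group_add, 'z) monoidal_dgcat_scheme \<Rightarrow> (('o, 'm) twisted, 'm mat) monoidal_dgcat"
  where "twisted C =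
    \<lparr>Obj = twisted_complexes C,
     Hom = (\<lambda>(A, f) (B, g). mat_Hom C A B),
     Cmp = (\<lambda>(A, f) (B, g) (D, h). mat_Cmp C A B D),
     Idn = (\<lambda>(A, f). mat_Idn C A),
     Dif = (\<lambda>(A, f) (B, g) h. mat_Cmp C A A B h f + mat_Cmp C A B B g h),
     Unit = ([Unit C], 0),
     Tob = (\<lambda>(A, f) (B, g).
       (mat_Tob C A B,
        mat_Tmor C A A B B f (mat_Idn C B) + mat_Tmor C A A B B (mat_Idn C A) g)),
     Tmor = (\<lambda>(A, f) (A', f') (B, g) (B', g'). mat_Tmor C A A' B B')\<rparr>"

text \<open>In characteristic two the shift does not change the sign of the twisting cochain.\<close>

definition twisted_shift :: "('o \<Rightarrow> 'o) \<Rightarrow> ('o, 'm) twisted \<Rightarrow> ('o, 'm) twisted"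
  where "twisted_shift s = (\<lambda>(A, f). (map s A, f))"

text \<open>
  The cone of a closed morphism \<open>h\<close> of degree \<open>0\<close> from \<open>(A, f)\<close> to \<open>(B, g)\<close> is \<open>A[1] \<oplus> B\<close> with
  twisting cochain given by \<open>f\<close>, \<open>h\<close> and \<open>g\<close>, followed by the inclusion of \<open>B\<close> and the
  projection to \<open>A[1]\<close>.
\<close>

definition cone :: "('o \<Rightarrow> 'o) \<Rightarrow> ('o, 'm::ab_group_add) twisted \<Rightarrow> ('o, 'm) twisted
    \<Rightarrow> 'm mat \<Rightarrow> ('o, 'm) twisted"
  where "cone s = (\<lambda>(A, f) (B, g) h.
    (map s A @ B,
     \<lambda>i j. if i < length A then (if j < length A then f i j else h i (j - length A))
           else (if j < length A then 0 else g (i - length A) (j - length A))))"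

definition cone_incl :: "('o, 'm::ab_group_add, 'z) dgcat_scheme
    \<Rightarrow> ('o, 'm) twisted \<Rightarrow> ('o, 'm) twisted \<Rightarrow> 'm mat"
  where "cone_incl C = (\<lambda>(A, f) (B, g) i j.
    if i < length B \<and> j = length A + i then Idn C (B ! i) else 0)"

definition cone_proj :: "('o, 'm::ab_group_add, 'z) dgcat_scheme \<Rightarrow> ('o \<Rightarrow> 'o)
    \<Rightarrow> ('o, 'm) twisted \<Rightarrow> ('o, 'm) twisted \<Rightarrow> 'm mat"
  where "cone_proj C s = (\<lambda>(A, f) (B, g) i j.
    if i < length A \<and> j = i then Idn C (s (A ! i)) else 0)"

definition cone_triangle ::
    "('o, 'm::ab_group_add, 'z) monoidal_dgcat_scheme \<Rightarrow> ('o \<Rightarrow> 'o)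
      \<Rightarrow> ('o, 'm) twisted \<Rightarrow> ('o, 'm) twisted \<Rightarrow> 'm mat \<Rightarrow> (('o, 'm) twisted, 'm mat set) triangle"
  where "cone_triangle C s X Y h =
    (let D = twisted C; Z = cone s X Y h in
      (X, Y, Z,
       coh_class D X Y h,
       coh_class D Y Z (cone_incl C X Y),
       coh_class D Z (twisted_shift s X) (cone_proj C s X Y)))"


section \<open>The categories \<open>I'\<close> and \<open>I\<close>\<close>

definition I' :: "((nat \<times> int) list, dmor mat) monoidal_dgcat"
  where "I' = direct_sums elementary"

definition I'_shift :: "(nat \<times> int) list \<Rightarrow> (nat \<times> int) list"
  where "I'_shift = map elementary_shift"

type_synonym I_obj = "((nat \<times> int) list, dmor mat) twisted"
type_synonym I_mor = "dmor mat mat"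

definition catI :: "(I_obj, I_mor) monoidal_dgcat"
  where "catI = twisted I'"

definition I_shift :: "I_obj \<Rightarrow> I_obj"
  where "I_shift = twisted_shift I'_shift"

text \<open>
  Since \<open>Hom A[1] B[1]\<close> and \<open>Hom A B\<close> are the same complex of matrices, the shift is the
  identity on morphisms.
\<close>

definition I_shift_mor :: "I_obj \<Rightarrow> I_obj \<Rightarrow> I_mor set \<Rightarrow> I_mor set"
  where "I_shift_mor X Y F = F"

definition I_triangles :: "(I_obj, I_mor set) triangle set"
  where "I_triangles = {t \<in> triangles (H0 catI) I_shift.
    \<exists>X Y h. X \<in> Obj catI \<and> Y \<in> Obj catI \<and> h \<in> carrier (cocycles catI X Y) \<and>
      triangle_iso (H0 catI) I_shift I_shift_mor (cone_triangle I' I'_shift X Y h) t}"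

abbreviation K0_I_class :: "I_obj \<Rightarrow> (I_obj \<Rightarrow>\<^sub>0 int) set"
  where "K0_I_class \<equiv> K0_class (Obj catI) I_triangles"

abbreviation K0_I_mult ::
    "(I_obj \<Rightarrow>\<^sub>0 int) set \<Rightarrow> (I_obj \<Rightarrow>\<^sub>0 int) set \<Rightarrow> (I_obj \<Rightarrow>\<^sub>0 int) set"
  where "K0_I_mult \<equiv> K0_bifunctor (Obj catI) I_triangles (Tob catI)"

abbreviation K0_I_ring :: "(I_obj \<Rightarrow>\<^sub>0 int) set ring"
  where "K0_I_ring \<equiv> K0_ring (Obj catI) I_triangles (Tob catI) (Unit catI)"

end

(*
Since Cup and Cap are mutually inverse and, by the zigzag relation, Cup commutes with strands, every
diagram from Q^k to Q^l of degree d reduces to zero or to a single normal form, which exists exactly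
when 2d >= k - l. Counting diagrams modulo two (all generators have parity 1) shows that the normal
form is nonzero. Hence Q^k[m] depends, up to isomorphism, only on the weight k + 2m, and a twisted
complex is a list of weights with a strictly triangular matrix over the two-element field which
squares to zero. Such matrices form a ring in which the cone of h has components i, p, j, s with
p i = 1, s j = 1, p j = 0, s i = 0, i p + j s = 1 and twisting element i a p + j b s + j h p; all
axioms of a triangulated category become identities in this ring, up to elements t a + b t.

For the Grothendieck ring, the sum of \<i>^weight is invariant under homotopy equivalence: a contracting
homotopy, restricted to its weight-homogeneous part, makes the associated graded complex exact.
Conversely, a one-sided complex is an iterated cone of shifts of 1 and Q, so this invariant identifies
the free group on the objects modulo triangles with the Gaussian integers. Because the relations are
exactly the kernel of a multiplicative map, the multiplication descends without further argument.
*)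
theory Submission
  imports Defs "HOL-Library.Z2" "HOL-Computational_Algebra.Primes"
begin


section \<open>Diagrams modulo the local relations\<close>

text \<open>The half strand is the obstacle. It gives a nonzero morphism of degree 0 from each
  weight to every larger one, so that morphism spaces between elementary objects are nonzero in
  infinitely many degrees and provide no Euler form. The invariant has to be read off the objects
  themselves. This succeeds because twisting cochains and homotopies satisfy a one-sided bound on
  weights: identities between their products survive when only the entries that attain the bound are
  kept. The number \<open>\<i>\<close> is forced: the cup identifies the square of \<open>Q\<close>
  with the shift of the unit, a shift is -1 in the Grothendieck group, hence the class of
  \<open>Q\<close> squares to -1. The passage to a ring has a practical reason. Composition in a DG
  category carries its objects as arguments and holds its laws only for typed morphisms. Matrices of
  finite support over all indices form one ring without unit, where an object survives as an
  idempotent; cone computations then become rewriting, and degrees are checked separately.\<close>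

lemma bit_add_self: "x + x = (0 :: bit)"
  by (cases x) simp_all

section \<open>Counting diagrams modulo two\<close>

primrec parity :: "dterm \<Rightarrow> bit" where
  "parity Null = 0"
| "parity (Plus s t) = parity s + parity t"
| "parity Void = 1"
| "parity Strand = 1"
| "parity Cup = 1"
| "parity Cap = 1"
| "parity HalfStrand = 1"
| "parity (Over s t) = parity s * parity t"
| "parity (Beside s t) = parity s * parity t"

lemma parity_strands [simp]: "parity (strands k) = 1"
  by (induction k) simp_all

lemma parity_deq: "deq s t \<Longrightarrow> parity s = parity t"
proof (induction rule: deq.induct)
  case R2
  show ?case by (simp add: parity_strands del: strands.simps)
next
  case Plus_self
  show ?case by (simp only: parity.simps bit_add_self)
qed (simp_all only: parity.simps parity_strands distrib_left distrib_right ac_simps mult_1_left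
    mult_1_right add_0_left)

text \<open>A linear functional on all diagrams at once, multiplicative for both compositions. As
  diagram spaces have dimension at most one, it serves as their only coordinate; see
  \<open>ev_inject\<close>.\<close>

lift_definition ev :: "dmor \<Rightarrow> bit" is parity
  by (rule parity_deq)

lemma ev_zero [simp]: "ev 0 = 0" by transfer simp
lemma ev_add [simp]: "ev (x + y) = ev x + ev y" by transfer simp
lemma ev_vcomp [simp]: "ev (vcomp x y) = ev x * ev y" by transfer simp
lemma ev_hcomp [simp]: "ev (hcomp x y) = ev x * ev y" by transfer simp
lemma ev_idQ [simp]: "ev (idQ k) = 1" by transfer simp

lift_definition cup :: dmor is Cup .
lift_definition cap :: dmor is Cap .
lift_definition hf :: dmor is HalfStrand .

lemma ev_generators [simp]: "ev cup = 1" "ev cap = 1" "ev hf = 1"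
  by (transfer, simp)+

section \<open>Diagram spaces and their compositions\<close>

lemma has_type_strands: "has_type k k 0 (strands k)"
proof (induction k)
  case (Suc k)
  then show ?case using has_type.intros(9)[OF has_type.intros(4) Suc] by simp
qed (simp add: has_type.intros)

lemma diagHom_abs: "has_type k l d t \<Longrightarrow> abs_dmor t \<in> diagHom k l d"
  by (auto simp: diagHom_def)

lemma diagHom_zero [simp]: "0 \<in> diagHom k l d"
  unfolding zero_dmor_def by (intro diagHom_abs has_type.intros)

lemma diagHom_add: "x \<in> diagHom k l d \<Longrightarrow> y \<in> diagHom k l d \<Longrightarrow> x + y \<in> diagHom k l d"
  unfolding diagHom_def by (force simp: plus_dmor.abs_eq intro: has_type.intros(2))

lemma diagHom_vcomp:
  "x \<in> diagHom k l d \<Longrightarrow> y \<in> diagHom l m e \<Longrightarrow> vcomp y x \<in> diagHom k m (d + e)"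
  unfolding diagHom_def by (force simp: vcomp.abs_eq intro: has_type.intros(8))

lemma diagHom_hcomp:
  "x \<in> diagHom k l d \<Longrightarrow> y \<in> diagHom k' l' d' \<Longrightarrow> hcomp x y \<in> diagHom (k + k') (l + l') (d + d')"
  unfolding diagHom_def by (force simp: hcomp.abs_eq intro: has_type.intros(9))

lemma diagHom_idQ: "idQ k \<in> diagHom k k 0"
  unfolding idQ_def by (simp add: diagHom_abs has_type_strands)

lemma diagHom_generators: "cup \<in> diagHom 0 2 (-1)" "cap \<in> diagHom 2 0 1" "hf \<in> diagHom 0 1 0"
  unfolding cup_def cap_def hf_def by (intro diagHom_abs has_type.intros)+

lemma hcomp_assoc: "hcomp (hcomp x y) z = hcomp x (hcomp y z)"
  by transfer (rule deq.Beside_assoc)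

lemma idQ_zero_hcomp [simp]: "hcomp (idQ 0) x = x" "hcomp x (idQ 0) = x"
  by (transfer, simp add: deq.Beside_Void_left deq.Beside_Void_right)+

lemma idQ_Suc: "idQ (Suc k) = hcomp (idQ 1) (idQ k)"
  by transfer (simp, intro deq.cong_Beside deq.sym[OF deq.Beside_Void_right] deq.refl)

lemma hcomp_idQ: "hcomp (idQ k) (idQ l) = idQ (k + l)"
proof (induction k)
  case (Suc k)
  then show ?case
    by (metis add_Suc hcomp_assoc idQ_Suc)
qed simp

lemma vcomp_idQ_left: "x \<in> diagHom k l d \<Longrightarrow> vcomp (idQ l) x = x"
  by (auto simp: diagHom_def idQ.abs_eq vcomp.abs_eq dmor.abs_eq_iff intro: deq.R1a_top)

lemma vcomp_idQ_right: "x \<in> diagHom k l d \<Longrightarrow> vcomp x (idQ k) = x"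
  by (auto simp: diagHom_def idQ.abs_eq vcomp.abs_eq dmor.abs_eq_iff intro: deq.R1a_bottom)

lemma interchange_diag:
  assumes "x \<in> diagHom k l d" "x' \<in> diagHom l m e" "y \<in> diagHom k' l' d'" "y' \<in> diagHom l' m' e'"
  shows "hcomp (vcomp x' x) (vcomp y' y) = vcomp (hcomp x' y') (hcomp x y)"
  using assms by (auto simp: diagHom_def hcomp.abs_eq vcomp.abs_eq dmor.abs_eq_iff intro: deq.R1c)

lemma vcomp_assoc: "vcomp (vcomp x y) z = vcomp x (vcomp y z)"
  by transfer (rule deq.Over_assoc)

lemma hcomp_split_right:
  assumes "x \<in> diagHom k l d" "y \<in> diagHom k' l' d'"
  shows "hcomp x y = vcomp (hcomp (idQ l) y) (hcomp x (idQ k'))"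
  using interchange_diag[OF assms(1) diagHom_idQ diagHom_idQ assms(2)] assms
  by (simp add: vcomp_idQ_left vcomp_idQ_right)

lemma hcomp_split_left:
  assumes "x \<in> diagHom k l d" "y \<in> diagHom k' l' d'"
  shows "hcomp x y = vcomp (hcomp x (idQ l')) (hcomp (idQ k) y)"
  using interchange_diag[OF diagHom_idQ assms(1) assms(2) diagHom_idQ] assms
  by (simp add: vcomp_idQ_left vcomp_idQ_right)

section \<open>Cups and caps: mutual inverses, centrality of the cup\<close>

lemma R1b': "vcomp (hcomp cap (idQ 1)) (hcomp (idQ 1) cup) = idQ 1"
proof -
  have e: "idQ 1 = abs_dmor Strand"
    by (simp add: idQ.abs_eq dmor.abs_eq_iff deq.Beside_Void_right)
  show ?thesis unfolding e cap_def cup_def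
    by (simp add: hcomp.abs_eq vcomp.abs_eq dmor.abs_eq_iff deq.R1b)
qed

lemma cup_cap: "vcomp cup cap = idQ 2"
  by transfer (rule deq.R2)

lemma cap_cup: "vcomp cap cup = idQ 0"
  by transfer (simp add: deq.R3)

lemma hf_idQ_one: "hcomp hf (idQ 1) = hcomp (idQ 1) hf"
proof -
  have e: "idQ 1 = abs_dmor Strand"
    by (simp add: idQ.abs_eq dmor.abs_eq_iff deq.Beside_Void_right)
  show ?thesis unfolding e hf_def
    by (simp add: hcomp.abs_eq dmor.abs_eq_iff deq.R4)
qed

text \<open>By the zigzag and the handle slide, \<open>cup \<otimes> id\<close> and \<open>id \<otimes> cup\<close> have the same inverse.\<close>

lemma cup_idQ_one: "hcomp cup (idQ 1) = hcomp (idQ 1) cup"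
proof -
  note d = diagHom_generators diagHom_idQ
  have "hcomp (idQ 1) cup = vcomp (idQ 3) (hcomp (idQ 1) cup)"
    using vcomp_idQ_left[OF diagHom_hcomp[OF d(4)[of 1] d(1)]]
    by (simp add: numeral_3_eq_3)
  \<comment> \<open>The handle slide, read backwards, creates the cap that the zigzag then removes
    together with the given cup.\<close>
  also have "idQ 3 = hcomp (vcomp cup cap) (vcomp (idQ 1) (idQ 1))"
    by (simp add: cup_cap hcomp_idQ vcomp_idQ_left[OF diagHom_idQ])
  also have "\<dots> = vcomp (hcomp cup (idQ 1)) (hcomp cap (idQ 1))"
    by (rule interchange_diag[OF d(2) d(1) d(4) d(4)])
  finally have "hcomp (idQ 1) cup = vcomp (hcomp cup (idQ 1)) (idQ 1)"
    by (simp only: vcomp_assoc R1b')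
  then show ?thesis
    using vcomp_idQ_right[OF diagHom_hcomp[OF d(1) d(4)[of 1]]] by simp
qed

lemma idQ_commute_ind:
  assumes "hcomp x (idQ 1) = hcomp (idQ 1) x"
  shows "hcomp x (idQ k) = hcomp (idQ k) x"
proof (induction k)
  case (Suc k)
  then show ?case by (metis assms hcomp_assoc idQ_Suc)
qed simp

text \<open>By interchange the cup can be placed on top of \<open>x\<close> on either side; there it
  only has to pass identity strands.\<close>

lemma cup_commute:
  assumes "x \<in> diagHom k l d"
  shows "hcomp cup x = hcomp x cup"
  using hcomp_split_left[OF assms diagHom_generators(1)]
    hcomp_split_right[OF diagHom_generators(1) assms]
    hcomp_split_left[OF diagHom_generators(1) assms]
    hcomp_split_right[OF assms diagHom_generators(1)]
  by (simp add: idQ_commute_ind[OF cup_idQ_one])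

section \<open>Normal forms of diagrams\<close>

primrec cups :: "nat \<Rightarrow> dmor" where
  "cups 0 = idQ 0"
| "cups (Suc n) = hcomp cup (cups n)"

primrec hfs :: "nat \<Rightarrow> dmor" where
  "hfs 0 = idQ 0"
| "hfs (Suc n) = hcomp hf (hfs n)"

lemma cups_diagHom: "cups n \<in> diagHom 0 (2 * n) (- int n)"
proof (induction n)
  case (Suc n)
  show ?case using diagHom_hcomp[OF diagHom_generators(1) Suc] by simp
qed (use diagHom_idQ[of 0] in simp)

lemma hfs_diagHom: "hfs n \<in> diagHom 0 n 0"
proof (induction n)
  case (Suc n)
  show ?case using diagHom_hcomp[OF diagHom_generators(3) Suc] by simp
qed (use diagHom_idQ[of 0] in simp)

lemma cups_add: "hcomp (cups m) (cups n) = cups (m + n)"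
  by (induction m) (simp_all add: hcomp_assoc)

lemma hfs_add: "hcomp (hfs m) (hfs n) = hfs (m + n)"
  by (induction m) (simp_all add: hcomp_assoc)

lemma cups_commute: "x \<in> diagHom k l d \<Longrightarrow> hcomp (cups n) x = hcomp x (cups n)"
proof (induction n)
  case (Suc n)
  then show ?case by (metis cup_commute cups.simps(2) hcomp_assoc)
qed simp

lemma hfs_commute: "hcomp (hfs n) (idQ k) = hcomp (idQ k) (hfs n)"
proof (induction n)
  case (Suc n)
  then show ?case by (metis idQ_commute_ind[OF hf_idQ_one] hfs.simps(2) hcomp_assoc)
qed simp

lemma ev_cups [simp]: "ev (cups n) = 1" and ev_hfs [simp]: "ev (hfs n) = 1"
  by (induction n) simp_all

text \<open>
  Cups are central and invertible, so a diagram is determined by its product with cups; this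
  turns the caps, which are inverse to cups, into a matter of bookkeeping.
\<close>

definition standard :: "nat \<Rightarrow> nat \<Rightarrow> int \<Rightarrow> dmor \<Rightarrow> bool" where
  "standard k l d x \<longleftrightarrow> (\<exists>a b n. 2 * a + l = 2 * b + n + k \<and> d = int a - int b \<and>
     hcomp (cups a) x = hcomp (cups b) (hcomp (hfs n) (idQ k)))"

lemma standard_ev: "standard k l d x \<Longrightarrow> ev x = 1"
  unfolding standard_def by (metis ev_cups ev_hcomp ev_hfs ev_idQ mult_1)

text \<open>A cap on top of the cup closes a loop, which the loop relation removes.\<close>

lemma cup_cancel:
  assumes "x \<in> diagHom k l d" "y \<in> diagHom k l d" "hcomp cup x = hcomp cup y"
  shows "x = y"
proof -
  have "z = vcomp (hcomp cap (idQ l)) (hcomp cup z)" if "z \<in> diagHom k l d" for z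
    using interchange_diag[OF diagHom_generators(1,2) that diagHom_idQ] that
    by (simp add: cap_cup vcomp_idQ_left)
  then show ?thesis using assms by metis
qed

lemma cups_cancel:
  assumes "x \<in> diagHom k l d" "y \<in> diagHom k l d" "hcomp (cups n) x = hcomp (cups n) y"
  shows "x = y"
  using assms
proof (induction n)
  case (Suc n)
  have "hcomp (cups n) x = hcomp (cups n) y"
    using cup_cancel[OF diagHom_hcomp[OF cups_diagHom Suc.prems(1)]
        diagHom_hcomp[OF cups_diagHom Suc.prems(2)]] Suc.prems(3)
    by (simp add: hcomp_assoc)
  then show ?case using Suc by blast
qed simp

text \<open>Source, target and degree fix the number of half strands,
  \<open>n = 2 * d + l - k\<close>, and the difference \<open>a - b\<close>. After adding cups both
  morphisms satisfy the same equation, and cups cancel.\<close>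

lemma standard_unique:
  assumes "x \<in> diagHom k l d" "y \<in> diagHom k l d" "standard k l d x" "standard k l d y"
  shows "x = y"
proof -
  obtain a b n where x: "2 * a + l = 2 * b + n + k" "d = int a - int b"
    "hcomp (cups a) x = hcomp (cups b) (hcomp (hfs n) (idQ k))"
    using assms(3) unfolding standard_def by auto
  obtain a' b' n' where y: "2 * a' + l = 2 * b' + n' + k" "d = int a' - int b'"
    "hcomp (cups a') y = hcomp (cups b') (hcomp (hfs n') (idQ k))"
    using assms(4) unfolding standard_def by auto
  have n: "n = n'" "a + b' = a' + b" using x y by linarith+
  have "hcomp (cups (a + a')) x = hcomp (cups (a' + b)) (hcomp (hfs n) (idQ k))"
    by (metis x(3) add.commute cups_add hcomp_assoc)
  moreover have "hcomp (cups (a + a')) y = hcomp (cups (a + b')) (hcomp (hfs n) (idQ k))"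
    by (metis y(3) n(1) cups_add hcomp_assoc)
  ultimately show ?thesis using cups_cancel[OF assms(1,2)] n(2) by metis
qed

text \<open>Beside enough cups \<open>y\<close> becomes cups and half strands next to identity
  strands. Composing with that means placing these cups and half strands beside \<open>x\<close>, so
  vertical composition turns into horizontal composition.\<close>

lemma standard_vcomp:
  assumes "x \<in> diagHom k l d" "y \<in> diagHom l m e" "standard k l d x" "standard l m e y"
  shows "standard k m (d + e) (vcomp y x)"
proof -
  obtain a b n where x: "2 * a + l = 2 * b + n + k" "d = int a - int b"
    "hcomp (cups a) x = hcomp (cups b) (hcomp (hfs n) (idQ k))"
    using assms(3) unfolding standard_def by auto
  obtain a' b' n' where y: "2 * a' + m = 2 * b' + n' + l" "e = int a' - int b'"
    "hcomp (cups a') y = hcomp (cups b') (hcomp (hfs n') (idQ l))"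
    using assms(4) unfolding standard_def by auto
  have "hcomp (cups a') (vcomp y x) = vcomp (hcomp (cups a') y) x"
    using interchange_diag[OF diagHom_idQ cups_diagHom assms(1,2)]
    by (simp add: vcomp_idQ_right[OF cups_diagHom])
  also have "\<dots> = vcomp (hcomp (hcomp (cups b') (hfs n')) (idQ l)) x"
    by (simp add: y(3) hcomp_assoc)
  also have "\<dots> = hcomp (hcomp (cups b') (hfs n')) x"
    using hcomp_split_left[OF diagHom_hcomp[OF cups_diagHom hfs_diagHom] assms(1)] by simp
  finally have "hcomp (cups (a + a')) (vcomp y x)
      = hcomp (cups b') (hcomp (hcomp (cups a) (hfs n')) x)"
    by (metis cups_add cups_commute[OF cups_diagHom] hcomp_assoc)
  also have "\<dots> = hcomp (cups b') (hcomp (hfs n') (hcomp (cups b) (hcomp (hfs n) (idQ k))))"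
    by (metis cups_commute[OF hfs_diagHom] hcomp_assoc x(3))
  also have "\<dots> = hcomp (cups (b + b')) (hcomp (hfs (n + n')) (idQ k))"
    by (metis add.commute cups_commute[OF hfs_diagHom] hcomp_assoc cups_add hfs_add)
  finally show ?thesis
    unfolding standard_def using x(1,2) y(1,2)
    by (intro exI[of _ "a + a'"] exI[of _ "b + b'"] exI[of _ "n + n'"]) simp
qed

text \<open>The identity strands of the left factor separate its cups and half strands from those of
  the right factor. Cups pass them by centrality, half strands by the commutation relation
  (R4).\<close>

lemma standard_hcomp:
  assumes "x \<in> diagHom k l d" "y \<in> diagHom k' l' d'" "standard k l d x" "standard k' l' d' y"
  shows "standard (k + k') (l + l') (d + d') (hcomp x y)"
proof -
  obtain a b n where x: "2 * a + l = 2 * b + n + k" "d = int a - int b"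
    "hcomp (cups a) x = hcomp (cups b) (hcomp (hfs n) (idQ k))"
    using assms(3) unfolding standard_def by auto
  obtain a' b' n' where y: "2 * a' + l' = 2 * b' + n' + k'" "d' = int a' - int b'"
    "hcomp (cups a') y = hcomp (cups b') (hcomp (hfs n') (idQ k'))"
    using assms(4) unfolding standard_def by auto
  have "hcomp (cups (a + a')) (hcomp x y) = hcomp (hcomp (cups a) x) (hcomp (cups a') y)"
    by (metis assms(1) cups_add cups_commute hcomp_assoc)
  also have "\<dots> = hcomp (cups b) (hcomp (hcomp (hfs n) (hcomp (idQ k) (cups b')))
      (hcomp (hfs n') (idQ k')))"
    by (simp add: x(3) y(3) hcomp_assoc)
  also have "hcomp (hfs n) (hcomp (idQ k) (cups b')) = hcomp (cups b') (hcomp (hfs n) (idQ k))"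
    by (metis cups_commute[OF diagHom_hcomp[OF hfs_diagHom diagHom_idQ]] hcomp_assoc)
  also have "hcomp (cups b) (hcomp (hcomp (cups b') (hcomp (hfs n) (idQ k)))
      (hcomp (hfs n') (idQ k'))) = hcomp (hcomp (cups b) (cups b'))
      (hcomp (hfs n) (hcomp (hcomp (idQ k) (hfs n')) (idQ k')))"
    by (simp add: hcomp_assoc)
  also have "\<dots> = hcomp (cups (b + b')) (hcomp (hfs (n + n')) (idQ (k + k')))"
    by (simp add: cups_add hcomp_assoc flip: hfs_commute hfs_add hcomp_idQ)
  finally show ?thesis
    unfolding standard_def using x(1,2) y(1,2)
    by (intro exI[of _ "a + a'"] exI[of _ "b + b'"] exI[of _ "n + n'"]) simp
qed

lemma vcomp_zero [simp]: "vcomp 0 x = 0" "vcomp x 0 = 0"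
  and hcomp_zero [simp]: "hcomp 0 x = 0" "hcomp x 0 = 0"
proof -
  have "vcomp (0 + 0) x = vcomp 0 x + vcomp 0 x" by transfer (rule deq.Over_Plus_left)
  then show "vcomp 0 x = 0" by simp
  have "vcomp x (0 + 0) = vcomp x 0 + vcomp x 0" by transfer (rule deq.Over_Plus_right)
  then show "vcomp x 0 = 0" by simp
  have "hcomp (0 + 0) x = hcomp 0 x + hcomp 0 x" by transfer (rule deq.Beside_Plus_left)
  then show "hcomp 0 x = 0" by simp
  have "hcomp x (0 + 0) = hcomp x 0 + hcomp x 0" by transfer (rule deq.Beside_Plus_right)
  then show "hcomp x 0 = 0" by simp
qed

lemma dmor_add_self [simp]: "x + x = (0 :: dmor)"
  by transfer (rule deq.Plus_self)

lemma zero_or_standard: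
  "has_type k l d t \<Longrightarrow> abs_dmor t = 0 \<or> standard k l d (abs_dmor t)"
proof (induction rule: has_type.induct)
  case (1 k l d)
  then show ?case by (simp add: zero_dmor_def)
next
  case (2 k l d s t)
  \<comment> \<open>Two standard terms of equal type denote the same morphism, and in characteristic
    two their sum vanishes.\<close>
  then show ?case
    using standard_unique[OF diagHom_abs[OF 2(1)] diagHom_abs[OF 2(2)]]
    by (auto simp flip: plus_dmor.abs_eq)
next
  case 3
  have "abs_dmor Void = idQ 0" by (simp add: idQ.abs_eq)
  then show ?case unfolding standard_def
    by (intro disjI2 exI[of _ "0::nat"]) simp
next
  case 4
  have "abs_dmor Strand = idQ 1"
    by (simp add: idQ.abs_eq dmor.abs_eq_iff deq.sym[OF deq.Beside_Void_right])
  then show ?case unfolding standard_def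
    by (intro disjI2 exI[of _ "0::nat"]) simp
next
  case 5
  show ?case unfolding standard_def cup_def[symmetric]
    by (intro disjI2 exI[of _ "0::nat"] exI[of _ "1::nat"]) simp
next
  case 6
  \<comment> \<open>Interchange identifies the cup beside the cap with the cup on top of the cap,
    and the handle slide makes this two strands. A cap is thus the division of two strands by one
    cup.\<close>
  have "hcomp cup cap = idQ 2"
    using hcomp_split_left[OF diagHom_generators(1,2)] by (simp add: cup_cap)
  then show ?case unfolding standard_def cap_def[symmetric]
    by (intro disjI2 exI[of _ "1::nat"] exI[of _ "0::nat"]) simp
next
  case 7
  show ?case unfolding standard_def hf_def[symmetric]
    by (intro disjI2 exI[of _ "0::nat"] exI[of _ "1::nat"] conjI) simp_all
next
  case (8 k l d t m e s)
  then show ?case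
    using standard_vcomp[OF diagHom_abs[OF 8(1)] diagHom_abs[OF 8(2)]]
    by (auto simp flip: vcomp.abs_eq)
next
  case (9 k l d s k' l' d' t)
  then show ?case
    using standard_hcomp[OF diagHom_abs[OF 9(1)] diagHom_abs[OF 9(2)]]
    by (auto simp flip: hcomp.abs_eq)
qed

section \<open>Dimensions of the diagram spaces\<close>

lemma diagHom_cases: "x \<in> diagHom k l d \<Longrightarrow> x = 0 \<or> standard k l d x"
  using zero_or_standard by (auto simp: diagHom_def)

text \<open>A diagram space contains at most one nonzero element, and there the value is 1.\<close>

lemma ev_inject:
  assumes "x \<in> diagHom k l d" "y \<in> diagHom k l d" "ev x = ev y"
  shows "x = y"
  using assms diagHom_cases[OF assms(1)] diagHom_cases[OF assms(2)]
    standard_unique[OF assms(1,2)] by (auto dest: standard_ev)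

text \<open>The number \<open>2 * d + l - k\<close> of half strands in a normal form cannot be
  negative.\<close>

lemma diagHom_eq_zero:
  assumes "x \<in> diagHom k l d" "2 * d < int k - int l"
  shows "x = 0"
proof (rule ccontr)
  assume "x \<noteq> 0"
  then obtain a b n where "2 * a + l = 2 * b + n + k" "d = int a - int b"
    using diagHom_cases[OF assms(1)] unfolding standard_def by auto
  then show False using assms(2) by linarith
qed

primrec caps :: "nat \<Rightarrow> dmor" where
  "caps 0 = idQ 0"
| "caps (Suc n) = hcomp cap (caps n)"

lemma caps_diagHom: "caps n \<in> diagHom (2 * n) 0 (int n)"
proof (induction n)
  case (Suc n)
  show ?case using diagHom_hcomp[OF diagHom_generators(2) Suc] by (simp add: algebra_simps)
qed (use diagHom_idQ[of 0] in simp)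

lemma ev_caps [simp]: "ev (caps n) = 1"
  by (induction n) simp_all

lemma diagHom_nonzero:
  assumes "int k - int l \<le> 2 * d"
  shows "\<exists>x\<in>diagHom k l d. ev x = 1"
proof -
  \<comment> \<open>Caps account for a positive degree and cups for a negative one, so one of
    \<open>a\<close> and \<open>b\<close> is 0. Half strands supply the missing end points; the
    assumption says that their number \<open>n\<close> is not truncated.\<close>
  define a b n where "a = nat d" and "b = nat (- d)" and "n = nat (int l - int k + 2 * d)"
  have len: "2 * b + (n + k) = 2 * a + l" and deg: "- int b + int a = d"
    using assms unfolding a_def b_def n_def by linarith+
  define x where "x = vcomp (hcomp (caps a) (idQ l)) (hcomp (cups b) (hcomp (hfs n) (idQ k)))"
  have "hcomp (cups b) (hcomp (hfs n) (idQ k)) \<in> diagHom (0 + (0 + k)) (2 * b + (n + k)) (- int b + (0 + 0))"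
    by (intro diagHom_hcomp cups_diagHom hfs_diagHom diagHom_idQ)
  moreover have "hcomp (caps a) (idQ l) \<in> diagHom (2 * a + l) (0 + l) (int a + 0)"
    by (intro diagHom_hcomp caps_diagHom diagHom_idQ)
  ultimately have "x \<in> diagHom k l d"
    unfolding x_def using diagHom_vcomp len deg by fastforce
  then show ?thesis by (intro bexI[of _ x]) (simp_all add: x_def)
qed

section \<open>Direct sums\<close>

context dg_category
begin

lemma sum_Hom:
  assumes "A \<in> Obj C" "B \<in> Obj C" "\<And>j. j \<in> J \<Longrightarrow> f j \<in> Hom C A B n"
  shows "sum f J \<in> Hom C A B n"
  using assms(3) by (induction J rule: infinite_finite_induct)
    (simp_all add: zero_Hom add_Hom assms(1,2))

lemma Cmp_zero_right:
  assumes "A \<in> Obj C" "B \<in> Obj C" "D \<in> Obj C" "g \<in> Hom C B D n"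
  shows "Cmp C A B D g 0 = 0"
  using Cmp_add_right[OF assms(1-3) zero_Hom zero_Hom assms(4)] assms by simp

lemma Cmp_zero_left:
  assumes "A \<in> Obj C" "B \<in> Obj C" "D \<in> Obj C" "f \<in> Hom C A B n"
  shows "Cmp C A B D 0 f = 0"
  using Cmp_add_left[OF assms(1-4) zero_Hom zero_Hom] assms by simp

lemma Dif_zero:
  assumes "A \<in> Obj C" "B \<in> Obj C"
  shows "Dif C A B 0 = 0"
  using Dif_add[OF assms zero_Hom[OF assms] zero_Hom[OF assms]] by simp

lemma Cmp_sum_right:
  assumes "A \<in> Obj C" "B \<in> Obj C" "D \<in> Obj C" "\<And>j. j \<in> J \<Longrightarrow> f j \<in> Hom C A B m" "g \<in> Hom C B D n"
  shows "Cmp C A B D g (sum f J) = (\<Sum>j\<in>J. Cmp C A B D g (f j))"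
  using assms(4)
proof (induction J rule: infinite_finite_induct)
  case (insert j J)
  then show ?case
    using Cmp_add_right[OF assms(1-3) _ sum_Hom[OF assms(1,2)] assms(5), of "f j" m J f] by simp
qed (simp_all add: Cmp_zero_right[OF assms(1-3,5)])

lemma Cmp_sum_left:
  assumes "A \<in> Obj C" "B \<in> Obj C" "D \<in> Obj C" "f \<in> Hom C A B m" "\<And>j. j \<in> J \<Longrightarrow> g j \<in> Hom C B D n"
  shows "Cmp C A B D (sum g J) f = (\<Sum>j\<in>J. Cmp C A B D (g j) f)"
  using assms(5)
proof (induction J rule: infinite_finite_induct)
  case (insert j J)
  then show ?case
    using Cmp_add_left[OF assms(1-4) _ sum_Hom[OF assms(2,3)], of "g j" n J g] by simp
qed (simp_all add: Cmp_zero_left[OF assms(1-4)])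

lemma Dif_sum:
  assumes "A \<in> Obj C" "B \<in> Obj C" "\<And>j. j \<in> J \<Longrightarrow> f j \<in> Hom C A B m"
  shows "Dif C A B (sum f J) = (\<Sum>j\<in>J. Dif C A B (f j))"
  using assms(3)
proof (induction J rule: infinite_finite_induct)
  case (insert j J)
  then show ?case
    using Dif_add[OF assms(1,2) _ sum_Hom[OF assms(1,2)], of "f j" m J f] by simp
qed (simp_all add: Dif_zero[OF assms(1,2)])

section \<open>Matrices over a DG category\<close>

lemma mat_HomD:
  "M \<in> mat_Hom C A B n \<Longrightarrow> i < length A \<Longrightarrow> j < length B \<Longrightarrow> M i j \<in> Hom C (A ! i) (B ! j) n"
  "M \<in> mat_Hom C A B n \<Longrightarrow> \<not> (i < length A \<and> j < length B) \<Longrightarrow> M i j = 0"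
  unfolding mat_Hom_def by (metis (mono_tags, lifting) mem_Collect_eq)+

lemma mat_HomI:
  assumes "\<And>i j. i < length A \<Longrightarrow> j < length B \<Longrightarrow> M i j \<in> Hom C (A ! i) (B ! j) n"
    and "\<And>i j. \<not> (i < length A \<and> j < length B) \<Longrightarrow> M i j = 0"
  shows "M \<in> mat_Hom C A B n"
  using assms by (simp add: mat_Hom_def)

lemma mat_eqI:
  assumes "M \<in> mat_Hom C A B n" "M' \<in> mat_Hom C A B n'"
    and "\<And>i j. i < length A \<Longrightarrow> j < length B \<Longrightarrow> M i j = M' i j"
  shows "M = M'"
  by (intro ext) (metis assms mat_HomD(2))

lemma nth_Obj: "A \<in> lists (Obj C) \<Longrightarrow> i < length A \<Longrightarrow> A ! i \<in> Obj C"
  by auto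

lemma mat_Cmp_Hom:
  assumes "A \<in> lists (Obj C)" "B \<in> lists (Obj C)" "D \<in> lists (Obj C)"
    and "f \<in> mat_Hom C A B m" "g \<in> mat_Hom C B D n"
  shows "mat_Cmp C A B D g f \<in> mat_Hom C A D (m + n)"
  using assms mat_HomD(1)
  by (intro mat_HomI) (auto simp: mat_Cmp_def simp del: in_lists_conv_set intro!: sum_Hom Cmp_Hom nth_Obj)

lemma mat_add_Hom:
  assumes "A \<in> lists (Obj C)" "B \<in> lists (Obj C)" "f \<in> mat_Hom C A B n" "g \<in> mat_Hom C A B n"
  shows "f + g \<in> mat_Hom C A B n"
  using assms mat_HomD[OF assms(3)] mat_HomD[OF assms(4)]
  by (intro mat_HomI) (auto simp del: in_lists_conv_set intro!: add_Hom nth_Obj)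

lemma mat_zero_Hom:
  assumes "A \<in> lists (Obj C)" "B \<in> lists (Obj C)"
  shows "0 \<in> mat_Hom C A B n"
  using assms by (intro mat_HomI) (auto simp del: in_lists_conv_set intro!: zero_Hom nth_Obj)

lemma mat_Idn_Hom:
  assumes "A \<in> lists (Obj C)"
  shows "mat_Idn C A \<in> mat_Hom C A A 0"
  using assms by (intro mat_HomI)
    (auto simp: mat_Idn_def simp del: in_lists_conv_set intro!: zero_Hom Idn_Hom nth_Obj)

lemma mat_Dif_Hom:
  assumes "A \<in> lists (Obj C)" "B \<in> lists (Obj C)" "f \<in> mat_Hom C A B n"
  shows "mat_Dif C A B f \<in> mat_Hom C A B (n + 1)"
  using assms mat_HomD(1)[OF assms(3)] by (intro mat_HomI)
    (auto simp: mat_Dif_def simp del: in_lists_conv_set intro!: Dif_Hom nth_Obj)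

lemma mat_char_two:
  assumes "A \<in> lists (Obj C)" "B \<in> lists (Obj C)" "f \<in> mat_Hom C A B n"
  shows "f + f = 0"
proof (intro ext)
  fix i j
  show "(f + f) i j = 0 i j"
  proof (cases "i < length A \<and> j < length B")
    case True
    then show ?thesis
      using char_two[OF nth_Obj[OF assms(1)] nth_Obj[OF assms(2)] mat_HomD(1)[OF assms(3)]] by simp
  qed (use mat_HomD(2)[OF assms(3)] in simp)
qed

lemma mat_Cmp_assoc:
  assumes A: "A \<in> lists (Obj C)" and B: "B \<in> lists (Obj C)" and D: "D \<in> lists (Obj C)"
    and E: "E \<in> lists (Obj C)"
    and f: "f \<in> mat_Hom C A B m" and g: "g \<in> mat_Hom C B D n" and h: "h \<in> mat_Hom C D E p"
  shows "mat_Cmp C A D E h (mat_Cmp C A B D g f) = mat_Cmp C A B E (mat_Cmp C B D E h g) f"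
proof (rule mat_eqI)
  show "mat_Cmp C A D E h (mat_Cmp C A B D g f) \<in> mat_Hom C A E (m + n + p)"
    by (intro mat_Cmp_Hom assms)
  show "mat_Cmp C A B E (mat_Cmp C B D E h g) f \<in> mat_Hom C A E (m + (n + p))"
    by (intro mat_Cmp_Hom assms)
  fix i l assume i: "i < length A" and l: "l < length E"
  note f' = mat_HomD(1)[OF f i] and g' = mat_HomD(1)[OF g] and h' = mat_HomD(1)[OF h _ l]
  note Ob = nth_Obj[OF A i] nth_Obj[OF B] nth_Obj[OF D] nth_Obj[OF E l]
  have "mat_Cmp C A D E h (mat_Cmp C A B D g f) i l =
      (\<Sum>k<length D. \<Sum>j<length B. Cmp C (A!i) (D!k) (E!l) (h k l) (Cmp C (A!i) (B!j) (D!k) (g j k) (f i j)))"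
    using i l unfolding mat_Cmp_def
    by (simp, intro sum.cong[OF HOL.refl] Cmp_sum_right[where m = "m + n"] Cmp_Hom)
      (auto intro: Ob f' g' h')
  also have "\<dots> = (\<Sum>k<length D. \<Sum>j<length B. Cmp C (A!i) (B!j) (E!l) (Cmp C (B!j) (D!k) (E!l) (h k l) (g j k)) (f i j))"
    by (intro sum.cong[OF HOL.refl] Cmp_assoc) (auto intro: Ob f' g' h')
  also have "\<dots> = (\<Sum>j<length B. \<Sum>k<length D. Cmp C (A!i) (B!j) (E!l) (Cmp C (B!j) (D!k) (E!l) (h k l) (g j k)) (f i j))"
    by (rule sum.swap)
  also have "\<dots> = mat_Cmp C A B E (mat_Cmp C B D E h g) f i l"
    using i l unfolding mat_Cmp_def
    by (simp, intro sum.cong[OF HOL.refl] Cmp_sum_left[where n = "n + p", symmetric] Cmp_Hom)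
      (auto intro: Ob f' g' h')
  finally show "mat_Cmp C A D E h (mat_Cmp C A B D g f) i l = mat_Cmp C A B E (mat_Cmp C B D E h g) f i l" .
qed

lemma mat_Cmp_Idn_right:
  assumes A: "A \<in> lists (Obj C)" and B: "B \<in> lists (Obj C)" and f: "f \<in> mat_Hom C A B n"
  shows "mat_Cmp C A A B f (mat_Idn C A) = f"
proof (rule mat_eqI[OF _ f])
  show "mat_Cmp C A A B f (mat_Idn C A) \<in> mat_Hom C A B (0 + n)"
    by (intro mat_Cmp_Hom assms mat_Idn_Hom)
  fix i k assume i: "i < length A" and k: "k < length B"
  note Ob = nth_Obj[OF A] nth_Obj[OF B k] and f' = mat_HomD(1)[OF f _ k]
  have "Cmp C (A!i) (A!j) (B!k) (f j k) (mat_Idn C A i j) = (if i = j then f i k else 0)"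
    if j: "j < length A" for j
    using Cmp_Idn_right[OF Ob(1)[OF j] Ob(2) f'[OF j]] j i
      Cmp_zero_right[OF Ob(1)[OF i] Ob(1)[OF j] Ob(2) f'[OF j]]
    by (auto simp: mat_Idn_def)
  then show "mat_Cmp C A A B f (mat_Idn C A) i k = f i k"
    using i k by (simp add: mat_Cmp_def)
qed

lemma mat_Cmp_Idn_left:
  assumes A: "A \<in> lists (Obj C)" and B: "B \<in> lists (Obj C)" and f: "f \<in> mat_Hom C A B n"
  shows "mat_Cmp C A B B (mat_Idn C B) f = f"
proof (rule mat_eqI[OF _ f])
  show "mat_Cmp C A B B (mat_Idn C B) f \<in> mat_Hom C A B (n + 0)"
    by (intro mat_Cmp_Hom assms mat_Idn_Hom)
  fix i k assume i: "i < length A" and k: "k < length B"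
  note Ob = nth_Obj[OF A i] nth_Obj[OF B] and f' = mat_HomD(1)[OF f i]
  have "Cmp C (A!i) (B!j) (B!k) (mat_Idn C B j k) (f i j) = (if j = k then f i k else 0)"
    if j: "j < length B" for j
    using Cmp_Idn_left[OF Ob(1) Ob(2)[OF j] f'[OF j]] j k
      Cmp_zero_left[OF Ob(1) Ob(2)[OF j] Ob(2)[OF k] f'[OF j]]
    by (auto simp: mat_Idn_def)
  then show "mat_Cmp C A B B (mat_Idn C B) f i k = f i k"
    using i k by (simp add: mat_Cmp_def)
qed

lemma mat_Cmp_add_right:
  assumes A: "A \<in> lists (Obj C)" and B: "B \<in> lists (Obj C)" and D: "D \<in> lists (Obj C)"
    and f: "f \<in> mat_Hom C A B m" and f': "f' \<in> mat_Hom C A B m" and g: "g \<in> mat_Hom C B D n"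
  shows "mat_Cmp C A B D g (f + f') = mat_Cmp C A B D g f + mat_Cmp C A B D g f'"
proof (intro ext)
  fix i k
  show "mat_Cmp C A B D g (f + f') i k = (mat_Cmp C A B D g f + mat_Cmp C A B D g f') i k"
  proof (cases "i < length A \<and> k < length D")
    case True
    have "Cmp C (A!i) (B!j) (D!k) (g j k) (f i j + f' i j)
        = Cmp C (A!i) (B!j) (D!k) (g j k) (f i j) + Cmp C (A!i) (B!j) (D!k) (g j k) (f' i j)"
      if "j < length B" for j
      using True that by (intro Cmp_add_right[where m = m and n = n] nth_Obj[OF A] nth_Obj[OF B] nth_Obj[OF D]
        mat_HomD(1)[OF f] mat_HomD(1)[OF f'] mat_HomD(1)[OF g]) auto
    then show ?thesis using True by (simp add: mat_Cmp_def flip: sum.distrib)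
  qed (auto simp: mat_Cmp_def)
qed

lemma mat_Cmp_add_left:
  assumes A: "A \<in> lists (Obj C)" and B: "B \<in> lists (Obj C)" and D: "D \<in> lists (Obj C)"
    and f: "f \<in> mat_Hom C A B m" and g: "g \<in> mat_Hom C B D n" and g': "g' \<in> mat_Hom C B D n"
  shows "mat_Cmp C A B D (g + g') f = mat_Cmp C A B D g f + mat_Cmp C A B D g' f"
proof (intro ext)
  fix i k
  show "mat_Cmp C A B D (g + g') f i k = (mat_Cmp C A B D g f + mat_Cmp C A B D g' f) i k"
  proof (cases "i < length A \<and> k < length D")
    case True
    have "Cmp C (A!i) (B!j) (D!k) (g j k + g' j k) (f i j)
        = Cmp C (A!i) (B!j) (D!k) (g j k) (f i j) + Cmp C (A!i) (B!j) (D!k) (g' j k) (f i j)"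
      if "j < length B" for j
      using True that by (intro Cmp_add_left[where m = m and n = n] nth_Obj[OF A] nth_Obj[OF B] nth_Obj[OF D]
        mat_HomD(1)[OF f] mat_HomD(1)[OF g] mat_HomD(1)[OF g']) auto
    then show ?thesis using True by (simp add: mat_Cmp_def flip: sum.distrib)
  qed (auto simp: mat_Cmp_def)
qed

lemma mat_Dif_add:
  assumes A: "A \<in> lists (Obj C)" and B: "B \<in> lists (Obj C)"
    and f: "f \<in> mat_Hom C A B n" and g: "g \<in> mat_Hom C A B n"
  shows "mat_Dif C A B (f + g) = mat_Dif C A B f + mat_Dif C A B g"
  using Dif_add[OF nth_Obj[OF A] nth_Obj[OF B] mat_HomD(1)[OF f] mat_HomD(1)[OF g]]
  by (intro ext) (simp add: mat_Dif_def)

lemma mat_Dif_Dif: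
  assumes A: "A \<in> lists (Obj C)" and B: "B \<in> lists (Obj C)" and f: "f \<in> mat_Hom C A B n"
  shows "mat_Dif C A B (mat_Dif C A B f) = 0"
  using Dif_Dif[OF nth_Obj[OF A] nth_Obj[OF B] mat_HomD(1)[OF f]]
  by (intro ext) (simp add: mat_Dif_def)

lemma mat_Leibniz:
  assumes A: "A \<in> lists (Obj C)" and B: "B \<in> lists (Obj C)" and D: "D \<in> lists (Obj C)"
    and f: "f \<in> mat_Hom C A B m" and g: "g \<in> mat_Hom C B D n"
  shows "mat_Dif C A D (mat_Cmp C A B D g f)
    = mat_Cmp C A B D (mat_Dif C B D g) f + mat_Cmp C A B D g (mat_Dif C A B f)"
proof (intro ext)
  fix i k
  show "mat_Dif C A D (mat_Cmp C A B D g f) i k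
    = (mat_Cmp C A B D (mat_Dif C B D g) f + mat_Cmp C A B D g (mat_Dif C A B f)) i k"
  proof (cases "i < length A \<and> k < length D")
    case True
    then have ik: "i < length A" "k < length D" by auto
    note Ob = nth_Obj[OF A ik(1)] nth_Obj[OF B] nth_Obj[OF D ik(2)]
    note fg = mat_HomD(1)[OF f ik(1)] mat_HomD(1)[OF g _ ik(2)]
    have "Dif C (A!i) (D!k) (\<Sum>j<length B. Cmp C (A!i) (B!j) (D!k) (g j k) (f i j))
      = (\<Sum>j<length B. Dif C (A!i) (D!k) (Cmp C (A!i) (B!j) (D!k) (g j k) (f i j)))"
      by (intro Dif_sum[where m = "m + n"] Cmp_Hom) (auto intro: Ob fg)
    also have "\<dots> = (\<Sum>j<length B. Cmp C (A!i) (B!j) (D!k) (Dif C (B!j) (D!k) (g j k)) (f i j)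
        + Cmp C (A!i) (B!j) (D!k) (g j k) (Dif C (A!i) (B!j) (f i j)))"
      by (intro sum.cong[OF HOL.refl] Leibniz) (auto intro: Ob fg)
    finally show ?thesis using ik by (simp add: mat_Cmp_def mat_Dif_def flip: sum.distrib)
  qed (auto simp: mat_Cmp_def mat_Dif_def)
qed

end

context strict_monoidal_dg_category
begin

lemma dg_category_direct_sums: "dg_category (direct_sums C)"
  by unfold_locales (simp_all del: in_lists_conv_set add: direct_sums_def mat_zero_Hom mat_add_Hom mat_char_two
      mat_Cmp_Hom mat_Cmp_assoc mat_Idn_Hom mat_Cmp_Idn_right mat_Cmp_Idn_left mat_Cmp_add_right
      mat_Cmp_add_left mat_Dif_Hom mat_Dif_add mat_Dif_Dif mat_Leibniz)

lemma Tmor_zero: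
  assumes "A \<in> Obj C" "A' \<in> Obj C" "B \<in> Obj C" "B' \<in> Obj C"
  shows "f \<in> Hom C A A' m \<Longrightarrow> Tmor C A A' B B' f 0 = 0" "g \<in> Hom C B B' n \<Longrightarrow> Tmor C A A' B B' 0 g = 0"
  using Tmor_add_right[OF assms _ zero_Hom zero_Hom] Tmor_add_left[OF assms zero_Hom zero_Hom] assms
  by force+

lemma Tmor_sum_left:
  assumes "A \<in> Obj C" "A' \<in> Obj C" "B \<in> Obj C" "B' \<in> Obj C"
    "\<And>j. j \<in> J \<Longrightarrow> f j \<in> Hom C A A' m" "g \<in> Hom C B B' n"
  shows "Tmor C A A' B B' (sum f J) g = (\<Sum>j\<in>J. Tmor C A A' B B' (f j) g)"
  using assms(5)
proof (induction J rule: infinite_finite_induct)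
  case (insert j J)
  then show ?case
    using Tmor_add_left[OF assms(1-4) _ sum_Hom[OF assms(1,2)] assms(6), of "f j" m J f] by simp
qed (simp_all add: Tmor_zero(2)[OF assms(1-4,6)])

lemma Tmor_sum_right:
  assumes "A \<in> Obj C" "A' \<in> Obj C" "B \<in> Obj C" "B' \<in> Obj C"
    "f \<in> Hom C A A' m" "\<And>j. j \<in> J \<Longrightarrow> g j \<in> Hom C B B' n"
  shows "Tmor C A A' B B' f (sum g J) = (\<Sum>j\<in>J. Tmor C A A' B B' f (g j))"
  using assms(6)
proof (induction J rule: infinite_finite_induct)
  case (insert j J)
  then show ?case
    using Tmor_add_right[OF assms(1-5) _ sum_Hom[OF assms(3,4)], of "g j" n J g] by simp
qed (simp_all add: Tmor_zero(1)[OF assms(1-5)])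

end

section \<open>Tensor products of matrices\<close>

lemma length_mat_Tob [simp]: "length (mat_Tob C A B) = length A * length B"
  by (induction A) (simp_all add: mat_Tob_def)

lemma div_mod_less:
  assumes "p < m * (n :: nat)"
  shows "p div n < m" "p mod n < n"
proof -
  have "n > 0" using assms by (cases n) auto
  then show "p div n < m" "p mod n < n" using assms by (auto simp: less_mult_imp_div_less)
qed

lemma mat_Tob_nth:
  assumes "p < length A * length B"
  shows "mat_Tob C A B ! p = Tob C (A ! (p div length B)) (B ! (p mod length B))"
  using assms
proof (induction A arbitrary: p)
  case (Cons a A)
  have T: "mat_Tob C (a # A) B = map (Tob C a) B @ mat_Tob C A B" by (simp add: mat_Tob_def)
  show ?case
  proof (cases "p < length B")
    case False
    then have p: "p = length B + (p - length B)" "p - length B < length A * length B"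
      using Cons.prems by auto
    have "B \<noteq> []" using Cons.prems by auto
    then have d: "p div length B = Suc ((p - length B) div length B)"
      "p mod length B = (p - length B) mod length B"
      using False by (simp_all add: le_div_geq le_mod_geq)
    show ?thesis using False Cons.IH[OF p(2)] by (simp add: T nth_append d)
  qed (simp add: T nth_append)
qed simp

text \<open>The summands of a tensor product are numbered by \<open>q = i * n + j\<close>; this
  turns a sum over such positions into a sum over both factors.\<close>

lemma sum_lessThan_mult:
  "(\<Sum>q<m * n. f (q div n) (q mod n)) = (\<Sum>i<m. \<Sum>j<(n :: nat). f i j)"
proof -
  have lt: "i * n + j < m * n" if "i < m" "j < n" for i j
  proof -
    have "i * n + j < Suc i * n" using that by simp
    also have "\<dots> \<le> m * n" using that by (intro mult_le_mono1) simp
    finally show ?thesis .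
  qed
  have "(\<Sum>q<m * n. f (q div n) (q mod n)) = (\<Sum>(i, j)\<in>{..<m} \<times> {..<n}. f i j)"
    by (rule sum.reindex_bij_witness[where i = "\<lambda>(i, j). i * n + j" and j = "\<lambda>q. (q div n, q mod n)"])
      (auto simp: div_mod_less lt)
  then show ?thesis by (simp add: sum.cartesian_product)
qed

context strict_monoidal_dg_category
begin

lemma mat_Tob_Obj:
  assumes "A \<in> lists (Obj C)" "B \<in> lists (Obj C)"
  shows "mat_Tob C A B \<in> lists (Obj C)"
  using assms by (auto simp: mat_Tob_def intro!: Tob_Obj)

lemma mat_Tmor_nth:
  assumes "p < length A * length B" "q < length A' * length B'"
  shows "mat_Tmor C A A' B B' f g p q = Tmor C (A ! (p div length B)) (A' ! (q div length B'))
    (B ! (p mod length B)) (B' ! (q mod length B')) (f (p div length B) (q div length B'))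
    (g (p mod length B) (q mod length B'))"
  using assms by (simp add: mat_Tmor_def Let_def)

lemma mat_Tmor_Hom:
  assumes A: "A \<in> lists (Obj C)" and A': "A' \<in> lists (Obj C)"
    and B: "B \<in> lists (Obj C)" and B': "B' \<in> lists (Obj C)"
    and f: "f \<in> mat_Hom C A A' m" and g: "g \<in> mat_Hom C B B' n"
  shows "mat_Tmor C A A' B B' f g \<in> mat_Hom C (mat_Tob C A B) (mat_Tob C A' B') (m + n)"
proof (rule mat_HomI)
  fix p q assume "p < length (mat_Tob C A B)" "q < length (mat_Tob C A' B')"
  then have pq: "p < length A * length B" "q < length A' * length B'" by simp_all
  note d = div_mod_less[OF pq(1)] div_mod_less[OF pq(2)]
  show "mat_Tmor C A A' B B' f g p q \<in> Hom C (mat_Tob C A B ! p) (mat_Tob C A' B' ! q) (m + n)"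
    unfolding mat_Tob_nth[OF pq(1)] mat_Tob_nth[OF pq(2)] mat_Tmor_nth[OF pq]
    by (intro Tmor_Hom nth_Obj[OF A] nth_Obj[OF A'] nth_Obj[OF B] nth_Obj[OF B'] d
        mat_HomD(1)[OF f] mat_HomD(1)[OF g])
qed (auto simp: mat_Tmor_def)

lemma mat_Tmor_add_left:
  assumes A: "A \<in> lists (Obj C)" and A': "A' \<in> lists (Obj C)"
    and B: "B \<in> lists (Obj C)" and B': "B' \<in> lists (Obj C)"
    and f: "f \<in> mat_Hom C A A' m" and f': "f' \<in> mat_Hom C A A' m" and g: "g \<in> mat_Hom C B B' n"
  shows "mat_Tmor C A A' B B' (f + f') g = mat_Tmor C A A' B B' f g + mat_Tmor C A A' B B' f' g"
proof (intro ext)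
  fix p q
  show "mat_Tmor C A A' B B' (f + f') g p q = (mat_Tmor C A A' B B' f g + mat_Tmor C A A' B B' f' g) p q"
  proof (cases "p < length A * length B \<and> q < length A' * length B'")
    case True
    then have pq: "p < length A * length B" "q < length A' * length B'" by simp_all
    note d = div_mod_less[OF pq(1)] div_mod_less[OF pq(2)]
    show ?thesis
      using pq Tmor_add_left[OF nth_Obj[OF A d(1)] nth_Obj[OF A' d(3)] nth_Obj[OF B d(2)]
          nth_Obj[OF B' d(4)] mat_HomD(1)[OF f d(1,3)] mat_HomD(1)[OF f' d(1,3)] mat_HomD(1)[OF g d(2,4)]]
      by (simp add: mat_Tmor_nth)
  qed (auto simp: mat_Tmor_def)
qed

lemma mat_Tmor_add_right:
  assumes A: "A \<in> lists (Obj C)" and A': "A' \<in> lists (Obj C)"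
    and B: "B \<in> lists (Obj C)" and B': "B' \<in> lists (Obj C)"
    and f: "f \<in> mat_Hom C A A' m" and g: "g \<in> mat_Hom C B B' n" and g': "g' \<in> mat_Hom C B B' n"
  shows "mat_Tmor C A A' B B' f (g + g') = mat_Tmor C A A' B B' f g + mat_Tmor C A A' B B' f g'"
proof (intro ext)
  fix p q
  show "mat_Tmor C A A' B B' f (g + g') p q = (mat_Tmor C A A' B B' f g + mat_Tmor C A A' B B' f g') p q"
  proof (cases "p < length A * length B \<and> q < length A' * length B'")
    case True
    then have pq: "p < length A * length B" "q < length A' * length B'" by simp_all
    note d = div_mod_less[OF pq(1)] div_mod_less[OF pq(2)]
    show ?thesis
      using pq Tmor_add_right[OF nth_Obj[OF A d(1)] nth_Obj[OF A' d(3)] nth_Obj[OF B d(2)]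
          nth_Obj[OF B' d(4)] mat_HomD(1)[OF f d(1,3)] mat_HomD(1)[OF g d(2,4)] mat_HomD(1)[OF g' d(2,4)]]
      by (simp add: mat_Tmor_nth)
  qed (auto simp: mat_Tmor_def)
qed

text \<open>Different positions differ in the quotient or in the remainder, so an entry off the
  diagonal has a vanishing factor.\<close>

lemma mat_Tmor_Idn:
  assumes A: "A \<in> lists (Obj C)" and B: "B \<in> lists (Obj C)"
  shows "mat_Tmor C A A B B (mat_Idn C A) (mat_Idn C B) = mat_Idn C (mat_Tob C A B)"
proof (rule mat_eqI)
  show "mat_Tmor C A A B B (mat_Idn C A) (mat_Idn C B) \<in> mat_Hom C (mat_Tob C A B) (mat_Tob C A B) (0 + 0)"
    by (intro mat_Tmor_Hom mat_Idn_Hom A B)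
  show "mat_Idn C (mat_Tob C A B) \<in> mat_Hom C (mat_Tob C A B) (mat_Tob C A B) 0"
    by (intro mat_Idn_Hom mat_Tob_Obj A B)
  fix p q assume "p < length (mat_Tob C A B)" "q < length (mat_Tob C A B)"
  then have pq: "p < length A * length B" "q < length A * length B" by simp_all
  note d = div_mod_less[OF pq(1)] div_mod_less[OF pq(2)]
  note Ob = nth_Obj[OF A d(1)] nth_Obj[OF A d(3)] nth_Obj[OF B d(2)] nth_Obj[OF B d(4)]
  have eq: "p = q \<longleftrightarrow> p div length B = q div length B \<and> p mod length B = q mod length B"
    by (metis div_mult_mod_eq)
  show "mat_Tmor C A A B B (mat_Idn C A) (mat_Idn C B) p q = mat_Idn C (mat_Tob C A B) p q"
  proof (cases "p = q")
    case True
    then show ?thesis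
      unfolding mat_Tmor_nth[OF pq] using pq d Tmor_Idn[OF Ob(1,3)]
      by (simp add: mat_Idn_def mat_Tob_nth)
  next
    case False
    then consider "p div length B \<noteq> q div length B" | "p mod length B \<noteq> q mod length B"
      using eq by blast
    then show ?thesis
    proof cases
      case 1
      then show ?thesis
        unfolding mat_Tmor_nth[OF pq]
        using False Tmor_zero(2)[OF Ob mat_HomD(1)[OF mat_Idn_Hom[OF B] d(2,4)]]
        by (simp add: mat_Idn_def[of C A] mat_Idn_def[of C "mat_Tob C A B"])
    next
      case 2
      then show ?thesis
        unfolding mat_Tmor_nth[OF pq]
        using False Tmor_zero(1)[OF Ob mat_HomD(1)[OF mat_Idn_Hom[OF A] d(1,3)]]
        by (simp add: mat_Idn_def[of C B] mat_Idn_def[of C "mat_Tob C A B"])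
    qed
  qed
qed

text \<open>Distributing over both compositions gives a double sum over intermediate indices. Read
  lexicographically it is the single sum that composes the two tensor products.\<close>

lemma mat_interchange:
  assumes A: "A \<in> lists (Obj C)" and A': "A' \<in> lists (Obj C)" and A'': "A'' \<in> lists (Obj C)"
    and B: "B \<in> lists (Obj C)" and B': "B' \<in> lists (Obj C)" and B'': "B'' \<in> lists (Obj C)"
    and f: "f \<in> mat_Hom C A A' m" and f': "f' \<in> mat_Hom C A' A'' m'"
    and g: "g \<in> mat_Hom C B B' n" and g': "g' \<in> mat_Hom C B' B'' n'"
  shows "mat_Tmor C A A'' B B'' (mat_Cmp C A A' A'' f' f) (mat_Cmp C B B' B'' g' g)
    = mat_Cmp C (mat_Tob C A B) (mat_Tob C A' B') (mat_Tob C A'' B'')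
        (mat_Tmor C A' A'' B' B'' f' g') (mat_Tmor C A A' B B' f g)"
proof (rule mat_eqI)
  show "mat_Tmor C A A'' B B'' (mat_Cmp C A A' A'' f' f) (mat_Cmp C B B' B'' g' g)
      \<in> mat_Hom C (mat_Tob C A B) (mat_Tob C A'' B'') (m + m' + (n + n'))"
    by (intro mat_Tmor_Hom mat_Cmp_Hom assms)
  show "mat_Cmp C (mat_Tob C A B) (mat_Tob C A' B') (mat_Tob C A'' B'')
        (mat_Tmor C A' A'' B' B'' f' g') (mat_Tmor C A A' B B' f g)
      \<in> mat_Hom C (mat_Tob C A B) (mat_Tob C A'' B'') (m + n + (m' + n'))"
    by (intro mat_Tmor_Hom mat_Cmp_Hom mat_Tob_Obj assms)
  fix p r assume "p < length (mat_Tob C A B)" "r < length (mat_Tob C A'' B'')"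
  then have pr: "p < length A * length B" "r < length A'' * length B''" by simp_all
  define i j k l where ijkl: "i = p div length B" "j = p mod length B" "k = r div length B''" "l = r mod length B''"
  have d: "i < length A" "j < length B" "k < length A''" "l < length B''"
    using div_mod_less[OF pr(1)] div_mod_less[OF pr(2)] by (simp_all add: ijkl)
  note Ob = nth_Obj[OF A d(1)] nth_Obj[OF A'] nth_Obj[OF A'' d(3)]
    nth_Obj[OF B d(2)] nth_Obj[OF B'] nth_Obj[OF B'' d(4)]
  note H = mat_HomD(1)[OF f d(1)] mat_HomD(1)[OF f' _ d(3)] mat_HomD(1)[OF g d(2)] mat_HomD(1)[OF g' _ d(4)]
  let ?T = "\<lambda>x y. Tmor C (A!i) (A''!k) (B!j) (B''!l)
    (Cmp C (A!i) (A'!x) (A''!k) (f' x k) (f i x)) (Cmp C (B!j) (B'!y) (B''!l) (g' y l) (g j y))"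
  have "mat_Tmor C A A'' B B'' (mat_Cmp C A A' A'' f' f) (mat_Cmp C B B' B'' g' g) p r
      = Tmor C (A!i) (A''!k) (B!j) (B''!l)
        (\<Sum>x<length A'. Cmp C (A!i) (A'!x) (A''!k) (f' x k) (f i x))
        (\<Sum>y<length B'. Cmp C (B!j) (B'!y) (B''!l) (g' y l) (g j y))"
    unfolding mat_Tmor_nth[OF pr] using d by (simp add: mat_Cmp_def flip: ijkl)
  also have "\<dots> = (\<Sum>x<length A'. Tmor C (A!i) (A''!k) (B!j) (B''!l)
        (Cmp C (A!i) (A'!x) (A''!k) (f' x k) (f i x))
        (\<Sum>y<length B'. Cmp C (B!j) (B'!y) (B''!l) (g' y l) (g j y)))"
    by (intro Tmor_sum_left[where m = "m + m'" and n = "n + n'"] sum_Hom Cmp_Hom) (auto intro: Ob H)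
  also have "\<dots> = (\<Sum>x<length A'. \<Sum>y<length B'. ?T x y)"
    by (intro sum.cong[OF HOL.refl] Tmor_sum_right[where m = "m + m'" and n = "n + n'"] Cmp_Hom)
      (auto intro: Ob H)
  also have "\<dots> = (\<Sum>q<length A' * length B'. ?T (q div length B') (q mod length B'))"
    by (rule sum_lessThan_mult[symmetric])
  also have "\<dots> = (\<Sum>q<length A' * length B'. Cmp C (mat_Tob C A B ! p) (mat_Tob C A' B' ! q) (mat_Tob C A'' B'' ! r)
      (mat_Tmor C A' A'' B' B'' f' g' q r) (mat_Tmor C A A' B B' f g p q))"
  proof (intro sum.cong[OF HOL.refl])
    fix q assume "q \<in> {..<length A' * length B'}"
    then have q: "q < length A' * length B'" by simp
    note dq = div_mod_less[OF q]
    show "?T (q div length B') (q mod length B') = Cmp C (mat_Tob C A B ! p) (mat_Tob C A' B' ! q) (mat_Tob C A'' B'' ! r)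
      (mat_Tmor C A' A'' B' B'' f' g' q r) (mat_Tmor C A A' B B' f g p q)"
      unfolding mat_Tmor_nth[OF pr(1) q] mat_Tmor_nth[OF q pr(2)] mat_Tob_nth[OF pr(1)]
        mat_Tob_nth[OF pr(2)] mat_Tob_nth[OF q] ijkl[symmetric]
      by (intro interchange[where m = m and m' = m' and n = n and n' = n'] Ob H dq)
  qed
  finally show "mat_Tmor C A A'' B B'' (mat_Cmp C A A' A'' f' f) (mat_Cmp C B B' B'' g' g) p r
    = mat_Cmp C (mat_Tob C A B) (mat_Tob C A' B') (mat_Tob C A'' B'')
        (mat_Tmor C A' A'' B' B'' f' g') (mat_Tmor C A A' B B' f g) p r"
    using pr by (simp add: mat_Cmp_def)
qed

lemma mat_Dif_Tmor:
  assumes A: "A \<in> lists (Obj C)" and A': "A' \<in> lists (Obj C)"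
    and B: "B \<in> lists (Obj C)" and B': "B' \<in> lists (Obj C)"
    and f: "f \<in> mat_Hom C A A' m" and g: "g \<in> mat_Hom C B B' n"
  shows "mat_Dif C (mat_Tob C A B) (mat_Tob C A' B') (mat_Tmor C A A' B B' f g)
    = mat_Tmor C A A' B B' (mat_Dif C A A' f) g + mat_Tmor C A A' B B' f (mat_Dif C B B' g)"
proof (intro ext)
  fix p q
  show "mat_Dif C (mat_Tob C A B) (mat_Tob C A' B') (mat_Tmor C A A' B B' f g) p q
    = (mat_Tmor C A A' B B' (mat_Dif C A A' f) g + mat_Tmor C A A' B B' f (mat_Dif C B B' g)) p q"
  proof (cases "p < length A * length B \<and> q < length A' * length B'")
    case True
    then have pq: "p < length A * length B" "q < length A' * length B'" by simp_all
    note d = div_mod_less[OF pq(1)] div_mod_less[OF pq(2)]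
    show ?thesis
      using pq d Dif_Tmor[OF nth_Obj[OF A d(1)] nth_Obj[OF A' d(3)] nth_Obj[OF B d(2)] nth_Obj[OF B' d(4)]
          mat_HomD(1)[OF f d(1,3)] mat_HomD(1)[OF g d(2,4)]]
      by (simp add: mat_Dif_def mat_Tob_nth mat_Tmor_nth)
  qed (auto simp: mat_Dif_def mat_Tmor_def)
qed

lemma mat_Tob_append: "mat_Tob C (A @ A') B = mat_Tob C A B @ mat_Tob C A' B"
  by (simp add: mat_Tob_def)

lemma mat_Tob_Cons: "mat_Tob C (a # A) B = map (Tob C a) B @ mat_Tob C A B"
  by (simp add: mat_Tob_def)

lemma mat_Tob_assoc:
  assumes "A \<in> lists (Obj C)" "B \<in> lists (Obj C)" "D \<in> lists (Obj C)"
  shows "mat_Tob C (mat_Tob C A B) D = mat_Tob C A (mat_Tob C B D)"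
  using assms(1)
proof (induction A)
  case (Cons a A)
  have "mat_Tob C (map (Tob C a) B) D = map (Tob C a) (mat_Tob C B D)"
  proof -
    have "a \<in> Obj C" using Cons by simp
    then show ?thesis
      using assms(2,3) by (induction B) (auto simp: mat_Tob_def Tob_assoc)
  qed
  then show ?case using Cons by (simp add: mat_Tob_Cons mat_Tob_append)
qed (simp add: mat_Tob_def)

lemma mat_Tmor_assoc:
  assumes A: "A \<in> lists (Obj C)" and A': "A' \<in> lists (Obj C)"
    and B: "B \<in> lists (Obj C)" and B': "B' \<in> lists (Obj C)"
    and D: "D \<in> lists (Obj C)" and D': "D' \<in> lists (Obj C)"
    and f: "f \<in> mat_Hom C A A' m" and g: "g \<in> mat_Hom C B B' n" and h: "h \<in> mat_Hom C D D' k"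
  shows "mat_Tmor C (mat_Tob C A B) (mat_Tob C A' B') D D' (mat_Tmor C A A' B B' f g) h
    = mat_Tmor C A A' (mat_Tob C B D) (mat_Tob C B' D') f (mat_Tmor C B B' D D' g h)"
proof (intro ext)
  \<comment> \<open>A position in a triple product can be decoded from either bracketing; the three
    coordinates obtained by division are the same.\<close>
  have index: "p div l < m * n" "p mod (n * l) < n * l" "p mod (n * l) div l = p div l mod n"
    "p mod (n * l) mod l = p mod l" "p div (n * l) = p div l div n" if "p < m * n * l" for p m n l :: nat
  proof -
    show "p div l < m * n" by (rule div_mod_less(1)[OF that])
    show "p mod (n * l) < n * l" using that by (cases "n * l = 0") auto
    show "p mod (n * l) div l = p div l mod n"
      by (metis div_mult2_eq mod_mult2_eq mult.commute div_mult_self4 mod_div_trivial add.commute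
          add.left_neutral mult_0_right div_mult_self1_is_m nonzero_mult_div_cancel_left
          mult_div_mod_eq minus_mod_eq_mult_div)
    show "p mod (n * l) mod l = p mod l" by (simp add: mod_mod_cancel)
    show "p div (n * l) = p div l div n" by (metis div_mult2_eq mult.commute)
  qed
  fix p q
  show "mat_Tmor C (mat_Tob C A B) (mat_Tob C A' B') D D' (mat_Tmor C A A' B B' f g) h p q
    = mat_Tmor C A A' (mat_Tob C B D) (mat_Tob C B' D') f (mat_Tmor C B B' D D' g h) p q"
  proof (cases "p < length A * length B * length D \<and> q < length A' * length B' * length D'")
    case True
    then have pq: "p < length A * length B * length D" "q < length A' * length B' * length D'" by simp_all
    note ip = index[OF pq(1)] and iq = index[OF pq(2)]
    note dp = div_mod_less[OF ip(1)] div_mod_less[OF pq(1)] and dq = div_mod_less[OF iq(1)] div_mod_less[OF pq(2)]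
    show ?thesis
      using pq ip iq
        Tmor_assoc[OF nth_Obj[OF A dp(1)] nth_Obj[OF A' dq(1)] nth_Obj[OF B dp(2)] nth_Obj[OF B' dq(2)]
          nth_Obj[OF D dp(4)] nth_Obj[OF D' dq(4)] mat_HomD(1)[OF f dp(1) dq(1)]
          mat_HomD(1)[OF g dp(2) dq(2)] mat_HomD(1)[OF h dp(4) dq(4)]]
      by (simp add: mat_Tmor_nth mat_Tob_nth mult.assoc)
  qed (auto simp: mat_Tmor_def mult.assoc)
qed

lemma mat_Tob_Unit:
  assumes "A \<in> lists (Obj C)"
  shows "mat_Tob C [Unit C] A = A" "mat_Tob C A [Unit C] = A"
  using assms by (induction A) (auto simp: mat_Tob_def Tob_Unit)

lemma mat_Tmor_Unit:
  assumes A: "A \<in> lists (Obj C)" and A': "A' \<in> lists (Obj C)" and f: "f \<in> mat_Hom C A A' n"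
  shows "mat_Tmor C [Unit C] [Unit C] A A' (mat_Idn C [Unit C]) f = f"
    and "mat_Tmor C A A' [Unit C] [Unit C] f (mat_Idn C [Unit C]) = f"
proof -
  have U: "[Unit C] \<in> lists (Obj C)" by (simp add: Unit_Obj)
  note T = mat_Tob_Unit[OF A] mat_Tob_Unit[OF A']
  note Ob = nth_Obj[OF A] nth_Obj[OF A']
  have m: "mat_Tmor C [Unit C] [Unit C] A A' (mat_Idn C [Unit C]) f \<in> mat_Hom C A A' (0 + n)"
    using mat_Tmor_Hom[OF U U A A' mat_Idn_Hom[OF U] f] by (simp add: T)
  show "mat_Tmor C [Unit C] [Unit C] A A' (mat_Idn C [Unit C]) f = f"
    by (rule mat_eqI[OF m f])
      (simp add: mat_Tmor_def mat_Idn_def Tmor_Unit(1)[OF Ob mat_HomD(1)[OF f]])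
  have m: "mat_Tmor C A A' [Unit C] [Unit C] f (mat_Idn C [Unit C]) \<in> mat_Hom C A A' (n + 0)"
    using mat_Tmor_Hom[OF A A' U U f mat_Idn_Hom[OF U]] by (simp add: T)
  show "mat_Tmor C A A' [Unit C] [Unit C] f (mat_Idn C [Unit C]) = f"
    by (rule mat_eqI[OF m f])
      (simp add: mat_Tmor_def mat_Idn_def Tmor_Unit(2)[OF Ob mat_HomD(1)[OF f]])
qed

lemma strict_monoidal_direct_sums: "strict_monoidal_dg_category (direct_sums C)"
proof (rule strict_monoidal_dg_category.intro[OF dg_category_direct_sums],
    rule strict_monoidal_dg_category_axioms.intro)
qed (simp_all del: in_lists_conv_set add: direct_sums_def Unit_Obj mat_Tob_Obj mat_Tmor_Hom mat_Tmor_add_left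
    mat_Tmor_add_right mat_Tmor_Idn mat_interchange mat_Dif_Tmor mat_Tob_assoc mat_Tmor_assoc
    mat_Tob_Unit mat_Tmor_Unit)

end

section \<open>Twisted complexes\<close>

context strict_monoidal_dg_category
begin

lemma mat_Cmp_zero:
  assumes "A \<in> lists (Obj C)" "B \<in> lists (Obj C)" "D \<in> lists (Obj C)"
  shows "f \<in> mat_Hom C A B m \<Longrightarrow> mat_Cmp C A B D 0 f = 0"
    and "g \<in> mat_Hom C B D n \<Longrightarrow> mat_Cmp C A B D g 0 = 0"
  using dg_category.Cmp_zero_left[OF dg_category_direct_sums, unfolded direct_sums_def, simplified dgcat.simps]
    dg_category.Cmp_zero_right[OF dg_category_direct_sums, unfolded direct_sums_def, simplified dgcat.simps]
    assms by blast+

lemma mat_Tmor_zero: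
  assumes "A \<in> lists (Obj C)" "A' \<in> lists (Obj C)" "B \<in> lists (Obj C)" "B' \<in> lists (Obj C)"
  shows "f \<in> mat_Hom C A A' m \<Longrightarrow> mat_Tmor C A A' B B' f 0 = 0"
    and "g \<in> mat_Hom C B B' n \<Longrightarrow> mat_Tmor C A A' B B' 0 g = 0"
  using mat_Tmor_add_right[OF assms _ mat_zero_Hom mat_zero_Hom]
    mat_Tmor_add_left[OF assms mat_zero_Hom mat_zero_Hom] assms by force+

lemma twisted_complexesD:
  assumes "(A, f) \<in> twisted_complexes C"
  shows "A \<in> lists (Obj C)" "f \<in> mat_Hom C A A 1" "\<And>i j. \<not> i < j \<Longrightarrow> f i j = 0"
    "mat_Cmp C A A A f f = 0"
  using assms unfolding twisted_complexes_def by blast+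

lemma mat_add_self:
  assumes "A \<in> lists (Obj C)" "B \<in> lists (Obj C)" "f \<in> mat_Hom C A B n"
  shows "f + f = 0" "f + (f + g) = g"
  using mat_char_two[OF assms] by (simp_all flip: add.assoc)

lemma dg_category_twisted: "dg_category (twisted C)"
proof (rule dg_category.intro)
  show "0 \<in> Hom (twisted C) X Y n" if "X \<in> Obj (twisted C)" "Y \<in> Obj (twisted C)" for X Y n
    using that by (auto simp: twisted_def simp del: in_lists_conv_set split: prod.splits intro!: mat_zero_Hom dest: twisted_complexesD(1))
  show "f + g \<in> Hom (twisted C) X Y n"
    if "X \<in> Obj (twisted C)" "Y \<in> Obj (twisted C)" "f \<in> Hom (twisted C) X Y n" "g \<in> Hom (twisted C) X Y n"
    for X Y f g n
    using that by (auto simp: twisted_def simp del: in_lists_conv_set split: prod.splits intro!: mat_add_Hom dest: twisted_complexesD(1))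
  show "f + f = 0"
    if "X \<in> Obj (twisted C)" "Y \<in> Obj (twisted C)" "f \<in> Hom (twisted C) X Y n" for X Y f n
    using that twisted_complexesD(1)[of "fst X" "snd X"] twisted_complexesD(1)[of "fst Y" "snd Y"]
      mat_char_two[of "fst X" "fst Y" f n]
    by (simp add: twisted_def case_prod_unfold)
  show "Idn (twisted C) X \<in> Hom (twisted C) X X 0" if "X \<in> Obj (twisted C)" for X
    using that by (auto simp: twisted_def simp del: in_lists_conv_set split: prod.splits intro!: mat_Idn_Hom dest: twisted_complexesD(1))
  fix X Y V W f f' g g' h m n k
  assume X: "X \<in> Obj (twisted C)" and Y: "Y \<in> Obj (twisted C)"
  obtain A a where XA: "X = (A, a)" by (cases X)
  obtain B b where YB: "Y = (B, b)" by (cases Y)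
  have A: "A \<in> lists (Obj C)" "a \<in> mat_Hom C A A 1" "mat_Cmp C A A A a a = 0"
    and B: "B \<in> lists (Obj C)" "b \<in> mat_Hom C B B 1" "mat_Cmp C B B B b b = 0"
    using X Y by (auto simp: XA YB twisted_def dest: twisted_complexesD)
  show "Cmp (twisted C) X X Y f (Idn (twisted C) X) = f" if "f \<in> Hom (twisted C) X Y n" for f n
    using that mat_Cmp_Idn_right[OF A(1) B(1)] by (simp add: twisted_def XA YB)
  show "Cmp (twisted C) X Y Y (Idn (twisted C) Y) f = f" if "f \<in> Hom (twisted C) X Y n" for f n
    using that mat_Cmp_Idn_left[OF A(1) B(1)] by (simp add: twisted_def XA YB)
  have DH: "mat_Cmp C A A B f a \<in> mat_Hom C A B (n + 1)" "mat_Cmp C A B B b f \<in> mat_Hom C A B (n + 1)"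
    if "f \<in> mat_Hom C A B n" for f n
    using mat_Cmp_Hom[OF A(1,1) B(1) A(2) that] mat_Cmp_Hom[OF A(1) B(1,1) that B(2)]
    by (simp_all add: add.commute)
  show "Dif (twisted C) X Y f \<in> Hom (twisted C) X Y (n + 1)" if "f \<in> Hom (twisted C) X Y n" for f n
    using that DH[of f n] by (auto simp: twisted_def XA YB intro!: mat_add_Hom[OF A(1) B(1)])
  show "Dif (twisted C) X Y (f + g) = Dif (twisted C) X Y f + Dif (twisted C) X Y g"
    if "f \<in> Hom (twisted C) X Y n" "g \<in> Hom (twisted C) X Y n" for f g n
    using that mat_Cmp_add_left[OF A(1,1) B(1) A(2)] mat_Cmp_add_right[OF A(1) B(1,1) _ _ B(2)]
    by (simp add: twisted_def XA YB add_ac)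
  show "Dif (twisted C) X Y (Dif (twisted C) X Y f) = 0" if "f \<in> Hom (twisted C) X Y n" for f n
  proof -
    have f: "f \<in> mat_Hom C A B n" using that by (simp add: twisted_def XA YB)
    let ?fa = "mat_Cmp C A A B f a" and ?bf = "mat_Cmp C A B B b f"
    \<comment> \<open>Of the four terms of the iterated differential, two contain the square of a
      twisting cochain, and the two mixed ones coincide.\<close>
    have "mat_Cmp C A A B ?fa a = 0" "mat_Cmp C A B B b ?bf = 0"
      "mat_Cmp C A A B ?bf a = mat_Cmp C A B B b ?fa"
      using mat_Cmp_assoc[OF A(1,1,1) B(1) A(2,2) f] mat_Cmp_assoc[OF A(1) B(1,1,1) f B(2,2)]
        mat_Cmp_assoc[OF A(1,1) B(1,1) A(2) f B(2)] mat_Cmp_zero[OF A(1,1) B(1)] mat_Cmp_zero[OF A(1) B(1,1)]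
      by (simp_all add: A(3) B(3) f mat_Cmp_zero(1)[OF A(1) B(1,1) f] mat_Cmp_zero(2)[OF A(1,1) B(1) f])
    moreover have "mat_Cmp C A B B b ?fa + mat_Cmp C A B B b ?fa = 0"
      using mat_Cmp_Hom[OF A(1) B(1,1) DH(1)[OF f] B(2)] by (rule mat_char_two[OF A(1) B(1)])
    ultimately show ?thesis
      using mat_Cmp_add_left[OF A(1,1) B(1) A(2) DH[OF f]] mat_Cmp_add_right[OF A(1) B(1,1) DH[OF f] B(2)]
      by (simp add: twisted_def XA YB)
  qed
  assume V: "V \<in> Obj (twisted C)"
  obtain D d where VD: "V = (D, d)" by (cases V)
  have D: "D \<in> lists (Obj C)" "d \<in> mat_Hom C D D 1"
    using V by (auto simp: VD twisted_def dest: twisted_complexesD)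
  show "Cmp (twisted C) X Y V g f \<in> Hom (twisted C) X V (m + n)"
    if "f \<in> Hom (twisted C) X Y m" "g \<in> Hom (twisted C) Y V n" for f g m n
    using that mat_Cmp_Hom[OF A(1) B(1) D(1)] by (simp add: twisted_def XA YB VD)
  show "Cmp (twisted C) X Y V g (f + f') = Cmp (twisted C) X Y V g f + Cmp (twisted C) X Y V g f'"
    if "f \<in> Hom (twisted C) X Y m" "f' \<in> Hom (twisted C) X Y m" "g \<in> Hom (twisted C) Y V n" for f f' g m n
    using that mat_Cmp_add_right[OF A(1) B(1) D(1)] by (simp add: twisted_def XA YB VD)
  show "Cmp (twisted C) X Y V (g + g') f = Cmp (twisted C) X Y V g f + Cmp (twisted C) X Y V g' f"
    if "f \<in> Hom (twisted C) X Y m" "g \<in> Hom (twisted C) Y V n" "g' \<in> Hom (twisted C) Y V n" for f g g' m n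
    using that mat_Cmp_add_left[OF A(1) B(1) D(1)] by (simp add: twisted_def XA YB VD)
  show "Dif (twisted C) X V (Cmp (twisted C) X Y V g f)
      = Cmp (twisted C) X Y V (Dif (twisted C) Y V g) f + Cmp (twisted C) X Y V g (Dif (twisted C) X Y f)"
    if "f \<in> Hom (twisted C) X Y m" "g \<in> Hom (twisted C) Y V n" for f g m n
  proof -
    have f: "f \<in> mat_Hom C A B m" and g: "g \<in> mat_Hom C B D n"
      using that by (simp_all add: twisted_def XA YB VD)
    have gH: "mat_Cmp C B B D g b \<in> mat_Hom C B D (n + 1)" "mat_Cmp C B D D d g \<in> mat_Hom C B D (n + 1)"
      using mat_Cmp_Hom[OF B(1,1) D(1) B(2) g] mat_Cmp_Hom[OF B(1) D(1,1) g D(2)]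
      by (simp_all add: add.commute)
    \<comment> \<open>The term \<open>g b f\<close> occurs in both summands on the right of the
      Leibniz rule and cancels there.\<close>
    have "mat_Cmp C A B D (mat_Cmp C B B D g b) f \<in> mat_Hom C A D (m + (n + 1))"
      by (rule mat_Cmp_Hom[OF A(1) B(1) D(1) f gH(1)])
    note self = mat_add_self[OF A(1) D(1) this]
    show ?thesis
      using mat_Cmp_add_left[OF A(1) B(1) D(1) f gH] mat_Cmp_add_right[OF A(1) B(1) D(1) DH[OF f] g]
        mat_Cmp_assoc[OF A(1) B(1,1) D(1) f B(2) g] mat_Cmp_assoc[OF A(1) B(1) D(1,1) f g D(2)]
        mat_Cmp_assoc[OF A(1,1) B(1) D(1) A(2) f g]
      by (simp add: twisted_def XA YB VD self add_ac)
  qed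
  assume W: "W \<in> Obj (twisted C)"
  obtain E k where WE: "W = (E, k)" by (cases W)
  have E: "E \<in> lists (Obj C)"
    using W by (auto simp: WE twisted_def dest: twisted_complexesD(1))
  show "Cmp (twisted C) X V W h (Cmp (twisted C) X Y V g f) = Cmp (twisted C) X Y W (Cmp (twisted C) Y V W h g) f"
    if "f \<in> Hom (twisted C) X Y m" "g \<in> Hom (twisted C) Y V n" "h \<in> Hom (twisted C) V W p" for f g h m n p
    using that mat_Cmp_assoc[OF A(1) B(1) D(1) E] by (simp add: twisted_def XA YB VD WE)
qed

section \<open>Tensor products of twisted complexes\<close>

lemma twisted_Unit_Obj: "([Unit C], 0) \<in> twisted_complexes C"
proof -
  have U: "[Unit C] \<in> lists (Obj C)" by (simp add: Unit_Obj)
  show ?thesis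
    unfolding twisted_complexes_def
    using U mat_zero_Hom[OF U U] mat_Cmp_zero(1)[OF U U U mat_zero_Hom[OF U U]]
    by (simp del: in_lists_conv_set)
qed

lemma twisted_Tob_Obj:
  assumes X: "(A, a) \<in> twisted_complexes C" and Y: "(B, b) \<in> twisted_complexes C"
  shows "(mat_Tob C A B, mat_Tmor C A A B B a (mat_Idn C B) + mat_Tmor C A A B B (mat_Idn C A) b)
    \<in> twisted_complexes C"
proof -
  note A = twisted_complexesD[OF X] and B = twisted_complexesD[OF Y]
  note IA = mat_Idn_Hom[OF A(1)] and IB = mat_Idn_Hom[OF B(1)]
  let ?T = "mat_Tob C A B" and ?a = "mat_Tmor C A A B B a (mat_Idn C B)"
    and ?b = "mat_Tmor C A A B B (mat_Idn C A) b"
  have T: "?T \<in> lists (Obj C)" by (rule mat_Tob_Obj[OF A(1) B(1)])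
  have H: "?a \<in> mat_Hom C ?T ?T 1" "?b \<in> mat_Hom C ?T ?T 1"
    using mat_Tmor_Hom[OF A(1,1) B(1,1) A(2) IB] mat_Tmor_Hom[OF A(1,1) B(1,1) IA B(2)] by simp_all
  note ic = mat_interchange[OF A(1,1,1) B(1,1,1), symmetric]
  note unit = mat_Cmp_Idn_right[OF A(1,1)] mat_Cmp_Idn_left[OF A(1,1)]
    mat_Cmp_Idn_right[OF B(1,1)] mat_Cmp_Idn_left[OF B(1,1)]
  have "mat_Cmp C ?T ?T ?T ?a ?a = 0" "mat_Cmp C ?T ?T ?T ?b ?b = 0"
    "mat_Cmp C ?T ?T ?T ?a ?b = mat_Tmor C A A B B a b"
    "mat_Cmp C ?T ?T ?T ?b ?a = mat_Tmor C A A B B a b"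
    using ic[OF A(2,2) IB IB] ic[OF IA IA B(2,2)] ic[OF IA A(2) B(2) IB] ic[OF A(2) IA IB B(2)]
      unit(1)[OF A(2)] unit(2)[OF A(2)] unit(3)[OF B(2)] unit(4)[OF B(2)] unit(1)[OF IA] unit(3)[OF IB]
      mat_Tmor_zero(1)[OF A(1,1) B(1,1) IA] mat_Tmor_zero(2)[OF A(1,1) B(1,1) IB] A(4) B(4)
    by simp_all
  \<comment> \<open>Both mixed products equal the tensor product of \<open>a\<close> and
    \<open>b\<close>, hence they cancel in characteristic two.\<close>
  then have "mat_Cmp C ?T ?T ?T (?a + ?b) (?a + ?b) = 0"
    using mat_Cmp_add_left[OF T T T mat_add_Hom[OF T T H] H] mat_Cmp_add_right[OF T T T H H(1)]
      mat_Cmp_add_right[OF T T T H H(2)] mat_char_two[OF T T mat_Tmor_Hom[OF A(1,1) B(1,1) A(2) B(2)]]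
    by simp
  \<comment> \<open>One-sidedness: \<open>?a\<close> fixes the inner index and raises the outer one,
    \<open>?b\<close> fixes the outer index and raises the inner one. Either way the lexicographic
    position increases.\<close>
  moreover have "(?a + ?b) p q = 0" if pq: "\<not> p < q" for p q
  proof (cases "p < length A * length B \<and> q < length A * length B")
    case True
    then have pq': "p < length A * length B" "q < length A * length B" by simp_all
    note d = div_mod_less[OF pq'(1)] div_mod_less[OF pq'(2)]
    note Ob = nth_Obj[OF A(1) d(1)] nth_Obj[OF A(1) d(3)] nth_Obj[OF B(1) d(2)] nth_Obj[OF B(1) d(4)]
    note za = Tmor_zero(2)[OF Ob mat_HomD(1)[OF IB d(2,4)]] Tmor_zero(1)[OF Ob mat_HomD(1)[OF A(2) d(1,3)]]
    note zb = Tmor_zero(1)[OF Ob mat_HomD(1)[OF IA d(1,3)]] Tmor_zero(2)[OF Ob mat_HomD(1)[OF B(2) d(2,4)]]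
    have pd: "p = p div length B * length B + p mod length B" "q = q div length B * length B + q mod length B"
      by simp_all
    have "?a p q = 0"
    proof (cases "p mod length B = q mod length B")
      case True
      then have "\<not> p div length B < q div length B"
        using pd pq by (metis add_less_cancel_right mult_less_mono1 not_less_zero d(2) gr0I)
      then show ?thesis unfolding mat_Tmor_nth[OF pq'] using A(3) za(1) by simp
    next
      case False
      then have "mat_Idn C B (p mod length B) (q mod length B) = 0" by (simp add: mat_Idn_def)
      then show ?thesis unfolding mat_Tmor_nth[OF pq'] using za(2) by simp
    qed
    moreover have "?b p q = 0"
    proof (cases "p div length B = q div length B")
      case True
      then have "\<not> p mod length B < q mod length B"
        using pd pq by (metis nat_add_left_cancel_less)
      then show ?thesis unfolding mat_Tmor_nth[OF pq'] using B(3) zb(1) by simp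
    next
      case False
      then have "mat_Idn C A (p div length B) (q div length B) = 0" by (simp add: mat_Idn_def)
      then show ?thesis unfolding mat_Tmor_nth[OF pq'] using zb(2) by simp
    qed
    ultimately show ?thesis by simp
  qed (auto simp: mat_Tmor_def)
  ultimately show ?thesis
    unfolding twisted_complexes_def using T mat_add_Hom[OF T T H] by blast
qed

lemma strict_monoidal_twisted: "strict_monoidal_dg_category (twisted C)"
proof (rule strict_monoidal_dg_category.intro[OF dg_category_twisted],
    rule strict_monoidal_dg_category_axioms.intro)
  show "Unit (twisted C) \<in> Obj (twisted C)"
    using twisted_Unit_Obj by (simp add: twisted_def)
  show "Tob (twisted C) X Y \<in> Obj (twisted C)" if "X \<in> Obj (twisted C)" "Y \<in> Obj (twisted C)" for X Y
    using that twisted_Tob_Obj by (cases X; cases Y) (simp add: twisted_def)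
  show "Tob (twisted C) (Unit (twisted C)) X = X" "Tob (twisted C) X (Unit (twisted C)) = X"
    if X: "X \<in> Obj (twisted C)" for X
  proof -
    obtain A a where XA: "X = (A, a)" by (cases X)
    have A: "A \<in> lists (Obj C)" "a \<in> mat_Hom C A A 1"
      using X by (auto simp: XA twisted_def dest: twisted_complexesD)
    have U: "[Unit C] \<in> lists (Obj C)" by (simp add: Unit_Obj)
    show "Tob (twisted C) (Unit (twisted C)) X = X" "Tob (twisted C) X (Unit (twisted C)) = X"
      using mat_Tmor_Unit[OF A(1,1,2)] mat_Tob_Unit[OF A(1)]
        mat_Tmor_zero(1)[OF A(1,1) U U mat_Idn_Hom[OF A(1)]]
        mat_Tmor_zero(2)[OF U U A(1,1) mat_Idn_Hom[OF A(1)]]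
      by (simp_all add: twisted_def XA)
  qed
  show "Tmor (twisted C) (Unit (twisted C)) (Unit (twisted C)) X X' (Idn (twisted C) (Unit (twisted C))) f = f"
    "Tmor (twisted C) X X' (Unit (twisted C)) (Unit (twisted C)) f (Idn (twisted C) (Unit (twisted C))) = f"
    if "X \<in> Obj (twisted C)" "X' \<in> Obj (twisted C)" "f \<in> Hom (twisted C) X X' n" for X X' f n
    using that by (cases X; cases X';
        simp add: twisted_def mat_Tmor_Unit[OF twisted_complexesD(1) twisted_complexesD(1)])+
  fix X X' X'' Y Y' Y'' V V'
  assume X: "X \<in> Obj (twisted C)" and X': "X' \<in> Obj (twisted C)"
    and Y: "Y \<in> Obj (twisted C)" and Y': "Y' \<in> Obj (twisted C)"
  obtain A a where XA: "X = (A, a)" by (cases X)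
  obtain A' a' where XA': "X' = (A', a')" by (cases X')
  obtain B b where YB: "Y = (B, b)" by (cases Y)
  obtain B' b' where YB': "Y' = (B', b')" by (cases Y')
  have A: "A \<in> lists (Obj C)" "a \<in> mat_Hom C A A 1" and A': "A' \<in> lists (Obj C)" "a' \<in> mat_Hom C A' A' 1"
    and B: "B \<in> lists (Obj C)" "b \<in> mat_Hom C B B 1" and B': "B' \<in> lists (Obj C)" "b' \<in> mat_Hom C B' B' 1"
    using X X' Y Y' by (auto simp: XA XA' YB YB' twisted_def dest: twisted_complexesD)
  note eqs = XA XA' YB YB'
  note IA = mat_Idn_Hom[OF A(1)] and IB = mat_Idn_Hom[OF B(1)]
  note IA' = mat_Idn_Hom[OF A'(1)] and IB' = mat_Idn_Hom[OF B'(1)]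
  show "Tmor (twisted C) X X' Y Y' f g \<in> Hom (twisted C) (Tob (twisted C) X Y) (Tob (twisted C) X' Y') (m + n)"
    if "f \<in> Hom (twisted C) X X' m" "g \<in> Hom (twisted C) Y Y' n" for f g m n
    using that mat_Tmor_Hom[OF A(1) A'(1) B(1) B'(1)] by (simp add: twisted_def eqs)
  show "Tmor (twisted C) X X' Y Y' (f + f') g = Tmor (twisted C) X X' Y Y' f g + Tmor (twisted C) X X' Y Y' f' g"
    if "f \<in> Hom (twisted C) X X' m" "f' \<in> Hom (twisted C) X X' m" "g \<in> Hom (twisted C) Y Y' n" for f f' g m n
    using that mat_Tmor_add_left[OF A(1) A'(1) B(1) B'(1)] by (simp add: twisted_def eqs)
  show "Tmor (twisted C) X X' Y Y' f (g + g') = Tmor (twisted C) X X' Y Y' f g + Tmor (twisted C) X X' Y Y' f g'"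
    if "f \<in> Hom (twisted C) X X' m" "g \<in> Hom (twisted C) Y Y' n" "g' \<in> Hom (twisted C) Y Y' n" for f g g' m n
    using that mat_Tmor_add_right[OF A(1) A'(1) B(1) B'(1)] by (simp add: twisted_def eqs)
  show "Dif (twisted C) (Tob (twisted C) X Y) (Tob (twisted C) X' Y') (Tmor (twisted C) X X' Y Y' f g)
      = Tmor (twisted C) X X' Y Y' (Dif (twisted C) X X' f) g + Tmor (twisted C) X X' Y Y' f (Dif (twisted C) Y Y' g)"
    if "f \<in> Hom (twisted C) X X' m" "g \<in> Hom (twisted C) Y Y' n" for f g m n
  proof -
    have f: "f \<in> mat_Hom C A A' m" and g: "g \<in> mat_Hom C B B' n"
      using that by (simp_all add: twisted_def eqs)
    note T = mat_Tob_Obj[OF A(1) B(1)] and T' = mat_Tob_Obj[OF A'(1) B'(1)]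
    have H: "mat_Tmor C A A B B a (mat_Idn C B) \<in> mat_Hom C (mat_Tob C A B) (mat_Tob C A B) 1"
      "mat_Tmor C A A B B (mat_Idn C A) b \<in> mat_Hom C (mat_Tob C A B) (mat_Tob C A B) 1"
      "mat_Tmor C A' A' B' B' a' (mat_Idn C B') \<in> mat_Hom C (mat_Tob C A' B') (mat_Tob C A' B') 1"
      "mat_Tmor C A' A' B' B' (mat_Idn C A') b' \<in> mat_Hom C (mat_Tob C A' B') (mat_Tob C A' B') 1"
      using mat_Tmor_Hom[OF A(1,1) B(1,1) A(2) IB] mat_Tmor_Hom[OF A(1,1) B(1,1) IA B(2)]
        mat_Tmor_Hom[OF A'(1,1) B'(1,1) A'(2) IB'] mat_Tmor_Hom[OF A'(1,1) B'(1,1) IA' B'(2)] by simp_all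
    have D: "mat_Cmp C A A A' f a \<in> mat_Hom C A A' (m + 1)" "mat_Cmp C A A' A' a' f \<in> mat_Hom C A A' (m + 1)"
      "mat_Cmp C B B B' g b \<in> mat_Hom C B B' (n + 1)" "mat_Cmp C B B' B' b' g \<in> mat_Hom C B B' (n + 1)"
      using mat_Cmp_Hom[OF A(1,1) A'(1) A(2) f] mat_Cmp_Hom[OF A(1) A'(1,1) f A'(2)]
        mat_Cmp_Hom[OF B(1,1) B'(1) B(2) g] mat_Cmp_Hom[OF B(1) B'(1,1) g B'(2)]
      by (simp_all add: add.commute)
    \<comment> \<open>By interchange each twist acts on one tensor factor, and the identity on the
      other factor is absorbed.\<close>
    show ?thesis
      using mat_Cmp_add_right[OF T T T' H(1,2) mat_Tmor_Hom[OF A(1) A'(1) B(1) B'(1) f g]]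
        mat_Cmp_add_left[OF T T' T' mat_Tmor_Hom[OF A(1) A'(1) B(1) B'(1) f g] H(3,4)]
        mat_interchange[OF A(1,1) A'(1) B(1,1) B'(1) A(2) f IB g]
        mat_interchange[OF A(1,1) A'(1) B(1,1) B'(1) IA f B(2) g]
        mat_interchange[OF A(1) A'(1,1) B(1) B'(1,1) f A'(2) g IB']
        mat_interchange[OF A(1) A'(1,1) B(1) B'(1,1) f IA' g B'(2)]
        mat_Cmp_Idn_right[OF A(1) A'(1) f] mat_Cmp_Idn_left[OF A(1) A'(1) f]
        mat_Cmp_Idn_right[OF B(1) B'(1) g] mat_Cmp_Idn_left[OF B(1) B'(1) g]
        mat_Tmor_add_left[OF A(1) A'(1) B(1) B'(1) D(1,2) g]
        mat_Tmor_add_right[OF A(1) A'(1) B(1) B'(1) f D(3,4)]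
      by (simp add: twisted_def eqs add_ac)
  qed
  show "Tmor (twisted C) X X Y Y (Idn (twisted C) X) (Idn (twisted C) Y) = Idn (twisted C) (Tob (twisted C) X Y)"
    using mat_Tmor_Idn[OF A(1) B(1)] by (simp add: twisted_def eqs)
  assume V: "V \<in> Obj (twisted C)"
  obtain D d where VD: "V = (D, d)" by (cases V)
  have D: "D \<in> lists (Obj C)" "d \<in> mat_Hom C D D 1"
    using V by (auto simp: VD twisted_def dest: twisted_complexesD)
  note ID = mat_Idn_Hom[OF D(1)]
  show "Tob (twisted C) (Tob (twisted C) X Y) V = Tob (twisted C) X (Tob (twisted C) Y V)"
  proof -
    have H: "mat_Tmor C A A B B a (mat_Idn C B) \<in> mat_Hom C (mat_Tob C A B) (mat_Tob C A B) 1"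
      "mat_Tmor C A A B B (mat_Idn C A) b \<in> mat_Hom C (mat_Tob C A B) (mat_Tob C A B) 1"
      "mat_Tmor C B B D D b (mat_Idn C D) \<in> mat_Hom C (mat_Tob C B D) (mat_Tob C B D) 1"
      "mat_Tmor C B B D D (mat_Idn C B) d \<in> mat_Hom C (mat_Tob C B D) (mat_Tob C B D) 1"
      using mat_Tmor_Hom[OF A(1,1) B(1,1) A(2) IB] mat_Tmor_Hom[OF A(1,1) B(1,1) IA B(2)]
        mat_Tmor_Hom[OF B(1,1) D(1,1) B(2) ID] mat_Tmor_Hom[OF B(1,1) D(1,1) IB D(2)] by simp_all
    note T = mat_Tob_Obj[OF A(1) B(1)] and T' = mat_Tob_Obj[OF B(1) D(1)]
    show ?thesis
      using mat_Tmor_add_left[OF T T D(1,1) H(1,2) ID] mat_Tmor_add_right[OF A(1,1) T' T' IA H(3,4)]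
        mat_Tmor_assoc[OF A(1,1) B(1,1) D(1,1) A(2) IB ID] mat_Tmor_assoc[OF A(1,1) B(1,1) D(1,1) IA B(2) ID]
        mat_Tmor_assoc[OF A(1,1) B(1,1) D(1,1) IA IB D(2)]
      by (simp add: twisted_def eqs VD mat_Tob_assoc[OF A(1) B(1) D(1)] mat_Tmor_Idn[OF A(1) B(1)]
          mat_Tmor_Idn[OF B(1) D(1)] add_ac)
  qed
  assume X'': "X'' \<in> Obj (twisted C)" and Y'': "Y'' \<in> Obj (twisted C)" and V': "V' \<in> Obj (twisted C)"
  obtain A'' a'' where XA'': "X'' = (A'', a'')" by (cases X'')
  obtain B'' b'' where YB'': "Y'' = (B'', b'')" by (cases Y'')
  obtain D' d' where VD': "V' = (D', d')" by (cases V')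
  have A'': "A'' \<in> lists (Obj C)" and B'': "B'' \<in> lists (Obj C)" and D': "D' \<in> lists (Obj C)"
    using X'' Y'' V' by (auto simp: XA'' YB'' VD' twisted_def dest: twisted_complexesD(1))
  show "Tmor (twisted C) X X'' Y Y'' (Cmp (twisted C) X X' X'' f' f) (Cmp (twisted C) Y Y' Y'' g' g)
      = Cmp (twisted C) (Tob (twisted C) X Y) (Tob (twisted C) X' Y') (Tob (twisted C) X'' Y'')
          (Tmor (twisted C) X' X'' Y' Y'' f' g') (Tmor (twisted C) X X' Y Y' f g)"
    if "f \<in> Hom (twisted C) X X' m" "f' \<in> Hom (twisted C) X' X'' m'"
      "g \<in> Hom (twisted C) Y Y' n" "g' \<in> Hom (twisted C) Y' Y'' n'" for f f' g g' m m' n n'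
    using that mat_interchange[OF A(1) A'(1) A'' B(1) B'(1) B'']
    by (simp add: twisted_def eqs XA'' YB'')
  show "Tmor (twisted C) (Tob (twisted C) X Y) (Tob (twisted C) X' Y') V V' (Tmor (twisted C) X X' Y Y' f g) h
      = Tmor (twisted C) X X' (Tob (twisted C) Y V) (Tob (twisted C) Y' V') f (Tmor (twisted C) Y Y' V V' g h)"
    if "f \<in> Hom (twisted C) X X' m" "g \<in> Hom (twisted C) Y Y' n" "h \<in> Hom (twisted C) V V' p" for f g h m n p
    using that mat_Tmor_assoc[OF A(1) A'(1) B(1) B'(1) D(1) D']
    by (simp add: twisted_def eqs VD VD')
qed

end

section \<open>Cones in a ring with twisting elements\<close>

text \<open>
  A differential graded category whose morphisms all lie in one ring: \<open>M A B n\<close> is the set of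
  morphisms of degree \<open>n\<close>, \<open>e A\<close> the identity, and \<open>a A\<close> the twisting element, the differential
  of \<open>t\<close> being \<open>t * a A + a B * t\<close>. The shift \<open>T\<close> only relabels degrees; \<open>N\<close> is a zero object.
\<close>

locale twisted_ring =
  fixes Ob :: "'o set"
    and M :: "'o \<Rightarrow> 'o \<Rightarrow> int \<Rightarrow> 'r::ring set"
    and e a :: "'o \<Rightarrow> 'r"
    and T :: "'o \<Rightarrow> 'o"
    and N :: 'o
  assumes char2: "x + x = (0 :: 'r)"
    and M_zero: "0 \<in> M A B n"
    and M_add: "x \<in> M A B n \<Longrightarrow> y \<in> M A B n \<Longrightarrow> x + y \<in> M A B n"
    and M_mult: "x \<in> M A B m \<Longrightarrow> y \<in> M B D n \<Longrightarrow> y * x \<in> M A D (m + n)"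
    and M_e: "e A \<in> M A A 0"
    and e_right: "x \<in> M A B n \<Longrightarrow> x * e A = x"
    and e_left: "x \<in> M A B n \<Longrightarrow> e B * x = x"
    and M_a: "A \<in> Ob \<Longrightarrow> a A \<in> M A A 1"
    and a_a: "A \<in> Ob \<Longrightarrow> a A * a A = 0"
    and T_bij: "bij_betw T Ob Ob"
    and M_T_left: "M (T A) B n = M A B (n - 1)"
    and M_T_right: "M A (T B) n = M A B (n + 1)"
    and e_T: "e (T A) = e A"
    and a_T: "a (T A) = a A"
    and N_Ob: "N \<in> Ob"
    and e_N: "e N = 0"
begin

definition Z :: "'o \<Rightarrow> 'o \<Rightarrow> 'r set"
  where "Z A B = {x \<in> M A B 0. x * a A = a B * x}"

definition Bd :: "'o \<Rightarrow> 'o \<Rightarrow> 'r set"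
  where "Bd A B = (\<lambda>t. t * a A + a B * t) ` M A B (-1)"

text \<open>\<open>hq\<close>: homotopic cocycles; \<open>isop\<close>: cocycles which are inverse to each other up to homotopy.\<close>

definition hq :: "'o \<Rightarrow> 'o \<Rightarrow> 'r \<Rightarrow> 'r \<Rightarrow> bool"
  where "hq A B x y \<longleftrightarrow> x \<in> Z A B \<and> y \<in> Z A B \<and> x + y \<in> Bd A B"

definition isop :: "'o \<Rightarrow> 'o \<Rightarrow> 'r \<Rightarrow> 'r \<Rightarrow> bool"
  where "isop A B x y \<longleftrightarrow> x \<in> Z A B \<and> y \<in> Z B A \<and> hq A A (y * x) (e A) \<and> hq B B (x * y) (e B)"

section \<open>Calculus of cocycles up to homotopy\<close>

lemma T_Ob: "A \<in> Ob \<Longrightarrow> T A \<in> Ob"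
  using T_bij by (auto simp: bij_betw_def)

lemma char2': "x + (x + y) = (y :: 'r)"
  by (simp add: char2 flip: add.assoc)

lemma add_eq_0_char2: "x + y = 0 \<longleftrightarrow> x = (y :: 'r)"
  by (metis char2 char2' add.right_neutral)

text \<open>Products are normalized by bracketing to the right, which hides \<open>u * v\<close>
  inside a longer product. This variant lets the rule \<open>u * v = w\<close> act there as
  well.\<close>

lemma assoc_ext: "u * v = w \<Longrightarrow> u * (v * y) = w * (y :: 'r)"
  by (simp flip: mult.assoc)

lemma Z_M: "x \<in> Z A B \<Longrightarrow> x \<in> M A B 0"
  and Z_a: "x \<in> Z A B \<Longrightarrow> a B * x = x * a A"
  by (simp_all add: Z_def)

lemma Z_e: "A \<in> Ob \<Longrightarrow> e A \<in> Z A A"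
  by (simp add: Z_def M_e e_right[OF M_a] e_left[OF M_a])

lemma Z_zero: "0 \<in> Z A B"
  by (simp add: Z_def M_zero)

lemma Z_add: "x \<in> Z A B \<Longrightarrow> y \<in> Z A B \<Longrightarrow> x + y \<in> Z A B"
  by (simp add: Z_def M_add algebra_simps)

lemma Z_mult: "x \<in> Z A B \<Longrightarrow> y \<in> Z B D \<Longrightarrow> y * x \<in> Z A D"
  using M_mult[of x A B 0 y D 0] by (auto simp: Z_def) (metis mult.assoc)

lemma Z_T [simp]: "Z (T A) (T B) = Z A B"
  by (simp add: Z_def M_T_left M_T_right a_T)

lemma Bd_T [simp]: "Bd (T A) (T B) = Bd A B"
  by (simp add: Bd_def M_T_left M_T_right a_T)

lemma hq_T [simp]: "hq (T A) (T B) x y = hq A B x y"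
  by (simp add: hq_def)

lemma isop_T [simp]: "isop (T A) (T B) x y = isop A B x y"
  by (simp add: isop_def e_T)

lemma BdI: "t \<in> M A B (-1) \<Longrightarrow> x = t * a A + a B * t \<Longrightarrow> x \<in> Bd A B"
  by (auto simp: Bd_def)

lemma Bd_zero: "0 \<in> Bd A B"
  by (rule BdI[OF M_zero]) simp

lemma Bd_add: "x \<in> Bd A B \<Longrightarrow> y \<in> Bd A B \<Longrightarrow> x + y \<in> Bd A B"
proof -
  assume "x \<in> Bd A B" "y \<in> Bd A B"
  then obtain t t' where "t \<in> M A B (-1)" "t' \<in> M A B (-1)"
    "x = t * a A + a B * t" "y = t' * a A + a B * t'" by (auto simp: Bd_def)
  then show ?thesis by (intro BdI[of "t + t'"]) (auto simp: M_add algebra_simps)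
qed

lemma Bd_mult_left: "x \<in> Bd A B \<Longrightarrow> y \<in> Z B D \<Longrightarrow> y * x \<in> Bd A D"
proof -
  assume "x \<in> Bd A B" and y: "y \<in> Z B D"
  then obtain t where t: "t \<in> M A B (-1)" "x = t * a A + a B * t" by (auto simp: Bd_def)
  show ?thesis
    using M_mult[OF t(1) Z_M[OF y]] Z_a[OF y] t(2)
    by (intro BdI[of "y * t"]) (auto simp: algebra_simps simp flip: mult.assoc)
qed

lemma Bd_mult_right: "x \<in> Bd B D \<Longrightarrow> y \<in> Z A B \<Longrightarrow> x * y \<in> Bd A D"
proof -
  assume "x \<in> Bd B D" and y: "y \<in> Z A B"
  then obtain t where t: "t \<in> M B D (-1)" "x = t * a B + a D * t" by (auto simp: Bd_def)
  have "x * y = (t * y) * a A + a D * (t * y)"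
    by (simp add: t(2) ring_distribs mult.assoc Z_a[OF y])
  then show ?thesis
    using M_mult[OF Z_M[OF y] t(1)] by (intro BdI[of "t * y"]) auto
qed

lemma hq_refl: "x \<in> Z A B \<Longrightarrow> hq A B x x"
  by (simp add: hq_def char2 Bd_zero)

lemma hq_sym: "hq A B x y \<Longrightarrow> hq A B y x"
  by (simp add: hq_def add.commute)

lemma hq_trans [trans]: "hq A B x y \<Longrightarrow> hq A B y z \<Longrightarrow> hq A B x z"
proof -
  assume h: "hq A B x y" "hq A B y z"
  have "x + z = (x + y) + (y + z)" by (simp add: add.assoc char2')
  moreover have "(x + y) + (y + z) \<in> Bd A B" using h by (metis hq_def Bd_add)
  ultimately show ?thesis using h unfolding hq_def by metis
qed

lemma hq_Z: "hq A B x y \<Longrightarrow> x \<in> Z A B" "hq A B x y \<Longrightarrow> y \<in> Z A B"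
  by (simp_all add: hq_def)

lemma hq_left: "hq A B x y \<Longrightarrow> z \<in> Z B D \<Longrightarrow> hq A D (z * x) (z * y)"
  by (auto simp: hq_def Z_mult simp flip: distrib_left intro: Bd_mult_left)

lemma hq_right: "hq B D x y \<Longrightarrow> z \<in> Z A B \<Longrightarrow> hq A D (x * z) (y * z)"
  by (auto simp: hq_def Z_mult simp flip: distrib_right intro: Bd_mult_right)

lemma hq_mult: "hq A B x y \<Longrightarrow> hq B D x' y' \<Longrightarrow> hq A D (x' * x) (y' * y)"
  by (meson hq_left hq_right hq_trans hq_Z)

lemma hqI: "x \<in> Z A B \<Longrightarrow> y \<in> Z A B \<Longrightarrow> t \<in> M A B (-1) \<Longrightarrow> x + y = t * a A + a B * t \<Longrightarrow> hq A B x y"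
  by (auto simp: hq_def intro: BdI)

lemma isop_Z: "isop A B x y \<Longrightarrow> x \<in> Z A B" "isop A B x y \<Longrightarrow> y \<in> Z B A"
  by (simp_all add: isop_def)

lemma isop_hq: "isop A B x y \<Longrightarrow> hq A A (y * x) (e A)" "isop A B x y \<Longrightarrow> hq B B (x * y) (e B)"
  by (simp_all add: isop_def)

lemma isop_sym: "isop A B x y \<Longrightarrow> isop B A y x"
  by (simp add: isop_def)

lemma isop_e: "A \<in> Ob \<Longrightarrow> isop A A (e A) (e A)"
  by (simp add: isop_def Z_e e_left[OF M_e] hq_refl)

lemma isop_comp:
  assumes "isop A B x y" "isop B D x' y'"
  shows "isop A D (x' * x) (y * y')"
proof -
  note z = isop_Z[OF assms(1)] isop_Z[OF assms(2)]
  have "hq A A (y * (y' * x') * x) (y * e B * x)"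
    by (rule hq_right[OF hq_left[OF isop_hq(1)[OF assms(2)] z(2)] z(1)])
  also have "y * e B * x = y * x" using e_right[OF Z_M[OF z(2)]] by simp
  also have "hq A A (y * x) (e A)" by (rule isop_hq(1)[OF assms(1)])
  finally have 1: "hq A A (y * y' * (x' * x)) (e A)" by (simp add: mult.assoc)
  have "hq D D (x' * (x * y) * y') (x' * e B * y')"
    by (rule hq_right[OF hq_left[OF isop_hq(2)[OF assms(1)] z(3)] z(4)])
  also have "x' * e B * y' = x' * y'" using e_right[OF Z_M[OF z(3)]] by simp
  also have "hq D D (x' * y') (e D)" by (rule isop_hq(2)[OF assms(2)])
  finally have "hq D D (x' * x * (y * y')) (e D)" by (simp add: mult.assoc)
  then show ?thesis using 1 z by (simp add: isop_def Z_mult)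
qed

lemma isop_cancel_left:
  assumes "isop B D x y" "hq A D (x * u) v" "u \<in> Z A B"
  shows "hq A B u (y * v)"
proof -
  have "hq A B (e B * u) (y * x * u)"
    by (rule hq_sym[OF hq_right[OF isop_hq(1)[OF assms(1)] assms(3)]])
  also have "hq A B (y * x * u) (y * v)"
    using hq_left[OF assms(2) isop_Z(2)[OF assms(1)]] by (simp add: mult.assoc)
  finally show ?thesis by (simp add: e_left[OF Z_M[OF assms(3)]])
qed

lemma isop_cancel_right:
  assumes "isop A B x y" "hq A D (u * x) v" "u \<in> Z B D"
  shows "hq B D u (v * y)"
proof -
  have "hq B D (u * e B) (u * (x * y))"
    by (rule hq_sym[OF hq_left[OF isop_hq(2)[OF assms(1)] assms(3)]])
  also have "hq B D (u * (x * y)) (v * y)"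
    using hq_right[OF assms(2) isop_Z(2)[OF assms(1)]] by (simp add: mult.assoc)
  finally show ?thesis by (simp add: e_right[OF Z_M[OF assms(3)]])
qed

text \<open>\<open>C = T X \<oplus> Y\<close>; the injection \<open>i\<close> and the projection \<open>p\<close> of \<open>T X\<close> have degrees \<open>-1\<close> and \<open>1\<close> with respect to \<open>X\<close>.\<close>

definition conedata :: "'o \<Rightarrow> 'o \<Rightarrow> 'r \<Rightarrow> 'o \<Rightarrow> 'r \<Rightarrow> 'r \<Rightarrow> 'r \<Rightarrow> 'r \<Rightarrow> bool"
  where "conedata X Y h C i p j s \<longleftrightarrow> X \<in> Ob \<and> Y \<in> Ob \<and> C \<in> Ob \<and> h \<in> Z X Y \<and>
    i \<in> M X C (-1) \<and> p \<in> M C X 1 \<and> j \<in> M Y C 0 \<and> s \<in> M C Y 0 \<and>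
    p * i = e X \<and> s * j = e Y \<and> p * j = 0 \<and> s * i = 0 \<and> i * p + j * s = e C \<and>
    a C = i * a X * p + j * a Y * s + j * h * p"

section \<open>Morphisms from, to and between cones\<close>

lemma conedata_Ob:
  assumes "conedata X Y h C i p j s"
  shows "X \<in> Ob" "Y \<in> Ob" "C \<in> Ob" "h \<in> Z X Y"
  using assms by (auto simp: conedata_def)

lemma conedata_M:
  assumes "conedata X Y h C i p j s"
  shows "i \<in> M X C (-1)" "p \<in> M C X 1" "j \<in> M Y C 0" "s \<in> M C Y 0"
  using assms by (auto simp: conedata_def)

lemma conedata_e:
  assumes "conedata X Y h C i p j s"
  shows "e C = i * p + j * s"
  using assms by (auto simp: conedata_def)

lemma conedata_rules:
  assumes "conedata X Y h C i p j s"
  shows "p * i = e X" "s * j = e Y" "p * j = 0" "s * i = 0"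
    "e X * p = p" "e Y * s = s" "i * e X = i" "j * e Y = j"
    "e C * i = i" "e C * j = j" "p * e C = p" "s * e C = s" "e Y * h = h" "h * e X = h"
    "a C * i = i * a X + j * h" "a C * j = j * a Y" "p * a C = a X * p" "s * a C = a Y * s + h * p"
    "a Y * h = h * a X" "e X * a X = a X" "e Y * a Y = a Y" "a X * e X = a X" "a Y * e Y = a Y"
proof -
  show 1: "p * i = e X" "s * j = e Y" "p * j = 0" "s * i = 0"
    using assms by (auto simp: conedata_def)
  show 2: "e X * p = p" "e Y * s = s" "i * e X = i" "j * e Y = j"
    "e C * i = i" "e C * j = j" "p * e C = p" "s * e C = s" "e Y * h = h" "h * e X = h"
    "e X * a X = a X" "e Y * a Y = a Y" "a X * e X = a X" "a Y * e Y = a Y"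
    using assms unfolding conedata_def by (auto intro: e_left e_right Z_M M_a)
  note c = 1 1[THEN assoc_ext] 2 2[THEN assoc_ext]
  have aC: "a C = i * a X * p + j * a Y * s + j * h * p" using assms by (auto simp: conedata_def)
  show "a C * i = i * a X + j * h" "a C * j = j * a Y" "p * a C = a X * p" "s * a C = a Y * s + h * p"
    unfolding aC by (simp_all add: ring_distribs mult.assoc c)
  show "a Y * h = h * a X" using assms by (auto simp: conedata_def Z_a)
qed

lemma conedata_Z:
  assumes "conedata X Y h C i p j s"
  shows "j \<in> Z Y C" "p \<in> Z C (T X)"
  using conedata_M[OF assms] conedata_rules[OF assms] by (simp_all add: Z_def M_T_right a_T)

text \<open>The summand \<open>j * h * p\<close> of the twist is exactly what keeps \<open>i\<close>
  and \<open>s\<close> from being closed. So these two are the null homotopies of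
  \<open>j * h\<close> and \<open>h * p\<close>.\<close>

lemma conedata_null:
  assumes "conedata X Y h C i p j s"
  shows "hq X C (j * h) 0" "hq C (T Y) (h * p) 0"
proof -
  note c = assms
  note r = conedata_rules[OF c] conedata_rules[OF c, THEN assoc_ext]
  show "hq X C (j * h) 0"
    using conedata_M[OF c] Z_mult[OF conedata_Ob(4)[OF c] conedata_Z(1)[OF c]]
    by (intro hqI[where t = i]) (simp_all add: Z_zero r char2 char2')
  show "hq C (T Y) (h * p) 0"
    using conedata_M[OF c] conedata_Ob(4)[OF c] Z_mult[OF conedata_Z(2)[OF c], of h "T Y"]
    by (intro hqI[where t = s]) (simp_all add: Z_zero r char2 char2' M_T_right a_T add_ac)
qed

lemma conedata_T:
  assumes "conedata X Y h C i p j s"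
  shows "conedata (T X) (T Y) h (T C) i p j s"
  using assms by (simp add: conedata_def M_T_right M_T_left e_T a_T T_Ob)

text \<open>Exactness at the cone. The restriction \<open>g * i\<close> fails to be closed by
  \<open>g * j * h\<close>; the null homotopy \<open>t\<close> of \<open>g * j\<close> repairs this
  through the correction \<open>t * h\<close>.\<close>

lemma cone_exact:
  assumes c: "conedata X Y h C i p j s" and g: "g \<in> Z C W" "g * j \<in> Bd Y W"
  shows "\<exists>k\<in>Z (T X) W. hq C W g (k * p)"
proof -
  obtain t where t: "t \<in> M Y W (-1)" "g * j = t * a Y + a W * t" using g(2) by (auto simp: Bd_def)
  note m = conedata_M[OF c]
  note r = conedata_rules[OF c] e_right[OF t(1)] Z_a[OF g(1)] e_right[OF Z_M[OF g(1)]] t(2)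
  note r = r r[THEN assoc_ext] ring_distribs mult.assoc char2 char2' add_ac
  define k where "k = g * i + t * h"
  have "k \<in> M (T X) W 0"
    using M_mult[OF m(1) Z_M[OF g(1)]] M_mult[OF Z_M[OF conedata_Ob(4)[OF c]] t(1)]
    by (simp add: k_def M_T_left M_add)
  moreover have "k * a X = a W * k"
    by (simp add: k_def r)
  ultimately have k: "k \<in> Z (T X) W" by (simp add: Z_def a_T)
  have "t * s \<in> M C W (-1)" using M_mult[OF m(4) t(1)] by simp
  moreover have "g + k * p = (t * s) * a C + a W * (t * s)"
  proof -
    \<comment> \<open>The inserted identity \<open>i * p + j * s\<close> splits \<open>g\<close>
      into its components, a step that rewriting in the other direction would undo.\<close>
    have "g = g * i * p + g * j * s"
      using e_right[OF Z_M[OF g(1)]] by (simp add: conedata_e[OF c] ring_distribs flip: mult.assoc)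
    then have "g + k * p = (g * i * p + g * j * s) + k * p" by simp
    then show ?thesis by (simp add: k_def r)
  qed
  ultimately have "hq C W g (k * p)"
    using g(1) Z_mult[OF conedata_Z(2)[OF c] k] by (intro hqI)
  then show ?thesis using k by blast
qed

text \<open>The homotopy \<open>t\<close> of the given square becomes the off-diagonal entry of a
  triangular matrix with diagonal \<open>x\<close>, \<open>y\<close>. The two remaining squares
  therefore commute strictly.\<close>

lemma cone_map:
  assumes c: "conedata X Y h C i p j s" and c': "conedata X' Y' h' C' i' p' j' s'"
    and x: "x \<in> Z X X'" and y: "y \<in> Z Y Y'" and sq: "hq X Y' (y * h) (h' * x)"
  shows "\<exists>z\<in>Z C C'. z * j = j' * y \<and> p' * z = x * p"
proof -
  obtain t where t: "t \<in> M X Y' (-1)" "y * h + h' * x = t * a X + a Y' * t"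
    using sq by (auto simp: hq_def Bd_def)
  have t2: "y * h = h' * x + t * a X + a Y' * t"
    using t(2) by (metis add.assoc add.commute char2')
  note m = conedata_M[OF c] conedata_M[OF c'] Z_M[OF x] Z_M[OF y]
  note r = conedata_rules[OF c] conedata_rules[OF c'] e_right[OF t(1)] e_left[OF t(1)]
    e_right[OF Z_M[OF x]] e_left[OF Z_M[OF x]] e_right[OF Z_M[OF y]] e_left[OF Z_M[OF y]]
    Z_a[OF x] Z_a[OF y] t2
  note r = r r[THEN assoc_ext] ring_distribs mult.assoc char2 char2' add_ac
  define z where "z = i' * x * p + j' * y * s + j' * t * p"
  have "i' * (x * p) \<in> M C C' 0" "j' * (y * s) \<in> M C C' 0" "j' * (t * p) \<in> M C C' 0"
    using M_mult[OF M_mult[OF m(2) m(9)] m(5)] M_mult[OF M_mult[OF m(4) m(10)] m(7)]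
      M_mult[OF M_mult[OF m(2) t(1)] m(7)] by simp_all
  then have "z \<in> M C C' 0" by (simp add: z_def M_add mult.assoc)
  moreover have "z * a C = a C' * z" by (simp add: z_def r)
  ultimately have "z \<in> Z C C'" by (simp add: Z_def)
  moreover have "z * j = j' * y" "p' * z = x * p" by (simp_all add: z_def r)
  ultimately show ?thesis by blast
qed

text \<open>Up to homotopy, \<open>z + e C\<close> factors through \<open>p\<close> and vanishes after \<open>p\<close>, so its square is null.\<close>

lemma cone_endo:
  assumes c: "conedata X Y h C i p j s" and z: "z \<in> Z C C"
    and zj: "hq Y C (z * j) j" and pz: "hq C (T X) (p * z) p"
  shows "hq C C (z * z) (e C)"
proof -
  note Ob = conedata_Ob[OF c]
  define w where "w = z + e C"
  have wZ: "w \<in> Z C C" unfolding w_def by (intro Z_add z Z_e Ob)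
  have "w * j \<in> Bd Y C" using zj by (simp add: w_def hq_def ring_distribs conedata_rules[OF c])
  then obtain k where k: "k \<in> Z (T X) C" "hq C C w (k * p)" using cone_exact[OF c wZ] by blast
  have "hq C (T X) (p * w) 0"
    using pz wZ conedata_Z[OF c]
    by (simp add: w_def hq_def ring_distribs conedata_rules[OF c] Z_mult Z_zero Z_add)
  from hq_left[OF this k(1)] have "hq C C (k * p * w) 0" by (simp add: mult.assoc)
  with hq_right[OF k(2) wZ] have "hq C C (w * w) 0" by (rule hq_trans)
  moreover have "z * z + e C = w * w"
    using e_left[OF Z_M[OF z]] e_right[OF Z_M[OF z]]
    by (simp add: w_def ring_distribs e_left[OF M_e] char2' add_ac)
  ultimately show ?thesis using z Z_e[OF Ob(3)] by (simp add: hq_def Z_mult)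
qed

text \<open>The five lemma. A map \<open>w\<close> of cones in the opposite direction, built from
  the inverses of \<open>x\<close> and \<open>y\<close>, makes \<open>w * z\<close> and
  \<open>z * w\<close> compatible with the cone maps, so by \<open>cone_endo\<close> their squares
  are homotopic to identities. Hence \<open>w * z * w\<close> is the inverse of
  \<open>z\<close>.\<close>

lemma cone_map_iso:
  assumes c: "conedata X Y h C i p j s" and c': "conedata X' Y' h' C' i' p' j' s'"
    and x: "isop X X' x x'" and y: "isop Y Y' y y'" and sq: "hq X Y' (y * h) (h' * x)"
    and z: "z \<in> Z C C'" "hq Y C' (z * j) (j' * y)" "hq C (T X') (p' * z) (x * p)"
  shows "\<exists>z'. isop C C' z z'"
proof -
  note Ob = conedata_Ob[OF c] conedata_Ob[OF c']
  note jp = conedata_Z[OF c] conedata_Z[OF c']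
  note Zx = isop_Z[OF x] and Zy = isop_Z[OF y]
  have "hq X' Y (y' * h') (h * x')"
  proof -
    have "hq X Y h (y' * (h' * x))" by (rule isop_cancel_left[OF y sq Ob(4)])
    then have "hq X Y (y' * h' * x) h" by (simp add: hq_sym mult.assoc)
    then show ?thesis by (rule isop_cancel_right[OF x]) (rule Z_mult[OF Ob(8) Zy(2)])
  qed
  then obtain w where w: "w \<in> Z C' C" "w * j' = j * y'" "p * w = x' * p'"
    using cone_map[OF c' c Zx(2) Zy(2)] by blast
  have "hq Y C (w * z * j) j"
  proof -
    have "hq Y C (w * (z * j)) (w * (j' * y))" by (rule hq_left[OF z(2) w(1)])
    also have "w * (j' * y) = j * (y' * y)" by (metis w(2) mult.assoc)
    also have "hq Y C (j * (y' * y)) (j * e Y)" by (rule hq_left[OF isop_hq(1)[OF y] jp(1)])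
    finally show ?thesis by (simp add: mult.assoc conedata_rules[OF c])
  qed
  moreover have "hq C (T X) (p * (w * z)) p"
  proof -
    have x'T: "x' \<in> Z (T X') (T X)" and e: "hq (T X) (T X) (x' * x) (e X)"
      using Zx isop_hq(1)[OF x] by simp_all
    have "p * (w * z) = x' * (p' * z)" by (metis w(3) mult.assoc)
    also have "hq C (T X) (x' * (p' * z)) (x' * (x * p))" by (rule hq_left[OF z(3) x'T])
    also have "x' * (x * p) = x' * x * p" by (simp add: mult.assoc)
    also have "hq C (T X) (x' * x * p) (e X * p)" by (rule hq_right[OF e jp(2)])
    finally show ?thesis by (simp add: conedata_rules[OF c])
  qed
  ultimately have 1: "hq C C (w * z * (w * z)) (e C)"
    by (rule cone_endo[OF c Z_mult[OF z(1) w(1)]])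
  have "hq Y' C' (z * w * j') j'"
  proof -
    have "z * w * j' = z * j * y'" by (simp add: w(2) mult.assoc)
    also have "hq Y' C' (z * j * y') (j' * y * y')" by (rule hq_right[OF z(2) Zy(2)])
    also have "j' * y * y' = j' * (y * y')" by (simp add: mult.assoc)
    also have "hq Y' C' (j' * (y * y')) (j' * e Y')" by (rule hq_left[OF isop_hq(2)[OF y] jp(3)])
    finally show ?thesis by (simp add: conedata_rules[OF c'])
  qed
  moreover have "hq C' (T X') (p' * (z * w)) p'"
  proof -
    have xT: "x \<in> Z (T X) (T X')" and e: "hq (T X') (T X') (x * x') (e X')"
      using Zx isop_hq(2)[OF x] by simp_all
    have "hq C' (T X') (p' * z * w) (x * p * w)" by (rule hq_right[OF z(3) w(1)])
    also have "x * p * w = x * x' * p'" by (simp add: mult.assoc w(3))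
    also have "hq C' (T X') (x * x' * p') (e X' * p')" by (rule hq_right[OF e jp(4)])
    finally show ?thesis by (simp add: conedata_rules[OF c'] mult.assoc)
  qed
  ultimately have 2: "hq C' C' (z * w * (z * w)) (e C')"
    by (rule cone_endo[OF c' Z_mult[OF w(1) z(1)]])
  have "isop C C' z (w * z * w)"
    unfolding isop_def using 1 2 z(1) w(1) by (auto simp: mult.assoc intro!: Z_mult)
  then show ?thesis by blast
qed

text \<open>
  The comparison with the cone of \<open>u\<close> is the identity on \<open>X\<close> and \<open>Y\<close>; by the five lemma
  (\<open>cone_map_iso\<close>) this is no restriction.
\<close>

definition dist :: "'o \<Rightarrow> 'o \<Rightarrow> 'o \<Rightarrow> 'r \<Rightarrow> 'r \<Rightarrow> 'r \<Rightarrow> bool"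
  where "dist X Y W u v w \<longleftrightarrow> W \<in> Ob \<and> v \<in> Z Y W \<and> w \<in> Z W (T X) \<and>
    (\<exists>C i p j s z z'. conedata X Y u C i p j s \<and> isop W C z z' \<and>
      hq Y C (z * v) j \<and> hq W (T X) (p * z) w)"

lemma dist_Ob:
  assumes "dist X Y W u v w"
  shows "X \<in> Ob" "Y \<in> Ob" "W \<in> Ob" "u \<in> Z X Y" "v \<in> Z Y W" "w \<in> Z W (T X)"
  using assms by (auto simp: dist_def conedata_def)

lemma dist_cone: "conedata X Y u C i p j s \<Longrightarrow> dist X Y C u j p"
  unfolding dist_def
  by (intro conjI exI[of _ C] exI[of _ i] exI[of _ p] exI[of _ j] exI[of _ s] exI[of _ "e C"])
    (auto intro: isop_e conedata_Ob conedata_Z simp: conedata_rules hq_refl conedata_Z)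

end

section \<open>Distinguished triangles and the axioms of a triangulated category\<close>

locale twisted_ring_cones = twisted_ring +
  assumes cone_ex: "X \<in> Ob \<Longrightarrow> Y \<in> Ob \<Longrightarrow> h \<in> Z X Y \<Longrightarrow> \<exists>C i p j s. conedata X Y h C i p j s"
begin

text \<open>\<open>dist\<close> supplies a comparison with some cone of \<open>u\<close> itself.
  Composing it with a map of cones reaches every cone over an isomorphic base, which removes all
  dependence on the choice.\<close>

lemma dist_iso_cone:
  assumes d: "dist X Y W u v w" and c': "conedata X' Y' u' C' i' p' j' s'"
    and x: "isop X X' x x'" and y: "isop Y Y' y y'" and sq: "hq X Y' (y * u) (u' * x)"
  shows "\<exists>z z'. isop W C' z z' \<and> hq Y C' (z * v) (j' * y) \<and> hq W (T X') (p' * z) (x * w)"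
proof -
  obtain C i p j s z z' where c: "conedata X Y u C i p j s" and z: "isop W C z z'"
    "hq Y C (z * v) j" "hq W (T X) (p * z) w"
    using d unfolding dist_def by blast
  obtain q where q: "q \<in> Z C C'" "q * j = j' * y" "p' * q = x * p"
    using cone_map[OF c c' isop_Z(1)[OF x] isop_Z(1)[OF y] sq] by blast
  have jp: "j \<in> Z Y C" "p \<in> Z C (T X)" by (fact conedata_Z[OF c])+
  have xT: "x \<in> Z (T X) (T X')" using isop_Z(1)[OF x] by simp
  have "hq Y C' (q * j) (j' * y)" "hq C (T X') (p' * q) (x * p)"
    using q jp xT by (auto intro!: hq_refl Z_mult simp flip: q(2))
  then obtain q' where q': "isop C C' q q'" using cone_map_iso[OF c c' x y sq q(1)] by blast
  have "hq Y C' (q * (z * v)) (q * j)" by (rule hq_left[OF z(2) q(1)])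
  moreover have "hq W (T X') (x * (p * z)) (x * w)" by (rule hq_left[OF z(3) xT])
  moreover have "x * (p * z) = p' * (q * z)" by (metis q(3) mult.assoc)
  ultimately show ?thesis using isop_comp[OF z(1) q'] q(2) by (metis mult.assoc)
qed

text \<open>The comparison of \<open>W'\<close> with the cone of \<open>u'\<close> goes back to
  \<open>W\<close> along the inverse of \<open>z\<close> and from there uses
  \<open>dist_iso_cone\<close>.\<close>

lemma dist_iso:
  assumes d: "dist X Y W u v w"
    and x: "isop X X' x x'" and y: "isop Y Y' y y'" and z: "isop W W' z z'"
    and Ob': "X' \<in> Ob" "Y' \<in> Ob" "W' \<in> Ob"
    and u': "u' \<in> Z X' Y'" and v': "v' \<in> Z Y' W'" and w': "w' \<in> Z W' (T X')"
    and sq: "hq X Y' (y * u) (u' * x)" "hq Y W' (z * v) (v' * y)" "hq W (T X') (x * w) (w' * z)"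
  shows "dist X' Y' W' u' v' w'"
proof -
  obtain C' i' p' j' s' where c': "conedata X' Y' u' C' i' p' j' s'"
    using cone_ex[OF Ob'(1,2) u'] by blast
  obtain q q' where q: "isop W C' q q'" "hq Y C' (q * v) (j' * y)" "hq W (T X') (p' * q) (x * w)"
    using dist_iso_cone[OF d c' x y sq(1)] by blast
  note jp = conedata_Z[OF c']
  have zi: "isop W' W z' z" by (rule isop_sym[OF z])
  note r = isop_Z[OF q(1)] isop_Z[OF z] isop_Z[OF y]
  have "hq Y' C' (q * z' * v') j'"
  proof -
    have "hq Y W v (z' * (v' * y))" by (rule isop_cancel_left[OF z sq(2) dist_Ob(5)[OF d]])
    from hq_left[OF hq_sym[OF this] r(1)]
    have "hq Y C' (q * z' * v' * y) (q * v)" by (simp add: mult.assoc)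
    also note q(2)
    finally have "hq Y C' (q * z' * v' * y) (j' * y)" .
    then have "hq Y' C' (q * z' * v') (j' * y * y')"
      by (rule isop_cancel_right[OF y]) (rule Z_mult[OF v' Z_mult[OF r(4,1)]])
    also have "j' * y * y' = j' * (y * y')" by (simp add: mult.assoc)
    also have "hq Y' C' (j' * (y * y')) (j' * e Y')" by (rule hq_left[OF isop_hq(2)[OF y] jp(1)])
    finally show ?thesis by (simp add: conedata_rules[OF c'])
  qed
  moreover have "hq W' (T X') (p' * (q * z')) w'"
  proof -
    have "hq W (T X') (w' * z) (p' * q)" by (rule hq_sym[OF hq_trans[OF q(3) sq(3)]])
    then have "hq W' (T X') w' (p' * q * z')" by (rule isop_cancel_right[OF z _ w'])
    then show ?thesis by (simp add: hq_sym mult.assoc)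
  qed
  ultimately show ?thesis
    unfolding dist_def using Ob'(3) v' w' c' isop_comp[OF zi q(1)] by blast
qed

lemma cone_e_null:
  assumes c: "conedata X X (e X) C i p j s"
  shows "hq C C (e C) 0"
proof -
  have "hq C C 0 (e C)"
  proof (rule hqI)
    \<comment> \<open>The twist of this cone contains \<open>j * p\<close>, the identity from the
      shifted copy of \<open>X\<close> to the other copy. The homotopy \<open>i * s\<close> runs
      backwards along it.\<close>
    show "i * s \<in> M C C (-1)" using M_mult[OF conedata_M(4,1)[OF c]] by simp
    show "0 + e C = i * s * a C + a C * (i * s)"
      by (simp add: conedata_e[OF c] ring_distribs mult.assoc conedata_rules[OF c]
          conedata_rules[OF c, THEN assoc_ext] char2 char2' add_ac)
  qed (use Z_e[OF conedata_Ob(3)[OF c]] Z_zero in auto)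
  then show ?thesis by (rule hq_sym)
qed

lemma dist_id:
  assumes X: "X \<in> Ob" and W: "W \<in> Ob" and null: "e W \<in> Bd W W"
  shows "dist X X W (e X) 0 0"
proof -
  obtain C i p j s where c: "conedata X X (e X) C i p j s"
    using cone_ex[OF X X Z_e[OF X]] by blast
  have Ce: "hq C C 0 (e C)" by (rule hq_sym[OF cone_e_null[OF c]])
  have We: "hq W W 0 (e W)" using null W by (simp add: hq_def Z_zero Z_e)
  \<comment> \<open>Between contractible objects the zero morphism is an equivalence.\<close>
  have "isop W C 0 0" using Ce We by (simp add: isop_def Z_zero)
  moreover have "hq X C (0 * 0) j"
    using conedata_null(1)[OF c] by (simp add: conedata_rules[OF c] hq_sym)
  ultimately show ?thesis
    unfolding dist_def using c W by (fastforce simp: Z_zero hq_refl)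
qed

text \<open>The cone \<open>D\<close> of \<open>j\<close> has the summands \<open>T Y\<close>,
  \<open>T X\<close> and \<open>Y\<close>, and its twist contains the identity from
  \<open>T Y\<close> to \<open>Y\<close>. Contracting this pair with the homotopy
  \<open>I * s * S\<close> leaves \<open>T X\<close>. The inclusion \<open>J * i\<close> of
  \<open>T X\<close> is not closed; the term \<open>I * u\<close> in \<open>z\<close> corrects it
  and also produces the third map \<open>u\<close>.\<close>

lemma dist_rotate_cone:
  assumes c: "conedata X Y u C i p j s"
  shows "dist Y C (T X) j p u"
proof -
  note Ob = conedata_Ob[OF c]
  obtain D I P J S where d: "conedata Y C j D I P J S"
    using cone_ex[OF Ob(2,3) conedata_Z(1)[OF c]] by blast
  note r = conedata_rules[OF c] conedata_rules[OF d]
  note r = r r[THEN assoc_ext] ring_distribs mult.assoc char2 char2' add_ac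
  note m = conedata_M[OF c] conedata_M[OF d] Z_M[OF Ob(4)]
  define z where "z = J * i + I * u"
  have z: "z \<in> Z (T X) D"
    using M_add[OF M_mult[OF m(1,7)], of "I * u"] M_mult[OF m(9) m(5)]
    by (simp add: Z_def M_T_left a_T z_def r)
  have z': "p * S \<in> Z D (T X)"
    using M_mult[OF m(8) m(2)] by (simp add: Z_def M_T_right a_T r)
  have "p * S * z = e X" by (simp add: z_def r)
  then have 1: "hq (T X) (T X) (p * S * z) (e (T X))"
    using Z_e[OF Ob(1)] by (simp add: e_T hq_refl)
  have eD: "e D = I * P + J * (i * p + j * s) * S"
    using conedata_e[OF c] conedata_e[OF d] by (simp add: r flip: conedata_e[OF c])
  have 2: "hq D D (z * (p * S)) (e D)"
  proof (rule hqI)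
    show "I * s * S \<in> M D D (-1)" using M_mult[OF m(8) M_mult[OF m(4,5)]] by simp
    show "z * (p * S) + e D = I * s * S * a D + a D * (I * s * S)"
      by (simp add: eD) (simp add: z_def r)
  qed (use Z_mult[OF z' z] Z_e conedata_Ob[OF d] in auto)
  have zp: "hq C D (z * p) J"
  proof (rule hqI)
    show "I * s \<in> M C D (-1)" using M_mult[OF m(4,5)] by simp
    have "J = J * e C" by (simp add: r)
    then have "J = J * i * p + J * j * s" by (simp add: conedata_e[OF c] ring_distribs mult.assoc)
    then have "z * p + J = z * p + (J * i * p + J * j * s)" by simp
    then show "z * p + J = I * s * a C + a D * (I * s)"
      by (simp add: z_def r)
  qed (use Z_mult[OF conedata_Z(2)[OF c] z] conedata_Z[OF d] in auto)
  have Pz: "hq (T X) (T Y) (P * z) u"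
    using Ob(4) by (simp add: z_def r hq_refl)
  have "isop (T X) D z (p * S)" using 1 2 z z' by (simp add: isop_def)
  then show ?thesis
    unfolding dist_def using d zp Pz Ob T_Ob conedata_Z[OF c] by fastforce
qed

lemma dist_rotate:
  assumes d: "dist X Y W u v w"
  shows "dist Y W (T X) v w u"
proof -
  obtain C i p j s z z' where c: "conedata X Y u C i p j s" and z: "isop W C z z'"
    "hq Y C (z * v) j" "hq W (T X) (p * z) w"
    using d unfolding dist_def by blast
  note Ob = dist_Ob[OF d] and jp = conedata_Z[OF c]
  have TX: "T X \<in> Ob" using Ob T_Ob by blast
  have "hq Y W (z' * j) v"
    by (rule hq_sym[OF isop_cancel_left[OF z(1,2) Ob(5)]])
  moreover have "hq C (T X) p (w * z')"
    by (rule isop_cancel_right[OF z(1,3) jp(2)])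
  ultimately show ?thesis
    using Ob TX e_left[OF Z_M[OF jp(2)]] e_left[OF Z_M[OF Ob(4)]] e_right[OF Z_M[OF Ob(4)]]
      e_right[OF Z_M[OF Ob(5)]]
    by (intro dist_iso[OF dist_rotate_cone[OF c] isop_e isop_sym[OF z(1)] isop_e])
      (auto simp: e_T hq_refl)
qed

text \<open>A shifted cone is a cone for the same ring elements (\<open>conedata_T\<close>), so an
  equivalence with it is at once an equivalence of the unshifted objects.\<close>

lemma dist_T_cancel:
  assumes d: "dist (T X) (T Y) (T W) u v w"
    and Ob: "X \<in> Ob" "Y \<in> Ob" "W \<in> Ob" "u \<in> Z X Y" "v \<in> Z Y W" "w \<in> Z W (T X)"
  shows "dist X Y W u v w"
proof -
  obtain C i p j s where c: "conedata X Y u C i p j s"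
    using cone_ex[OF Ob(1,2,4)] by blast
  note jp = conedata_Z[OF c]
  have "hq (T X) (T Y) (e (T Y) * u) (u * e (T X))"
    using Ob e_left[OF Z_M[OF Ob(4)]] e_right[OF Z_M[OF Ob(4)]] by (simp add: e_T hq_refl)
  from dist_iso_cone[OF d conedata_T[OF c] isop_e isop_e this]
  obtain z z' where "isop (T W) (T C) z z'" "hq (T Y) (T C) (z * v) (j * e (T Y))"
    "hq (T W) (T (T X)) (p * z) (e (T X) * w)"
    using Ob T_Ob by blast
  then have "isop W C z z'" "hq Y C (z * v) j" "hq W (T X) (p * z) w"
    using e_left[OF Z_M[OF Ob(6)]] by (simp_all add: e_T conedata_rules[OF c])
  then show ?thesis unfolding dist_def using Ob c by blast
qed

text \<open>Rotating the rotated triangle twice more yields the shift of the original one, without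
  signs in characteristic two; \<open>dist_T_cancel\<close> then removes the shift.\<close>

lemma dist_rotate_iff:
  assumes "X \<in> Ob" "Y \<in> Ob" "W \<in> Ob" "u \<in> Z X Y" "v \<in> Z Y W" "w \<in> Z W (T X)"
  shows "dist X Y W u v w \<longleftrightarrow> dist Y W (T X) v w u"
proof
  assume "dist Y W (T X) v w u"
  from dist_rotate[OF dist_rotate[OF this]] show "dist X Y W u v w"
    by (rule dist_T_cancel) (use assms in auto)
qed (rule dist_rotate)

text \<open>The strict map between the cones is conjugated by the two comparisons; this is where
  strictness is lost and only homotopies remain.\<close>

lemma dist_map:
  assumes d: "dist X Y W u v w" and d': "dist X' Y' W' u' v' w'"
    and x: "x \<in> Z X X'" and y: "y \<in> Z Y Y'" and sq: "hq X Y' (y * u) (u' * x)"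
  shows "\<exists>z\<in>Z W W'. hq Y W' (z * v) (v' * y) \<and> hq W (T X') (x * w) (w' * z)"
proof -
  obtain C i p j s z z' where c: "conedata X Y u C i p j s" and z: "isop W C z z'"
    "hq Y C (z * v) j" "hq W (T X) (p * z) w"
    using d unfolding dist_def by blast
  obtain D I P J S t t' where k: "conedata X' Y' u' D I P J S" and t: "isop W' D t t'"
    "hq Y' D (t * v') J" "hq W' (T X') (P * t) w'"
    using d' unfolding dist_def by blast
  obtain q where q: "q \<in> Z C D" "q * j = J * y" "P * q = x * p"
    using cone_map[OF c k x y sq] by blast
  note zz = isop_Z[OF z(1)] isop_Z[OF t(1)]
  have xT: "x \<in> Z (T X) (T X')" using x by simp
  have "hq Y W' (t' * q * (z * v)) (t' * q * j)"
    by (rule hq_left[OF z(2) Z_mult[OF q(1) zz(4)]])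
  also have "t' * q * j = t' * J * y" using q(2) by (simp add: mult.assoc)
  also have "hq Y W' (t' * J * y) (v' * y)"
    by (rule hq_right[OF hq_sym[OF isop_cancel_left[OF t(1,2) dist_Ob(5)[OF d']]] y])
  finally have 1: "hq Y W' (t' * q * z * v) (v' * y)" by (simp add: mult.assoc)
  have "hq W (T X') (x * w) (x * (p * z))" by (rule hq_left[OF hq_sym[OF z(3)] xT])
  also have "x * (p * z) = P * (q * z)" by (metis q(3) mult.assoc)
  also have "hq W (T X') (P * (q * z)) (w' * t' * (q * z))"
    by (rule hq_right[OF isop_cancel_right[OF t(1,3) conedata_Z(2)[OF k]] Z_mult[OF zz(1) q(1)]])
  finally have 2: "hq W (T X') (x * w) (w' * (t' * q * z))" by (simp add: mult.assoc)
  show ?thesis using 1 2 Z_mult[OF zz(1) Z_mult[OF q(1) zz(4)]] by blast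
qed

text \<open>In block form \<open>u\<close> is diagonal with entries 1 and \<open>g\<close>, and
  \<open>v\<close> is diagonal with entries \<open>f\<close> and 1. The cone \<open>D\<close> of
  \<open>u\<close> consists of \<open>T (T X)\<close>, \<open>T Y\<close>, \<open>T X\<close> and
  \<open>V\<close>. The entry 1 of \<open>u\<close> joins \<open>T (T X)\<close> to
  \<open>T X\<close>; contracting this pair leaves \<open>T Y\<close> and \<open>V\<close>, which is
  \<open>C2\<close>.\<close>

lemma octahedron_cones:
  assumes c1: "conedata X Y f C1 i1 p1 j1 s1" and c2: "conedata Y V g C2 i2 p2 j2 s2"
    and c3: "conedata X V (g * f) C3 i3 p3 j3 s3"
  shows "\<exists>u\<in>Z C1 C3. \<exists>v\<in>Z C3 C2. dist C1 C3 C2 u v (j1 * p2) \<and>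
    u * j1 = j3 * g \<and> p3 * u = p1 \<and> v * j3 = j2 \<and> p2 * v = f * p3"
proof -
  note r = conedata_rules[OF c1] conedata_rules[OF c2] conedata_rules[OF c3]
  note r = r r[THEN assoc_ext] ring_distribs mult.assoc char2 char2' add_ac
  note m1 = conedata_M[OF c1] and m2 = conedata_M[OF c2] and m3 = conedata_M[OF c3]
  note fM = Z_M[OF conedata_Ob(4)[OF c1]] and gM = Z_M[OF conedata_Ob(4)[OF c2]]
  define u where "u = i3 * p1 + j3 * g * s1"
  define v where "v = i2 * f * p3 + j2 * s3"
  define w where "w = j1 * p2"
  have "j3 * g * s1 \<in> M C1 C3 0" "i2 * f * p3 \<in> M C3 C2 0"
    using M_mult[OF m1(4) M_mult[OF gM m3(3)]] M_mult[OF m3(2) M_mult[OF fM m2(1)]] by simp_all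
  then have "u \<in> M C1 C3 0" "v \<in> M C3 C2 0"
    using M_mult[OF m1(2) m3(1)] M_mult[OF m3(4) m2(3)] by (simp_all add: u_def v_def M_add)
  then have u: "u \<in> Z C1 C3" and v: "v \<in> Z C3 C2"
    by (simp_all add: Z_def) (simp_all add: u_def v_def r)
  have w: "w \<in> Z C2 (T C1)"
    unfolding w_def using conedata_Z(1)[OF c1] by (intro Z_mult[OF conedata_Z(2)[OF c2]]) simp
  have eqs: "u * j1 = j3 * g" "p3 * u = p1" "v * j3 = j2" "p2 * v = f * p3"
    by (simp_all add: u_def v_def r)
  obtain D I P J S where d: "conedata C1 C3 u D I P J S"
    using cone_ex[OF conedata_Ob(3)[OF c1] conedata_Ob(3)[OF c3] u] by blast
  note m = conedata_M[OF d]
  have ui: "u * i1 = i3" "s2 * v = s3" "v * u = i2 * f * p1 + j2 * g * s1"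
    by (simp_all add: u_def v_def r)
  note r' = eqs ui conedata_rules[OF d]
  note r = r r' r'[THEN assoc_ext]
  define z where "z = J * j3 * s2 + I * j1 * p2"
  define z' where "z' = v * S + i2 * s1 * P"
  have "J * j3 * s2 \<in> M C2 D 0" "I * j1 * p2 \<in> M C2 D 0"
    using M_mult[OF m2(4) M_mult[OF m3(3) m(3)]] M_mult[OF m2(2) M_mult[OF m1(3) m(1)]] by simp_all
  then have z: "z \<in> Z C2 D" by (simp add: Z_def z_def M_add) (simp add: r)
  have "v * S \<in> M D C2 0" "i2 * s1 * P \<in> M D C2 0"
    using M_mult[OF m(4) Z_M[OF v]] M_mult[OF m(2) M_mult[OF m1(4) m2(1)]] by simp_all
  then have z': "z' \<in> Z D C2"
    using Z_a[OF v] Z_a[OF v, THEN assoc_ext] by (simp add: Z_def z'_def M_add) (simp add: r)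
  have "e C2 = j2 * s2 + i2 * p2" by (simp add: conedata_e[OF c2] add.commute)
  then have "z' * z = e C2" by (simp add: z_def z'_def r)
  then have 1: "hq C2 C2 (z' * z) (e C2)" using Z_e conedata_Ob(3)[OF c2] by (simp add: hq_refl)
  have eD: "e D = I * (i1 * p1 + j1 * s1) * P + J * (i3 * p3 + j3 * s3) * S"
    by (simp add: conedata_e[OF d] conedata_rules[OF d] flip: conedata_e[OF c1] conedata_e[OF c3])
  \<comment> \<open>Since \<open>z' * z\<close> is already the identity, only this composite needs a
    homotopy. It maps the summand \<open>T X\<close> of \<open>C3\<close> to the summand
    \<open>T (T X)\<close> of \<open>T C1\<close>.\<close>
  have 2: "hq D D (z * z') (e D)"
  proof (rule hqI)
    show "I * i1 * p3 * S \<in> M D D (-1)"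
      using M_mult[OF m(4) M_mult[OF m3(2) M_mult[OF m1(1) m(1)]]] by (simp add: mult.assoc)
    show "z * z' + e D = I * i1 * p3 * S * a D + a D * (I * i1 * p3 * S)"
      by (simp add: eD) (simp add: z_def z'_def r)
  qed (use Z_mult[OF z' z] Z_e conedata_Ob[OF d] in auto)
  have 3: "hq C3 D (z * v) J"
  proof (rule hqI)
    show "I * i1 * p3 \<in> M C3 D (-1)"
      using M_mult[OF m3(2) M_mult[OF m1(1) m(1)]] by (simp add: mult.assoc)
    have "J = J * e C3" by (simp add: r)
    then have "J = J * i3 * p3 + J * j3 * s3" by (simp add: conedata_e[OF c3] ring_distribs mult.assoc)
    then have "z * v + J = z * v + (J * i3 * p3 + J * j3 * s3)" by simp
    then show "z * v + J = I * i1 * p3 * a C3 + a D * (I * i1 * p3)"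
      by (simp add: z_def r)
  qed (use Z_mult[OF v z] conedata_Z[OF d] in auto)
  have "P * z = w" by (simp add: z_def w_def r)
  then have 4: "hq C2 (T C1) (P * z) w" using w by (simp add: hq_refl)
  have "isop C2 D z z'" using 1 2 z z' by (simp add: isop_def)
  then have "dist C1 C3 C2 u v w"
    unfolding dist_def using d v w 3 4 conedata_Ob(3)[OF c2] by blast
  then show ?thesis using u v eqs by (auto simp: w_def)
qed

lemma dist_octahedron:
  assumes d1: "dist X Y W1 f f1 f2" and d2: "dist Y V W2 g g1 g2"
    and d3: "dist X V W3 h h1 h2" and h: "hq X V h (g * f)"
  shows "\<exists>u\<in>Z W1 W3. \<exists>v\<in>Z W3 W2. dist W1 W3 W2 u v (f1 * g2) \<and>
    hq Y W3 (u * f1) (h1 * g) \<and> hq W1 (T X) (h2 * u) f2 \<and>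
    hq V W2 (v * h1) g1 \<and> hq W3 (T Y) (g2 * v) (f * h2)"
proof -
  note Ob1 = dist_Ob[OF d1] and Ob2 = dist_Ob[OF d2] and Ob3 = dist_Ob[OF d3]
  obtain C1 i1 p1 j1 s1 where c1: "conedata X Y f C1 i1 p1 j1 s1" using cone_ex Ob1 by metis
  obtain C2 i2 p2 j2 s2 where c2: "conedata Y V g C2 i2 p2 j2 s2" using cone_ex Ob2 by metis
  obtain C3 i3 p3 j3 s3 where c3: "conedata X V (g * f) C3 i3 p3 j3 s3"
    using cone_ex[OF Ob1(1) Ob2(2) Z_mult[OF Ob1(4) Ob2(4)]] by metis
  note jp = conedata_Z[OF c1] conedata_Z[OF c2] conedata_Z[OF c3]
  \<comment> \<open>Replaces a triangle by the cone of a morphism homotopic to its first map. The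
    freedom is needed for the third triangle, whose first map \<open>h\<close> is merely homotopic
    to \<open>g * f\<close>.\<close>
  have normal: "\<exists>z z'. isop W C z z' \<and> hq B C (z * b) j \<and> hq W (T A) (p * z) k"
    if d: "dist A B W x b k" and c: "conedata A B y C i p j s" and "hq A B x y"
    for A B W x b k y C i p j s
  proof -
    have "hq A B (e B * x) (y * e A)"
      using that(3) e_left[OF Z_M[OF dist_Ob(4)[OF d]]] by (simp add: conedata_rules[OF c])
    from dist_iso_cone[OF d c isop_e isop_e this] dist_Ob[OF d] show ?thesis
      using e_left[OF Z_M[OF dist_Ob(6)[OF d]]] by (simp add: conedata_rules[OF c] e_T)
  qed
  obtain z1 y1 where z1: "isop W1 C1 z1 y1" "hq Y C1 (z1 * f1) j1" "hq W1 (T X) (p1 * z1) f2"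
    using normal[OF d1 c1 hq_refl] Ob1 by blast
  obtain z2 y2 where z2: "isop W2 C2 z2 y2" "hq V C2 (z2 * g1) j2" "hq W2 (T Y) (p2 * z2) g2"
    using normal[OF d2 c2 hq_refl] Ob2 by blast
  obtain z3 y3 where z3: "isop W3 C3 z3 y3" "hq V C3 (z3 * h1) j3" "hq W3 (T X) (p3 * z3) h2"
    using normal[OF d3 c3 h] by blast
  obtain u v where uv: "u \<in> Z C1 C3" "v \<in> Z C3 C2" and d: "dist C1 C3 C2 u v (j1 * p2)"
    and eq: "u * j1 = j3 * g" "p3 * u = p1" "v * j3 = j2" "p2 * v = f * p3"
    using octahedron_cones[OF c1 c2 c3] by blast
  note zz = isop_Z[OF z1(1)] isop_Z[OF z2(1)] isop_Z[OF z3(1)]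
  define u' where "u' = y3 * u * z1"
  define v' where "v' = y2 * v * z3"
  have u': "u' \<in> Z W1 W3" and v': "v' \<in> Z W3 W2"
    unfolding u'_def v'_def by (auto intro!: Z_mult zz uv simp: mult.assoc)
  have c1z: "hq W1 C3 (z3 * u') (u * z1)"
  proof -
    have "hq W1 C3 (z3 * y3 * (u * z1)) (e C3 * (u * z1))"
      by (rule hq_right[OF isop_hq(2)[OF z3(1)] Z_mult[OF zz(1) uv(1)]])
    then show ?thesis
      using e_left[OF Z_M[OF uv(1)], THEN assoc_ext] by (simp add: u'_def mult.assoc)
  qed
  have c2z: "hq W3 C2 (z2 * v') (v * z3)"
  proof -
    have "hq W3 C2 (z2 * y2 * (v * z3)) (e C2 * (v * z3))"
      by (rule hq_right[OF isop_hq(2)[OF z2(1)] Z_mult[OF zz(5) uv(2)]])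
    then show ?thesis
      using e_left[OF Z_M[OF uv(2)], THEN assoc_ext] by (simp add: v'_def mult.assoc)
  qed
  have "hq Y W3 (u' * f1) (h1 * g)"
  proof -
    have "hq Y C3 (z3 * (u' * f1)) (u * (z1 * f1))"
      using hq_right[OF c1z Ob1(5)] by (simp add: mult.assoc)
    also have "hq Y C3 (u * (z1 * f1)) (u * j1)" by (rule hq_left[OF z1(2) uv(1)])
    also have "u * j1 = j3 * g" by (rule eq)
    finally have "hq Y W3 (u' * f1) (y3 * j3 * g)"
      using isop_cancel_left[OF z3(1) _ Z_mult[OF Ob1(5) u']] by (simp add: mult.assoc)
    also have "hq Y W3 (y3 * j3 * g) (h1 * g)"
      by (rule hq_right[OF hq_sym[OF isop_cancel_left[OF z3(1,2) Ob3(5)]] Ob2(4)])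
    finally show ?thesis .
  qed
  moreover have "hq W1 (T X) (h2 * u') f2"
  proof -
    have "hq W1 (T X) (h2 * u') (p3 * z3 * u')" by (rule hq_right[OF hq_sym[OF z3(3)] u'])
    also have "hq W1 (T X) (p3 * z3 * u') (p3 * (u * z1))"
      using hq_left[OF c1z jp(6)] by (simp add: mult.assoc)
    also have "p3 * (u * z1) = p1 * z1" by (metis eq(2) mult.assoc)
    also note z1(3)
    finally show ?thesis .
  qed
  moreover have "hq V W2 (v' * h1) g1"
  proof -
    have "hq V C2 (z2 * (v' * h1)) (v * (z3 * h1))"
      using hq_right[OF c2z Ob3(5)] by (simp add: mult.assoc)
    also have "hq V C2 (v * (z3 * h1)) (v * j3)" by (rule hq_left[OF z3(2) uv(2)])
    also have "v * j3 = j2" by (rule eq)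
    also have "hq V C2 j2 (z2 * g1)" by (rule hq_sym[OF z2(2)])
    finally have "hq V W2 (v' * h1) (y2 * (z2 * g1))"
      by (rule isop_cancel_left[OF z2(1) _ Z_mult[OF Ob3(5) v']])
    also have "hq V W2 (y2 * (z2 * g1)) g1"
      using hq_right[OF isop_hq(1)[OF z2(1)] Ob2(5)] e_left[OF Z_M[OF Ob2(5)]]
      by (simp add: mult.assoc)
    finally show ?thesis .
  qed
  moreover have fT: "f \<in> Z (T X) (T Y)" using Ob1(4) by simp
  have "hq W3 (T Y) (g2 * v') (f * h2)"
  proof -
    have "hq W3 (T Y) (g2 * v') (p2 * z2 * v')" by (rule hq_right[OF hq_sym[OF z2(3)] v'])
    also have "hq W3 (T Y) (p2 * z2 * v') (p2 * (v * z3))"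
      using hq_left[OF c2z jp(4)] by (simp add: mult.assoc)
    also have "p2 * (v * z3) = f * (p3 * z3)" by (metis eq(4) mult.assoc)
    also have "hq W3 (T Y) (f * (p3 * z3)) (f * h2)" by (rule hq_left[OF z3(3) fT])
    finally show ?thesis .
  qed
  moreover have "dist W1 W3 W2 u' v' (f1 * g2)"
  proof (rule dist_iso[OF d isop_sym[OF z1(1)] isop_sym[OF z3(1)] isop_sym[OF z2(1)]])
    have f1T: "f1 \<in> Z (T Y) (T W1)" using Ob1(5) by simp
    show "f1 * g2 \<in> Z W2 (T W1)" by (rule Z_mult[OF Ob2(6) f1T])
    have "hq C1 C1 (z1 * y1) (e C1)" by (rule isop_hq(2)[OF z1(1)])
    from hq_left[OF hq_sym[OF this] Z_mult[OF uv(1) zz(6)]]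
    show "hq C1 W3 (y3 * u) (u' * y1)"
      using e_right[OF Z_M[OF uv(1)]] by (simp add: u'_def mult.assoc)
    have "hq C3 C3 (z3 * y3) (e C3)" by (rule isop_hq(2)[OF z3(1)])
    from hq_left[OF hq_sym[OF this] Z_mult[OF uv(2) zz(4)]]
    show "hq C3 W2 (y2 * v) (v' * y3)"
      using e_right[OF Z_M[OF uv(2)]] by (simp add: v'_def mult.assoc)
    have "hq (T Y) (T W1) (y1 * j1) f1"
      using hq_sym[OF isop_cancel_left[OF z1(1,2) Ob1(5)]] by simp
    from hq_right[OF this jp(4)]
    have "hq C2 (T W1) (y1 * (j1 * p2)) (f1 * p2)" by (simp add: mult.assoc)
    also have "hq C2 (T W1) (f1 * p2) (f1 * g2 * y2)"
      using hq_left[OF isop_cancel_right[OF z2(1,3) jp(4)] f1T] by (simp add: mult.assoc)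
    finally show "hq C2 (T W1) (y1 * (j1 * p2)) (f1 * g2 * y2)" .
  qed (use Ob1 Ob2 Ob3 u' v' in auto)
  ultimately show ?thesis using u' v' by blast
qed

end

section \<open>The zeroth cohomology category\<close>

context dg_category
begin

lemma cocycles_comm_group:
  assumes "A \<in> Obj C" "B \<in> Obj C"
  shows "comm_group (cocycles C A B)"
proof (rule comm_groupI)
  have D0: "Dif C A B 0 = 0"
    using Dif_add[OF assms zero_Hom[OF assms] zero_Hom[OF assms]] by simp
  show "\<one>\<^bsub>cocycles C A B\<^esub> \<in> carrier (cocycles C A B)"
    using D0 assms by (simp add: cocycles_def zero_Hom)
  show "\<exists>g\<in>carrier (cocycles C A B). g \<otimes>\<^bsub>cocycles C A B\<^esub> f = \<one>\<^bsub>cocycles C A B\<^esub>"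
    if "f \<in> carrier (cocycles C A B)" for f
    using that char_two[OF assms] by (auto simp: cocycles_def intro!: bexI[of _ f])
qed (use assms in \<open>auto simp: cocycles_def add_Hom Dif_add ac_simps\<close>)

lemma coboundaries_subgroup:
  assumes "A \<in> Obj C" "B \<in> Obj C"
  shows "subgroup (coboundaries C A B) (cocycles C A B)"
proof -
  interpret comm_group "cocycles C A B" by (rule cocycles_comm_group[OF assms])
  have D: "Dif C A B f + Dif C A B f = 0" if "f \<in> Hom C A B n" for f n
    by (rule char_two[OF assms Dif_Hom[OF assms that]])
  have "Dif C A B f \<in> Hom C A B 0" if "f \<in> Hom C A B (-1)" for f
    using Dif_Hom[OF assms that] by simp
  then have sub: "coboundaries C A B \<subseteq> carrier (cocycles C A B)"
    using Dif_Dif[OF assms] by (auto simp: coboundaries_def cocycles_def)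
  show ?thesis
  proof (rule subgroupI[OF sub])
    show "coboundaries C A B \<noteq> {}"
      using zero_Hom[OF assms] by (auto simp: coboundaries_def)
    show "inv\<^bsub>cocycles C A B\<^esub> f \<in> coboundaries C A B" if f: "f \<in> coboundaries C A B" for f
    proof -
      have "f \<otimes>\<^bsub>cocycles C A B\<^esub> f = \<one>\<^bsub>cocycles C A B\<^esub>"
        using f D by (auto simp: coboundaries_def cocycles_def)
      then have "inv\<^bsub>cocycles C A B\<^esub> f = f"
        using f sub by (intro inv_equality) auto
      then show ?thesis using f by simp
    qed
    show "f \<otimes>\<^bsub>cocycles C A B\<^esub> g \<in> coboundaries C A B"
      if fg: "f \<in> coboundaries C A B" "g \<in> coboundaries C A B" for f g
    proof -
      obtain s t where st: "s \<in> Hom C A B (-1)" "t \<in> Hom C A B (-1)"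
        "f = Dif C A B s" "g = Dif C A B t" using fg by (auto simp: coboundaries_def)
      have "f + g = Dif C A B (s + t)" using st by (simp add: Dif_add[OF assms st(1,2)])
      then show ?thesis
        using add_Hom[OF assms st(1,2)] by (auto simp: coboundaries_def cocycles_def)
    qed
  qed
qed

lemma coboundaries_normal:
  assumes "A \<in> Obj C" "B \<in> Obj C"
  shows "normal (coboundaries C A B) (cocycles C A B)"
  using comm_group.subgroup_imp_normal[OF cocycles_comm_group coboundaries_subgroup] assms by blast

lemma H0_comm_group:
  assumes "A \<in> Obj C" "B \<in> Obj C"
  shows "comm_group (mor (H0 C) A B)"
  unfolding H0_def
  using comm_group.abelian_FactGroup[OF cocycles_comm_group coboundaries_subgroup] assms by simp

end

text \<open>The bridge from a DG category to the ring calculus. The bijections \<open>\<phi>\<close>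
  carry cocycles and coboundaries to \<open>Z\<close> and \<open>Bd\<close>, and \<open>ct\<close>
  ties the concrete cone triangles to \<open>conedata\<close>. Everything about cohomology classes
  can then be decided by \<open>hq\<close>, \<open>isop\<close> and \<open>dist\<close>.\<close>

locale realized_dg_category = dg_category D + twisted_ring_cones "Obj D" M e a T N
  for D :: "('o, 'm::ab_group_add, 'z) dgcat_scheme"
    and M :: "'o \<Rightarrow> 'o \<Rightarrow> int \<Rightarrow> 'r::ring set"
    and e a :: "'o \<Rightarrow> 'r"
    and T :: "'o \<Rightarrow> 'o"
    and N :: 'o +
  fixes \<phi> :: "'m \<Rightarrow> 'r"
    and ct :: "'o \<Rightarrow> 'o \<Rightarrow> 'm \<Rightarrow> ('o, 'm set) triangle"
  assumes phi_bij: "\<lbrakk>A \<in> Obj D; B \<in> Obj D\<rbrakk> \<Longrightarrow> bij_betw \<phi> (Hom D A B n) (M A B n)"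
    and phi_add: "\<lbrakk>A \<in> Obj D; B \<in> Obj D; f \<in> Hom D A B n; g \<in> Hom D A B n\<rbrakk>
        \<Longrightarrow> \<phi> (f + g) = \<phi> f + \<phi> g"
    and phi_Cmp: "\<lbrakk>A \<in> Obj D; B \<in> Obj D; E \<in> Obj D; f \<in> Hom D A B m; g \<in> Hom D B E n\<rbrakk>
        \<Longrightarrow> \<phi> (Cmp D A B E g f) = \<phi> g * \<phi> f"
    and phi_Idn: "A \<in> Obj D \<Longrightarrow> \<phi> (Idn D A) = e A"
    and phi_Dif: "\<lbrakk>A \<in> Obj D; B \<in> Obj D; f \<in> Hom D A B n\<rbrakk>
        \<Longrightarrow> \<phi> (Dif D A B f) = \<phi> f * a A + a B * \<phi> f"
    and Hom_T: "\<lbrakk>A \<in> Obj D; B \<in> Obj D\<rbrakk> \<Longrightarrow> Hom D (T A) (T B) n = Hom D A B n"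
    and Dif_T: "\<lbrakk>A \<in> Obj D; B \<in> Obj D\<rbrakk> \<Longrightarrow> Dif D (T A) (T B) = Dif D A B"
    and ct: "\<lbrakk>X \<in> Obj D; Y \<in> Obj D; h \<in> carrier (cocycles D X Y)\<rbrakk>
        \<Longrightarrow> \<exists>W i j s p. conedata X Y (\<phi> h) W i (\<phi> p) (\<phi> j) s \<and>
              j \<in> Hom D Y W 0 \<and> p \<in> Hom D W (T X) 0 \<and>
              ct X Y h = (X, Y, W, coh_class D X Y h, coh_class D Y W j, coh_class D W (T X) p)"
begin

text \<open>Names a morphism of the cohomology category by a ring element, so that equality of
  morphisms becomes \<open>hq\<close> (\<open>cls_eq_iff\<close>) and composition the product
  (\<open>comp_cls\<close>).\<close>

definition cls :: "'o \<Rightarrow> 'o \<Rightarrow> 'r \<Rightarrow> 'm set"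
  where "cls A B x = coh_class D A B (inv_into (Hom D A B 0) \<phi> x)"

lemma phi_zero: "\<phi> 0 = 0"
  using phi_add[OF N_Ob N_Ob zero_Hom[OF N_Ob N_Ob] zero_Hom[OF N_Ob N_Ob]] by simp

lemma phi_Hom: "\<lbrakk>A \<in> Obj D; B \<in> Obj D; f \<in> Hom D A B n\<rbrakk> \<Longrightarrow> \<phi> f \<in> M A B n"
  using bij_betw_apply[OF phi_bij] .

lemma phi_surj: "\<lbrakk>A \<in> Obj D; B \<in> Obj D; x \<in> M A B n\<rbrakk> \<Longrightarrow> \<exists>f\<in>Hom D A B n. \<phi> f = x"
  using bij_betw_imp_surj_on[OF phi_bij] by (metis imageE)

lemma phi_inj: "\<lbrakk>A \<in> Obj D; B \<in> Obj D; f \<in> Hom D A B n; g \<in> Hom D A B n; \<phi> f = \<phi> g\<rbrakk> \<Longrightarrow> f = g"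
  using phi_bij[of A B n] by (auto simp: bij_betw_def inj_on_def)

lemma phi_cocycle:
  assumes "A \<in> Obj D" "B \<in> Obj D"
  shows "f \<in> carrier (cocycles D A B) \<longleftrightarrow> f \<in> Hom D A B 0 \<and> \<phi> f \<in> Z A B"
proof -
  have "Dif D A B f = 0 \<longleftrightarrow> \<phi> f * a A = a B * \<phi> f" if f: "f \<in> Hom D A B 0"
  proof -
    have "Dif D A B f = 0 \<longleftrightarrow> \<phi> (Dif D A B f) = 0"
      using phi_inj[OF assms Dif_Hom[OF assms f] zero_Hom[OF assms]] phi_zero by auto
    then show ?thesis by (simp add: phi_Dif[OF assms f] add_eq_0_char2)
  qed
  then show ?thesis
    using phi_Hom[OF assms] by (auto simp: cocycles_def Z_def)
qed

lemma phi_coboundary: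
  assumes AB: "A \<in> Obj D" "B \<in> Obj D" and f: "f \<in> Hom D A B 0"
  shows "f \<in> coboundaries D A B \<longleftrightarrow> \<phi> f \<in> Bd A B"
proof
  assume "f \<in> coboundaries D A B"
  then show "\<phi> f \<in> Bd A B"
    using phi_Hom[OF AB] phi_Dif[OF AB] by (auto simp: coboundaries_def Bd_def)
next
  assume "\<phi> f \<in> Bd A B"
  then obtain t where t: "t \<in> M A B (-1)" "\<phi> f = t * a A + a B * t" by (auto simp: Bd_def)
  then obtain g where g: "g \<in> Hom D A B (-1)" "\<phi> g = t"
    using phi_surj[OF AB] by blast
  have "\<phi> (Dif D A B g) = \<phi> f" using phi_Dif[OF AB g(1)] g(2) t(2) by simp
  then have "f = Dif D A B g"
    using phi_inj[OF AB f] Dif_Hom[OF AB g(1)] by simp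
  then show "f \<in> coboundaries D A B" using g by (auto simp: coboundaries_def)
qed

lemma coh_class_eq_iff:
  assumes AB: "A \<in> Obj D" "B \<in> Obj D"
    and f: "f \<in> carrier (cocycles D A B)" and g: "g \<in> carrier (cocycles D A B)"
  shows "coh_class D A B f = coh_class D A B g \<longleftrightarrow> hq A B (\<phi> f) (\<phi> g)"
proof -
  interpret G: comm_group "cocycles D A B" by (rule cocycles_comm_group[OF AB])
  interpret S: subgroup "coboundaries D A B" "cocycles D A B" by (rule coboundaries_subgroup[OF AB])
  have "g + g = 0" using g char_two[OF AB] by (auto simp: cocycles_def)
  then have inv: "inv\<^bsub>cocycles D A B\<^esub> g = g"
    using g by (intro G.inv_equality) (auto simp: cocycles_def)
  have "coh_class D A B f = coh_class D A B g \<longleftrightarrow> f \<in> coboundaries D A B #>\<^bsub>cocycles D A B\<^esub> g"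
    unfolding coh_class_def
    using G.repr_independence[OF _ g S.subgroup_axioms] G.rcos_self[OF f S.subgroup_axioms] by auto
  also have "\<dots> \<longleftrightarrow> f + g \<in> coboundaries D A B"
    using S.rcos_module[OF G.group_axioms g f] inv by (simp add: cocycles_def)
  also have "\<dots> \<longleftrightarrow> \<phi> (f + g) \<in> Bd A B"
    using f g by (intro phi_coboundary[OF AB]) (auto simp: cocycles_def add_Hom[OF AB])
  also have "\<phi> (f + g) = \<phi> f + \<phi> g" using f g by (auto simp: cocycles_def phi_add[OF AB])
  finally show ?thesis using f g phi_cocycle[OF AB] by (simp add: hq_def)
qed

lemma cls_phi: "\<lbrakk>A \<in> Obj D; B \<in> Obj D; f \<in> Hom D A B 0\<rbrakk> \<Longrightarrow> cls A B (\<phi> f) = coh_class D A B f"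
  using phi_bij[of A B 0] by (simp add: cls_def bij_betw_def inv_into_f_f)

lemma Z_phi:
  assumes "A \<in> Obj D" "B \<in> Obj D" "x \<in> Z A B"
  obtains f where "f \<in> carrier (cocycles D A B)" "\<phi> f = x" "cls A B x = coh_class D A B f"
proof -
  obtain f where f: "f \<in> Hom D A B 0" "\<phi> f = x"
    using phi_surj[OF assms(1,2) Z_M[OF assms(3)]] by blast
  then show ?thesis using assms cls_phi[OF assms(1,2) f(1)] phi_cocycle[OF assms(1,2)] by (intro that) auto
qed

lemma cls_eq_iff:
  assumes "A \<in> Obj D" "B \<in> Obj D" "x \<in> Z A B" "y \<in> Z A B"
  shows "cls A B x = cls A B y \<longleftrightarrow> hq A B x y"
  using Z_phi[OF assms(1,2,3)] Z_phi[OF assms(1,2,4)] coh_class_eq_iff[OF assms(1,2)] by metis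

lemma cls_eqI: "\<lbrakk>A \<in> Obj D; B \<in> Obj D; hq A B x y\<rbrakk> \<Longrightarrow> cls A B x = cls A B y"
  using cls_eq_iff hq_Z by blast

section \<open>Morphisms of the cohomology category as classes of ring elements\<close>

lemma carrier_H0: "arr (H0 D) A B = coh_class D A B ` carrier (cocycles D A B)"
  by (auto simp: H0_def FactGroup_def RCOSETS_def coh_class_def)

lemma arr_iff:
  assumes "A \<in> Obj D" "B \<in> Obj D"
  shows "F \<in> arr (H0 D) A B \<longleftrightarrow> (\<exists>x\<in>Z A B. F = cls A B x)"
proof
  assume "F \<in> arr (H0 D) A B"
  then obtain f where "f \<in> carrier (cocycles D A B)" "F = coh_class D A B f"
    by (auto simp: carrier_H0)
  then show "\<exists>x\<in>Z A B. F = cls A B x"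
    using phi_cocycle[OF assms] cls_phi[OF assms] by metis
next
  assume "\<exists>x\<in>Z A B. F = cls A B x"
  then show "F \<in> arr (H0 D) A B" using Z_phi[OF assms] unfolding carrier_H0 by (metis imageI)
qed

lemma arrE:
  assumes "A \<in> Obj D" "B \<in> Obj D" "F \<in> arr (H0 D) A B"
  obtains x where "x \<in> Z A B" "F = cls A B x"
  using arr_iff[OF assms(1,2), THEN iffD1, OF assms(3)] by (elim bexE)

lemma cls_arr: "\<lbrakk>A \<in> Obj D; B \<in> Obj D; x \<in> Z A B\<rbrakk> \<Longrightarrow> cls A B x \<in> arr (H0 D) A B"
  using arr_iff by blast

lemma mem_coh_class:
  assumes AB: "A \<in> Obj D" "B \<in> Obj D"
    and f: "f \<in> carrier (cocycles D A B)" and g: "g \<in> coh_class D A B f"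
  shows "g \<in> carrier (cocycles D A B)" "hq A B (\<phi> g) (\<phi> f)"
proof -
  interpret G: comm_group "cocycles D A B" by (rule cocycles_comm_group[OF AB])
  interpret S: subgroup "coboundaries D A B" "cocycles D A B" by (rule coboundaries_subgroup[OF AB])
  show 1: "g \<in> carrier (cocycles D A B)"
    using g f G.r_coset_subset_G[OF S.subset] by (auto simp: coh_class_def)
  have "coh_class D A B g = coh_class D A B f"
    using g G.repr_independence[OF _ f S.subgroup_axioms] by (simp add: coh_class_def)
  then show "hq A B (\<phi> g) (\<phi> f)" using coh_class_eq_iff[OF AB 1 f] by simp
qed

lemma coh_class_self:
  assumes AB: "A \<in> Obj D" "B \<in> Obj D" and f: "f \<in> carrier (cocycles D A B)"
  shows "f \<in> coh_class D A B f"
proof -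
  interpret G: comm_group "cocycles D A B" by (rule cocycles_comm_group[OF AB])
  show ?thesis unfolding coh_class_def
    by (rule G.rcos_self[OF f coboundaries_subgroup[OF AB]])
qed

text \<open>Composition in \<open>H0\<close> is a union over all representatives. Products of
  homotopic cocycles are homotopic, so every member of the union is the same coset, and there is at
  least one.\<close>

lemma comp_cls:
  assumes Ob: "A \<in> Obj D" "B \<in> Obj D" "E \<in> Obj D" and x: "x \<in> Z A B" and y: "y \<in> Z B E"
  shows "comp (H0 D) A B E (cls B E y) (cls A B x) = cls A E (y * x)"
proof -
  obtain f where f: "f \<in> carrier (cocycles D A B)" "\<phi> f = x" "cls A B x = coh_class D A B f"
    using Z_phi[OF Ob(1,2) x] by blast
  obtain g where g: "g \<in> carrier (cocycles D B E)" "\<phi> g = y" "cls B E y = coh_class D B E g"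
    using Z_phi[OF Ob(2,3) y] by blast
  have "coh_class D A E (Cmp D A B E g' f') = cls A E (y * x)"
    if "f' \<in> coh_class D A B f" "g' \<in> coh_class D B E g" for f' g'
  proof -
    note f' = mem_coh_class[OF Ob(1,2) f(1) that(1)]
    note g' = mem_coh_class[OF Ob(2,3) g(1) that(2)]
    have h: "f' \<in> Hom D A B 0" "g' \<in> Hom D B E 0" using f'(1) g'(1) by (auto simp: cocycles_def)
    have "coh_class D A E (Cmp D A B E g' f') = cls A E (\<phi> (Cmp D A B E g' f'))"
      using Cmp_Hom[OF Ob h] by (simp add: cls_phi Ob)
    also have "\<dots> = cls A E (\<phi> g' * \<phi> f')" by (simp add: phi_Cmp[OF Ob h])
    also have "\<dots> = cls A E (y * x)"
      using hq_mult[OF f'(2) g'(2)] f(2) g(2) by (intro cls_eqI Ob) simp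
    finally show ?thesis .
  qed
  then show ?thesis
    using coh_class_self[OF Ob(1,2) f(1)] coh_class_self[OF Ob(2,3) g(1)]
    by (auto simp: H0_def f(3) g(3))
qed

lemma mult_cls:
  assumes Ob: "A \<in> Obj D" "B \<in> Obj D" and x: "x \<in> Z A B" and y: "y \<in> Z A B"
  shows "cls A B x \<otimes>\<^bsub>mor (H0 D) A B\<^esub> cls A B y = cls A B (x + y)"
proof -
  obtain f where f: "f \<in> carrier (cocycles D A B)" "\<phi> f = x" "cls A B x = coh_class D A B f"
    using Z_phi[OF Ob x] by blast
  obtain g where g: "g \<in> carrier (cocycles D A B)" "\<phi> g = y" "cls A B y = coh_class D A B g"
    using Z_phi[OF Ob y] by blast
  have h: "f \<in> Hom D A B 0" "g \<in> Hom D A B 0" using f(1) g(1) by (auto simp: cocycles_def)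
  have "cls A B x \<otimes>\<^bsub>mor (H0 D) A B\<^esub> cls A B y = coh_class D A B (f \<otimes>\<^bsub>cocycles D A B\<^esub> g)"
    using normal.rcos_sum[OF coboundaries_normal[OF Ob] f(1) g(1)]
    by (simp add: H0_def FactGroup_def f(3) g(3) coh_class_def)
  also have "\<dots> = coh_class D A B (f + g)" by (simp add: cocycles_def)
  also have "\<dots> = cls A B (x + y)"
    using cls_phi[OF Ob add_Hom[OF Ob h]] phi_add[OF Ob h] f(2) g(2) by simp
  finally show ?thesis .
qed

lemma zero_mor_cls:
  assumes Ob: "A \<in> Obj D" "B \<in> Obj D"
  shows "zero_mor (H0 D) A B = cls A B 0"
proof -
  interpret comm_group "mor (H0 D) A B" by (rule H0_comm_group[OF Ob])
  have "cls A B 0 \<otimes>\<^bsub>mor (H0 D) A B\<^esub> cls A B 0 = cls A B 0"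
    by (simp add: mult_cls[OF Ob] Z_zero)
  then show ?thesis
    using cls_arr[OF Ob Z_zero] by (simp add: zero_mor_def)
qed

lemma ident_cls: "A \<in> Obj D \<Longrightarrow> ident (H0 D) A = cls A A (e A)"
  using cls_phi[OF _ _ Idn_Hom] by (simp add: H0_def phi_Idn)

lemma neg_mor_arr:
  assumes Ob: "A \<in> Obj D" "B \<in> Obj D" and F: "F \<in> arr (H0 D) A B"
  shows "neg_mor (H0 D) A B F = F"
proof -
  interpret comm_group "mor (H0 D) A B" by (rule H0_comm_group[OF Ob])
  obtain x where "x \<in> Z A B" "F = cls A B x" using F arr_iff[OF Ob] by blast
  then have "F \<otimes>\<^bsub>mor (H0 D) A B\<^esub> F = \<one>\<^bsub>mor (H0 D) A B\<^esub>"
    using zero_mor_cls[OF Ob] by (simp add: mult_cls[OF Ob] char2 zero_mor_def)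
  then show ?thesis using F by (simp add: neg_mor_def inv_equality)
qed

lemma obj_H0: "obj (H0 D) = Obj D"
  by (simp add: H0_def)

lemma iso_mor_cls:
  assumes Ob: "A \<in> Obj D" "B \<in> Obj D" and x: "x \<in> Z A B"
  shows "iso_mor (H0 D) A B (cls A B x) \<longleftrightarrow> (\<exists>y. isop A B x y)"
proof
  assume "iso_mor (H0 D) A B (cls A B x)"
  then obtain G where G: "G \<in> arr (H0 D) B A"
    "comp (H0 D) A B A G (cls A B x) = ident (H0 D) A"
    "comp (H0 D) B A B (cls A B x) G = ident (H0 D) B"
    unfolding iso_mor_def by blast
  obtain y where "y \<in> Z B A" "G = cls B A y" by (rule arrE[OF Ob(2,1) G(1)])
  with G have "isop A B x y"
    using x Ob by (simp add: isop_def comp_cls ident_cls cls_eq_iff Z_mult Z_e)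
  then show "\<exists>y. isop A B x y" by blast
next
  assume "\<exists>y. isop A B x y"
  then obtain y where y: "isop A B x y" by blast
  note yZ = isop_Z(2)[OF y] and h = isop_hq[OF y]
  show "iso_mor (H0 D) A B (cls A B x)"
    unfolding iso_mor_def
    using cls_arr[OF Ob x] cls_arr[OF Ob(2,1) yZ] cls_eqI[OF _ _ h(1)] cls_eqI[OF _ _ h(2)] Ob x yZ
    by (auto simp: comp_cls ident_cls intro!: bexI[of _ "cls B A y"])
qed

lemma iso_mor_isop:
  assumes Ob: "A \<in> Obj D" "B \<in> Obj D" and F: "iso_mor (H0 D) A B F"
  obtains x y where "isop A B x y" "F = cls A B x"
proof -
  obtain x where x: "x \<in> Z A B" "F = cls A B x"
    using F by (auto simp: iso_mor_def elim: arrE[OF Ob])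
  then show ?thesis using F iso_mor_cls[OF Ob x(1)] that by blast
qed

text \<open>An object is zero up to homotopy exactly when its identity is a coboundary; multiplying
  that coboundary with a cocycle makes the cocycle null.\<close>

lemma zero_object_iff: "zero_object (H0 D) W \<longleftrightarrow> W \<in> Obj D \<and> e W \<in> Bd W W"
proof
  assume z: "zero_object (H0 D) W"
  then have W: "W \<in> Obj D" by (simp add: zero_object_def obj_H0)
  have "cls W W (e W) = cls W W 0"
    using z W cls_arr[OF W W Z_e[OF W]] cls_arr[OF W W Z_zero]
    unfolding zero_object_def obj_H0 by blast
  then have "hq W W (e W) 0" using cls_eq_iff[OF W W Z_e[OF W] Z_zero] by simp
  then show "W \<in> Obj D \<and> e W \<in> Bd W W" using W by (simp add: hq_def)
next
  assume "W \<in> Obj D \<and> e W \<in> Bd W W"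
  then have W: "W \<in> Obj D" and h: "hq W W (e W) 0" by (auto simp: hq_def Z_e Z_zero)
  have "F = cls A W 0" if A: "A \<in> Obj D" and F: "F \<in> arr (H0 D) A W" for A F
  proof -
    obtain x where x: "x \<in> Z A W" "F = cls A W x" by (rule arrE[OF A W F])
    have "hq A W x 0" using hq_right[OF h x(1)] e_left[OF Z_M[OF x(1)]] by simp
    then show ?thesis using x(2) cls_eqI[OF A W] by blast
  qed
  moreover have "F = cls W A 0" if A: "A \<in> Obj D" and F: "F \<in> arr (H0 D) W A" for A F
  proof -
    obtain x where x: "x \<in> Z W A" "F = cls W A x" by (rule arrE[OF W A F])
    have "hq W A x 0" using hq_left[OF h x(1)] e_right[OF Z_M[OF x(1)]] by simp
    then show ?thesis using x(2) cls_eqI[OF W A] by blast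
  qed
  ultimately show "zero_object (H0 D) W"
    unfolding zero_object_def obj_H0 using W cls_arr[OF _ _ Z_zero] by blast
qed

lemma zero_object_N: "zero_object (H0 D) N"
  by (simp add: zero_object_iff N_Ob e_N Bd_zero)

text \<open>The cone of the zero morphism is a direct sum with shifted first summand, hence the
  shift is first undone on \<open>A\<close>.\<close>

lemma biproduct_H0:
  assumes A: "A \<in> Obj D" and B: "B \<in> Obj D"
  shows "\<exists>S i1 i2 p1 p2. biproduct (H0 D) A B S i1 i2 p1 p2"
proof -
  obtain A' where A': "A' \<in> Obj D" "T A' = A" using A bij_betw_imp_surj_on[OF T_bij] by (metis imageE)
  obtain W i p j s where c: "conedata A' B 0 W i p j s"
    using cone_ex[OF A'(1) B Z_zero] by blast
  note r = conedata_rules[OF c] and m = conedata_M[OF c] and W = conedata_Ob(3)[OF c]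
  have e: "e A' = e A" and a: "a A' = a A" using e_T[of A'] a_T[of A'] A' by simp_all
  have Mi: "i \<in> M A W 0" and Mp: "p \<in> M W A 0"
    using m M_T_left[of A' W 0] M_T_right[of W A' 0] A' by simp_all
  have Z: "i \<in> Z A W" "p \<in> Z W A" "j \<in> Z B W" "s \<in> Z W B"
    using r m Mi Mp a by (simp_all add: Z_def)
  have "biproduct (H0 D) A B W (cls A W i) (cls B W j) (cls W A p) (cls W B s)"
    unfolding biproduct_def
    using Z A B W r e conedata_e[OF c]
    by (simp add: obj_H0 cls_arr comp_cls ident_cls zero_mor_cls mult_cls Z_mult)
  then show ?thesis by blast
qed

lemma additive_H0: "additive_category (H0 D)"
proof (rule additive_category.intro, unfold obj_H0)
  show "\<exists>W. zero_object (H0 D) W" using zero_object_N by blast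
  show "\<exists>S i1 i2 p1 p2. biproduct (H0 D) A B S i1 i2 p1 p2"
    if "A \<in> Obj D" "B \<in> Obj D" for A B using biproduct_H0 that .
  show "comm_group (mor (H0 D) A B)" if "A \<in> Obj D" "B \<in> Obj D" for A B
    by (rule H0_comm_group[OF that])
  show "ident (H0 D) A \<in> arr (H0 D) A A" if "A \<in> Obj D" for A
    using that by (simp add: ident_cls cls_arr Z_e)
next
  fix A B E E' F G G' K
  assume Ob: "A \<in> Obj D" "B \<in> Obj D"
  note arr = arr_iff[OF Ob]
  show "comp (H0 D) A A B F (ident (H0 D) A) = F" if "F \<in> arr (H0 D) A B"
    using that Ob arr e_right[OF Z_M] by (auto simp: comp_cls ident_cls Z_e)
  show "comp (H0 D) A B B (ident (H0 D) B) F = F" if "F \<in> arr (H0 D) A B"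
    using that Ob arr e_left[OF Z_M] by (auto simp: comp_cls ident_cls Z_e)
  assume E: "E \<in> Obj D"
  note arr' = arr_iff[OF Ob(2) E]
  show "comp (H0 D) A B E G F \<in> arr (H0 D) A E"
    if "F \<in> arr (H0 D) A B" "G \<in> arr (H0 D) B E"
    using that Ob E arr arr' by (auto simp: comp_cls intro!: cls_arr Z_mult)
  show "comp (H0 D) A B E G (F \<otimes>\<^bsub>mor (H0 D) A B\<^esub> K)
      = comp (H0 D) A B E G F \<otimes>\<^bsub>mor (H0 D) A E\<^esub> comp (H0 D) A B E G K"
    if FKG: "F \<in> arr (H0 D) A B" "K \<in> arr (H0 D) A B" "G \<in> arr (H0 D) B E"
  proof -
    obtain x where x: "x \<in> Z A B" "F = cls A B x" by (rule arrE[OF Ob FKG(1)])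
    obtain y where y: "y \<in> Z A B" "K = cls A B y" by (rule arrE[OF Ob FKG(2)])
    obtain z where z: "z \<in> Z B E" "G = cls B E z" by (rule arrE[OF Ob(2) E FKG(3)])
    show ?thesis using x y z Ob E by (simp add: comp_cls mult_cls Z_add Z_mult[of _ A B] distrib_left)
  qed
  show "comp (H0 D) A B E (G \<otimes>\<^bsub>mor (H0 D) B E\<^esub> G') F
      = comp (H0 D) A B E G F \<otimes>\<^bsub>mor (H0 D) A E\<^esub> comp (H0 D) A B E G' F"
    if FG: "F \<in> arr (H0 D) A B" "G \<in> arr (H0 D) B E" "G' \<in> arr (H0 D) B E"
  proof -
    obtain x where x: "x \<in> Z A B" "F = cls A B x" by (rule arrE[OF Ob FG(1)])
    obtain y where y: "y \<in> Z B E" "G = cls B E y" by (rule arrE[OF Ob(2) E FG(2)])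
    obtain z where z: "z \<in> Z B E" "G' = cls B E z" by (rule arrE[OF Ob(2) E FG(3)])
    show ?thesis using x y z Ob E by (simp add: comp_cls mult_cls Z_add Z_mult[of _ A B] distrib_right)
  qed
  assume E': "E' \<in> Obj D"
  show "comp (H0 D) A E E' K (comp (H0 D) A B E G F) = comp (H0 D) A B E' (comp (H0 D) B E E' K G) F"
    if FGK: "F \<in> arr (H0 D) A B" "G \<in> arr (H0 D) B E" "K \<in> arr (H0 D) E E'"
  proof -
    obtain x where x: "x \<in> Z A B" "F = cls A B x" by (rule arrE[OF Ob FGK(1)])
    obtain y where y: "y \<in> Z B E" "G = cls B E y" by (rule arrE[OF Ob(2) E FGK(2)])
    obtain z where z: "z \<in> Z E E'" "K = cls E E' z" by (rule arrE[OF E E' FGK(3)])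
    show ?thesis
      using x y z Ob E E' Z_mult[OF x(1) y(1)] Z_mult[OF y(1) z(1)] by (simp add: comp_cls mult.assoc)
  qed
qed

section \<open>Shift and distinguished triangles of the cohomology category\<close>

definition Tm :: "'o \<Rightarrow> 'o \<Rightarrow> 'm set \<Rightarrow> 'm set"
  where "Tm A B F = F"

lemma mor_T: "\<lbrakk>A \<in> Obj D; B \<in> Obj D\<rbrakk> \<Longrightarrow> mor (H0 D) (T A) (T B) = mor (H0 D) A B"
  by (simp add: H0_def cocycles_def coboundaries_def Hom_T Dif_T)

lemma cls_T: "\<lbrakk>A \<in> Obj D; B \<in> Obj D\<rbrakk> \<Longrightarrow> cls (T A) (T B) x = cls A B x"
  by (simp add: cls_def coh_class_def cocycles_def coboundaries_def Hom_T Dif_T)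

definition \<Delta> :: "('o, 'm set) triangle set"
  where "\<Delta> = {t \<in> triangles (H0 D) T. \<exists>X Y h. X \<in> Obj D \<and> Y \<in> Obj D \<and>
    h \<in> carrier (cocycles D X Y) \<and> triangle_iso (H0 D) T Tm (ct X Y h) t}"

lemma triangles_iff:
  "(X, Y, W, U, V, S) \<in> triangles (H0 D) T \<longleftrightarrow> X \<in> Obj D \<and> Y \<in> Obj D \<and> W \<in> Obj D \<and>
    (\<exists>u v w. u \<in> Z X Y \<and> v \<in> Z Y W \<and> w \<in> Z W (T X) \<and>
      U = cls X Y u \<and> V = cls Y W v \<and> S = cls W (T X) w)"
  (is "?L \<longleftrightarrow> ?R")
proof
  assume ?L
  then have Ob: "X \<in> Obj D" "Y \<in> Obj D" "W \<in> Obj D"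
    and arr: "U \<in> arr (H0 D) X Y" "V \<in> arr (H0 D) Y W" "S \<in> arr (H0 D) W (T X)"
    by (simp_all add: triangles_def obj_H0)
  obtain u where "u \<in> Z X Y" "U = cls X Y u" by (rule arrE[OF Ob(1,2) arr(1)])
  moreover obtain v where "v \<in> Z Y W" "V = cls Y W v" by (rule arrE[OF Ob(2,3) arr(2)])
  moreover obtain w where "w \<in> Z W (T X)" "S = cls W (T X) w"
    by (rule arrE[OF Ob(3) T_Ob[OF Ob(1)] arr(3)])
  ultimately show ?R using Ob by blast
next
  assume ?R
  then show ?L by (auto simp: triangles_def obj_H0 intro!: cls_arr T_Ob)
qed

lemma triangle_iso_cls:
  assumes Ob: "X \<in> Obj D" "Y \<in> Obj D" "W \<in> Obj D" "X' \<in> Obj D" "Y' \<in> Obj D" "W' \<in> Obj D"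
    and Z: "u \<in> Z X Y" "v \<in> Z Y W" "w \<in> Z W (T X)"
      "u' \<in> Z X' Y'" "v' \<in> Z Y' W'" "w' \<in> Z W' (T X')"
  shows "triangle_iso (H0 D) T Tm (X, Y, W, cls X Y u, cls Y W v, cls W (T X) w)
      (X', Y', W', cls X' Y' u', cls Y' W' v', cls W' (T X') w') \<longleftrightarrow>
    (\<exists>x x' y y' z z'. isop X X' x x' \<and> isop Y Y' y y' \<and> isop W W' z z' \<and>
      hq X Y' (y * u) (u' * x) \<and> hq Y W' (z * v) (v' * y) \<and> hq W (T X') (x * w) (w' * z))"
    (is "?L \<longleftrightarrow> ?R")
proof -
  have sq: "comp (H0 D) X Y Y' (cls Y Y' y) (cls X Y u) = comp (H0 D) X X' Y' (cls X' Y' u') (cls X X' x) \<and>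
      comp (H0 D) Y W W' (cls W W' z) (cls Y W v) = comp (H0 D) Y Y' W' (cls Y' W' v') (cls Y Y' y) \<and>
      comp (H0 D) W (T X) (T X') (Tm X X' (cls X X' x)) (cls W (T X) w)
        = comp (H0 D) W W' (T X') (cls W' (T X') w') (cls W W' z) \<longleftrightarrow>
      hq X Y' (y * u) (u' * x) \<and> hq Y W' (z * v) (v' * y) \<and> hq W (T X') (x * w) (w' * z)"
    if "x \<in> Z X X'" "y \<in> Z Y Y'" "z \<in> Z W W'" for x y z
  proof -
    have xT: "x \<in> Z (T X) (T X')" using that by simp
    have "Tm X X' (cls X X' x) = cls (T X) (T X') x" using Ob by (simp add: Tm_def cls_T)
    then show ?thesis
      using that xT Ob Z T_Ob by (simp add: comp_cls cls_eq_iff Z_mult[of _ _ _ _ "T X'"] Z_mult)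
  qed
  show ?thesis
  proof
    assume ?L
    then obtain F G H where i: "iso_mor (H0 D) X X' F" "iso_mor (H0 D) Y Y' G" "iso_mor (H0 D) W W' H"
      and c: "comp (H0 D) X Y Y' G (cls X Y u) = comp (H0 D) X X' Y' (cls X' Y' u') F \<and>
      comp (H0 D) Y W W' H (cls Y W v) = comp (H0 D) Y Y' W' (cls Y' W' v') G \<and>
      comp (H0 D) W (T X) (T X') (Tm X X' F) (cls W (T X) w)
        = comp (H0 D) W W' (T X') (cls W' (T X') w') H"
      by auto
    obtain x x' where x: "isop X X' x x'" "F = cls X X' x" using iso_mor_isop[OF Ob(1,4) i(1)] .
    obtain y y' where y: "isop Y Y' y y'" "G = cls Y Y' y" using iso_mor_isop[OF Ob(2,5) i(2)] .
    obtain z z' where z: "isop W W' z z'" "H = cls W W' z" using iso_mor_isop[OF Ob(3,6) i(3)] .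
    show ?R using c sq[OF isop_Z(1)[OF x(1)] isop_Z(1)[OF y(1)] isop_Z(1)[OF z(1)]] x y z by metis
  next
    assume ?R
    then obtain x x' y y' z z' where i: "isop X X' x x'" "isop Y Y' y y'" "isop W W' z z'"
      and c: "hq X Y' (y * u) (u' * x) \<and> hq Y W' (z * v) (v' * y) \<and> hq W (T X') (x * w) (w' * z)"
      by blast
    note iZ = isop_Z(1)[OF i(1)] isop_Z(1)[OF i(2)] isop_Z(1)[OF i(3)]
    have "iso_mor (H0 D) X X' (cls X X' x)" "iso_mor (H0 D) Y Y' (cls Y Y' y)"
      "iso_mor (H0 D) W W' (cls W W' z)"
      using i iZ Ob iso_mor_cls by blast+
    then show ?L using c sq[OF iZ] unfolding triangle_iso.simps by blast
  qed
qed

text \<open>Translates distinguished triangles into \<open>dist\<close>. The isomorphism of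
  triangles in the definition of \<open>\<Delta>\<close> may move all three objects, whereas
  \<open>dist\<close> fixes the base; \<open>dist_iso\<close> absorbs the difference in one
  direction, and \<open>dist_iso_cone\<close> with identities gives the other.\<close>

lemma \<Delta>_iff:
  "(X, Y, W, U, V, S) \<in> \<Delta> \<longleftrightarrow>
    (\<exists>u v w. dist X Y W u v w \<and> U = cls X Y u \<and> V = cls Y W v \<and> S = cls W (T X) w)"
proof
  assume t: "(X, Y, W, U, V, S) \<in> \<Delta>"
  then have Ob: "X \<in> Obj D" "Y \<in> Obj D" "W \<in> Obj D" by (simp_all add: \<Delta>_def triangles_iff)
  obtain u v w where Z: "u \<in> Z X Y" "v \<in> Z Y W" "w \<in> Z W (T X)"
    and eq: "U = cls X Y u" "V = cls Y W v" "S = cls W (T X) w"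
    using t by (auto simp: \<Delta>_def triangles_iff)
  obtain X' Y' h where h: "X' \<in> Obj D" "Y' \<in> Obj D" "h \<in> carrier (cocycles D X' Y')"
    and i: "triangle_iso (H0 D) T Tm (ct X' Y' h) (X, Y, W, U, V, S)"
    using t by (auto simp: \<Delta>_def)
  obtain W' i' j s p where c: "conedata X' Y' (\<phi> h) W' i' (\<phi> p) (\<phi> j) s"
    and jp: "j \<in> Hom D Y' W' 0" "p \<in> Hom D W' (T X') 0"
    and ct': "ct X' Y' h = (X', Y', W', coh_class D X' Y' h, coh_class D Y' W' j, coh_class D W' (T X') p)"
    using ct[OF h] by blast
  have W': "W' \<in> Obj D" by (rule conedata_Ob(3)[OF c])
  have "ct X' Y' h = (X', Y', W', cls X' Y' (\<phi> h), cls Y' W' (\<phi> j), cls W' (T X') (\<phi> p))"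
    using ct' jp h W' T_Ob phi_cocycle by (simp add: cls_phi)
  then have "triangle_iso (H0 D) T Tm (X', Y', W', cls X' Y' (\<phi> h), cls Y' W' (\<phi> j), cls W' (T X') (\<phi> p))
      (X, Y, W, cls X Y u, cls Y W v, cls W (T X) w)"
    using i eq by simp
  then obtain x x' y y' z z' where "isop X' X x x'" "isop Y' Y y y'" "isop W' W z z'"
    "hq X' Y (y * \<phi> h) (u * x)" "hq Y' W (z * \<phi> j) (v * y)" "hq W' (T X) (x * \<phi> p) (w * z)"
    using triangle_iso_cls[OF h(1,2) W' Ob conedata_Ob(4)[OF c] conedata_Z[OF c] Z] by blast
  then have "dist X Y W u v w" by (rule dist_iso[OF dist_cone[OF c] _ _ _ Ob Z])
  then show "\<exists>u v w. dist X Y W u v w \<and> U = cls X Y u \<and> V = cls Y W v \<and> S = cls W (T X) w"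
    using eq by blast
next
  assume "\<exists>u v w. dist X Y W u v w \<and> U = cls X Y u \<and> V = cls Y W v \<and> S = cls W (T X) w"
  then obtain u v w where d: "dist X Y W u v w"
    and eq: "U = cls X Y u" "V = cls Y W v" "S = cls W (T X) w" by blast
  note Ob = dist_Ob[OF d]
  obtain h where h: "h \<in> carrier (cocycles D X Y)" "\<phi> h = u" "cls X Y u = coh_class D X Y h"
    using Z_phi[OF Ob(1,2,4)] by blast
  obtain W' i' j s p where c: "conedata X Y (\<phi> h) W' i' (\<phi> p) (\<phi> j) s"
    and jp: "j \<in> Hom D Y W' 0" "p \<in> Hom D W' (T X) 0"
    and ct': "ct X Y h = (X, Y, W', coh_class D X Y h, coh_class D Y W' j, coh_class D W' (T X) p)"
    using ct[OF Ob(1,2) h(1)] by blast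
  have W': "W' \<in> Obj D" by (rule conedata_Ob(3)[OF c])
  have ct'': "ct X Y h = (X, Y, W', cls X Y (\<phi> h), cls Y W' (\<phi> j), cls W' (T X) (\<phi> p))"
    using ct' jp h Ob W' T_Ob phi_cocycle by (simp add: cls_phi)
  have sq: "hq X Y (e Y * u) (\<phi> h * e X)"
    using h(2) e_left[OF Z_M[OF Ob(4)]] e_right[OF Z_M[OF Ob(4)]] hq_refl[OF Ob(4)] by simp
  obtain z z' where z: "isop W W' z z'" "hq Y W' (z * v) (\<phi> j * e Y)" "hq W (T X) (\<phi> p * z) (e X * w)"
    using dist_iso_cone[OF d c isop_e[OF Ob(1)] isop_e[OF Ob(2)] sq] by blast
  note r = conedata_rules[OF c] e_left[OF Z_M[OF Ob(6)]]
  have "hq Y W (z' * \<phi> j) (v * e Y)"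
    using hq_sym[OF isop_cancel_left[OF z(1) z(2) Ob(5)]] e_right[OF Z_M[OF Ob(5)]]
    by (simp add: r)
  moreover have "hq W' (T X) (e X * \<phi> p) (w * z')"
    using isop_cancel_right[OF z(1,3) conedata_Z(2)[OF c]] e_left[OF Z_M[OF Ob(6)]]
    by (simp add: r e_T)
  ultimately have "triangle_iso (H0 D) T Tm (ct X Y h) (X, Y, W, U, V, S)"
    unfolding ct'' eq
    using triangle_iso_cls[OF Ob(1,2) W' Ob(1,2,3) conedata_Ob(4)[OF c] conedata_Z[OF c] Ob(4,5,6)]
      isop_e[OF Ob(1)] isop_e[OF Ob(2)] isop_sym[OF z(1)] sq h(2)
    by (metis h(2) hq_sym hq_trans conedata_rules(13,14)[OF c])
  then show "(X, Y, W, U, V, S) \<in> \<Delta>"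
    using Ob h eq by (auto simp: \<Delta>_def triangles_iff)
qed

text \<open>\<open>\<Delta>_iff\<close> only provides some representatives. Invariance under
  identities, with squares up to homotopy, replaces them by the given ones.\<close>

lemma cls_triangle_iff:
  assumes Ob: "X \<in> Obj D" "Y \<in> Obj D" "W \<in> Obj D"
    and Z: "u \<in> Z X Y" "v \<in> Z Y W" "w \<in> Z W (T X)"
  shows "(X, Y, W, cls X Y u, cls Y W v, cls W (T X) w) \<in> \<Delta> \<longleftrightarrow> dist X Y W u v w"
proof
  assume "(X, Y, W, cls X Y u, cls Y W v, cls W (T X) w) \<in> \<Delta>"
  then obtain u' v' w' where d: "dist X Y W u' v' w'"
    and eq: "cls X Y u = cls X Y u'" "cls Y W v = cls Y W v'" "cls W (T X) w = cls W (T X) w'"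
    unfolding \<Delta>_iff by blast
  note d_Ob = dist_Ob[OF d]
  have h: "hq X Y u' u" "hq Y W v' v" "hq W (T X) w' w"
    using eq cls_eq_iff[OF Ob(1,2) Z(1) d_Ob(4)] cls_eq_iff[OF Ob(2,3) Z(2) d_Ob(5)]
      cls_eq_iff[OF Ob(3) T_Ob[OF Ob(1)] Z(3) d_Ob(6)] by (blast intro: hq_sym)+
  have e: "e Y * u' = u'" "u * e X = u" "e W * v' = v'" "v * e Y = v" "e X * w' = w'" "w * e W = w"
    using e_left[OF Z_M[OF d_Ob(4)]] e_left[OF Z_M[OF d_Ob(5)]] e_left[OF Z_M[OF d_Ob(6)]]
      e_right[OF Z_M[OF Z(1)]] e_right[OF Z_M[OF Z(2)]] e_right[OF Z_M[OF Z(3)]]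
    by (simp_all add: e_T)
  show "dist X Y W u v w"
    using h by (intro dist_iso[OF d isop_e[OF Ob(1)] isop_e[OF Ob(2)] isop_e[OF Ob(3)] Ob Z])
      (simp_all add: e)
next
  assume "dist X Y W u v w"
  then show "(X, Y, W, cls X Y u, cls Y W v, cls W (T X) w) \<in> \<Delta>"
    unfolding \<Delta>_iff by blast
qed

lemma triangle_iso_trans:
  assumes "t \<in> triangles (H0 D) T" "t' \<in> \<Delta>" "triangle_iso (H0 D) T Tm t' t"
  shows "t \<in> \<Delta>"
proof -
  obtain X' Y' W' U' V' S' where t': "t' = (X', Y', W', U', V', S')" by (cases t') auto
  obtain X Y W U V S where t: "t = (X, Y, W, U, V, S)" by (cases t) auto
  obtain u v w where Z: "u \<in> Z X Y" "v \<in> Z Y W" "w \<in> Z W (T X)" and Ob: "X \<in> Obj D" "Y \<in> Obj D" "W \<in> Obj D"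
    and eq: "U = cls X Y u" "V = cls Y W v" "S = cls W (T X) w"
    using assms(1) unfolding t triangles_iff by blast
  obtain u' v' w' where d: "dist X' Y' W' u' v' w'"
    and eq': "U' = cls X' Y' u'" "V' = cls Y' W' v'" "S' = cls W' (T X') w'"
    using assms(2) unfolding t' \<Delta>_iff by blast
  obtain x x' y y' z z' where "isop X' X x x'" "isop Y' Y y y'" "isop W' W z z'"
    "hq X' Y (y * u') (u * x)" "hq Y' W (z * v') (v * y)" "hq W' (T X) (x * w') (w * z)"
    using assms(3) triangle_iso_cls[OF dist_Ob(1-3)[OF d] Ob dist_Ob(4-6)[OF d] Z]
    unfolding t t' eq eq' by blast
  then have "dist X Y W u v w" by (rule dist_iso[OF d _ _ _ Ob Z])
  then show ?thesis unfolding t \<Delta>_iff eq by blast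
qed

lemma triangulated_H0: "triangulated_category (H0 D) T Tm \<Delta>"
proof (rule triangulated_category.intro[OF additive_H0], rule triangulated_category_axioms.intro,
    unfold obj_H0)
  show "bij_betw T (Obj D) (Obj D)" by (rule T_bij)
  show "\<Delta> \<subseteq> triangles (H0 D) T" by (auto simp: \<Delta>_def)
  show "t' \<in> \<Delta>" if "t \<in> \<Delta>" "t' \<in> triangles (H0 D) T" "triangle_iso (H0 D) T Tm t t'" for t t'
    using triangle_iso_trans that by blast
  show "Tm A B \<in> iso (mor (H0 D) A B) (mor (H0 D) (T A) (T B))" if "A \<in> Obj D" "B \<in> Obj D" for A B
    using that by (simp add: mor_T Tm_def iso_def hom_def bij_betw_def inj_on_def)
  show "Tm A A (ident (H0 D) A) = ident (H0 D) (T A)" if "A \<in> Obj D" for A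
    using that by (simp add: Tm_def ident_cls T_Ob e_T cls_T)
  show "Tm A E (comp (H0 D) A B E G F) = comp (H0 D) (T A) (T B) (T E) (Tm B E G) (Tm A B F)"
    if H: "A \<in> Obj D" "B \<in> Obj D" "E \<in> Obj D" "F \<in> arr (H0 D) A B" "G \<in> arr (H0 D) B E" for A B E F G
  proof -
    obtain x where x: "x \<in> Z A B" "F = cls A B x" by (rule arrE[OF H(1,2,4)])
    obtain y where y: "y \<in> Z B E" "G = cls B E y" by (rule arrE[OF H(2,3,5)])
    note xy = x y
    have "comp (H0 D) (T A) (T B) (T E) (cls (T B) (T E) y) (cls (T A) (T B) x) = cls (T A) (T E) (y * x)"
      using that T_Ob xy by (intro comp_cls) simp_all
    then show ?thesis using that xy by (simp add: Tm_def cls_T comp_cls)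
  qed
  show "(X, X, W, ident (H0 D) X, zero_mor (H0 D) X W, zero_mor (H0 D) W (T X)) \<in> \<Delta>"
    if "X \<in> Obj D" "zero_object (H0 D) W" for X W
  proof -
    have W: "W \<in> Obj D" "e W \<in> Bd W W" using that(2) by (simp_all add: zero_object_iff)
    have "(X, X, W, cls X X (e X), cls X W 0, cls W (T X) 0) \<in> \<Delta>"
      using dist_id[OF that(1) W] by (simp add: cls_triangle_iff that W Z_e Z_zero)
    then show ?thesis using that(1) W by (simp add: ident_cls zero_mor_cls T_Ob)
  qed
  show "\<exists>W V S. (X, Y, W, U, V, S) \<in> \<Delta>"
    if XY: "X \<in> Obj D" "Y \<in> Obj D" and U: "U \<in> arr (H0 D) X Y" for X Y U
  proof -
    obtain u where u: "u \<in> Z X Y" "U = cls X Y u" by (rule arrE[OF XY U])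
    obtain W i p j s where "conedata X Y u W i p j s" using cone_ex[OF XY u(1)] by blast
    from dist_cone[OF this] show ?thesis unfolding \<Delta>_iff u(2) by blast
  qed
  show "(X, Y, W, U, V, S) \<in> \<Delta> \<longleftrightarrow> (Y, W, T X, V, S, neg_mor (H0 D) (T X) (T Y) (Tm X Y U)) \<in> \<Delta>"
    if t: "(X, Y, W, U, V, S) \<in> triangles (H0 D) T" for X Y W U V S
  proof -
    obtain u v w where Z: "u \<in> Z X Y" "v \<in> Z Y W" "w \<in> Z W (T X)"
      and Ob: "X \<in> Obj D" "Y \<in> Obj D" "W \<in> Obj D"
      and eq: "U = cls X Y u" "V = cls Y W v" "S = cls W (T X) w"
      using t unfolding triangles_iff by blast
    have uT: "u \<in> Z (T X) (T Y)" using Z(1) by simp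
    \<comment> \<open>Negation of morphisms is trivial here, so the sign in the rotation axiom
      disappears.\<close>
    have U: "neg_mor (H0 D) (T X) (T Y) (Tm X Y U) = cls (T X) (T Y) u"
      using neg_mor_arr[OF T_Ob T_Ob cls_arr[OF T_Ob T_Ob uT]] Ob by (simp add: Tm_def eq cls_T)
    have 1: "(X, Y, W, U, V, S) \<in> \<Delta> \<longleftrightarrow> dist X Y W u v w"
      unfolding eq by (rule cls_triangle_iff[OF Ob Z])
    have 2: "(Y, W, T X, V, S, cls (T X) (T Y) u) \<in> \<Delta> \<longleftrightarrow> dist Y W (T X) v w u"
      unfolding eq by (rule cls_triangle_iff[OF Ob(2,3) T_Ob[OF Ob(1)] Z(2,3) uT])
    show ?thesis unfolding U 1 2 by (rule dist_rotate_iff[OF Ob Z])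
  qed
  show "\<exists>c\<in>arr (H0 D) W W'. comp (H0 D) Y W W' c V = comp (H0 D) Y Y' W' V' b \<and>
      comp (H0 D) W (T X) (T X') (Tm X X' a) S = comp (H0 D) W W' (T X') S' c"
    if t: "(X, Y, W, U, V, S) \<in> \<Delta>" "(X', Y', W', U', V', S') \<in> \<Delta>"
      and ab: "a \<in> arr (H0 D) X X'" "b \<in> arr (H0 D) Y Y'"
        "comp (H0 D) X Y Y' b U = comp (H0 D) X X' Y' U' a"
    for X Y W U V S X' Y' W' U' V' S' a b
  proof -
    obtain u v w where d: "dist X Y W u v w"
      and eq: "U = cls X Y u" "V = cls Y W v" "S = cls W (T X) w"
      using t(1)[unfolded \<Delta>_iff] by blast
    obtain u' v' w' where d': "dist X' Y' W' u' v' w'"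
      and eq': "U' = cls X' Y' u'" "V' = cls Y' W' v'" "S' = cls W' (T X') w'"
      using t(2)[unfolded \<Delta>_iff] by blast
    note Ob = dist_Ob[OF d] and Ob' = dist_Ob[OF d']
    obtain x where x: "x \<in> Z X X'" "a = cls X X' x" by (rule arrE[OF Ob(1) Ob'(1) ab(1)])
    obtain y where y: "y \<in> Z Y Y'" "b = cls Y Y' y" by (rule arrE[OF Ob(2) Ob'(2) ab(2)])
    have "hq X Y' (y * u) (u' * x)"
      using ab(3) x y eq eq' Ob Ob' by (simp add: comp_cls cls_eq_iff Z_mult)
    then obtain z where z: "z \<in> Z W W'" "hq Y W' (z * v) (v' * y)" "hq W (T X') (x * w) (w' * z)"
      using dist_map[OF d d' x(1) y(1)] by blast
    have xT: "x \<in> Z (T X) (T X')" using x(1) by simp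
    have T: "Tm X X' a = cls (T X) (T X') x" using x Ob Ob' by (simp add: Tm_def cls_T)
    show ?thesis
      unfolding T using z Ob Ob' T_Ob x xT y eq eq' cls_arr[OF Ob(3) Ob'(3) z(1)]
      by (intro bexI[of _ "cls W W' z"]) (simp_all add: comp_cls cls_eqI)
  qed
  show "\<exists>u\<in>arr (H0 D) W1 W3. \<exists>v\<in>arr (H0 D) W3 W2.
      (W1, W3, W2, u, v, comp (H0 D) W2 (T Y) (T W1) (Tm Y W1 f1) g2) \<in> \<Delta> \<and>
      comp (H0 D) Y W1 W3 u f1 = comp (H0 D) Y V W3 h1 g \<and>
      comp (H0 D) W1 W3 (T X) h2 u = f2 \<and>
      comp (H0 D) V W3 W2 v h1 = g1 \<and>
      comp (H0 D) W3 W2 (T Y) g2 v = comp (H0 D) W3 (T X) (T Y) (Tm X Y f) h2"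
    if t: "(X, Y, W1, f, f1, f2) \<in> \<Delta>" "(Y, V, W2, g, g1, g2) \<in> \<Delta>"
      "(X, V, W3, comp (H0 D) X Y V g f, h1, h2) \<in> \<Delta>"
    for X Y W1 f f1 f2 V W2 g g1 g2 W3 h1 h2
  proof -
    obtain a a1 a2 where da: "dist X Y W1 a a1 a2"
      and ea: "f = cls X Y a" "f1 = cls Y W1 a1" "f2 = cls W1 (T X) a2"
      using t(1)[unfolded \<Delta>_iff] by blast
    obtain b b1 b2 where db: "dist Y V W2 b b1 b2"
      and eb: "g = cls Y V b" "g1 = cls V W2 b1" "g2 = cls W2 (T Y) b2"
      using t(2)[unfolded \<Delta>_iff] by blast
    obtain c c1 c2 where dc: "dist X V W3 c c1 c2"
      and ec: "comp (H0 D) X Y V g f = cls X V c" "h1 = cls V W3 c1" "h2 = cls W3 (T X) c2"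
      using t(3)[unfolded \<Delta>_iff] by blast
    note Oa = dist_Ob[OF da] and Ob = dist_Ob[OF db] and Oc = dist_Ob[OF dc]
    \<comment> \<open>The composite is known only as a class, so the first map of the third triangle
      agrees with \<open>b * a\<close> up to homotopy.\<close>
    have "hq X V c (b * a)"
      using ec(1) ea eb Oa Ob Oc by (simp add: comp_cls cls_eq_iff Z_mult hq_sym)
    then obtain u v where uv: "u \<in> Z W1 W3" "v \<in> Z W3 W2" and d: "dist W1 W3 W2 u v (a1 * b2)"
      and h: "hq Y W3 (u * a1) (c1 * b)" "hq W1 (T X) (c2 * u) a2" "hq V W2 (v * c1) b1"
        "hq W3 (T Y) (b2 * v) (a * c2)"
      using dist_octahedron[OF da db dc] by blast
    have aT: "a \<in> Z (T X) (T Y)" "a1 \<in> Z (T Y) (T W1)" using Oa by simp_all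
    have Tm: "Tm X Y (cls X Y a) = cls (T X) (T Y) a"
      "Tm Y W1 (cls Y W1 a1) = cls (T Y) (T W1) a1"
      using Oa by (simp_all add: Tm_def cls_T)
    have t': "(W1, W3, W2, cls W1 W3 u, cls W3 W2 v, cls W2 (T W1) (a1 * b2)) \<in> \<Delta>"
      unfolding \<Delta>_iff using d by blast
    have e: "comp (H0 D) W2 (T Y) (T W1) (cls (T Y) (T W1) a1) (cls W2 (T Y) b2) = cls W2 (T W1) (a1 * b2)"
      "comp (H0 D) Y W1 W3 (cls W1 W3 u) (cls Y W1 a1) = cls Y W3 (u * a1)"
      "comp (H0 D) Y V W3 (cls V W3 c1) (cls Y V b) = cls Y W3 (c1 * b)"
      "comp (H0 D) W1 W3 (T X) (cls W3 (T X) c2) (cls W1 W3 u) = cls W1 (T X) (c2 * u)"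
      "comp (H0 D) V W3 W2 (cls W3 W2 v) (cls V W3 c1) = cls V W2 (v * c1)"
      "comp (H0 D) W3 W2 (T Y) (cls W2 (T Y) b2) (cls W3 W2 v) = cls W3 (T Y) (b2 * v)"
      "comp (H0 D) W3 (T X) (T Y) (cls (T X) (T Y) a) (cls W3 (T X) c2) = cls W3 (T Y) (a * c2)"
      using uv Oa Ob Oc T_Ob aT by (simp_all add: comp_cls)
    have arr: "cls W1 W3 u \<in> arr (H0 D) W1 W3" "cls W3 W2 v \<in> arr (H0 D) W3 W2"
      using uv Oa Ob Oc by (simp_all add: cls_arr)
    show ?thesis
      unfolding ea eb ec(2,3) Tm
      by (rule bexI[OF bexI[OF _ arr(2)] arr(1)])
        (use t' h Oa Ob Oc T_Ob in \<open>simp add: e cls_eqI\<close>)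
  qed
qed

end

section \<open>Matrices of finite support\<close>

lemma vcomp_add: "vcomp x (y + z) = vcomp x y + vcomp x z" "vcomp (x + y) z = vcomp x z + vcomp y z"
  and hcomp_add: "hcomp x (y + z) = hcomp x y + hcomp x z" "hcomp (x + y) z = hcomp x z + hcomp y z"
  by (transfer, rule deq.Over_Plus_right deq.Over_Plus_left deq.Beside_Plus_right deq.Beside_Plus_left)+

lemma elementary_simps [simp]:
  "Hom elementary A B n = diagHom (fst A) (fst B) (n + snd B - snd A)"
  "Cmp elementary A B E g f = vcomp g f" "Idn elementary A = idQ (fst A)" "Dif elementary A B f = 0"
  "Unit elementary = (0, 0)" "Tob elementary A B = (fst A + fst B, snd A + snd B)"
  "Tmor elementary A A' B B' f g = hcomp f g" "A \<in> Obj elementary"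
  by (simp_all add: elementary_def case_prod_unfold)

lemma dg_category_elementary: "dg_category elementary"
proof (rule dg_category.intro, unfold elementary_simps)
  show "vcomp g f \<in> diagHom (fst A) (fst E) (m + n + snd E - snd A)"
    if "f \<in> diagHom (fst A) (fst B) (m + snd B - snd A)" "g \<in> diagHom (fst B) (fst E) (n + snd E - snd B)"
    for A B E :: "nat \<times> int" and f g m n
    using diagHom_vcomp[OF that] by (simp add: algebra_simps)
  show "idQ (fst A) \<in> diagHom (fst A) (fst A) (0 + snd A - snd A)" for A :: "nat \<times> int"
    by (simp add: diagHom_idQ)
qed (simp_all only: diagHom_zero diagHom_add dmor_add_self vcomp_assoc vcomp_add add_0 vcomp_zero
    vcomp_idQ_left vcomp_idQ_right)

lemma strict_monoidal_elementary: "strict_monoidal_dg_category elementary"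
proof (rule strict_monoidal_dg_category.intro[OF dg_category_elementary],
    rule strict_monoidal_dg_category_axioms.intro, unfold elementary_simps)
  show "hcomp f g \<in> diagHom (fst (fst A + fst B, snd A + snd B)) (fst (fst A' + fst B', snd A' + snd B'))
      (m + n + snd (fst A' + fst B', snd A' + snd B') - snd (fst A + fst B, snd A + snd B))"
    if "f \<in> diagHom (fst A) (fst A') (m + snd A' - snd A)" "g \<in> diagHom (fst B) (fst B') (n + snd B' - snd B)"
    for A A' B B' :: "nat \<times> int" and f g m n
    using diagHom_hcomp[OF that] by (simp add: algebra_simps)
qed (simp_all only: hcomp_add hcomp_idQ hcomp_assoc hcomp_zero add_0 interchange_diag fst_conv snd_conv
    idQ_zero_hcomp add.assoc add_0_right add_0 prod.collapse elementary_simps)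

lemma strict_monoidal_I': "strict_monoidal_dg_category I'"
  unfolding I'_def
  by (rule strict_monoidal_dg_category.strict_monoidal_direct_sums[OF strict_monoidal_elementary])

lemma strict_monoidal_catI: "strict_monoidal_dg_category catI"
  unfolding catI_def
  by (rule strict_monoidal_dg_category.strict_monoidal_twisted[OF strict_monoidal_I'])

text \<open>Matrices of all shapes inhabit a single type, so products need no objects as arguments.
  The price is the missing unit for infinite index types; identities are the idempotents of finite
  index sets.\<close>

typedef (overloaded) ('i, 'a::zero) fmat = "{x :: 'i \<Rightarrow> 'i \<Rightarrow> 'a. finite {(i, j). x i j \<noteq> 0}}"
  morphisms entry Abs_fmat
  by (rule exI[of _ "\<lambda>_ _. 0"]) simp

setup_lifting type_definition_fmat

lemma finite_support: "finite {(i, j). entry x i j \<noteq> 0}"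
  using entry[of x] by simp

lemma finite_row: "finite {j. entry x i j \<noteq> 0}"
  by (rule finite_subset[OF _ finite_imageI[OF finite_support[of x], of snd]]) force

lemma fmat_eqI: "(\<And>i j. entry x i j = entry y i j) \<Longrightarrow> x = y"
  by (simp add: entry_inject[symmetric] fun_eq_iff)

lemma entry_Abs_fmat:
  assumes "finite S" "\<And>i j. x i j \<noteq> 0 \<Longrightarrow> i \<in> S \<and> j \<in> S"
  shows "entry (Abs_fmat x) = x"
  using finite_subset[OF _ finite_cartesian_product[OF assms(1,1)], of "{(i, j). x i j \<noteq> 0}"] assms(2)
  by (intro Abs_fmat_inverse) auto

text \<open>Rows belong to the source of a morphism, so \<open>y * x\<close> stands for \<open>y\<close> after \<open>x\<close>.\<close>

instantiation fmat :: (type, ring) ring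
begin

lift_definition zero_fmat :: "('a, 'b) fmat" is "\<lambda>_ _. 0"
  by simp

lift_definition plus_fmat :: "('a, 'b) fmat \<Rightarrow> ('a, 'b) fmat \<Rightarrow> ('a, 'b) fmat"
  is "\<lambda>x y i j. x i j + y i j"
  subgoal for x y
    by (rule finite_subset[of _ "{(i, j). x i j \<noteq> 0} \<union> {(i, j). y i j \<noteq> 0}"]) auto
  done

lift_definition uminus_fmat :: "('a, 'b) fmat \<Rightarrow> ('a, 'b) fmat" is "\<lambda>x i j. - x i j"
  by simp

lift_definition minus_fmat :: "('a, 'b) fmat \<Rightarrow> ('a, 'b) fmat \<Rightarrow> ('a, 'b) fmat"
  is "\<lambda>x y i j. x i j - y i j"
  subgoal for x y
    by (rule finite_subset[of _ "{(i, j). x i j \<noteq> 0} \<union> {(i, j). y i j \<noteq> 0}"]) auto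
  done

text \<open>Summation is restricted to the support of a row of \<open>x\<close>, because the index
  type may be infinite.\<close>

lift_definition times_fmat :: "('a, 'b) fmat \<Rightarrow> ('a, 'b) fmat \<Rightarrow> ('a, 'b) fmat"
  is "\<lambda>y x i k. \<Sum>j | x i j \<noteq> 0. y j k * x i j"
  subgoal for y x
  proof (rule finite_subset)
    show "finite (fst ` {(i, j). x i j \<noteq> 0} \<times> snd ` {(i, j). y i j \<noteq> 0})"
      if "finite {(i, j). y i j \<noteq> 0}" "finite {(i, j). x i j \<noteq> 0}" using that by blast
    show "{(i, k). (\<Sum>j | x i j \<noteq> 0. y j k * x i j) \<noteq> 0}
        \<subseteq> fst ` {(i, j). x i j \<noteq> 0} \<times> snd ` {(i, j). y i j \<noteq> 0}"
    proof clarify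
      fix i k assume "(\<Sum>j | x i j \<noteq> 0. y j k * x i j) \<noteq> 0"
      then obtain j where "x i j \<noteq> 0" "y j k * x i j \<noteq> 0"
        by (auto elim: sum.not_neutral_contains_not_neutral)
      then have "(i, j) \<in> {(i, j). x i j \<noteq> 0}" "(j, k) \<in> {(i, j). y i j \<noteq> 0}" by auto
      then show "i \<in> fst ` {(i, j). x i j \<noteq> 0} \<and> k \<in> snd ` {(i, j). y i j \<noteq> 0}"
        by (metis fst_conv snd_conv image_eqI)
    qed
  qed
  done

lemma entry_times:
  assumes "finite J" "\<And>j. entry x i j \<noteq> 0 \<Longrightarrow> j \<in> J"
  shows "entry (y * x) i k = (\<Sum>j\<in>J. entry y j k * entry x i j)"
  unfolding times_fmat.rep_eq by (rule sum.mono_neutral_left) (use assms in auto)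

instance
proof
  fix x y z :: "('a, 'b) fmat"
  show "z * y * x = z * (y * x)"
  proof (rule fmat_eqI)
    fix i l
    define J where "J = snd ` {(i, j). entry x i j \<noteq> 0}"
    define K where "K = snd ` {(i, j). entry y i j \<noteq> 0}"
    have J: "finite J" "\<And>i j. entry x i j \<noteq> 0 \<Longrightarrow> j \<in> J"
      unfolding J_def using finite_support[of x] by force+
    have K: "finite K" "\<And>i j. entry y i j \<noteq> 0 \<Longrightarrow> j \<in> K"
      unfolding K_def using finite_support[of y] by force+
    have yx: "entry (y * x) i k = (\<Sum>j\<in>J. entry y j k * entry x i j)" for k
      using J by (intro entry_times)
    have "k \<in> K" if "entry (y * x) i k \<noteq> 0" for k
    proof -
      obtain j where "entry y j k * entry x i j \<noteq> 0"
        using \<open>entry (y * x) i k \<noteq> 0\<close> unfolding yx by (auto elim: sum.not_neutral_contains_not_neutral)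
      then show ?thesis using K(2)[of j k] by (metis mult_zero_left)
    qed
    then have "entry (z * (y * x)) i l = (\<Sum>k\<in>K. entry z k l * (\<Sum>j\<in>J. entry y j k * entry x i j))"
      using K(1) by (subst entry_times) (auto simp: yx)
    also have "\<dots> = (\<Sum>j\<in>J. (\<Sum>k\<in>K. entry z k l * entry y j k) * entry x i j)"
      by (simp add: sum_distrib_left sum_distrib_right mult.assoc) (rule sum.swap)
    also have "\<dots> = (\<Sum>j\<in>J. entry (z * y) j l * entry x i j)"
      using K by (intro sum.cong[OF HOL.refl]) (subst entry_times[of K], auto)
    also have "\<dots> = entry (z * y * x) i l"
      using J by (subst entry_times[of J x]) auto
    finally show "entry (z * y * x) i l = entry (z * (y * x)) i l" by simp
  qed
  show "(x + y) * z = x * z + y * z"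
    by (rule fmat_eqI) (simp add: times_fmat.rep_eq plus_fmat.rep_eq ring_distribs sum.distrib)
  show "z * (x + y) = z * x + z * y"
  proof (rule fmat_eqI)
    fix i k
    define J where "J = {j. entry x i j \<noteq> 0} \<union> {j. entry y i j \<noteq> 0}"
    have J: "finite J" "\<And>j. entry x i j \<noteq> 0 \<Longrightarrow> j \<in> J" "\<And>j. entry y i j \<noteq> 0 \<Longrightarrow> j \<in> J"
      "\<And>j. entry (x + y) i j \<noteq> 0 \<Longrightarrow> j \<in> J"
      by (auto simp: J_def finite_row plus_fmat.rep_eq)
    have "entry (z * w) i k = (\<Sum>j\<in>J. entry z j k * entry w i j)" if "w \<in> {x, y, x + y}" for w
      using that J by (intro entry_times) auto
    then show "entry (z * (x + y)) i k = entry (z * x + z * y) i k"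
      by (simp add: plus_fmat.rep_eq ring_distribs sum.distrib)
  qed
qed (rule fmat_eqI, simp add: plus_fmat.rep_eq zero_fmat.rep_eq uminus_fmat.rep_eq minus_fmat.rep_eq ac_simps)+

end

lemmas entry_simps = zero_fmat.rep_eq plus_fmat.rep_eq

type_synonym bmat = "(nat \<times> nat, bit) fmat"

lemma bmat_add_self: "x + x = (0 :: ('i, bit) fmat)"
  by (rule fmat_eqI) (simp add: entry_simps bit_add_self)

definition map_mat :: "'i set \<Rightarrow> ('i \<Rightarrow> 'i) \<Rightarrow> ('i, bit) fmat"
  where "map_mat S \<sigma> = Abs_fmat (\<lambda>i j. of_bool (i \<in> S \<and> j = \<sigma> i))"

lemma entry_map_mat: "finite S \<Longrightarrow> entry (map_mat S \<sigma>) i j = of_bool (i \<in> S \<and> j = \<sigma> i)"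
  unfolding map_mat_def by (subst entry_Abs_fmat[of "S \<union> \<sigma> ` S"]) (auto split: if_splits)

lemma entry_times_map_mat:
  assumes "finite S"
  shows "entry (x * map_mat S \<sigma>) i k = (if i \<in> S then entry x (\<sigma> i) k else 0)"
proof -
  have "entry (x * map_mat S \<sigma>) i k = (\<Sum>j\<in>{\<sigma> i}. entry x j k * entry (map_mat S \<sigma>) i j)"
    by (rule entry_times) (auto simp: entry_map_mat[OF assms])
  also have "\<dots> = entry x (\<sigma> i) k * entry (map_mat S \<sigma>) i (\<sigma> i)"
    by (simp only: finite.emptyI empty_iff not_False_eq_True sum.insert sum.empty add_0_right)
  finally show ?thesis by (simp add: entry_map_mat[OF assms])
qed

lemma entry_map_mat_times:
  assumes "finite S" "inj_on \<sigma> S"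
  shows "entry (map_mat S \<sigma> * x) i k = (if k \<in> \<sigma> ` S then entry x i (the_inv_into S \<sigma> k) else 0)"
proof -
  have "entry (map_mat S \<sigma> * x) i k = (\<Sum>j\<in>{j. entry x i j \<noteq> 0}. entry (map_mat S \<sigma>) j k * entry x i j)"
    by (rule entry_times[OF finite_row]) simp
  also have "\<dots> = (\<Sum>j\<in>{j. entry x i j \<noteq> 0}.
      if the_inv_into S \<sigma> k = j then (if k \<in> \<sigma> ` S then entry x i j else 0) else 0)"
    using assms(2) by (intro sum.cong[OF HOL.refl])
      (auto simp: entry_map_mat[OF assms(1)] the_inv_into_f_f f_the_inv_into_f the_inv_into_into)
  also have "\<dots> = (if k \<in> \<sigma> ` S then entry x i (the_inv_into S \<sigma> k) else 0)"
    unfolding sum.delta'[OF finite_row] by simp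
  finally show ?thesis .
qed

section \<open>Realization of morphisms by matrices over the two-element field\<close>

text \<open>An object of \<open>catI\<close> has two layers, a list of terms each of which is a list
  of summands. Pairs of positions flatten them into one index set.\<close>

definition idx :: "'a list list \<Rightarrow> (nat \<times> nat) set"
  where "idx A = {(i, a). i < length A \<and> a < length (A ! i)}"

definition lab :: "'a list list \<Rightarrow> nat \<times> nat \<Rightarrow> 'a"
  where "lab A p = A ! fst p ! snd p"

text \<open>\<open>Q\<^sup>2\<close> is isomorphic to \<open>1[1]\<close>, so only \<open>k + 2 * m\<close> matters for the object \<open>Q\<^sup>k[m]\<close>.\<close>

definition weight :: "nat \<times> int \<Rightarrow> int"
  where "weight x = int (fst x) + 2 * snd x"

definition wt :: "(nat \<times> int) list list \<Rightarrow> nat \<times> nat \<Rightarrow> int"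
  where "wt A p = weight (lab A p)"

text \<open>The inequality is the exact condition for a nonzero diagram between two shifted
  elementary objects, by \<open>diagHom_eq_zero\<close> and \<open>diagHom_nonzero\<close>.\<close>

definition bmat_Hom :: "(nat \<times> int) list list \<Rightarrow> (nat \<times> int) list list \<Rightarrow> int \<Rightarrow> bmat set"
  where "bmat_Hom A B n =
    {x. \<forall>p q. entry x p q \<noteq> 0 \<longrightarrow> p \<in> idx A \<and> q \<in> idx B \<and> wt A p \<le> wt B q + 2 * n}"

definition bmat_of :: "I_mor \<Rightarrow> bmat"
  where "bmat_of f = Abs_fmat (\<lambda>p q. ev (f (fst p) (fst q) (snd p) (snd q)))"

lemma bmat_HomD:
  assumes "x \<in> bmat_Hom A B n" "entry x p q \<noteq> 0"
  shows "p \<in> idx A" "q \<in> idx B" "wt A p \<le> wt B q + 2 * n"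
  using assms unfolding bmat_Hom_def by blast+

lemma bmat_Hom_outside:
  assumes "x \<in> bmat_Hom A B n" "\<not> (p \<in> idx A \<and> q \<in> idx B)"
  shows "entry x p q = 0"
  using assms unfolding bmat_Hom_def by blast

lemma finite_idx: "finite (idx A)"
proof -
  have "idx A = (SIGMA i:{..<length A}. {..<length (A ! i)})" by (auto simp: idx_def)
  then show ?thesis by simp
qed

lemma lists_I' [simp]: "A \<in> lists (Obj I')"
  by (simp add: I'_def direct_sums_def) (simp add: elementary_def)

lemma mat_Hom_I'_iff:
  "f \<in> mat_Hom I' A B n \<longleftrightarrow> (\<forall>p q. if p \<in> idx A \<and> q \<in> idx B
    then f (fst p) (fst q) (snd p) (snd q) \<in> Hom elementary (lab A p) (lab B q) n
    else f (fst p) (fst q) (snd p) (snd q) = 0)" (is "?L \<longleftrightarrow> ?R")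
proof
  have I': "Hom I' = mat_Hom elementary" by (simp add: I'_def direct_sums_def)
  show ?R if ?L
  proof (intro allI)
    fix p q :: "nat \<times> nat"
    obtain i a j b where pq: "p = (i, a)" "q = (j, b)" by (cases p; cases q)
    show "if p \<in> idx A \<and> q \<in> idx B
      then f (fst p) (fst q) (snd p) (snd q) \<in> Hom elementary (lab A p) (lab B q) n
      else f (fst p) (fst q) (snd p) (snd q) = 0"
    proof (cases "i < length A \<and> j < length B")
      case True
      then have "f i j \<in> mat_Hom elementary (A ! i) (B ! j) n"
        using that unfolding mat_Hom_def I' by (metis (mono_tags, lifting) mem_Collect_eq)
      then have "if a < length (A ! i) \<and> b < length (B ! j)
          then f i j a b \<in> Hom elementary (A ! i ! a) (B ! j ! b) n else f i j a b = 0"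
        unfolding mat_Hom_def by blast
      then show ?thesis
        using True by (auto simp: pq idx_def lab_def simp del: elementary_simps split: if_splits)
    next
      case False
      then have "f i j = 0" using that unfolding mat_Hom_def by (metis (mono_tags, lifting) mem_Collect_eq)
      then show ?thesis using False by (auto simp: pq idx_def)
    qed
  qed
  assume R: ?R
  show ?L
    unfolding mat_Hom_def[of I'] I'
  proof (intro CollectI allI)
    fix i j
    have R': "if i < length A \<and> a < length (A ! i) \<and> j < length B \<and> b < length (B ! j)
      then f i j a b \<in> Hom elementary (A ! i ! a) (B ! j ! b) n else f i j a b = 0" for a b
      using R[rule_format, of "(i, a)" "(j, b)"] by (auto simp add: idx_def lab_def simp del: elementary_simps split: if_splits)
    show "if i < length A \<and> j < length B then f i j \<in> mat_Hom elementary (A ! i) (B ! j) n else f i j = 0"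
    proof (cases "i < length A \<and> j < length B")
      case True
      then show ?thesis
        unfolding mat_Hom_def using R' by (auto simp del: elementary_simps split: if_splits)
    next
      case False
      then have "f i j a b = 0" for a b using R'[of a b] by (auto split: if_splits)
      then have "f i j = 0" by (intro ext) simp
      then show ?thesis using False by auto
    qed
  qed
qed

lemma mat_Hom_I'D:
  assumes "f \<in> mat_Hom I' A B n"
  shows "(i, a) \<in> idx A \<Longrightarrow> (j, b) \<in> idx B \<Longrightarrow> f i j a b \<in> Hom elementary (lab A (i, a)) (lab B (j, b)) n"
    and "\<not> ((i, a) \<in> idx A \<and> (j, b) \<in> idx B) \<Longrightarrow> f i j a b = 0"
  using assms[unfolded mat_Hom_I'_iff, rule_format, of "(i, a)" "(j, b)"]
  by (simp_all split: if_splits)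

lemma mat_Hom_I'I:
  assumes "\<And>p q. p \<in> idx A \<Longrightarrow> q \<in> idx B
      \<Longrightarrow> f (fst p) (fst q) (snd p) (snd q) \<in> Hom elementary (lab A p) (lab B q) n"
    and "\<And>p q. \<not> (p \<in> idx A \<and> q \<in> idx B) \<Longrightarrow> f (fst p) (fst q) (snd p) (snd q) = 0"
  shows "f \<in> mat_Hom I' A B n"
  unfolding mat_Hom_I'_iff using assms by presburger

lemma entry_bmat_of:
  assumes "f \<in> mat_Hom I' A B n"
  shows "entry (bmat_of f) p q = ev (f (fst p) (fst q) (snd p) (snd q))"
proof -
  have "ev (f (fst p) (fst q) (snd p) (snd q)) = 0" if "\<not> (p \<in> idx A \<and> q \<in> idx B)" for p q
    using mat_Hom_I'D(2)[OF assms, of "fst p" "snd p" "fst q" "snd q"] that by simp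
  then show ?thesis
    unfolding bmat_of_def
    by (subst entry_Abs_fmat[of "idx A \<union> idx B"]) (auto simp: finite_idx simp del: bit_not_zero_iff)
qed

lemma elementary_Hom_zero:
  "x \<in> Hom elementary s t n \<Longrightarrow> ev x \<noteq> 0 \<Longrightarrow> weight s \<le> weight t + 2 * n"
  using diagHom_eq_zero[of x "fst s" "fst t" "n + snd t - snd s"]
  by (force simp: weight_def)

lemma bmat_of_Hom:
  assumes "f \<in> mat_Hom I' A B n"
  shows "bmat_of f \<in> bmat_Hom A B n"
  unfolding bmat_Hom_def
proof (intro CollectI allI impI)
  fix p q assume nz: "entry (bmat_of f) p q \<noteq> 0"
  then have nz: "ev (f (fst p) (fst q) (snd p) (snd q)) \<noteq> 0" by (simp add: entry_bmat_of[OF assms])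
  have c: "if p \<in> idx A \<and> q \<in> idx B
    then f (fst p) (fst q) (snd p) (snd q) \<in> Hom elementary (lab A p) (lab B q) n
    else f (fst p) (fst q) (snd p) (snd q) = 0"
    using assms unfolding mat_Hom_I'_iff by blast
  show "p \<in> idx A \<and> q \<in> idx B \<and> wt A p \<le> wt B q + 2 * n"
  proof (cases "p \<in> idx A \<and> q \<in> idx B")
    case True
    then show ?thesis using c nz elementary_Hom_zero unfolding wt_def by simp
  next
    case False
    then show ?thesis using c nz by simp
  qed
qed

lemma bmat_of_inj:
  assumes f: "f \<in> mat_Hom I' A B n" and g: "g \<in> mat_Hom I' A B n" and eq: "bmat_of f = bmat_of g"
  shows "f = g"
proof (intro ext)
  fix i j a b
  have e: "ev (f i j a b) = ev (g i j a b)"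
    using arg_cong[OF eq, of "\<lambda>x. entry x (i, a) (j, b)"] by (simp add: entry_bmat_of[OF f] entry_bmat_of[OF g])
  show "f i j a b = g i j a b"
  proof (cases "(i, a) \<in> idx A \<and> (j, b) \<in> idx B")
    case True
    then show ?thesis
      using mat_Hom_I'D(1)[OF f, of i a j b] mat_Hom_I'D(1)[OF g, of i a j b] ev_inject[OF _ _ e]
      by simp
  next
    case False
    then show ?thesis using mat_Hom_I'D(2)[OF f] mat_Hom_I'D(2)[OF g] by metis
  qed
qed

text \<open>For every nonzero entry the weight inequality provides a diagram of value 1; any choice
  will do.\<close>

lemma bmat_of_surj:
  assumes x: "x \<in> bmat_Hom A B n"
  shows "\<exists>f\<in>mat_Hom I' A B n. bmat_of f = x"
proof -
  define f where "f = (\<lambda>i j a b. if entry x (i, a) (j, b) \<noteq> 0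
    then (SOME y. y \<in> Hom elementary (lab A (i, a)) (lab B (j, b)) n \<and> ev y = 1) else 0)"
  have f: "f (fst p) (fst q) (snd p) (snd q) \<in> Hom elementary (lab A p) (lab B q) n \<and>
      ev (f (fst p) (fst q) (snd p) (snd q)) = entry x p q" if "entry x p q \<noteq> 0" for p q
  proof -
    have "wt A p \<le> wt B q + 2 * n" using x that unfolding bmat_Hom_def by blast
    then have "int (fst (lab A p)) - int (fst (lab B q)) \<le> 2 * (n + snd (lab B q) - snd (lab A p))"
      by (simp add: wt_def weight_def)
    then have "\<exists>y. y \<in> Hom elementary (lab A p) (lab B q) n \<and> ev y = 1"
      using diagHom_nonzero by fastforce
    from someI_ex[OF this] show ?thesis using that by (simp add: f_def)
  qed
  have z: "f (fst p) (fst q) (snd p) (snd q) = 0" if "entry x p q = 0" for p q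
    using that by (simp add: f_def)
  have "f \<in> mat_Hom I' A B n"
    unfolding mat_Hom_I'_iff
  proof (intro allI)
    fix p q
    show "if p \<in> idx A \<and> q \<in> idx B
      then f (fst p) (fst q) (snd p) (snd q) \<in> Hom elementary (lab A p) (lab B q) n
      else f (fst p) (fst q) (snd p) (snd q) = 0"
    proof (cases "entry x p q = 0")
      case True
      then show ?thesis using z[OF True] by simp
    next
      case False
      then have "p \<in> idx A \<and> q \<in> idx B" using x unfolding bmat_Hom_def by blast
      then show ?thesis using f[OF False] by simp
    qed
  qed
  moreover from this have "bmat_of f = x"
  proof (intro fmat_eqI)
    fix p q assume "f \<in> mat_Hom I' A B n"
    then show "entry (bmat_of f) p q = entry x p q"
      using f[of p q] z[of p q] by (cases "entry x p q = 0") (simp_all add: entry_bmat_of)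
  qed
  ultimately show ?thesis by blast
qed

lemma ev_sum: "ev (sum f J) = (\<Sum>j\<in>J. ev (f j))"
  by (induction J rule: infinite_finite_induct) simp_all

lemma fun_sum_apply: "(sum f J) x = (\<Sum>j\<in>J. f j x)"
  by (induction J rule: infinite_finite_induct) simp_all

lemma I'_Hom_add:
  "f \<in> mat_Hom I' A B n \<Longrightarrow> g \<in> mat_Hom I' A B n \<Longrightarrow> f + g \<in> mat_Hom I' A B n"
  and I'_Hom_zero: "0 \<in> mat_Hom I' A B n"
  and I'_Cmp_Hom: "f \<in> mat_Hom I' A B m \<Longrightarrow> g \<in> mat_Hom I' B D n \<Longrightarrow> mat_Cmp I' A B D g f \<in> mat_Hom I' A D (m + n)"
  and I'_Idn_Hom: "mat_Idn I' A \<in> mat_Hom I' A A 0"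
proof -
  interpret strict_monoidal_dg_category I' by (rule strict_monoidal_I')
  show "f \<in> mat_Hom I' A B n \<Longrightarrow> g \<in> mat_Hom I' A B n \<Longrightarrow> f + g \<in> mat_Hom I' A B n"
    "0 \<in> mat_Hom I' A B n" "mat_Idn I' A \<in> mat_Hom I' A A 0"
    "f \<in> mat_Hom I' A B m \<Longrightarrow> g \<in> mat_Hom I' B D n \<Longrightarrow> mat_Cmp I' A B D g f \<in> mat_Hom I' A D (m + n)"
    by (simp_all add: mat_add_Hom mat_zero_Hom mat_Idn_Hom mat_Cmp_Hom del: in_lists_conv_set)
qed

lemma bmat_of_add:
  "f \<in> mat_Hom I' A B n \<Longrightarrow> g \<in> mat_Hom I' A B n \<Longrightarrow> bmat_of (f + g) = bmat_of f + bmat_of g"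
  by (rule fmat_eqI) (simp add: entry_bmat_of[OF I'_Hom_add] entry_bmat_of entry_simps)

lemma bmat_of_zero: "bmat_of 0 = 0"
  by (rule fmat_eqI) (simp add: entry_bmat_of[OF I'_Hom_zero[of "[]" "[]" 0]] entry_simps)

lemma bmat_of_Idn: "bmat_of (mat_Idn I' A) = map_mat (idx A) id"
proof (rule fmat_eqI)
  fix p q :: "nat \<times> nat"
  obtain i a j b where pq: "p = (i, a)" "q = (j, b)" by (cases p; cases q)
  have "Idn I' (A ! i) = mat_Idn elementary (A ! i)" by (simp add: I'_def direct_sums_def)
  then show "entry (bmat_of (mat_Idn I' A)) p q = entry (map_mat (idx A) id) p q"
    unfolding entry_bmat_of[OF I'_Idn_Hom] entry_map_mat[OF finite_idx]
    by (auto simp: mat_Idn_def pq idx_def)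
qed

lemma sum_idx: "(\<Sum>q\<in>idx B. f (fst q) (snd q)) = (\<Sum>j<length B. \<Sum>b<length (B ! j). f j b)"
proof -
  have "idx B = (SIGMA j:{..<length B}. {..<length (B ! j)})" by (auto simp: idx_def)
  then show ?thesis by (simp add: sum.Sigma case_prod_unfold)
qed

lemma bmat_of_Cmp:
  assumes f: "f \<in> mat_Hom I' A B m" and g: "g \<in> mat_Hom I' B D n"
  shows "bmat_of (mat_Cmp I' A B D g f) = bmat_of g * bmat_of f"
proof (rule fmat_eqI)
  fix p r :: "nat \<times> nat"
  note fH = bmat_of_Hom[OF f] and gH = bmat_of_Hom[OF g] and cH = bmat_of_Hom[OF I'_Cmp_Hom[OF f g]]
  have prod: "entry (bmat_of g * bmat_of f) p r = (\<Sum>q\<in>idx B. entry (bmat_of g) q r * entry (bmat_of f) p q)"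
    by (rule entry_times[OF finite_idx]) (rule bmat_HomD(2)[OF fH])
  show "entry (bmat_of (mat_Cmp I' A B D g f)) p r = entry (bmat_of g * bmat_of f) p r"
  proof (cases "p \<in> idx A \<and> r \<in> idx D")
    case False
    then have "entry (bmat_of (mat_Cmp I' A B D g f)) p r = 0" using cH unfolding bmat_Hom_def by blast
    moreover have "entry (bmat_of g) q r * entry (bmat_of f) p q = 0" for q
      using False bmat_Hom_outside[OF fH] bmat_Hom_outside[OF gH] by (metis mult_zero_left mult_zero_right)
    ultimately show ?thesis unfolding prod by (simp only: sum.neutral_const)
  next
    case True
    obtain i a k c where pr: "p = (i, a)" "r = (k, c)" by (cases p; cases r)
    have ik: "i < length A" "a < length (A ! i)" "k < length D" "c < length (D ! k)"
      using True by (auto simp: pr idx_def)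
    have I': "Cmp I' = mat_Cmp elementary" by (simp add: I'_def direct_sums_def)
    have "mat_Cmp I' A B D g f i k a c
        = (\<Sum>j<length B. \<Sum>b<length (B ! j). vcomp (g j k b c) (f i j a b))"
      using ik unfolding mat_Cmp_def I' by (simp add: fun_sum_apply)
    then have "entry (bmat_of (mat_Cmp I' A B D g f)) p r
        = (\<Sum>j<length B. \<Sum>b<length (B ! j). ev (g j k b c) * ev (f i j a b))"
      unfolding entry_bmat_of[OF I'_Cmp_Hom[OF f g]] pr by (simp only: fst_conv snd_conv ev_sum ev_vcomp)
    also have "\<dots> = (\<Sum>q\<in>idx B. ev (g (fst q) k (snd q) c) * ev (f i (fst q) a (snd q)))"
      by (rule sum_idx[symmetric])
    also have "\<dots> = entry (bmat_of g * bmat_of f) p r"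
      unfolding prod entry_bmat_of[OF f] entry_bmat_of[OF g] by (simp only: pr fst_conv snd_conv)
    finally show ?thesis .
  qed
qed

lemma bmat_Hom_zero: "0 \<in> bmat_Hom A B n"
  by (simp add: bmat_Hom_def entry_simps)

lemma bmat_Hom_add:
  assumes "x \<in> bmat_Hom A B n" "y \<in> bmat_Hom A B n"
  shows "x + y \<in> bmat_Hom A B n"
  unfolding bmat_Hom_def
proof (intro CollectI allI impI)
  fix p q assume "entry (x + y) p q \<noteq> 0"
  then have "entry x p q \<noteq> 0 \<or> entry y p q \<noteq> 0" by (auto simp: entry_simps)
  then show "p \<in> idx A \<and> q \<in> idx B \<and> wt A p \<le> wt B q + 2 * n"
    using assms unfolding bmat_Hom_def by blast
qed

lemma bmat_Hom_mult:
  assumes x: "x \<in> bmat_Hom A B m" and y: "y \<in> bmat_Hom B D n"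
  shows "y * x \<in> bmat_Hom A D (m + n)"
  unfolding bmat_Hom_def
proof (intro CollectI allI impI)
  fix p r assume "entry (y * x) p r \<noteq> 0"
  then have "(\<Sum>q | entry x p q \<noteq> 0. entry y q r * entry x p q) \<noteq> 0" unfolding times_fmat.rep_eq .
  then obtain q where "entry y q r * entry x p q \<noteq> 0"
    by (rule sum.not_neutral_contains_not_neutral)
  then have "entry x p q \<noteq> 0" "entry y q r \<noteq> 0" by auto
  then have "p \<in> idx A \<and> wt A p \<le> wt B q + 2 * m" "r \<in> idx D \<and> wt B q \<le> wt D r + 2 * n"
    using x y unfolding bmat_Hom_def by blast+
  then show "p \<in> idx A \<and> r \<in> idx D \<and> wt A p \<le> wt D r + 2 * (m + n)" by auto
qed

lemma map_mat_Hom: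
  assumes "\<And>p. p \<in> idx A \<Longrightarrow> p \<in> S \<Longrightarrow> \<sigma> p \<in> idx B \<and> wt A p \<le> wt B (\<sigma> p) + 2 * n" "S \<subseteq> idx A"
  shows "map_mat S \<sigma> \<in> bmat_Hom A B n"
  using assms finite_subset[OF assms(2) finite_idx]
  by (auto simp: bmat_Hom_def entry_map_mat)

lemma bmat_e_right: "x \<in> bmat_Hom A B n \<Longrightarrow> x * map_mat (idx A) id = x"
  by (rule fmat_eqI) (simp add: entry_times_map_mat[OF finite_idx] bmat_Hom_outside)

lemma entry_map_mat_times':
  assumes "finite S" "\<And>i. i \<in> S \<Longrightarrow> \<tau> (\<sigma> i) = i"
  shows "entry (map_mat S \<sigma> * x) i k = (if k \<in> \<sigma> ` S then entry x i (\<tau> k) else 0)"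
proof -
  have inj: "inj_on \<sigma> S" by (rule inj_on_inverseI) (rule assms(2))
  show ?thesis
    unfolding entry_map_mat_times[OF assms(1) inj]
    using the_inv_into_f_f[OF inj] assms(2) by auto
qed

lemma bmat_e_left: "x \<in> bmat_Hom A B n \<Longrightarrow> map_mat (idx B) id * x = x"
  by (rule fmat_eqI) (simp add: entry_map_mat_times'[OF finite_idx, where \<tau> = id] bmat_Hom_outside)

section \<open>The shift in terms of weights and degrees\<close>

lemma weight_shift: "weight (elementary_shift x) = weight x + 2"
  by (simp add: weight_def elementary_shift_def case_prod_unfold)

lemma idx_shift: "idx (map I'_shift A) = idx A"
  by (auto simp: idx_def I'_shift_def)

lemma wt_shift: "p \<in> idx A \<Longrightarrow> wt (map I'_shift A) p = wt A p + 2"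
  by (auto simp: wt_def lab_def idx_def I'_shift_def weight_shift)

lemma bmat_Hom_shift:
  "bmat_Hom (map I'_shift A) B n = bmat_Hom A B (n - 1)"
  "bmat_Hom A (map I'_shift B) n = bmat_Hom A B (n + 1)"
proof -
  have "wt (map I'_shift A) p \<le> wt B q + 2 * n \<longleftrightarrow> wt A p \<le> wt B q + 2 * (n - 1)" if "p \<in> idx A" for p q
    using wt_shift[OF that] by auto
  then show "bmat_Hom (map I'_shift A) B n = bmat_Hom A B (n - 1)"
    unfolding bmat_Hom_def idx_shift by blast
  have "wt A p \<le> wt (map I'_shift B) q + 2 * n \<longleftrightarrow> wt A p \<le> wt B q + 2 * (n + 1)" if "q \<in> idx B" for p q
    using wt_shift[OF that] by auto
  then show "bmat_Hom A (map I'_shift B) n = bmat_Hom A B (n + 1)"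
    unfolding bmat_Hom_def idx_shift by blast
qed


section \<open>Block structure of cones\<close>

definition cone_sigma :: "nat \<Rightarrow> nat \<times> nat \<Rightarrow> nat \<times> nat"
  where "cone_sigma n p = (n + fst p, snd p)"

definition cone_tau :: "nat \<Rightarrow> nat \<times> nat \<Rightarrow> nat \<times> nat"
  where "cone_tau n p = (fst p - n, snd p)"

lemma cone_tau_sigma [simp]: "cone_tau n (cone_sigma n p) = p"
  by (simp add: cone_sigma_def cone_tau_def)

lemma idx_append: "idx (A @ B) = idx A \<union> cone_sigma (length A) ` idx B"
proof (intro equalityI subsetI)
  fix p assume p: "p \<in> idx (A @ B)"
  show "p \<in> idx A \<union> cone_sigma (length A) ` idx B"
  proof (cases "fst p < length A")
    case True
    then show ?thesis using p by (auto simp: idx_def nth_append)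
  next
    case False
    then have "p = cone_sigma (length A) (cone_tau (length A) p)" "cone_tau (length A) p \<in> idx B"
      using p by (auto simp: idx_def nth_append cone_sigma_def cone_tau_def)
    then show ?thesis by blast
  qed
qed (auto simp: idx_def nth_append cone_sigma_def)

lemma idx_disjoint: "cone_sigma (length A) q \<notin> idx A"
  by (auto simp: idx_def cone_sigma_def)

lemma lab_append: "p \<in> idx A \<Longrightarrow> lab (A @ B) p = lab A p" "lab (A @ B) (cone_sigma (length A) q) = lab B q"
  by (auto simp: lab_def idx_def nth_append cone_sigma_def)

lemma wt_append: "p \<in> idx A \<Longrightarrow> wt (A @ B) p = wt A p" "wt (A @ B) (cone_sigma (length A) q) = wt B q"
  by (simp_all add: wt_def lab_append)

abbreviation shift_list :: "(nat \<times> int) list list \<Rightarrow> (nat \<times> int) list list"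
  where "shift_list \<equiv> map I'_shift"

lemma idx_cone: "idx (shift_list A @ B) = idx A \<union> cone_sigma (length A) ` idx B"
  using idx_append[of "shift_list A" B] by (simp add: idx_shift)

lemma wt_cone:
  "p \<in> idx A \<Longrightarrow> wt (shift_list A @ B) p = wt A p + 2"
  "wt (shift_list A @ B) (cone_sigma (length A) q) = wt B q"
  using wt_append(1)[of p "shift_list A" B] wt_append(2)[of "shift_list A" B q]
  by (simp_all add: idx_shift wt_shift)

abbreviation idm :: "'a list list \<Rightarrow> bmat"
  where "idm A \<equiv> map_mat (idx A) id"

definition cone_j :: "'a list list \<Rightarrow> 'a list list \<Rightarrow> bmat"
  where "cone_j A B = map_mat (idx B) (cone_sigma (length A))"

definition cone_s :: "'a list list \<Rightarrow> 'a list list \<Rightarrow> bmat"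
  where "cone_s A B = map_mat (cone_sigma (length A) ` idx B) (cone_tau (length A))"

lemma entry_cone_j: "entry (cone_j A B) p q = of_bool (p \<in> idx B \<and> q = cone_sigma (length A) p)"
  by (simp add: cone_j_def entry_map_mat finite_idx)

lemma entry_cone_s:
  "entry (cone_s A B) p q = of_bool (p \<in> cone_sigma (length A) ` idx B \<and> q = cone_tau (length A) p)"
  by (simp add: cone_s_def entry_map_mat finite_idx)

lemma entry_idm: "entry (idm A) p q = of_bool (p \<in> idx A \<and> q = p)"
  by (simp add: entry_map_mat finite_idx)

lemma entry_times_cone_s:
  "entry (x * cone_s A B) p q = (if p \<in> cone_sigma (length A) ` idx B then entry x (cone_tau (length A) p) q else 0)"
  unfolding cone_s_def by (rule entry_times_map_mat) (simp add: finite_idx)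

lemma entry_times_cone_j:
  "entry (x * cone_j A B) p q = (if p \<in> idx B then entry x (cone_sigma (length A) p) q else 0)"
  unfolding cone_j_def by (rule entry_times_map_mat[OF finite_idx])

lemma entry_cone_j_times:
  "entry (cone_j A B * x) p q = (if q \<in> cone_sigma (length A) ` idx B then entry x p (cone_tau (length A) q) else 0)"
  unfolding cone_j_def by (rule entry_map_mat_times'[OF finite_idx]) simp

lemma cone_equations:
  shows "cone_s A B * cone_j A B = idm B" "idm A * cone_j A B = 0" "cone_s A B * idm A = 0"
    "idm A * idm A = idm A" "idm A + cone_j A B * cone_s A B = idm (shift_list A @ B)"
proof -
  show "cone_s A B * cone_j A B = idm B"
    by (rule fmat_eqI) (auto simp: entry_times_cone_j entry_cone_s entry_idm)
  show "idm A * cone_j A B = 0"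
    by (rule fmat_eqI) (auto simp: entry_times_cone_j entry_idm entry_simps idx_disjoint)
  show "cone_s A B * idm A = 0"
    by (rule fmat_eqI) (auto simp: entry_times_map_mat[OF finite_idx] entry_cone_s entry_simps idx_disjoint)
  show "idm A * idm A = idm A"
    by (rule fmat_eqI) (auto simp: entry_times_map_mat[OF finite_idx] entry_idm)
  show "idm A + cone_j A B * cone_s A B = idm (shift_list A @ B)"
  proof (rule fmat_eqI)
    fix p q
    show "entry (idm A + cone_j A B * cone_s A B) p q = entry (idm (shift_list A @ B)) p q"
      unfolding entry_simps entry_times_cone_s entry_idm entry_cone_j
      unfolding idx_cone using idx_disjoint by auto
  qed
qed

lemma cone_j_Hom: "cone_j A B \<in> bmat_Hom B (shift_list A @ B) 0"
  unfolding cone_j_def by (rule map_mat_Hom) (auto simp: idx_cone wt_cone)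

lemma cone_s_Hom: "cone_s A B \<in> bmat_Hom (shift_list A @ B) B 0"
  unfolding cone_s_def by (rule map_mat_Hom) (auto simp: idx_cone wt_cone)

text \<open>The shifted terms of \<open>A\<close> come first in the cone and keep their indices.
  Injection and projection are therefore the identity matrix of \<open>A\<close>, merely read in
  another degree.\<close>

lemma cone_i_Hom: "idm A \<in> bmat_Hom A (shift_list A @ B) (-1)"
  by (rule map_mat_Hom) (auto simp: idx_cone wt_cone)

lemma cone_p_Hom: "idm A \<in> bmat_Hom (shift_list A @ B) A 1"
  by (rule map_mat_Hom) (auto simp: idx_cone wt_cone)

lemma elementary_shift_Hom:
  "Hom elementary (elementary_shift x) y n = Hom elementary x y (n - 1)"
  "Hom elementary x (elementary_shift y) n = Hom elementary x y (n + 1)"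
  by (simp_all add: elementary_shift_def case_prod_unfold algebra_simps)

lemma elementary_shift_Hom': "Hom elementary (elementary_shift x) (elementary_shift y) n = Hom elementary x y n"
  by (simp add: elementary_shift_def case_prod_unfold algebra_simps)

lemma lab_shift: "p \<in> idx A \<Longrightarrow> lab (shift_list A) p = elementary_shift (lab A p)"
  by (auto simp: lab_def idx_def I'_shift_def)

lemma mat_Hom_shift:
  "mat_Hom I' (shift_list A) B n = mat_Hom I' A B (n - 1)"
  "mat_Hom I' A (shift_list B) n = mat_Hom I' A B (n + 1)"
proof -
  have "mat_Hom I' A' B n = mat_Hom I' A B m"
    if "idx A' = idx A" "\<And>p q. p \<in> idx A \<Longrightarrow> q \<in> idx B \<Longrightarrow>
      Hom elementary (lab A' p) (lab B q) n = Hom elementary (lab A p) (lab B q) m" for A A' B n m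
    unfolding set_eq_iff mat_Hom_I'_iff that(1) using that(2) by (metis (no_types, lifting))
  note step = this
  show "mat_Hom I' (shift_list A) B n = mat_Hom I' A B (n - 1)"
    by (rule step) (simp_all add: idx_shift lab_shift elementary_shift_Hom del: elementary_simps)
  have "mat_Hom I' A B' n = mat_Hom I' A B m"
    if "idx B' = idx B" "\<And>p q. p \<in> idx A \<Longrightarrow> q \<in> idx B \<Longrightarrow>
      Hom elementary (lab A p) (lab B' q) n = Hom elementary (lab A p) (lab B q) m" for A B B' n m
    unfolding set_eq_iff mat_Hom_I'_iff that(1) using that(2) by (metis (no_types, lifting))
  note step = this
  show "mat_Hom I' A (shift_list B) n = mat_Hom I' A B (n + 1)"
    by (rule step) (simp_all add: idx_shift lab_shift elementary_shift_Hom del: elementary_simps)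
qed

lemma cone_incl_Hom: "cone_incl I' (A, f) (B, g) \<in> mat_Hom I' B (shift_list A @ B) 0"
  and bmat_of_cone_incl: "bmat_of (cone_incl I' (A, f) (B, g)) = cone_j A B"
proof -
  have I': "Idn I' = mat_Idn elementary" by (simp add: I'_def direct_sums_def)
  have entry: "cone_incl I' (A, f) (B, g) (fst p) (fst q) (snd p) (snd q)
      = (if p \<in> idx B \<and> q = cone_sigma (length A) p then idQ (fst (lab B p)) else 0)" for p q
    by (cases p; cases q) (auto simp: cone_incl_def I' mat_Idn_def idx_def cone_sigma_def lab_def)
  show H: "cone_incl I' (A, f) (B, g) \<in> mat_Hom I' B (shift_list A @ B) 0"
    unfolding mat_Hom_I'_iff entry using lab_append(2)[of "shift_list A" B]
    by (auto simp: idx_cone diagHom_idQ)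
  show "bmat_of (cone_incl I' (A, f) (B, g)) = cone_j A B"
    by (rule fmat_eqI) (auto simp: entry_bmat_of[OF H] entry entry_cone_j)
qed

lemma cone_proj_Hom: "cone_proj I' I'_shift (A, f) (B, g) \<in> mat_Hom I' (shift_list A @ B) (shift_list A) 0"
  and bmat_of_cone_proj: "bmat_of (cone_proj I' I'_shift (A, f) (B, g)) = idm A"
proof -
  have I': "Idn I' = mat_Idn elementary" by (simp add: I'_def direct_sums_def)
  have entry: "cone_proj I' I'_shift (A, f) (B, g) (fst p) (fst q) (snd p) (snd q)
      = (if p \<in> idx A \<and> q = p then idQ (fst (lab (shift_list A) p)) else 0)" for p q
    by (cases p; cases q) (auto simp: cone_proj_def I' mat_Idn_def idx_def lab_def I'_shift_def)
  show H: "cone_proj I' I'_shift (A, f) (B, g) \<in> mat_Hom I' (shift_list A @ B) (shift_list A) 0"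
    unfolding mat_Hom_I'_iff entry using lab_append(1)[of _ "shift_list A" B]
    by (auto simp: idx_cone idx_shift diagHom_idQ)
  show "bmat_of (cone_proj I' I'_shift (A, f) (B, g)) = idm A"
    by (rule fmat_eqI) (auto simp: entry_bmat_of[OF H] entry entry_idm)
qed

lemma idx_append_cases:
  obtains (left) "fst p < length A" | (right) p' where "p = cone_sigma (length A) p'" "\<not> fst p < length A"
proof (cases "fst p < length A")
  case False
  then have "p = cone_sigma (length A) (cone_tau (length A) p)" by (simp add: cone_sigma_def cone_tau_def)
  then show ?thesis using right False by blast
qed (rule left)

lemma idx_cone_iff:
  "fst p < length A \<Longrightarrow> p \<in> idx (shift_list A @ B) \<longleftrightarrow> p \<in> idx A"
  "cone_sigma (length A) p \<in> idx (shift_list A @ B) \<longleftrightarrow> p \<in> idx B"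
  by (auto simp: idx_cone idx_disjoint) (auto simp: cone_sigma_def)

lemma lab_cone:
  "p \<in> idx A \<Longrightarrow> lab (shift_list A @ B) p = elementary_shift (lab A p)"
  "lab (shift_list A @ B) (cone_sigma (length A) q) = lab B q"
  using lab_append(1)[of p "shift_list A" B] lab_append(2)[of "shift_list A" B q]
  by (simp_all add: idx_shift lab_shift)

text \<open>This is the twist \<open>i * a X * p + j * a Y * s + j * h * p\<close> required by
  \<open>conedata\<close>; the factors \<open>i\<close> and \<open>p\<close> are absorbed because
  both are \<open>idm A\<close>.\<close>

lemma cone_twist_Hom:
  assumes f: "f \<in> mat_Hom I' A A 1" and g: "g \<in> mat_Hom I' B B 1" and h: "h \<in> mat_Hom I' A B 0"
  shows "snd (cone I'_shift (A, f) (B, g) h) \<in> mat_Hom I' (shift_list A @ B) (shift_list A @ B) 1" (is ?H)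
    and "bmat_of (snd (cone I'_shift (A, f) (B, g) h))
      = bmat_of f + cone_j A B * bmat_of g * cone_s A B + cone_j A B * bmat_of h" (is ?E)
proof -
  let ?F = "snd (cone I'_shift (A, f) (B, g) h)" and ?s = "cone_sigma (length A)"
  define F where "F p q = ?F (fst p) (fst q) (snd p) (snd q)" for p q
  have FA: "F p q = f (fst p) (fst q) (snd p) (snd q)" if "fst p < length A" "fst q < length A" for p q
    using that by (simp add: F_def cone_def)
  have FB: "F (?s p) (?s q) = g (fst p) (fst q) (snd p) (snd q)" for p q
    by (simp add: F_def cone_def cone_sigma_def)
  have FAB: "F p (?s q) = h (fst p) (fst q) (snd p) (snd q)" if "fst p < length A" for p q
    using that by (simp add: F_def cone_def cone_sigma_def)
  have FBA: "F (?s p) q = 0" if "fst q < length A" for p q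
    using that by (simp add: F_def cone_def cone_sigma_def)
  have z: "k (fst p) (fst q) (snd p) (snd q) = 0"
    if "k \<in> mat_Hom I' D E n" "\<not> (p \<in> idx D \<and> q \<in> idx E)" for k D E n p q
    using mat_Hom_I'D(2)[OF that(1), of "fst p" "snd p" "fst q" "snd q"] that(2) by simp
  have m: "k (fst p) (fst q) (snd p) (snd q) \<in> Hom elementary (lab D p) (lab E q) n"
    if "k \<in> mat_Hom I' D E n" "p \<in> idx D" "q \<in> idx E" for k D E n p q
    using mat_Hom_I'D(1)[OF that(1), of "fst p" "snd p" "fst q" "snd q"] that(2,3) by simp
  have cases: P
    if "fst p < length A \<Longrightarrow> fst q < length A \<Longrightarrow> P"
      "\<And>q'. fst p < length A \<Longrightarrow> q = ?s q' \<Longrightarrow> P" "\<And>p'. p = ?s p' \<Longrightarrow> fst q < length A \<Longrightarrow> P"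
      "\<And>p' q'. p = ?s p' \<Longrightarrow> q = ?s q' \<Longrightarrow> P" for p q P
    using that idx_append_cases by metis
  have F_Hom: "F p q \<in> Hom elementary (lab (shift_list A @ B) p) (lab (shift_list A @ B) q) 1"
    if pq: "p \<in> idx (shift_list A @ B)" "q \<in> idx (shift_list A @ B)" for p q
  proof (rule cases[of p q])
    note e = elementary_shift_Hom elementary_shift_Hom'
    show ?thesis if "fst p < length A" "fst q < length A"
      using that pq m[OF f] by (simp add: FA idx_cone_iff lab_cone e del: elementary_simps)
    show ?thesis if "fst p < length A" "q = ?s q'" for q'
      using that pq m[OF h] by (simp add: FAB idx_cone_iff lab_cone e del: elementary_simps)
    show ?thesis if "p = ?s p'" "fst q < length A" for p'
      using that by (simp add: FBA)
    show ?thesis if "p = ?s p'" "q = ?s q'" for p' q'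
      using that pq m[OF g] by (simp add: FB idx_cone_iff lab_cone e del: elementary_simps)
  qed
  have F_zero: "F p q = 0"
    if pq: "\<not> (p \<in> idx (shift_list A @ B) \<and> q \<in> idx (shift_list A @ B))" for p q
  proof (rule cases[of p q])
    show ?thesis if "fst p < length A" "fst q < length A"
      using that pq z[OF f] by (simp add: FA idx_cone_iff)
    show ?thesis if "fst p < length A" "q = ?s q'" for q'
      using that pq z[OF h] by (simp add: FAB idx_cone_iff)
    show ?thesis if "p = ?s p'" "fst q < length A" for p'
      using that by (simp add: FBA)
    show ?thesis if "p = ?s p'" "q = ?s q'" for p' q'
      using that pq z[OF g] by (simp add: FB idx_cone_iff)
  qed
  show H: ?H
    using F_Hom F_zero unfolding F_def by (intro mat_Hom_I'I[where f = ?F])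
  have notin: "p \<notin> ?s ` X" if "fst p < length A" for p X
    using that by (auto simp: cone_sigma_def)
  have s_in: "?s p \<in> ?s ` X \<longleftrightarrow> p \<in> X" for p X
  proof -
    have "inj ?s" by (rule inj_on_inverseI[where g = "cone_tau (length A)"]) simp
    then show ?thesis by (rule inj_image_mem_iff)
  qed
  show ?E
  proof (rule fmat_eqI)
    fix p q
    note out = bmat_Hom_outside[OF bmat_of_Hom[OF f]] bmat_Hom_outside[OF bmat_of_Hom[OF g]]
      bmat_Hom_outside[OF bmat_of_Hom[OF h]]
    note ev = entry_bmat_of[OF f, symmetric] entry_bmat_of[OF g, symmetric] entry_bmat_of[OF h, symmetric]
    show "entry (bmat_of ?F) p q
      = entry (bmat_of f + cone_j A B * bmat_of g * cone_s A B + cone_j A B * bmat_of h) p q"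
      unfolding entry_bmat_of[OF H] entry_simps entry_times_cone_s entry_cone_j_times F_def[symmetric]
    proof (rule cases[of p q], goal_cases)
      case 1
      then show ?case by (simp add: FA notin ev)
    next
      case (2 q')
      then show ?case using out(1)[of p q] out(3)[of p q'] by (auto simp: FAB notin s_in idx_disjoint ev)
    next
      case (3 p')
      then show ?case using out(1)[of p q] by (simp add: FBA notin s_in idx_disjoint)
    next
      case (4 p' q')
      then show ?case using out(1)[of p q] out(2)[of p' q'] out(3)[of p q']
        by (auto simp: FB notin s_in idx_disjoint ev)
    qed
  qed
qed

section \<open>Realization of \<open>catI\<close> in the ring of matrices\<close>

lemma catI_simps:
  "Obj catI = twisted_complexes I'" "Hom catI X Y = mat_Hom I' (fst X) (fst Y)"
  "Cmp catI X Y V = mat_Cmp I' (fst X) (fst Y) (fst V)" "Idn catI X = mat_Idn I' (fst X)"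
  "Dif catI X Y h = mat_Cmp I' (fst X) (fst X) (fst Y) h (snd X) + mat_Cmp I' (fst X) (fst Y) (fst Y) (snd Y) h"
  "Unit catI = ([Unit I'], 0)"
  "fst (Tob catI X Y) = mat_Tob I' (fst X) (fst Y)"
  by (simp_all add: catI_def twisted_def case_prod_unfold)

lemma Obj_catI_iff:
  "X \<in> Obj catI \<longleftrightarrow> snd X \<in> mat_Hom I' (fst X) (fst X) 1 \<and> (\<forall>i j. \<not> i < j \<longrightarrow> snd X i j = 0) \<and>
    bmat_of (snd X) * bmat_of (snd X) = 0"
proof -
  have "mat_Cmp I' A A A f f = 0 \<longleftrightarrow> bmat_of f * bmat_of f = 0" if f: "f \<in> mat_Hom I' A A 1" for A f
  proof -
    have "mat_Cmp I' A A A f f \<in> mat_Hom I' A A 2" using I'_Cmp_Hom[OF f f] by simp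
    from bmat_of_inj[OF this I'_Hom_zero] show ?thesis
      using bmat_of_Cmp[OF f f] bmat_of_zero by metis
  qed
  then show ?thesis
    by (auto simp: catI_simps twisted_complexes_def case_prod_unfold simp del: in_lists_conv_set)
qed

text \<open>Composition of matrices of diagrams sees only the shapes of the objects, not their
  labels, and shifting preserves shapes. This makes the differential literally invariant under the
  shift.\<close>

lemma mat_Cmp_I'_shift:
  assumes "length A' = length A" "length B' = length B" "length D' = length D"
    "\<And>i. i < length A \<Longrightarrow> length (A' ! i) = length (A ! i)"
    "\<And>i. i < length B \<Longrightarrow> length (B' ! i) = length (B ! i)"
    "\<And>i. i < length D \<Longrightarrow> length (D' ! i) = length (D ! i)"
  shows "mat_Cmp I' A' B' D' = mat_Cmp I' A B D"
proof (intro ext)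
  fix g f i k a c
  have C: "Cmp I' = mat_Cmp elementary" by (simp add: I'_def direct_sums_def)
  have *: "mat_Cmp elementary P Q R = mat_Cmp elementary P' Q' R'"
    if "length P' = length P" "length Q' = length Q" "length R' = length R" for P Q R P' Q' R'
    using that by (intro ext) (simp add: mat_Cmp_def)
  have "Cmp I' (A' ! i) (B' ! j) (D' ! k) = Cmp I' (A ! i) (B ! j) (D ! k)"
    if "i < length A" "j < length B" "k < length D" for j
    unfolding C using that assms by (intro *) simp_all
  then have "mat_Cmp I' A' B' D' g f i k = mat_Cmp I' A B D g f i k"
    using assms(1-3) by (auto simp: mat_Cmp_def)
  then show "mat_Cmp I' A' B' D' g f i k a c = mat_Cmp I' A B D g f i k a c" by simp
qed

lemma fst_I_shift: "fst (I_shift X) = shift_list (fst X)" "snd (I_shift X) = snd X"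
  by (simp_all add: I_shift_def twisted_shift_def case_prod_unfold)

lemma I_shift_Obj_iff: "I_shift X \<in> Obj catI \<longleftrightarrow> X \<in> Obj catI"
  by (simp add: Obj_catI_iff fst_I_shift mat_Hom_shift)

definition I_unshift :: "I_obj \<Rightarrow> I_obj"
  where "I_unshift X = (map (map (\<lambda>x. (fst x, snd x - 1))) (fst X), snd X)"

lemma I_unshift: "I_shift (I_unshift X) = X" "I_unshift (I_shift X) = X"
  by (simp_all add: I_shift_def twisted_shift_def I_unshift_def case_prod_unfold I'_shift_def
      elementary_shift_def o_def)

lemma I_shift_bij: "bij_betw I_shift (Obj catI) (Obj catI)"
proof (rule bij_betw_byWitness[where f' = I_unshift])
  have "I_unshift X \<in> Obj catI" if "X \<in> Obj catI" for X
    using that I_shift_Obj_iff[of "I_unshift X"] by (simp only: I_unshift)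
  then show "I_unshift ` Obj catI \<subseteq> Obj catI" by blast
qed (simp_all add: I_unshift I_shift_Obj_iff image_subset_iff)

lemma bmat_of_twist: "X \<in> Obj catI \<Longrightarrow> bmat_of (snd X) \<in> bmat_Hom (fst X) (fst X) 1"
  by (simp add: Obj_catI_iff bmat_of_Hom)

lemma fst_cone: "fst (cone I'_shift X Y h) = shift_list (fst X) @ fst Y"
  by (simp add: cone_def case_prod_unfold)

interpretation bm: twisted_ring "Obj catI" "\<lambda>X Y. bmat_Hom (fst X) (fst Y)" "\<lambda>X. idm (fst X)"
  "\<lambda>X. bmat_of (snd X)" I_shift "([], 0)"
proof
  show "bij_betw I_shift (Obj catI) (Obj catI)" by (rule I_shift_bij)
  show "(([] :: (nat \<times> int) list list), 0 :: I_mor) \<in> Obj catI"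
    by (simp add: Obj_catI_iff I'_Hom_zero bmat_of_zero)
  show "idm (fst ([] :: (nat \<times> int) list list, 0 :: I_mor)) = 0"
    by (rule fmat_eqI, unfold entry_idm entry_simps) (simp add: idx_def)
  show "idm (fst A) \<in> bmat_Hom (fst A) (fst A) 0" for A :: I_obj
    by (rule map_mat_Hom) auto
qed (simp_all add: bmat_add_self bmat_Hom_zero bmat_Hom_add bmat_Hom_mult bmat_e_right bmat_e_left
    bmat_of_twist fst_I_shift bmat_Hom_shift idx_shift Obj_catI_iff)

lemma cone_conedata:
  assumes X: "X \<in> Obj catI" and Y: "Y \<in> Obj catI" and hH: "h \<in> mat_Hom I' (fst X) (fst Y) 0"
    and h: "bmat_of h \<in> bm.Z X Y"
  shows "bm.conedata X Y (bmat_of h) (cone I'_shift X Y h) (idm (fst X)) (idm (fst X))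
    (cone_j (fst X) (fst Y)) (cone_s (fst X) (fst Y))"
proof -
  obtain A f where XA: "X = (A, f)" by (cases X)
  obtain B g where YB: "Y = (B, g)" by (cases Y)
  have f: "f \<in> mat_Hom I' A A 1" "\<And>i j. \<not> i < j \<Longrightarrow> f i j = 0" "bmat_of f * bmat_of f = 0"
    using X by (simp_all add: Obj_catI_iff XA)
  have g: "g \<in> mat_Hom I' B B 1" "\<And>i j. \<not> i < j \<Longrightarrow> g i j = 0" "bmat_of g * bmat_of g = 0"
    using Y by (simp_all add: Obj_catI_iff YB)
  have h': "h \<in> mat_Hom I' A B 0" "bmat_of g * bmat_of h = bmat_of h * bmat_of f"
    using hH bm.Z_a[OF h] by (simp_all add: XA YB)
  let ?C = "shift_list A @ B" and ?F = "snd (cone I'_shift (A, f) (B, g) h)"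
  note F = cone_twist_Hom[OF f(1) g(1) h'(1)]
  define j s where "j = cone_j A B" and "s = cone_s A B"
  note fH = bmat_of_Hom[OF f(1)] and gH = bmat_of_Hom[OF g(1)] and hH' = bmat_of_Hom[OF h'(1)]
  have jH: "j \<in> bmat_Hom B ?C 0" and sH: "s \<in> bmat_Hom ?C B 0"
    unfolding j_def s_def by (rule cone_j_Hom cone_s_Hom)+
  note eq = cone_equations(1-3,5)[where A = A and B = B, folded j_def s_def] cone_equations(4)[of A]
  have "bmat_of f * j = (bmat_of f * idm A) * j" by (simp add: bmat_e_right[OF fH])
  then have fj: "bmat_of f * j = 0" by (simp add: mult.assoc eq(2))
  have "bmat_of h * j = (bmat_of h * idm A) * j" by (simp add: bmat_e_right[OF hH'])
  then have hj: "bmat_of h * j = 0" by (simp add: mult.assoc eq(2))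
  have "s * bmat_of f = s * (idm A * bmat_of f)" by (simp add: bmat_e_left[OF fH])
  then have sf: "s * bmat_of f = 0" by (simp add: eq(3) flip: mult.assoc)
  have FE: "bmat_of ?F = bmat_of f + j * bmat_of g * s + j * bmat_of h"
    using F(2) by (simp add: j_def s_def)
  note r = fj hj sf eq(1) f(3) g(3) bmat_e_left[OF hH'] bmat_e_left[OF gH] bmat_e_right[OF jH] h'(2)
  note r = r r[THEN bm.assoc_ext]
  \<comment> \<open>What remains of the square are terms with the squares of both twists, which
    vanish, and the products of \<open>h\<close> with either twist, which agree since
    \<open>h\<close> is a cocycle.\<close>
  have "bmat_of ?F * bmat_of ?F = 0"
    unfolding FE by (simp add: ring_distribs mult.assoc r bmat_add_self)
  moreover have "?F i k = 0" if "\<not> i < k" for i k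
    using that f(2) g(2) by (auto simp: cone_def)
  ultimately have "cone I'_shift X Y h \<in> Obj catI"
    using F(1) by (simp add: Obj_catI_iff fst_cone XA YB)
  moreover have "idm (fst X) * bmat_of (snd X) * idm (fst X) = bmat_of f"
    "j * bmat_of h * idm (fst X) = j * bmat_of h"
    by (simp_all add: XA bmat_e_left[OF fH] bmat_e_right[OF fH] bmat_e_right[OF hH'] mult.assoc)
  ultimately show ?thesis
    unfolding bm.conedata_def using X Y h cone_i_Hom[of A B] cone_p_Hom[of A B] jH sH FE eq
    by (simp add: fst_cone j_def s_def) (simp add: XA YB)
qed

interpretation bm: twisted_ring_cones "Obj catI" "\<lambda>X Y. bmat_Hom (fst X) (fst Y)" "\<lambda>X. idm (fst X)"
  "\<lambda>X. bmat_of (snd X)" I_shift "([], 0)"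
proof
  fix X Y h assume XY: "X \<in> Obj catI" "Y \<in> Obj catI" and h: "h \<in> bm.Z X Y"
  obtain h' where "h' \<in> mat_Hom I' (fst X) (fst Y) 0" "bmat_of h' = h"
    using bmat_of_surj[OF bm.Z_M[OF h]] by blast
  then show "\<exists>C i p j s. bm.conedata X Y h C i p j s"
    using cone_conedata[OF XY] h by blast
qed

lemma bmat_of_Dif:
  assumes "X \<in> Obj catI" "Y \<in> Obj catI" "h \<in> mat_Hom I' (fst X) (fst Y) n"
  shows "bmat_of (Dif catI X Y h) = bmat_of h * bmat_of (snd X) + bmat_of (snd Y) * bmat_of h"
proof -
  have a: "snd X \<in> mat_Hom I' (fst X) (fst X) 1" "snd Y \<in> mat_Hom I' (fst Y) (fst Y) 1"
    using assms by (simp_all add: Obj_catI_iff)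
  have "mat_Cmp I' (fst X) (fst X) (fst Y) h (snd X) \<in> mat_Hom I' (fst X) (fst Y) (n + 1)"
    "mat_Cmp I' (fst X) (fst Y) (fst Y) (snd Y) h \<in> mat_Hom I' (fst X) (fst Y) (n + 1)"
    using I'_Cmp_Hom[OF a(1) assms(3)] I'_Cmp_Hom[OF assms(3) a(2)] by (simp_all add: add.commute)
  then show ?thesis
    by (simp add: catI_simps bmat_of_add bmat_of_Cmp[OF a(1) assms(3)] bmat_of_Cmp[OF assms(3) a(2)])
qed

lemma cocycles_catI:
  assumes X: "X \<in> Obj catI" and Y: "Y \<in> Obj catI" and h: "h \<in> carrier (cocycles catI X Y)"
  shows "h \<in> mat_Hom I' (fst X) (fst Y) 0" "bmat_of h \<in> bm.Z X Y"
proof -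
  have h': "h \<in> mat_Hom I' (fst X) (fst Y) 0" "Dif catI X Y h = 0"
    using h by (simp_all add: cocycles_def catI_simps)
  then show "h \<in> mat_Hom I' (fst X) (fst Y) 0" "bmat_of h \<in> bm.Z X Y"
    using bmat_of_Dif[OF X Y h'(1)] bmat_of_Hom[OF h'(1)] bmat_of_zero
    by (simp_all add: bm.Z_def bm.add_eq_0_char2)
qed

interpretation bm: realized_dg_category catI "\<lambda>X Y. bmat_Hom (fst X) (fst Y)" "\<lambda>X. idm (fst X)"
  "\<lambda>X. bmat_of (snd X)" I_shift "([], 0)" bmat_of "cone_triangle I' I'_shift"
proof (rule realized_dg_category.intro)
  show "dg_category catI"
    using strict_monoidal_catI by (simp add: strict_monoidal_dg_category_def)
  show "twisted_ring_cones (Obj catI) (\<lambda>X Y. bmat_Hom (fst X) (fst Y)) (\<lambda>X. idm (fst X))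
     (\<lambda>X. bmat_of (snd X)) I_shift ([], 0)" by unfold_locales
  show "realized_dg_category_axioms catI (\<lambda>X Y. bmat_Hom (fst X) (fst Y)) (\<lambda>X. idm (fst X))
     (\<lambda>X. bmat_of (snd X)) I_shift bmat_of (cone_triangle I' I'_shift)"
  proof
    show "bij_betw bmat_of (Hom catI X Y n) (bmat_Hom (fst X) (fst Y) n)" for X Y n
      unfolding bij_betw_def catI_simps
      using bmat_of_inj bmat_of_surj bmat_of_Hom by (auto intro!: inj_onI) (metis image_eqI)
    show "Hom catI (I_shift A) (I_shift B) n = Hom catI A B n" for A B n
      by (simp add: catI_simps fst_I_shift mat_Hom_shift)
    show "Dif catI (I_shift A) (I_shift B) = Dif catI A B" for A B
    proof -
      have "mat_Cmp I' (shift_list P) (shift_list Q) (shift_list R) = mat_Cmp I' P Q R" for P Q R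
        by (rule mat_Cmp_I'_shift) (simp_all add: I'_shift_def)
      then show ?thesis by (intro ext) (simp add: catI_simps fst_I_shift)
    qed
    show "\<exists>W i j s p. bm.conedata X Y (bmat_of h) W i (bmat_of p) (bmat_of j) s \<and>
        j \<in> Hom catI Y W 0 \<and> p \<in> Hom catI W (I_shift X) 0 \<and>
        cone_triangle I' I'_shift X Y h = (X, Y, W, coh_class catI X Y h, coh_class catI Y W j, coh_class catI W (I_shift X) p)"
      if XY: "X \<in> Obj catI" "Y \<in> Obj catI" and h: "h \<in> carrier (cocycles catI X Y)" for X Y h
    proof -
      let ?W = "cone I'_shift X Y h" and ?j = "cone_incl I' X Y" and ?p = "cone_proj I' I'_shift X Y"
      have "bm.conedata X Y (bmat_of h) ?W (idm (fst X)) (bmat_of ?p) (bmat_of ?j) (cone_s (fst X) (fst Y))"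
        using cone_conedata[OF XY cocycles_catI[OF XY h]]
          bmat_of_cone_incl[of "fst X" "snd X" "fst Y" "snd Y"] bmat_of_cone_proj[of "fst X" "snd X" "fst Y" "snd Y"]
        by simp
      moreover have "?j \<in> Hom catI Y ?W 0" "?p \<in> Hom catI ?W (I_shift X) 0"
        using cone_incl_Hom[of "fst X" "snd X" "fst Y" "snd Y"] cone_proj_Hom[of "fst X" "snd X" "fst Y" "snd Y"]
        by (simp_all add: catI_simps fst_cone fst_I_shift)
      moreover have "cone_triangle I' I'_shift X Y h
          = (X, Y, ?W, coh_class catI X Y h, coh_class catI Y ?W ?j, coh_class catI ?W (I_shift X) ?p)"
        by (simp add: cone_triangle_def catI_def I_shift_def Let_def)
      ultimately show ?thesis by blast
    qed
  qed (simp_all add: catI_simps bmat_of_add bmat_of_Cmp bmat_of_Idn bmat_of_Dif[unfolded catI_simps])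
qed

lemma I_triangles_eq: "I_triangles = bm.\<Delta>"
proof -
  have "I_shift_mor = bm.Tm" by (intro ext) (simp add: I_shift_mor_def bm.Tm_def)
  then show ?thesis by (simp add: I_triangles_def bm.\<Delta>_def)
qed

lemma triangulated_catI: "triangulated_category (H0 catI) I_shift I_shift_mor I_triangles"
proof -
  have "I_shift_mor = bm.Tm" by (intro ext) (simp add: I_shift_mor_def bm.Tm_def)
  then show ?thesis using bm.triangulated_H0 by (simp add: I_triangles_eq)
qed

section \<open>The Euler characteristic\<close>

text \<open>Rank and nullity in multiplicative form: every fibre over the image is a translate of
  the kernel.\<close>

lemma card_kernel_image:
  fixes f :: "'a::ab_group_add \<Rightarrow> 'b::ab_group_add"
  assumes "finite G" and zero: "0 \<in> G" and diff: "\<And>x y. x \<in> G \<Longrightarrow> y \<in> G \<Longrightarrow> x - y \<in> G"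
    and add: "\<And>x y. f (x + y) = f x + f y"
  shows "card G = card {x \<in> G. f x = 0} * card (f ` G)"
proof -
  have f_diff: "f (x - y) = f x - f y" for x y
    using add[of "x - y" y] by (simp add: algebra_simps)
  have plus: "x + y \<in> G" if "x \<in> G" "y \<in> G" for x y
    using diff[OF that(1) diff[OF zero that(2)]] by simp
  have "card {x \<in> G. f x = y} = card {x \<in> G. f x = 0}" if y: "y \<in> f ` G" for y
  proof -
    obtain x0 where x0: "x0 \<in> G" "f x0 = y" using y by blast
    have "bij_betw (\<lambda>x. x + x0) {x \<in> G. f x = 0} {x \<in> G. f x = y}"
      by (rule bij_betw_byWitness[where f' = "\<lambda>x. x - x0"]) (auto simp: x0 add f_diff plus diff)
    then show ?thesis by (simp add: bij_betw_same_card)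
  qed
  moreover have "card G = (\<Sum>y\<in>f ` G. card {x \<in> G. f x = y})"
    unfolding card_eq_sum by (rule sum.image_gen[OF assms(1)])
  ultimately show ?thesis by simp
qed

lemma i_powi_add_2: "\<i> powi (v + 2) = - (\<i> powi v)"
  by (simp add: power_int_add)

text \<open>
  A contractible complex of vector spaces is exact, so the cardinality of each of its terms is the
  product of the cardinalities of two consecutive images, and the alternating sum telescopes. The
  powers of \<open>\<i>\<close> provide the alternating signs, since the differential has degree \<open>- 2\<close>.
\<close>

lemma contractible_sum_eq_0:
  fixes a t :: "('i, bit) fmat" and w :: "'i \<Rightarrow> int"
  assumes S: "finite S"
    and a: "\<And>p q. entry a p q \<noteq> 0 \<Longrightarrow> p \<in> S \<and> q \<in> S \<and> w p \<le> w q + 2"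
    and t: "\<And>p q. entry t p q \<noteq> 0 \<Longrightarrow> p \<in> S \<and> q \<in> S \<and> w p \<le> w q - 2"
    and aa: "a * a = 0" and ta: "t * a + a * t = map_mat S id"
  shows "(\<Sum>p\<in>S. \<i> powi w p) = 0"
proof -
  \<comment> \<open>Keeping only the entries for which the weight bound is attained passes to the
    associated graded complex.\<close>
  define a0 where "a0 = Abs_fmat (\<lambda>p q. if w p = w q + 2 then entry a p q else 0)"
  define t0 where "t0 = Abs_fmat (\<lambda>p q. if w p = w q - 2 then entry t p q else 0)"
  have a0: "entry a0 p q = (if w p = w q + 2 then entry a p q else 0)" for p q
    unfolding a0_def using a by (subst entry_Abs_fmat[OF S]) (auto split: if_splits)
  have t0: "entry t0 p q = (if w p = w q - 2 then entry t p q else 0)" for p q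
    unfolding t0_def using t by (subst entry_Abs_fmat[OF S]) (auto split: if_splits)
  have mult: "entry (y * x) p r = (\<Sum>q\<in>S. entry y q r * entry x p q)"
    if "x \<in> {a, t, a0, t0}" for x y p r
    by (rule entry_times[OF S]) (use that a t in \<open>auto simp: a0 t0 split: if_splits\<close>)
  have a0a0: "a0 * a0 = 0"
  proof (rule fmat_eqI)
    fix p r
    show "entry (a0 * a0) p r = entry 0 p r"
    proof (cases "w p = w r + 4")
      case True
      \<comment> \<open>The two factors change the weight by at most 2 each. A total drop of 4
        forces both to attain the bound, so no other terms occur in this entry.\<close>
      have "entry a0 q r * entry a0 p q = entry a q r * entry a p q" for q
        using a[of q r] a[of p q] True unfolding a0 by (cases "entry a q r"; cases "entry a p q") auto
      then have "entry (a0 * a0) p r = entry (a * a) p r" by (simp only: mult insertI1 insertI2)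
      then show ?thesis by (simp add: aa entry_simps)
    next
      case False
      then have "entry a0 q r * entry a0 p q = 0" for q unfolding a0 by auto
      then have "entry (a0 * a0) p r = 0" by (simp only: mult insertI1 insertI2 sum.neutral_const)
      then show ?thesis by (simp add: entry_simps)
    qed
  qed
  have t0a0: "t0 * a0 + a0 * t0 = map_mat S id"
  proof (rule fmat_eqI)
    fix p r
    show "entry (t0 * a0 + a0 * t0) p r = entry (map_mat S id) p r"
    proof (cases "w p = w r")
      case True
      \<comment> \<open>Again \<open>w p \<le> w q + 2 \<le> w r\<close>, and equality of the outer
        weights forces equality in both bounds.\<close>
      have "entry t0 q r * entry a0 p q = entry t q r * entry a p q" for q
        using a[of p q] t[of q r] True unfolding a0 t0
        by (cases "entry t q r"; cases "entry a p q") auto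
      moreover have "entry a0 q r * entry t0 p q = entry a q r * entry t p q" for q
        using a[of q r] t[of p q] True unfolding a0 t0
        by (cases "entry a q r"; cases "entry t p q") auto
      ultimately have "entry (t0 * a0) p r = entry (t * a) p r" "entry (a0 * t0) p r = entry (a * t) p r"
        by (simp_all only: mult insertI1 insertI2)
      then show ?thesis by (simp add: entry_simps flip: ta)
    next
      case False
      then have "entry t0 q r * entry a0 p q = 0" "entry a0 q r * entry t0 p q = 0" for q
        unfolding a0 t0 by auto
      then have "entry (t0 * a0) p r = 0" "entry (a0 * t0) p r = 0"
        by (simp_all only: mult insertI1 insertI2 sum.neutral_const)
      moreover have "p \<noteq> r" using False by auto
      ultimately show ?thesis by (simp add: entry_simps entry_map_mat[OF S])
    qed
  qed
  \<comment> \<open>Vectors are matrices supported in the single row \<open>c\<close>.\<close>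
  define c :: 'i where "c = undefined"
  define V where "V v = {x :: ('i, bit) fmat. \<forall>p q. entry x p q \<noteq> 0 \<longrightarrow> p = c \<and> q \<in> S \<and> w q = v}" for v
  define n where "n v = card {p \<in> S. w p = v}" for v
  have V_zero: "0 \<in> V v" for v by (simp add: V_def entry_simps)
  have V_row: "entry x p q = 0" if "x \<in> V v" "p \<noteq> c \<or> q \<notin> S \<or> w q \<noteq> v" for x p q v
    using that unfolding V_def by blast
  have V_diff: "x - y \<in> V v" if "x \<in> V v" "y \<in> V v" for x y v
    unfolding V_def using V_row[OF that(1)] V_row[OF that(2)]
    by (auto simp: minus_fmat.rep_eq) (metis add.left_neutral zero_neq_one)+
  have V_card: "finite (V v) \<and> card (V v) = 2 ^ n v" for v
  proof -
    define row where "row P = Abs_fmat (\<lambda>p q. of_bool (p = c \<and> q \<in> P) :: bit)" for P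
    have row: "entry (row P) p q = of_bool (p = c \<and> q \<in> P)" if "P \<subseteq> S" for P p q
      unfolding row_def using finite_subset[OF that S]
      by (subst entry_Abs_fmat[of "insert c P"]) (auto split: if_splits)
    have "bij_betw row (Pow {p \<in> S. w p = v}) (V v)"
    proof (rule bij_betw_byWitness[where f' = "\<lambda>x. {q. entry x c q = 1}"])
      show "\<forall>P\<in>Pow {p \<in> S. w p = v}. {q. entry (row P) c q = 1} = P"
        by (auto simp: row subset_iff)
      show "\<forall>x\<in>V v. row {q. entry x c q = 1} = x"
      proof
        fix x assume x: "x \<in> V v"
        then have sub: "{q. entry x c q = 1} \<subseteq> S" unfolding V_def by auto
        show "row {q. entry x c q = 1} = x"
        proof (rule fmat_eqI)
          fix i j
          show "entry (row {q. entry x c q = 1}) i j = entry x i j"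
            using V_row[OF x, of i j] by (cases "i = c"; cases "entry x c j") (auto simp: row[OF sub])
        qed
      qed
      show "row ` Pow {p \<in> S. w p = v} \<subseteq> V v"
        by (auto simp: V_def row subset_iff)
      show "(\<lambda>x. {q. entry x c q = 1}) ` V v \<subseteq> Pow {p \<in> S. w p = v}"
        unfolding V_def by auto
    qed
    then show ?thesis
      using S bij_betw_finite bij_betw_same_card by (fastforce simp: n_def card_Pow)
  qed
  have V_mult: "y * x \<in> V u" if x: "x \<in> V v" and y: "\<And>p q. entry y p q \<noteq> 0 \<Longrightarrow> w p = v \<Longrightarrow> q \<in> S \<and> w q = u" for x y v u
    unfolding V_def
  proof (intro CollectI allI impI)
    fix p r assume "entry (y * x) p r \<noteq> 0"
    then have "(\<Sum>q | entry x p q \<noteq> 0. entry y q r * entry x p q) \<noteq> 0" unfolding times_fmat.rep_eq .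
    then obtain q where q: "entry y q r * entry x p q \<noteq> 0" by (rule sum.not_neutral_contains_not_neutral)
    then have "entry y q r \<noteq> 0" "entry x p q \<noteq> 0" by auto
    then show "p = c \<and> r \<in> S \<and> w r = u" using x y[of q r] unfolding V_def by blast
  qed
  have V_a0: "a0 * x \<in> V (v - 2)" if "x \<in> V v" for x v
    by (rule V_mult[OF that]) (use a in \<open>auto simp: a0 split: if_splits\<close>)
  have V_t0: "t0 * x \<in> V (v + 2)" if "x \<in> V v" for x v
    by (rule V_mult[OF that]) (use t in \<open>auto simp: t0 split: if_splits\<close>)
  have V_id: "map_mat S id * x = x" if "x \<in> V v" for x v
    by (rule fmat_eqI) (use V_row[OF that] in \<open>auto simp: entry_map_mat_times'[OF S, where \<tau> = id]\<close>)
  define r where "r v = card ((*) a0 ` V v)" for v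
  have exact: "{x \<in> V v. a0 * x = 0} = (*) a0 ` V (v + 2)" for v
  proof (intro equalityI subsetI)
    fix x assume "x \<in> {x \<in> V v. a0 * x = 0}"
    then have x: "x \<in> V v" "a0 * x = 0" by auto
    have "x = (t0 * a0 + a0 * t0) * x" using V_id[OF x(1)] by (simp add: t0a0)
    then have "x = a0 * (t0 * x)" by (simp add: ring_distribs mult.assoc x(2))
    then show "x \<in> (*) a0 ` V (v + 2)" using V_t0[OF x(1)] by blast
  next
    fix x assume "x \<in> (*) a0 ` V (v + 2)"
    then obtain y where "y \<in> V (v + 2)" "x = a0 * y" by blast
    then show "x \<in> {x \<in> V v. a0 * x = 0}" using V_a0[of y "v + 2"] a0a0 by (simp flip: mult.assoc)
  qed
  \<comment> \<open>The kernel in weight \<open>v\<close> is the image coming from weight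
    \<open>v + 2\<close>, by exactness.\<close>
  have rr: "2 ^ n v = r (v + 2) * r v" for v
    using card_kernel_image[of "V v" "(*) a0"] V_card[of v] V_zero V_diff
    by (simp add: exact r_def ring_distribs)
  \<comment> \<open>A rank is recovered as an exponent: the cardinality of an image divides a power
    of two, hence is one.\<close>
  have "\<exists>k. r v = 2 ^ k" for v
  proof -
    have "r v dvd 2 ^ n v" using rr[of v] by simp
    then show ?thesis using divides_primepow_nat[of 2] by (auto simp: two_is_prime_nat)
  qed
  then obtain k where k: "r v = 2 ^ k v" for v by metis
  have nk: "n v = k (v + 2) + k v" for v
    using rr[of v] by (simp add: k flip: power_add)
  \<comment> \<open>As \<open>\<i> powi (v + 2)\<close> is the negative of
    \<open>\<i> powi v\<close>, the relation \<open>nk\<close> turns the contribution of weight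
    \<open>v\<close> into \<open>g v - g (v + 2)\<close>.\<close>
  define g where "g v = of_nat (k v) * \<i> powi v" for v
  define K where "K = w ` S \<union> (\<lambda>v. v - 2) ` w ` S"
  have n0: "n v = 0" if "v \<notin> w ` S" for v
  proof -
    have "{p \<in> S. w p = v} = {}" using that by blast
    then show ?thesis by (simp only: n_def card.empty)
  qed
  then have g0: "g v = 0" if "v \<notin> w ` S" for v using that nk[of v] by (simp add: g_def)
  have "(\<Sum>p\<in>S. \<i> powi w p) = (\<Sum>v\<in>w ` S. \<Sum>p\<in>{p \<in> S. w p = v}. \<i> powi w p)"
    by (rule sum.image_gen[OF S])
  also have "\<dots> = (\<Sum>v\<in>w ` S. of_nat (n v) * \<i> powi v)"
    by (intro sum.cong) (simp_all add: n_def)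
  also have "\<dots> = (\<Sum>v\<in>K. of_nat (n v) * \<i> powi v)"
    by (rule sum.mono_neutral_left) (auto simp: K_def S n0)
  also have "\<dots> = (\<Sum>v\<in>K. g v - g (v + 2))"
    by (intro sum.cong) (simp_all add: nk g_def i_powi_add_2 ring_distribs)
  also have "\<dots> = (\<Sum>v\<in>K. g v) - (\<Sum>v\<in>K. g (v + 2))" by (rule sum_subtractf)
  also have "(\<Sum>v\<in>K. g (v + 2)) = (\<Sum>u\<in>(\<lambda>v. v + 2) ` K. g u)"
    by (subst sum.reindex) (auto simp: inj_on_def)
  also have "\<dots> = (\<Sum>u\<in>w ` S. g u)"
    by (rule sum.mono_neutral_right) (auto simp: K_def S g0 image_Un image_image)
  also have "(\<Sum>v\<in>K. g v) = (\<Sum>u\<in>w ` S. g u)"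
    by (rule sum.mono_neutral_right) (auto simp: K_def S g0)
  finally show ?thesis by simp
qed

section \<open>Invariance of the Euler characteristic\<close>

context twisted_ring_cones
begin

text \<open>By the five lemma this cone is equivalent to the cone of an identity, which is
  contractible by \<open>cone_e_null\<close>.\<close>

lemma cone_iso_null:
  assumes c: "conedata X Y u C i p j s" and u: "isop X Y u u'"
  shows "e C \<in> Bd C C"
proof -
  note Ob = conedata_Ob[OF c]
  obtain C1 i1 p1 j1 s1 where c1: "conedata X X (e X) C1 i1 p1 j1 s1"
    using cone_ex[OF Ob(1,1) Z_e[OF Ob(1)]] by blast
  have sq: "hq X Y (u * e X) (u * e X)"
    using Z_mult[OF Z_e[OF Ob(1)] Ob(4)] by (rule hq_refl)
  obtain z where z: "z \<in> Z C1 C" "z * j1 = j * u" "p * z = e X * p1"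
    using cone_map[OF c1 c Z_e[OF Ob(1)] Ob(4) sq] by blast
  have "j * u \<in> Z X C" using Z_mult[OF Ob(4) conedata_Z(1)[OF c]] .
  moreover have "e X * p1 \<in> Z C1 (T X)" using conedata_Z(2)[OF c1] by (simp add: conedata_rules[OF c1])
  ultimately obtain z' where z': "isop C1 C z z'"
    using cone_map_iso[OF c1 c isop_e[OF Ob(1)] u sq z(1)] z(2,3) hq_refl by metis
  note zz = isop_Z[OF z']
  have "hq C C (z * (e C1 * z')) (z * (0 * z'))"
    by (intro hq_left[OF hq_right[OF cone_e_null[OF c1]]] zz)
  then have "hq C C (z * z') 0" using e_left[OF Z_M[OF zz(2)]] by simp
  from hq_trans[OF hq_sym[OF isop_hq(2)[OF z']] this] show ?thesis by (simp add: hq_def)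
qed

end

text \<open>A shift raises the weight by 2 and has to negate the value, so the base is a square root
  of -1. The object \<open>Q\<close>, of weight 1, receives the value \<open>\<i>\<close>.\<close>

definition euler :: "I_obj \<Rightarrow> complex"
  where "euler X = (\<Sum>p\<in>idx (fst X). \<i> powi wt (fst X) p)"

lemma sum_idx_cone:
  "(\<Sum>p\<in>idx (shift_list A @ B). \<i> powi wt (shift_list A @ B) p)
    = (\<Sum>p\<in>idx B. \<i> powi wt B p) - (\<Sum>p\<in>idx A. \<i> powi wt A p)"
proof -
  let ?s = "cone_sigma (length A)"
  have inj: "inj_on ?s (idx B)" by (rule inj_on_inverseI[where g = "cone_tau (length A)"]) simp
  have "(\<Sum>p\<in>idx (shift_list A @ B). \<i> powi wt (shift_list A @ B) p)
    = (\<Sum>p\<in>idx A. \<i> powi wt (shift_list A @ B) p) + (\<Sum>p\<in>?s ` idx B. \<i> powi wt (shift_list A @ B) p)"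
  proof -
    have "idx A \<inter> ?s ` idx B = {}" using idx_disjoint by blast
    then show ?thesis unfolding idx_cone by (intro sum.union_disjoint) (simp_all add: finite_idx)
  qed
  also have "(\<Sum>p\<in>?s ` idx B. \<i> powi wt (shift_list A @ B) p) = (\<Sum>p\<in>idx B. \<i> powi wt B p)"
    by (simp add: sum.reindex[OF inj] wt_cone)
  also have "(\<Sum>p\<in>idx A. \<i> powi wt (shift_list A @ B) p) = (\<Sum>p\<in>idx A. - (\<i> powi wt A p))"
    by (intro sum.cong) (simp_all add: wt_cone i_powi_add_2)
  finally show ?thesis by (simp add: sum_negf)
qed

lemma euler_cone: "euler (cone I'_shift X Y h) = euler Y - euler X"
  by (simp add: euler_def fst_cone sum_idx_cone)

lemma euler_contractible:
  assumes X: "X \<in> Obj catI" and null: "idm (fst X) \<in> bm.Bd X X"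
  shows "euler X = 0"
proof -
  obtain t where t: "t \<in> bmat_Hom (fst X) (fst X) (-1)"
    "idm (fst X) = t * bmat_of (snd X) + bmat_of (snd X) * t"
    using null unfolding bm.Bd_def by blast
  show ?thesis
    unfolding euler_def
  proof (rule contractible_sum_eq_0[OF finite_idx])
    show "p \<in> idx (fst X) \<and> q \<in> idx (fst X) \<and> wt (fst X) p \<le> wt (fst X) q + 2"
      if "entry (bmat_of (snd X)) p q \<noteq> 0" for p q
      using bmat_HomD[OF bmat_of_twist[OF X] that] by simp
    show "p \<in> idx (fst X) \<and> q \<in> idx (fst X) \<and> wt (fst X) p \<le> wt (fst X) q - 2"
      if "entry t p q \<noteq> 0" for p q
      using bmat_HomD[OF t(1) that] by simp
    show "bmat_of (snd X) * bmat_of (snd X) = 0" using X by (simp add: Obj_catI_iff)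
  qed (rule t(2)[symmetric])
qed

text \<open>The cone of an equivalence is contractible, and its value is the difference of the two
  sides.\<close>

lemma euler_iso:
  assumes X: "X \<in> Obj catI" and Y: "Y \<in> Obj catI" and u: "bm.isop X Y u u'"
  shows "euler X = euler Y"
proof -
  have uZ: "u \<in> bm.Z X Y" by (rule bm.isop_Z(1)[OF u])
  obtain h where h: "h \<in> mat_Hom I' (fst X) (fst Y) 0" "bmat_of h = u"
    using bmat_of_surj[OF bm.Z_M[OF uZ]] by blast
  let ?C = "cone I'_shift X Y h"
  have c: "bm.conedata X Y u ?C (idm (fst X)) (idm (fst X)) (cone_j (fst X) (fst Y)) (cone_s (fst X) (fst Y))"
    using cone_conedata[OF X Y h(1)] h(2) uZ by simp
  have "euler ?C = 0"
    by (rule euler_contractible[OF bm.conedata_Ob(3)[OF c] bm.cone_iso_null[OF c u]])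
  then show ?thesis by (simp add: euler_cone)
qed

lemma euler_dist:
  assumes "bm.dist X Y W u v w"
  shows "euler Y = euler X + euler W"
proof -
  note Ob = bm.dist_Ob[OF assms]
  obtain h where h: "h \<in> mat_Hom I' (fst X) (fst Y) 0" "bmat_of h = u"
    using bmat_of_surj[OF bm.Z_M[OF Ob(4)]] by blast
  let ?C = "cone I'_shift X Y h"
  have c: "bm.conedata X Y u ?C (idm (fst X)) (idm (fst X)) (cone_j (fst X) (fst Y)) (cone_s (fst X) (fst Y))"
    using cone_conedata[OF Ob(1,2) h(1)] h(2) Ob(4) by simp
  have "bm.hq X Y (idm (fst Y) * u) (u * idm (fst X))"
    using bm.conedata_rules[OF c] bm.hq_refl[OF Ob(4)] by simp
  then obtain z z' where "bm.isop W ?C z z'"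
    using bm.dist_iso_cone[OF assms c bm.isop_e[OF Ob(1)] bm.isop_e[OF Ob(2)]] by blast
  then have "euler W = euler ?C" by (rule euler_iso[OF Ob(3) bm.conedata_Ob(3)[OF c]])
  then show ?thesis by (simp add: euler_cone)
qed

section \<open>The Grothendieck ring\<close>

definition frag_euler :: "(I_obj \<Rightarrow>\<^sub>0 int) \<Rightarrow> complex"
  where "frag_euler x = (\<Sum>A\<in>Poly_Mapping.keys x. of_int (Poly_Mapping.lookup x A) * euler A)"

lemma frag_euler_superset:
  assumes "finite K" "Poly_Mapping.keys x \<subseteq> K"
  shows "frag_euler x = (\<Sum>A\<in>K. of_int (Poly_Mapping.lookup x A) * euler A)"
  unfolding frag_euler_def by (rule sum.mono_neutral_left) (use assms in \<open>auto simp: in_keys_iff\<close>)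

lemma frag_euler_add: "frag_euler (x + y) = frag_euler x + frag_euler y"
proof -
  let ?K = "Poly_Mapping.keys x \<union> Poly_Mapping.keys y"
  have K: "finite ?K" "Poly_Mapping.keys x \<subseteq> ?K" "Poly_Mapping.keys y \<subseteq> ?K" "Poly_Mapping.keys (x + y) \<subseteq> ?K"
    using keys_add[of x y] by auto
  show ?thesis
    unfolding frag_euler_superset[OF K(1,2)] frag_euler_superset[OF K(1,3)] frag_euler_superset[OF K(1,4)]
    by (simp add: lookup_add ring_distribs sum.distrib)
qed

lemma frag_euler_zero [simp]: "frag_euler 0 = 0"
  by (simp add: frag_euler_def)

lemma frag_euler_of [simp]: "frag_euler (frag_of A) = euler A"
  by (simp add: frag_euler_def)

lemma frag_euler_minus: "frag_euler (- x) = - frag_euler x"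
  using frag_euler_add[of x "- x"] by (simp add: eq_neg_iff_add_eq_0 add.commute)

lemma frag_euler_diff: "frag_euler (x - y) = frag_euler x - frag_euler y"
  using frag_euler_add[of x "- y"] by (simp add: frag_euler_minus)

lemma frag_euler_cmul: "frag_euler (frag_cmul c x) = of_int c * frag_euler x"
  unfolding frag_euler_superset[OF finite_keys keys_cmul]
  by (simp add: frag_euler_def sum_distrib_left mult.assoc)

lemma frag_euler_sum: "frag_euler (sum f J) = (\<Sum>j\<in>J. frag_euler (f j))"
  by (induction J rule: infinite_finite_induct) (simp_all add: frag_euler_add)

lemma frag_euler_extend:
  "frag_euler (frag_extend f x)
    = (\<Sum>A\<in>Poly_Mapping.keys x. of_int (Poly_Mapping.lookup x A) * frag_euler (f A))"
  by (simp add: frag_extend_def frag_euler_sum frag_euler_cmul)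

lemma sum_list_mat_Tob:
  fixes g :: "'o \<Rightarrow> complex"
  assumes "\<And>a b. g (Tob C a b) = g a * g b"
  shows "sum_list (map g (mat_Tob C A B)) = sum_list (map g A) * sum_list (map g B)"
proof (induction A)
  case (Cons a A)
  have "sum_list (map g (map (Tob C a) B)) = g a * sum_list (map g B)"
    by (induction B) (simp_all add: assms ring_distribs)
  then show ?case using Cons by (simp add: mat_Tob_def ring_distribs)
qed (simp add: mat_Tob_def)

lemma euler_sum_list:
  "euler X = sum_list (map (\<lambda>a. sum_list (map (\<lambda>x. \<i> powi weight x) a)) (fst X))"
proof -
  have "euler X = (\<Sum>p\<in>idx (fst X). \<i> powi weight (fst X ! fst p ! snd p))"
    by (simp add: euler_def wt_def lab_def)
  also have "\<dots> = (\<Sum>i<length (fst X). \<Sum>b<length (fst X ! i). \<i> powi weight (fst X ! i ! b))"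
    by (rule sum_idx)
  finally show ?thesis by (simp add: sum_list_sum_nth atLeast0LessThan)
qed

lemma euler_Tob: "euler (Tob catI X Y) = euler X * euler Y"
proof -
  have w: "\<i> powi weight (Tob elementary x y) = \<i> powi weight x * \<i> powi weight y" for x y
    by (simp add: weight_def power_int_add[symmetric] algebra_simps)
  have I': "Tob I' = mat_Tob elementary" by (simp add: I'_def direct_sums_def)
  show ?thesis
    unfolding euler_sum_list catI_simps
    \<comment> \<open>The product formula is used twice, for the terms of the complexes and for the
      summands inside the terms; weights add under the tensor product.\<close>
    by (rule sum_list_mat_Tob) (unfold I', rule sum_list_mat_Tob[OF w])
qed

section \<open>Relations of the Grothendieck group\<close>

abbreviation K0_rel :: "(I_obj \<Rightarrow>\<^sub>0 int) set"
  where "K0_rel \<equiv> K0_relations (Obj catI) I_triangles"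

lemma I_triangles_iff:
  "(X, Y, W, U, V, S) \<in> I_triangles \<longleftrightarrow>
    (\<exists>u v w. bm.dist X Y W u v w \<and> U = bm.cls X Y u \<and> V = bm.cls Y W v \<and> S = bm.cls W (I_shift X) w)"
  unfolding I_triangles_eq by (rule bm.\<Delta>_iff)

lemma K0_rel_generators:
  "{frag_of Y - frag_of X - frag_of W |X Y W u v w. (X, Y, W, u, v, w) \<in> I_triangles}
    = {frag_of Y - frag_of X - frag_of W |X Y W u v w. bm.dist X Y W u v w}"
  unfolding I_triangles_iff by blast

lemma K0_rel_subgroup: "subgroup K0_rel (free_Abelian_group (Obj catI))"
  unfolding K0_relations_def K0_rel_generators
proof (rule group.generate_is_subgroup[OF group_free_Abelian_group], clarify)
  fix X Y W u v w assume "bm.dist X Y W u v w"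
  note Ob = bm.dist_Ob(1-3)[OF this]
  have "Poly_Mapping.keys (frag_of Y - frag_of X - frag_of W) \<subseteq> {X, Y, W}"
    using keys_diff[of "frag_of Y - frag_of X" "frag_of W"] keys_diff[of "frag_of Y" "frag_of X"]
    by (auto simp: keys_frag_of)
  also have "\<dots> \<subseteq> Obj catI" using Ob by blast
  finally show "frag_of Y - frag_of X - frag_of W \<in> carrier (free_Abelian_group (Obj catI))" by simp
qed

lemma K0_rel_keys: "x \<in> K0_rel \<Longrightarrow> Poly_Mapping.keys x \<subseteq> Obj catI"
  using subgroup.mem_carrier[OF K0_rel_subgroup] by (simp only: carrier_free_Abelian_group_iff)

lemma K0_rel_zero: "0 \<in> K0_rel"
  using subgroup.one_closed[OF K0_rel_subgroup] by simp

lemma K0_rel_add: "x \<in> K0_rel \<Longrightarrow> y \<in> K0_rel \<Longrightarrow> x + y \<in> K0_rel"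
  using subgroup.m_closed[OF K0_rel_subgroup, of x y] by simp

lemma K0_rel_minus: "x \<in> K0_rel \<Longrightarrow> - x \<in> K0_rel"
  using subgroup.m_inv_closed[OF K0_rel_subgroup, of x] K0_rel_keys[of x] by simp

lemma K0_rel_diff: "x \<in> K0_rel \<Longrightarrow> y \<in> K0_rel \<Longrightarrow> x - y \<in> K0_rel"
  using K0_rel_add[OF _ K0_rel_minus, of x y] by simp

lemma K0_rel_dist: "bm.dist X Y W u v w \<Longrightarrow> frag_of Y - frag_of X - frag_of W \<in> K0_rel"
  unfolding K0_relations_def K0_rel_generators by (intro generate.incl) blast

lemma frag_euler_K0_rel: "x \<in> K0_rel \<Longrightarrow> frag_euler x = 0"
proof -
  have keys: "Poly_Mapping.keys x \<subseteq> Obj catI" if "x \<in> K0_rel" for x by (rule K0_rel_keys[OF that])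
  have gen: "frag_euler y = 0"
    if "y \<in> {frag_of Y - frag_of X - frag_of W |X Y W u v w. bm.dist X Y W u v w}" for y
    using that by (auto simp: frag_euler_diff dest: euler_dist)
  assume "x \<in> K0_rel"
  then show ?thesis
    unfolding K0_relations_def K0_rel_generators
  proof (induction rule: generate.induct)
    case (inv y)
    then have "y \<in> K0_rel" unfolding K0_relations_def K0_rel_generators by (rule generate.incl)
    then show ?case using gen[OF inv] keys by (simp add: frag_euler_minus)
  qed (simp_all add: gen frag_euler_add)
qed

text \<open>Realizes the weight \<open>w\<close> with at most one strand; \<open>unit_obj 0\<close>
  is the unit object and \<open>unit_obj 1\<close> is \<open>Q\<close>.\<close>

definition unit_obj :: "int \<Rightarrow> I_obj"
  where "unit_obj w = ([[(nat (w mod 2), w div 2)]], 0)"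

definition spanned :: "(I_obj \<Rightarrow>\<^sub>0 int) \<Rightarrow> bool"
  where "spanned x \<longleftrightarrow> (\<exists>a b. x - (frag_cmul a (frag_of (unit_obj 0)) + frag_cmul b (frag_of (unit_obj 1))) \<in> K0_rel)"

lemma spanned_zero: "spanned 0"
  unfolding spanned_def by (rule exI[of _ 0], rule exI[of _ 0]) (simp add: K0_rel_zero)

lemma spanned_diff:
  assumes "spanned x" "spanned y"
  shows "spanned (x - y)"
proof -
  let ?E = "\<lambda>a b. frag_cmul a (frag_of (unit_obj 0)) + frag_cmul b (frag_of (unit_obj 1))"
  obtain a b c d where "x - ?E a b \<in> K0_rel" "y - ?E c d \<in> K0_rel" using assms unfolding spanned_def by blast
  then have "(x - ?E a b) - (y - ?E c d) \<in> K0_rel" by (rule K0_rel_diff)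
  also have "(x - ?E a b) - (y - ?E c d) = (x - y) - ?E (a - c) (b - d)"
    by (simp add: frag_cmul_diff_distrib)
  finally show ?thesis unfolding spanned_def by blast
qed

lemma spanned_rel: "spanned x \<Longrightarrow> y - x \<in> K0_rel \<Longrightarrow> spanned y"
  unfolding spanned_def
proof (elim exE)
  fix a b
  assume "x - (frag_cmul a (frag_of (unit_obj 0)) + frag_cmul b (frag_of (unit_obj 1))) \<in> K0_rel" "y - x \<in> K0_rel"
  from K0_rel_add[OF this(2,1)]
  show "\<exists>a b. y - (frag_cmul a (frag_of (unit_obj 0)) + frag_cmul b (frag_of (unit_obj 1))) \<in> K0_rel"
    by (simp add: algebra_simps) blast
qed

section \<open>Generation by the classes of the unit object and of \<open>Q\<close>\<close>

abbreviation spanned_obj :: "I_obj \<Rightarrow> bool"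
  where "spanned_obj X \<equiv> spanned (frag_of X)"

lemma zero_rel: "frag_of ([], 0) \<in> K0_rel"
proof -
  have "idm (fst ([], 0) :: (nat \<times> int) list list) \<in> bm.Bd ([], 0) ([], 0)"
    using bm.Bd_zero bm.e_N by simp
  from K0_rel_minus[OF K0_rel_dist[OF bm.dist_id[OF bm.N_Ob bm.N_Ob this]]] show ?thesis by simp
qed

lemma dist_id_zero: "X \<in> Obj catI \<Longrightarrow> bm.dist X X ([], 0) (idm (fst X)) 0 0"
  using bm.dist_id[OF _ bm.N_Ob] bm.Bd_zero bm.e_N by simp

lemma iso_rel:
  assumes X: "X \<in> Obj catI" and Y: "Y \<in> Obj catI" and u: "bm.isop X Y u u'"
  shows "frag_of Y - frag_of X \<in> K0_rel"
proof -
  have "bm.dist X Y ([], 0) u 0 0"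
  proof (rule bm.dist_iso[OF dist_id_zero[OF X] bm.isop_e[OF X] u bm.isop_e[OF bm.N_Ob]])
    show "bm.hq X Y (u * idm (fst X)) (u * idm (fst X))"
      using bm.Z_mult[OF bm.Z_e[OF X] bm.isop_Z(1)[OF u]] by (rule bm.hq_refl)
  qed (simp_all add: X Y bm.N_Ob bm.isop_Z(1)[OF u] bm.Z_zero bm.hq_refl)
  from K0_rel_add[OF K0_rel_dist[OF this] zero_rel] show ?thesis by simp
qed

lemma spanned_iso:
  assumes "X \<in> Obj catI" "Y \<in> Obj catI" "bm.isop X Y u u'" "spanned_obj X"
  shows "spanned_obj Y"
  using spanned_rel[OF assms(4) iso_rel[OF assms(1-3)]] .

text \<open>Rotating the triangle of an identity gives one with \<open>X\<close>, the zero object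
  and the shift of \<open>X\<close>.\<close>

lemma shift_rel:
  assumes X: "X \<in> Obj catI"
  shows "frag_of (I_shift X) + frag_of X \<in> K0_rel"
proof -
  have "frag_of ([], 0) - frag_of X - frag_of (I_shift X) \<in> K0_rel"
    by (rule K0_rel_dist[OF bm.dist_rotate[OF dist_id_zero[OF X]]])
  from K0_rel_diff[OF zero_rel this] show ?thesis by (simp add: algebra_simps)
qed

lemma spanned_shift_iff:
  assumes X: "X \<in> Obj catI"
  shows "spanned_obj (I_shift X) \<longleftrightarrow> spanned_obj X"
proof
  assume "spanned_obj (I_shift X)"
  from spanned_rel[OF spanned_diff[OF spanned_zero this], of "frag_of X"] shift_rel[OF X]
  show "spanned_obj X" by (simp add: add.commute)
next
  assume "spanned_obj X"
  from spanned_rel[OF spanned_diff[OF spanned_zero this], of "frag_of (I_shift X)"] shift_rel[OF X]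
  show "spanned_obj (I_shift X)" by simp
qed

lemma spanned_cone:
  assumes "bm.conedata X Y h C i p j s" "spanned_obj X" "spanned_obj Y"
  shows "spanned_obj C"
proof -
  have "frag_of Y - frag_of X - frag_of C \<in> K0_rel" by (rule K0_rel_dist[OF bm.dist_cone[OF assms(1)]])
  from K0_rel_minus[OF this] have "frag_of C - (frag_of Y - frag_of X) \<in> K0_rel" by (simp add: algebra_simps)
  then show ?thesis by (rule spanned_rel[OF spanned_diff[OF assms(3,2)]])
qed

lemma zero_twist_Obj: "(A, 0) \<in> Obj catI"
  by (simp add: Obj_catI_iff I'_Hom_zero bmat_of_zero)

text \<open>Only weights have to match, so this covers both the regrouping of summands over the
  terms of a complex and the replacement of \<open>Q^k[m]\<close> by another object of the same
  weight.\<close>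

lemma reindex_iso:
  assumes \<sigma>: "bij_betw \<sigma> (idx A) (idx B)" and w: "\<And>p. p \<in> idx A \<Longrightarrow> wt B (\<sigma> p) = wt A p"
  shows "\<exists>u u'. bm.isop (A, 0) (B, 0) u u'"
proof -
  define \<tau> where "\<tau> = the_inv_into (idx A) \<sigma>"
  have inj: "inj_on \<sigma> (idx A)" and im: "\<sigma> ` idx A = idx B" using \<sigma> by (auto simp: bij_betw_def)
  have \<tau>: "\<tau> q \<in> idx A" "\<sigma> (\<tau> q) = q" if "q \<in> idx B" for q
    unfolding \<tau>_def using the_inv_into_into[OF inj, of q "idx A"] f_the_inv_into_f[OF inj, of q] that im
    by simp_all
  have \<tau>\<sigma>: "\<tau> (\<sigma> p) = p" if "p \<in> idx A" for p using that inj by (simp add: \<tau>_def the_inv_into_f_f)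
  have \<sigma>B: "\<sigma> p \<in> idx B" if "p \<in> idx A" for p using that im by blast
  let ?u = "map_mat (idx A) \<sigma>" and ?v = "map_mat (idx B) \<tau>"
  have "?u \<in> bmat_Hom A B 0" by (rule map_mat_Hom) (auto simp: \<sigma>B w)
  moreover have "?v \<in> bmat_Hom B A 0"
  proof (rule map_mat_Hom)
    fix q assume "q \<in> idx B"
    then show "\<tau> q \<in> idx A \<and> wt B q \<le> wt A (\<tau> q) + 2 * 0" using \<tau> w[of "\<tau> q"] by simp
  qed simp
  ultimately have Z: "?u \<in> bm.Z (A, 0) (B, 0)" "?v \<in> bm.Z (B, 0) (A, 0)"
    by (simp_all add: bm.Z_def bmat_of_zero)
  have "?v * ?u = idm A"
    by (rule fmat_eqI) (auto simp: entry_times_map_mat[OF finite_idx] entry_map_mat[OF finite_idx] \<sigma>B \<tau>\<sigma>)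
  moreover have "?u * ?v = idm B"
    by (rule fmat_eqI) (auto simp: entry_times_map_mat[OF finite_idx] entry_map_mat[OF finite_idx] \<tau>)
  ultimately have "bm.isop (A, 0) (B, 0) ?u ?v"
    using Z bm.Z_e[OF zero_twist_Obj[of A]] bm.Z_e[OF zero_twist_Obj[of B]]
    by (simp add: bm.isop_def bm.hq_refl)
  then show ?thesis by blast
qed

lemma weight_unit_obj: "weight (nat (w mod 2), w div 2) = w"
  by (simp add: weight_def)

text \<open>A shift changes the weight by 2 and the class by a sign, which leaves the weights 0 and
  1.\<close>

lemma spanned_unit_obj: "spanned_obj (unit_obj w)"
proof -
  have S: "I_shift (unit_obj w) = unit_obj (w + 2)" for w
    by (simp add: unit_obj_def I_shift_def twisted_shift_def I'_shift_def elementary_shift_def)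
  have Ob: "unit_obj w \<in> Obj catI" for w unfolding unit_obj_def by (rule zero_twist_Obj)
  have step: "spanned_obj (unit_obj (w + 2)) \<longleftrightarrow> spanned_obj (unit_obj w)" for w
    using spanned_shift_iff[OF Ob[of w]] by (simp add: S)
  have "spanned_obj (unit_obj (r + 2 * k)) \<longleftrightarrow> spanned_obj (unit_obj r)" for r k
  proof (induction k rule: int_induct[where k = 0])
    case (step1 k)
    then show ?case using step[of "r + 2 * k"] by (simp add: algebra_simps)
  next
    case (step2 k)
    then show ?case using step[of "r + 2 * (k - 1)"] by (simp add: algebra_simps)
  qed simp
  from this[of "w mod 2" "w div 2"] have eq: "spanned_obj (unit_obj w) \<longleftrightarrow> spanned_obj (unit_obj (w mod 2))"
    by simp
  have "spanned_obj (unit_obj 0)"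
    unfolding spanned_def by (rule exI[of _ 1], rule exI[of _ 0]) (simp add: K0_rel_zero)
  moreover have "spanned_obj (unit_obj 1)"
    unfolding spanned_def by (rule exI[of _ 0], rule exI[of _ 1]) (simp add: K0_rel_zero)
  moreover have "w mod 2 = 0 \<or> w mod 2 = 1" by presburger
  ultimately show ?thesis unfolding eq by metis
qed

lemma spanned_single: "spanned_obj ([[x]], 0)"
proof -
  have i: "idx [[x]] = {(0, 0)}" "idx [[y]] = {(0, 0)}" for x y :: "nat \<times> int" by (auto simp: idx_def)
  have "bij_betw id (idx [[(nat (weight x mod 2), weight x div 2)]]) (idx [[x]])" by (simp add: i)
  then obtain u u' where "bm.isop ([[(nat (weight x mod 2), weight x div 2)]], 0) ([[x]], 0) u u'"
    using reindex_iso[of id "[[(nat (weight x mod 2), weight x div 2)]]" "[[x]]"]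
    by (auto simp: i wt_def lab_def weight_unit_obj)
  then show ?thesis
    using spanned_iso[OF zero_twist_Obj zero_twist_Obj] spanned_unit_obj[of "weight x"] by (auto simp: unit_obj_def)
qed

lemma spanned_Nil:
  assumes "([], f) \<in> Obj catI"
  shows "spanned_obj ([], f)"
proof -
  have f: "f \<in> mat_Hom I' [] [] 1" using assms by (simp add: Obj_catI_iff)
  have "f = 0"
    by (intro ext) (use mat_Hom_I'D(2)[OF f] in \<open>simp add: idx_def\<close>)
  moreover have "spanned_obj ([], 0)"
    by (rule spanned_rel[OF spanned_zero]) (simp only: diff_zero zero_rel)
  ultimately show ?thesis by (simp only:)
qed

text \<open>A one-sided twisted complex is the cone of the first row of its twisting cochain.\<close>

lemma spanned_Cons:
  assumes X: "(map elementary_shift a # A, f) \<in> Obj catI" and a: "spanned_obj ([a], 0)"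
    and A: "\<And>g. (A, g) \<in> Obj catI \<Longrightarrow> spanned_obj (A, g)"
  shows "spanned_obj (map elementary_shift a # A, f)"
proof -
  interpret I': strict_monoidal_dg_category I' by (rule strict_monoidal_I')
  let ?a = "map elementary_shift a"
  have f: "f \<in> mat_Hom I' (?a # A) (?a # A) 1" "\<And>i j. \<not> i < j \<Longrightarrow> f i j = 0"
    "mat_Cmp I' (?a # A) (?a # A) (?a # A) f f = 0"
    using X unfolding catI_simps by (auto dest: I'.twisted_complexesD)
  have fD: "f i j \<in> Hom I' ((?a # A) ! i) ((?a # A) ! j) 1" if "i \<le> length A" "j \<le> length A" for i j
    using I'.mat_HomD(1)[OF f(1)] that by simp
  have fZ: "f i j = 0" if "\<not> (i \<le> length A \<and> j \<le> length A)" for i j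
    using I'.mat_HomD(2)[OF f(1), of i j] that by auto
  define g where "g i j = f (Suc i) (Suc j)" for i j
  define h where "h i j = (if i = 0 then f 0 (Suc j) else 0)" for i j :: nat
  have g: "g \<in> mat_Hom I' A A 1"
  proof (rule I'.mat_HomI)
    show "g i j \<in> Hom I' (A ! i) (A ! j) 1" if "i < length A" "j < length A" for i j
      using fD[of "Suc i" "Suc j"] that by (simp add: g_def)
  qed (auto simp: g_def fZ)
  have h: "h \<in> mat_Hom I' [?a] A 1"
  proof (rule I'.mat_HomI)
    show "h i j \<in> Hom I' ([?a] ! i) (A ! j) 1" if "i < length [?a]" "j < length A" for i j
      using fD[of 0 "Suc j"] that by (simp add: h_def)
  qed (auto simp: h_def fZ)
  \<comment> \<open>A column of \<open>f f = 0\<close> past the first, with the first intermediate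
    index dropped: column 0 of \<open>f\<close> vanishes by one-sidedness. The case
    \<open>i = 0\<close> makes \<open>h\<close> closed, the other cases make \<open>g\<close> a
    twist.\<close>
  have row: "(\<Sum>j<length A. Cmp I' ((?a # A) ! i) (A ! j) (A ! k) (g j k) (f i (Suc j))) = 0"
    if i: "i \<le> length A" and k: "k < length A" for i k
  proof -
    have "mat_Cmp I' (?a # A) (?a # A) (?a # A) f f i (Suc k) = 0" by (simp add: f(3))
    then have "(\<Sum>j<Suc (length A). Cmp I' ((?a # A) ! i) ((?a # A) ! j) ((?a # A) ! Suc k) (f j (Suc k)) (f i j)) = 0"
      using i k by (simp add: mat_Cmp_def)
    moreover have "Cmp I' ((?a # A) ! i) ?a (A ! k) (f 0 (Suc k)) (f i 0) = 0"
      using I'.Cmp_zero_right[OF I'.nth_Obj[OF lists_I'] I'.nth_Obj[OF lists_I'] I'.nth_Obj[OF lists_I'] fD[of 0 "Suc k"],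
          of i "?a # A"] i k f(2)[of i 0] by simp
    ultimately show ?thesis by (simp add: sum.lessThan_Suc_shift g_def del: sum.lessThan_Suc)
  qed
  have "mat_Cmp I' A A A g g = 0"
  proof (intro ext)
    fix i k x y
    have "mat_Cmp I' A A A g g i k = 0"
      using row[of "Suc i" k] by (simp add: mat_Cmp_def g_def[of i])
    then show "mat_Cmp I' A A A g g i k x y = 0 i k x y" by simp
  qed
  then have YO: "(A, g) \<in> Obj catI"
    unfolding catI_simps twisted_complexes_def using g f(2) by (auto simp: g_def simp del: in_lists_conv_set)
  have gh: "mat_Cmp I' [?a] A A g h = 0"
  proof (intro ext)
    fix i k x y
    have "mat_Cmp I' [?a] A A g h i k = 0"
      using row[of 0 k] by (simp add: mat_Cmp_def h_def)
    then show "mat_Cmp I' [?a] A A g h i k x y = 0 i k x y" by simp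
  qed
  have XO: "([a], 0) \<in> Obj catI" by (rule zero_twist_Obj)
  \<comment> \<open>A morphism of degree 1 from the shifted term is one of degree 0 from
    \<open>a\<close>; this is why the head is written as a shift.\<close>
  have hH: "h \<in> mat_Hom I' [a] A 0"
    using h mat_Hom_shift(1)[of "[a]" A 1] by (simp add: I'_shift_def)
  have "bmat_of g * bmat_of h = 0"
    using bmat_of_Cmp[OF h g] gh by (simp add: bmat_of_zero)
  then have hZ: "bmat_of h \<in> bm.Z ([a], 0) (A, g)"
    using bmat_of_Hom[OF hH] by (simp add: bm.Z_def bmat_of_zero)
  have "cone I'_shift ([a], 0) (A, g) h = (?a # A, f)"
  proof -
    have "snd (cone I'_shift ([a], 0) (A, g) h) i j = f i j" for i j
      using f(2) by (cases i; cases j) (auto simp: cone_def h_def g_def)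
    then have "snd (cone I'_shift ([a], 0) (A, g) h) = f" by (intro ext) metis
    moreover have "fst (cone I'_shift ([a], 0) (A, g) h) = ?a # A"
      unfolding fst_cone by (simp add: I'_shift_def)
    ultimately show ?thesis by (metis prod.collapse)
  qed
  then show ?thesis
    using spanned_cone[OF cone_conedata[OF XO YO _ hZ] a A[OF YO]] hH by simp
qed

lemma elementary_shift_surj: "\<exists>b. map elementary_shift b = a"
proof -
  have "map elementary_shift (map (\<lambda>x. (fst x, snd x - 1)) a) = a"
    by (simp add: elementary_shift_def case_prod_unfold o_def)
  then show ?thesis by blast
qed

text \<open>\<open>spanned_Cons\<close> needs the head to be spanned as an untwisted object. For
  heads with a single summand this is \<open>spanned_single\<close>; direct sums as heads come
  next.\<close>

lemma spanned_singles: "(map (\<lambda>x. [x]) xs, f) \<in> Obj catI \<Longrightarrow> spanned_obj (map (\<lambda>x. [x]) xs, f)"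
proof (induction xs arbitrary: f)
  case Nil
  then show ?case using spanned_Nil by simp
next
  case (Cons x xs)
  obtain y where y: "map elementary_shift [y] = [x]"
    using elementary_shift_surj[of "[x]"] by (metis length_0_conv length_Suc_conv length_map)
  show ?case
    using spanned_Cons[of "[y]" "map (\<lambda>x. [x]) xs" f] Cons spanned_single y by simp
qed

text \<open>A direct sum within one term is isomorphic to the same summands spread over successive
  terms with zero twist.\<close>

lemma spanned_direct_sum: "spanned_obj ([xs], 0)"
proof -
  have bij: "bij_betw (\<lambda>p. (snd p, fst p)) (idx (map (\<lambda>x. [x]) xs)) (idx [xs])"
    by (rule bij_betw_byWitness[where f' = "\<lambda>p. (snd p, fst p)"]) (auto simp: idx_def)
  have wt: "wt [xs] (snd p, fst p) = wt (map (\<lambda>x. [x]) xs) p" if "p \<in> idx (map (\<lambda>x. [x]) xs)" for p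
    using that by (auto simp: wt_def lab_def idx_def)
  obtain u u' where "bm.isop (map (\<lambda>x. [x]) xs, 0) ([xs], 0) u u'"
    using reindex_iso[OF bij wt] by blast
  then show ?thesis
    by (rule spanned_iso[OF zero_twist_Obj zero_twist_Obj _ spanned_singles[OF zero_twist_Obj]])
qed

lemma spanned_obj: "(A, f) \<in> Obj catI \<Longrightarrow> spanned_obj (A, f)"
proof (induction A arbitrary: f)
  case Nil
  then show ?case by (rule spanned_Nil)
next
  case (Cons a A)
  obtain b where b: "map elementary_shift b = a" using elementary_shift_surj by blast
  show ?case using spanned_Cons[of b A f] Cons spanned_direct_sum b by simp
qed

lemma spanned_frag: "Poly_Mapping.keys x \<subseteq> Obj catI \<Longrightarrow> spanned x"
proof -
  assume "Poly_Mapping.keys x \<subseteq> Obj catI"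
  then show "spanned x"
  proof (rule free_Abelian_group_induct)
    show "spanned_obj X" if "X \<in> Obj catI" for X
      using spanned_obj[of "fst X" "snd X"] that by simp
  qed (auto intro: spanned_zero spanned_diff)
qed

lemma euler_unit_obj: "euler (unit_obj w) = \<i> powi w"
  by (simp add: euler_sum_list unit_obj_def weight_unit_obj)

text \<open>Modulo relations a combination is \<open>a\<close> times the unit plus \<open>b\<close>
  times \<open>Q\<close>, with value \<open>a + b * \<i>\<close>. This vanishes only for
  \<open>a = b = 0\<close>, that is, for a combination that is itself a relation.\<close>

lemma K0_rel_iff: "x \<in> K0_rel \<longleftrightarrow> Poly_Mapping.keys x \<subseteq> Obj catI \<and> frag_euler x = 0"
proof
  assume x: "Poly_Mapping.keys x \<subseteq> Obj catI \<and> frag_euler x = 0"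
  let ?E = "\<lambda>a b. frag_cmul a (frag_of (unit_obj 0)) + frag_cmul b (frag_of (unit_obj 1))"
  obtain a b where ab: "x - ?E a b \<in> K0_rel" using spanned_frag x unfolding spanned_def by blast
  have "frag_euler (x - ?E a b) = - (of_int a + of_int b * \<i>)"
    using x by (simp add: frag_euler_diff frag_euler_add frag_euler_cmul euler_unit_obj)
  then have "of_int a + of_int b * \<i> = (0 :: complex)"
    unfolding frag_euler_K0_rel[OF ab] by (metis neg_equal_0_iff_equal)
  then have "a = 0" "b = 0" by (auto simp: complex_eq_iff)
  then show "x \<in> K0_rel" using ab by simp
qed (simp add: K0_rel_keys frag_euler_K0_rel)

section \<open>Identification of the Grothendieck ring\<close>

definition gauss :: "complex set"
  where "gauss = {of_int a + of_int b * \<i> |a b. True}"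

lemma frag_euler_gauss: "frag_euler ` carrier (free_Abelian_group (Obj catI)) = gauss"
proof (intro equalityI subsetI)
  let ?E = "\<lambda>a b. frag_cmul a (frag_of (unit_obj 0)) + frag_cmul b (frag_of (unit_obj 1))"
  have e: "frag_euler (?E a b) = of_int a + of_int b * \<i>" for a b
    by (simp add: frag_euler_add frag_euler_cmul euler_unit_obj)
  {
    fix c assume "c \<in> frag_euler ` carrier (free_Abelian_group (Obj catI))"
    then obtain x where x: "Poly_Mapping.keys x \<subseteq> Obj catI" "c = frag_euler x" by auto
    obtain a b where "x - ?E a b \<in> K0_rel" using spanned_frag[OF x(1)] unfolding spanned_def by blast
    from frag_euler_K0_rel[OF this] have "c = of_int a + of_int b * \<i>" by (simp add: x(2) frag_euler_diff e)
    then show "c \<in> gauss" unfolding gauss_def by blast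
  next
    fix c assume "c \<in> gauss"
    then obtain a b where "c = of_int a + of_int b * \<i>" unfolding gauss_def by blast
    moreover have "Poly_Mapping.keys (?E a b) \<subseteq> {unit_obj 0, unit_obj 1}"
      using keys_add[of "frag_cmul a (frag_of (unit_obj 0))" "frag_cmul b (frag_of (unit_obj 1))"]
      by (auto simp: keys_frag_of)
    moreover have "{unit_obj 0, unit_obj 1} \<subseteq> Obj catI" unfolding unit_obj_def using zero_twist_Obj by blast
    ultimately show "c \<in> frag_euler ` carrier (free_Abelian_group (Obj catI))"
      using e[of a b] by (intro image_eqI[of _ _ "?E a b"]) auto
  }
qed

text \<open>By \<open>K0_rel_iff\<close> the cosets of the relations are these fibres, so a Gaussian
  integer names an element of the Grothendieck group.\<close>

definition level :: "complex \<Rightarrow> (I_obj \<Rightarrow>\<^sub>0 int) set"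
  where "level c = {x. Poly_Mapping.keys x \<subseteq> Obj catI \<and> frag_euler x = c}"

lemma K0_coset_level:
  assumes "Poly_Mapping.keys x \<subseteq> Obj catI"
  shows "K0_coset (Obj catI) I_triangles x = level (frag_euler x)"
proof (intro equalityI subsetI)
  fix y assume "y \<in> K0_coset (Obj catI) I_triangles x"
  then obtain r where r: "r \<in> K0_rel" "y = r + x" by (auto simp: K0_coset_def r_coset_def)
  then show "y \<in> level (frag_euler x)"
    using assms keys_add[of r x] by (auto simp: level_def K0_rel_iff frag_euler_add)
next
  fix y assume "y \<in> level (frag_euler x)"
  then have "y - x \<in> K0_rel"
    using assms keys_diff[of y x] by (auto simp: level_def K0_rel_iff frag_euler_diff)
  then show "y \<in> K0_coset (Obj catI) I_triangles x"
    unfolding K0_coset_def r_coset_def by (auto intro!: bexI[of _ "y - x"])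
qed

lemma K0_I_class_level: "X \<in> Obj catI \<Longrightarrow> K0_I_class X = level (euler X)"
  using K0_coset_level[of "frag_of X"] by (simp add: K0_class_def keys_frag_of)

lemma level_nonempty: "c \<in> gauss \<Longrightarrow> \<exists>x. x \<in> level c"
proof -
  assume "c \<in> gauss"
  then obtain x where "x \<in> carrier (free_Abelian_group (Obj catI))" "frag_euler x = c"
    unfolding frag_euler_gauss[symmetric] by blast
  then have "x \<in> level c" by (simp add: level_def)
  then show ?thesis by blast
qed

lemma level_inj: "inj_on level gauss"
proof (rule inj_onI)
  fix c d assume "c \<in> gauss" "level c = level d"
  then show "c = d" using level_nonempty[of c] unfolding level_def by auto
qed

lemma Tob_catI_Obj: "X \<in> Obj catI \<Longrightarrow> Y \<in> Obj catI \<Longrightarrow> Tob catI X Y \<in> Obj catI"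
  by (rule strict_monoidal_dg_category.Tob_Obj[OF strict_monoidal_catI])

lemma frag_bilinear_Tob:
  assumes x: "Poly_Mapping.keys x \<subseteq> Obj catI" and y: "Poly_Mapping.keys y \<subseteq> Obj catI"
  shows "Poly_Mapping.keys (frag_bilinear (Tob catI) x y) \<subseteq> Obj catI"
    and "frag_euler (frag_bilinear (Tob catI) x y) = frag_euler x * frag_euler y"
proof -
  let ?f = "\<lambda>A. frag_extend (\<lambda>B. frag_of (Tob catI A B)) y"
  have "Poly_Mapping.keys (?f A) \<subseteq> Obj catI" if "A \<in> Poly_Mapping.keys x" for A
  proof (rule order.trans[OF keys_frag_extend UN_least])
    fix B assume "B \<in> Poly_Mapping.keys y"
    then have "Tob catI A B \<in> Obj catI" using that x y by (intro Tob_catI_Obj) blast+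
    then show "Poly_Mapping.keys (frag_of (Tob catI A B)) \<subseteq> Obj catI" by (simp add: keys_frag_of)
  qed
  then show "Poly_Mapping.keys (frag_bilinear (Tob catI) x y) \<subseteq> Obj catI"
    unfolding frag_bilinear_def using keys_frag_extend[of ?f x] by blast
  show "frag_euler (frag_bilinear (Tob catI) x y) = frag_euler x * frag_euler y"
    unfolding frag_bilinear_def frag_euler_extend frag_euler_of euler_Tob
      frag_euler_def[of x] frag_euler_def[of y] sum_product
    unfolding sum_distrib_left by (intro sum.cong HOL.refl) (simp add: ac_simps)
qed

text \<open>\<open>frag_euler\<close> is multiplicative, so all pairs of representatives contribute
  the same fibre to the union; nonemptiness of both fibres makes the union equal to it.\<close>

lemma K0_I_mult_level:
  assumes "c \<in> gauss" "d \<in> gauss"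
  shows "K0_I_mult (level c) (level d) = level (c * d)"
proof -
  have "K0_coset (Obj catI) I_triangles (frag_bilinear (Tob catI) x y) = level (c * d)"
    if "x \<in> level c" "y \<in> level d" for x y
    using that frag_bilinear_Tob[of x y] K0_coset_level by (simp add: level_def)
  then show ?thesis
    unfolding K0_bifunctor_def using level_nonempty[OF assms(1)] level_nonempty[OF assms(2)] by auto
qed

lemma euler_in_gauss: "X \<in> Obj catI \<Longrightarrow> euler X \<in> gauss"
  unfolding frag_euler_gauss[symmetric]
  by (rule image_eqI[of _ _ "frag_of X"]) (simp_all add: keys_frag_of)

lemma K0_I_mult_class:
  "X \<in> Obj catI \<Longrightarrow> Y \<in> Obj catI \<Longrightarrow> K0_I_mult (K0_I_class X) (K0_I_class Y) = K0_I_class (Tob catI X Y)"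
  by (simp add: K0_I_class_level K0_I_mult_level euler_in_gauss Tob_catI_Obj euler_Tob)

lemma ring_gaussian_integers: "ring gaussian_integers"
proof -
  have add: "\<exists>a b. of_int p + of_int q * \<i> + (of_int r + of_int s * \<i>) = of_int a + of_int b * \<i>" for p q r s
    by (rule exI[of _ "p + r"], rule exI[of _ "q + s"]) (simp add: algebra_simps)
  have mult: "\<exists>a b. (of_int p + of_int q * \<i>) * (of_int r + of_int s * \<i>) = of_int a + of_int b * \<i>" for p q r s
    by (rule exI[of _ "p * r - q * s"], rule exI[of _ "p * s + q * r"]) (simp add: complex_eq_iff)
  have neg: "\<exists>a b. - (of_int p + of_int q * \<i>) = of_int a + of_int b * \<i>" for p q
    by (rule exI[of _ "- p"], rule exI[of _ "- q"]) simp
  show ?thesis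
  proof (rule ringI)
    show "abelian_group gaussian_integers"
    proof (rule abelian_groupI)
      show "\<zero>\<^bsub>gaussian_integers\<^esub> \<in> carrier gaussian_integers"
        unfolding gaussian_integers_def by (simp, intro exI[of _ "0 :: int"]) simp
      show "\<exists>y\<in>carrier gaussian_integers. y \<oplus>\<^bsub>gaussian_integers\<^esub> x = \<zero>\<^bsub>gaussian_integers\<^esub>"
        if "x \<in> carrier gaussian_integers" for x
        using that neg unfolding gaussian_integers_def by (intro bexI[of _ "- x"]) auto
    qed (use add in \<open>auto simp: gaussian_integers_def\<close>)
    show "Group.monoid gaussian_integers"
    proof
      show "\<one>\<^bsub>gaussian_integers\<^esub> \<in> carrier gaussian_integers"
        unfolding gaussian_integers_def by (simp, intro exI[of _ "1 :: int"] exI[of _ "0 :: int"]) simp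
    qed (use mult in \<open>auto simp: gaussian_integers_def\<close>)
  qed (auto simp: gaussian_integers_def ring_distribs)
qed

lemma level_ring_iso: "level \<in> ring_iso gaussian_integers K0_I_ring"
proof -
  have carrier: "carrier gaussian_integers = gauss" by (simp add: gaussian_integers_def gauss_def)
  have K: "carrier K0_I_ring = level ` gauss"
  proof -
    have "carrier K0_I_ring = K0_coset (Obj catI) I_triangles ` carrier (free_Abelian_group (Obj catI))"
      by (auto simp: K0_ring_def K0_group_def FactGroup_def RCOSETS_def K0_coset_def)
    also have "\<dots> = (\<lambda>x. level (frag_euler x)) ` carrier (free_Abelian_group (Obj catI))"
      by (intro image_cong) (simp_all add: K0_coset_level)
    finally show ?thesis by (simp add: image_image flip: frag_euler_gauss)
  qed
  have normal: "K0_rel \<lhd> free_Abelian_group (Obj catI)"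
    by (rule comm_group.subgroup_imp_normal[OF abelian_free_Abelian_group K0_rel_subgroup])
  have add: "level (c + d) = level c \<oplus>\<^bsub>K0_I_ring\<^esub> level d" if cd: "c \<in> gauss" "d \<in> gauss" for c d
  proof -
    obtain x where x: "Poly_Mapping.keys x \<subseteq> Obj catI" "frag_euler x = c"
      using level_nonempty[OF cd(1)] by (auto simp: level_def)
    obtain y where y: "Poly_Mapping.keys y \<subseteq> Obj catI" "frag_euler y = d"
      using level_nonempty[OF cd(2)] by (auto simp: level_def)
    have xy: "Poly_Mapping.keys (x + y) \<subseteq> Obj catI" using x(1) y(1) keys_add[of x y] by blast
    have "K0_coset (Obj catI) I_triangles x \<oplus>\<^bsub>K0_I_ring\<^esub> K0_coset (Obj catI) I_triangles y
        = K0_coset (Obj catI) I_triangles (x + y)"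
      using normal.rcos_sum[OF normal, of x y] x(1) y(1)
      by (simp add: K0_ring_def K0_group_def FactGroup_def K0_coset_def)
    then show ?thesis using x y xy by (simp add: K0_coset_level frag_euler_add)
  qed
  have Unit: "Unit catI \<in> Obj catI" "euler (Unit catI) = 1"
    using strict_monoidal_dg_category.Unit_Obj[OF strict_monoidal_catI]
    by (simp_all add: euler_sum_list catI_simps) (simp add: I'_def direct_sums_def weight_def)
  show ?thesis
  proof (rule ring_iso_memI)
    show "bij_betw level (carrier gaussian_integers) (carrier K0_I_ring)"
      using level_inj by (simp add: bij_betw_def carrier K)
    show "level (\<one>\<^bsub>gaussian_integers\<^esub>) = \<one>\<^bsub>K0_I_ring\<^esub>"
      using Unit by (simp add: gaussian_integers_def K0_ring_def K0_I_class_level)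
    show "level (c \<otimes>\<^bsub>gaussian_integers\<^esub> d) = level c \<otimes>\<^bsub>K0_I_ring\<^esub> level d"
      if "c \<in> carrier gaussian_integers" "d \<in> carrier gaussian_integers" for c d
      using that K0_I_mult_level unfolding carrier by (simp add: gaussian_integers_def K0_ring_def)
    show "level (c \<oplus>\<^bsub>gaussian_integers\<^esub> d) = level c \<oplus>\<^bsub>K0_I_ring\<^esub> level d"
      if "c \<in> carrier gaussian_integers" "d \<in> carrier gaussian_integers" for c d
      using that add unfolding carrier by (simp add: gaussian_integers_def)
    show "level c \<in> carrier K0_I_ring" if "c \<in> carrier gaussian_integers" for c
      using that by (simp add: carrier K)
  qed
qed

lemma ring_K0_I: "ring K0_I_ring"
proof -
  \<comment> \<open>\<open>ring_iso_imp_img_ring\<close> yields a ring whose zero is replaced by the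
    image of zero. That image is the subgroup of relations, the zero already present.\<close>
  have "level 0 = \<zero>\<^bsub>K0_I_ring\<^esub>"
  proof -
    have "\<zero>\<^bsub>K0_I_ring\<^esub> = K0_rel" by (simp add: K0_ring_def K0_group_def FactGroup_def)
    then show ?thesis by (auto simp: level_def K0_rel_iff)
  qed
  then have "K0_I_ring\<lparr>zero := level \<zero>\<^bsub>gaussian_integers\<^esub>\<rparr> = K0_I_ring"
    by (simp add: gaussian_integers_def)
  then show ?thesis
    using ring.ring_iso_imp_img_ring[OF ring_gaussian_integers level_ring_iso] by simp
qed

theorem theorem1p1:
  "strict_monoidal_dg_category catI \<and>
   triangulated_category (H0 catI) I_shift I_shift_mor I_triangles \<and>
   (\<forall>A\<in>Obj catI. \<forall>B\<in>Obj catI.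
      K0_I_mult (K0_I_class A) (K0_I_class B) = K0_I_class (Tob catI A B)) \<and>
   ring K0_I_ring \<and>
   K0_I_ring \<simeq> gaussian_integers"
proof -
  have "gaussian_integers \<simeq> K0_I_ring"
    using level_ring_iso by (auto simp: is_ring_iso_def)
  then have "K0_I_ring \<simeq> gaussian_integers"
    by (rule ring_iso_sym[OF ring_gaussian_integers])
  then show ?thesis
    using strict_monoidal_catI triangulated_catI K0_I_mult_class ring_K0_I by blast
qed

end
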